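(* Assume the model satisfies the regularity condition (M) given in the context, let $\theta\in\Theta$, and let $f\in\mathcal{C}^4_p(S)$. Then there exist $\mathcal{F}^n_i$-measurable random variables $\xi_{1,i}$ and $\xi_{2,i}$ such that $$f(Y_i)=f(X_{t^n_{i-1}})+\Delta_n^{1/2}\,\partial_xf(X_{t^n_{i-1}})\,b(X_{t^n_{i-1}};\theta)\,\xi_{1,i}+\xi_{2,i},$$ where $\xi_{1,i}\sim\mathcal{N}(0,1/3)$ and is independent of $\mathcal{F}^n_{i-1}$, and $\xi_{2,i}$ satisfies the moment expansions $$\mathbb{E}_\theta(\xi_{2,i}\mid\mathcal{F}^n_{i-1})=\Delta_n\mathcal{H}_\theta f(X_{t^n_{i-1}})+\Delta_n^{3/2}R(\Delta_n,X_{t^n_{i-1}};\theta),$$ $$\mathbb{E}_\theta(\xi_{2,i}^2\mid\mathcal{F}^n_{i-1})=\Delta_n^2R(\Delta_n,X_{t^n_{i-1}};\theta),$$ with $$\mathcal{H}_\theta f(x)=\tfrac12\mathcal{L}_\theta f(x)-\tfrac1{12}b^2(x;\theta)\partial_x^2f(x).$$ Moreover, $$\mathbb{E}_\theta(\varepsilon_{1,i}\,\xi_{1,i})=\tfrac12,$$ where $\varepsilon_{1,i}=\Delta_n^{-1/2}(B_{t^n_i}-B_{t^n_{i-1}})$. (The distributional statements and expectations are under $\mathbb{P}_\theta$.)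
   Context: **Model.** Let $S=(l,r)$, $-\infty\le l<r\le\infty$, and $\Theta\subseteq\mathbb{R}^d$. A function $f:S\times\Theta\to\mathbb{R}$ is of polynomial growth in $x$ if for each $\theta$ there is $C_\theta>0$ with $|f(x;\theta)|\le C_\theta(1+|x|^{C_\theta})$ for all $x\in S$. $\mathcal{C}^j_p(S)$ is the class of $j$ times continuously differentiable $f:S\to\mathbb{R}$ such that $f$ and all its derivatives up to order $j$ are of polynomial growth. $\mathcal{C}^{2,0}_p(S\times\Theta)$ is the class of $f(x;\theta)$ that are twice continuously differentiable in $x$ and continuous in $\theta$, with $f,\partial_xf,\partial_x^2f$ of polynomial growth in $x$. **Condition (M).** For any $\theta\in\Theta$, the stochastic differential equation $dX_t=a(X_t;\theta)dt+b(X_t;\theta)dB_t$, $X_0\sim\mu_\theta$, has a weak solution $(\Omega,(\mathcal{F}_t),\mathbb{P}_\theta,(B_t),(X_t))$ with values in $S$, where $\mu_\theta$ is the invariant distribution, $(B_t)$ is a standard Brownian motion, $\mathcal{F}_t=\sigma(X_0,(B_s)_{s\le t})$, $X_0$ is independent of $(B_t)$, and $(X_t)$ is stationary and $\rho$-mixing under $\mathbb{P}_\theta$. Moreover $a,b\in\mathcal{C}^{2,0}_p(S\times\Theta)$; for each $\theta$ there is a constant $C>0$ with $|a(x;\theta)|+|b(x;\theta)|\le C(1+|x|)$; $b(x;\theta)>0$ for $x\in S$; and $\int_S|x|^k\mu_\theta(dx)<\infty$ for all $k\ge1$. **Sampling.** $(\Delta_n)$ is a sequence of positive numbers with $\Delta_n\to0$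 and $n\Delta_n\to\infty$; $t^n_i=i\Delta_n$, $\mathcal{F}^n_i=\mathcal{F}_{t^n_i}$, and $Y_i=\Delta_n^{-1}\int_{(i-1)\Delta_n}^{i\Delta_n}X_s\,ds$ for $i=1,\dots,n$. **Notation.** $\mathcal{L}_\theta f(x)=a(x;\theta)\partial_xf(x)+\tfrac12b^2(x;\theta)\partial_x^2f(x)$. $R(\Delta,x;\theta)$ denotes a generic real function (possibly different at each occurrence) with $|R(\Delta,x;\theta)|\le F(x;\theta)$, where $F$ does not depend on $\Delta$ (nor on $n,i$) and is of polynomial growth in $x$. The variable $\varepsilon_{1,i}$ is the $\mathcal{N}(0,1)$ variable appearing in the analogous expansion $f(X_{t^n_i})=f(X_{t^n_{i-1}})+\Delta_n^{1/2}\partial_xf(X_{t^n_{i-1}})b(X_{t^n_{i-1}};\theta)\varepsilon_{1,i}+\varepsilon_{2,i}$ of the diffusion itself. *)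

theory Defs
  imports "HOL-Probability.Probability"
begin

section \<open>Function classes\<close>

definition polynomial_growth :: "real set \<Rightarrow> (real \<Rightarrow> real) \<Rightarrow> bool" where
  "polynomial_growth S f \<longleftrightarrow> (\<exists>C>0. \<forall>x\<in>S. \<bar>f x\<bar> \<le> C * (1 + \<bar>x\<bar> powr C))"

text \<open>Meant for open \<open>S\<close>, so that the iterated derivatives on \<open>S\<close> depend only on the values of
  \<open>f\<close> on \<open>S\<close>; the derivatives of order below \<open>j\<close> are continuous because they are differentiable.\<close>

definition Cp :: "nat \<Rightarrow> real set \<Rightarrow> (real \<Rightarrow> real) \<Rightarrow> bool" where
  "Cp j S f \<longleftrightarrow>
     (\<forall>i<j. \<forall>x\<in>S. (deriv ^^ i) f field_differentiable at x) \<and>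
     continuous_on S ((deriv ^^ j) f) \<and>
     (\<forall>i\<le>j. polynomial_growth S ((deriv ^^ i) f))"

definition Cp20 :: "real set \<Rightarrow> 'p::topological_space set \<Rightarrow> (real \<Rightarrow> 'p \<Rightarrow> real) \<Rightarrow> bool" where
  "Cp20 S \<Theta> f \<longleftrightarrow>
     (\<forall>\<theta>\<in>\<Theta>. Cp 2 S (\<lambda>x. f x \<theta>)) \<and> (\<forall>x\<in>S. continuous_on \<Theta> (\<lambda>\<theta>. f x \<theta>))"

text \<open>The generic functions \<open>R(\<Delta>, x; \<theta>)\<close>, for a fixed value of \<open>\<theta>\<close>: the bound \<open>F\<close> does not
  depend on \<open>\<Delta>\<close>.\<close>

definition generic_remainder :: "real set \<Rightarrow> (real \<Rightarrow> real \<Rightarrow> real) \<Rightarrow> bool" where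
  "generic_remainder S R \<longleftrightarrow>
     (\<exists>F. polynomial_growth S F \<and> (\<forall>\<delta>>0. \<forall>x\<in>S. \<bar>R \<delta> x\<bar> \<le> F x))"

definition gen_L ::
  "(real \<Rightarrow> 'p \<Rightarrow> real) \<Rightarrow> (real \<Rightarrow> 'p \<Rightarrow> real) \<Rightarrow> 'p \<Rightarrow> (real \<Rightarrow> real) \<Rightarrow> real \<Rightarrow> real" where
  "gen_L a b \<theta> f x = a x \<theta> * deriv f x + 1/2 * (b x \<theta>)\<^sup>2 * (deriv ^^ 2) f x"

definition op_H ::
  "(real \<Rightarrow> 'p \<Rightarrow> real) \<Rightarrow> (real \<Rightarrow> 'p \<Rightarrow> real) \<Rightarrow> 'p \<Rightarrow> (real \<Rightarrow> real) \<Rightarrow> real \<Rightarrow> real" where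
  "op_H a b \<theta> f x = 1/2 * gen_L a b \<theta> f x - 1/12 * (b x \<theta>)\<^sup>2 * (deriv ^^ 2) f x"


section \<open>Processes\<close>

text \<open>The \<open>\<sigma>\<close>-algebra \<open>\<sigma>(Z\<^sub>t : t \<in> T)\<close> on the sample space of \<open>M\<close>. Only its underlying set and
  its measurable sets matter.\<close>

definition gen_alg :: "'w measure \<Rightarrow> real set \<Rightarrow> (real \<Rightarrow> 'w \<Rightarrow> real) \<Rightarrow> 'w measure" where
  "gen_alg M T Z = sigma (space M) (\<Union>t\<in>T. {Z t -` A \<inter> space M |A. A \<in> sets borel})"

definition indep_alg :: "'w measure \<Rightarrow> 'w measure \<Rightarrow> 'w measure \<Rightarrow> bool" where
  "indep_alg M A B \<longleftrightarrow> prob_space.indep_set M (sets A) (sets B)"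

definition indep_of_alg :: "'w measure \<Rightarrow> ('w \<Rightarrow> real) \<Rightarrow> 'w measure \<Rightarrow> bool" where
  "indep_of_alg M \<xi> A \<longleftrightarrow> indep_alg M (vimage_algebra (space M) \<xi> borel) A"

definition continuous_process :: "'w measure \<Rightarrow> (real \<Rightarrow> 'w \<Rightarrow> real) \<Rightarrow> bool" where
  "continuous_process M Z \<longleftrightarrow>
     (\<forall>t\<ge>0. Z t \<in> borel_measurable M) \<and> (\<forall>\<omega>\<in>space M. continuous_on {0..} (\<lambda>t. Z t \<omega>))"

definition standard_brownian_motion :: "'w measure \<Rightarrow> (real \<Rightarrow> 'w \<Rightarrow> real) \<Rightarrow> bool" where
  "standard_brownian_motion M B \<longleftrightarrow>
     continuous_process M B \<and>
     (AE \<omega> in M. B 0 \<omega> = 0) \<and>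
     (\<forall>s t. 0 \<le> s \<and> s < t \<longrightarrow>
        distributed M lborel (\<lambda>\<omega>. B t \<omega> - B s \<omega>) (normal_density 0 (sqrt (t - s))) \<and>
        indep_of_alg M (\<lambda>\<omega>. B t \<omega> - B s \<omega>) (gen_alg M {0..s} B))"

text \<open>\<open>\<F>\<^sub>t = \<sigma>(X\<^sub>0, (B\<^sub>s)\<^sub>s\<^sub>\<le>\<^sub>t)\<close>, without completion by null sets.\<close>

definition filt :: "'w measure \<Rightarrow> (real \<Rightarrow> 'w \<Rightarrow> real) \<Rightarrow> (real \<Rightarrow> 'w \<Rightarrow> real) \<Rightarrow> real \<Rightarrow> 'w measure" where
  "filt M B X t = sigma (space M) (sets (gen_alg M {0} X) \<union> sets (gen_alg M {0..t} B))"

definition stationary_process :: "'w measure \<Rightarrow> (real \<Rightarrow> 'w \<Rightarrow> real) \<Rightarrow> bool" where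
  "stationary_process M X \<longleftrightarrow>
     (\<forall>h\<ge>0. \<forall>T. finite T \<and> T \<subseteq> {0..} \<longrightarrow>
        distr M (Pi\<^sub>M T (\<lambda>_. borel)) (\<lambda>\<omega>. \<lambda>t\<in>T. X (t + h) \<omega>) =
        distr M (Pi\<^sub>M T (\<lambda>_. borel)) (\<lambda>\<omega>. \<lambda>t\<in>T. X t \<omega>))"

definition cov :: "'w measure \<Rightarrow> ('w \<Rightarrow> real) \<Rightarrow> ('w \<Rightarrow> real) \<Rightarrow> real" where
  "cov M U V =
     (\<integral>\<omega>. (U \<omega> - (\<integral>\<omega>'. U \<omega>' \<partial>M)) * (V \<omega> - (\<integral>\<omega>'. V \<omega>' \<partial>M)) \<partial>M)"

text \<open>The maximal correlation of two sub-\<open>\<sigma>\<close>-algebras. A constant \<open>U\<close> or \<open>V\<close> contributes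
  \<open>0 / 0 = 0\<close>, and all values are bounded by \<open>1\<close> (Cauchy-Schwarz), so the supremum is a genuine one.\<close>

definition rho_coeff :: "'w measure \<Rightarrow> 'w measure \<Rightarrow> 'w measure \<Rightarrow> real" where
  "rho_coeff M A B = Sup {\<bar>cov M U V\<bar> / (sqrt (cov M U U) * sqrt (cov M V V)) |U V.
     U \<in> borel_measurable A \<and> integrable M (\<lambda>\<omega>. (U \<omega>)\<^sup>2) \<and>
     V \<in> borel_measurable B \<and> integrable M (\<lambda>\<omega>. (V \<omega>)\<^sup>2)}"

definition rho_mixing :: "'w measure \<Rightarrow> (real \<Rightarrow> 'w \<Rightarrow> real) \<Rightarrow> bool" where
  "rho_mixing M X \<longleftrightarrow>
     ((\<lambda>t. SUP s\<in>{0..}. rho_coeff M (gen_alg M {0..s} X) (gen_alg M {s + t..} X)) \<longlongrightarrow> 0) at_top"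


section \<open>Ito integral and weak solutions\<close>

text \<open>The simple process \<open>\<Sum>j<m. \<eta>\<^sub>j 1\<^bsub>(\<tau>\<^sub>j, \<tau>\<^sub>j\<^sub>+\<^sub>1]\<^esub>\<close> with bounded \<open>\<F>\<^bsub>\<tau>\<^sub>j\<^esub>\<close>-measurable weights.\<close>

definition is_simple ::
  "'w measure \<Rightarrow> (real \<Rightarrow> 'w measure) \<Rightarrow> real \<Rightarrow> nat \<Rightarrow> (nat \<Rightarrow> real) \<Rightarrow> (nat \<Rightarrow> 'w \<Rightarrow> real) \<Rightarrow> bool" where
  "is_simple M F t m \<tau> \<eta> \<longleftrightarrow>
     (\<forall>j\<le>m. 0 \<le> \<tau> j \<and> \<tau> j \<le> t) \<and> (\<forall>j<m. \<tau> j < \<tau> (Suc j)) \<and>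
     (\<forall>j<m. \<eta> j \<in> borel_measurable (F (\<tau> j)) \<and> (\<exists>K. \<forall>\<omega>\<in>space M. \<bar>\<eta> j \<omega>\<bar> \<le> K))"

definition simple_val :: "nat \<Rightarrow> (nat \<Rightarrow> real) \<Rightarrow> (nat \<Rightarrow> 'w \<Rightarrow> real) \<Rightarrow> real \<Rightarrow> 'w \<Rightarrow> real" where
  "simple_val m \<tau> \<eta> s \<omega> = (\<Sum>j<m. \<eta> j \<omega> * indicator {\<tau> j<..\<tau> (Suc j)} s)"

definition simple_int ::
  "(real \<Rightarrow> 'w \<Rightarrow> real) \<Rightarrow> nat \<Rightarrow> (nat \<Rightarrow> real) \<Rightarrow> (nat \<Rightarrow> 'w \<Rightarrow> real) \<Rightarrow> 'w \<Rightarrow> real" where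
  "simple_int B m \<tau> \<eta> \<omega> = (\<Sum>j<m. \<eta> j \<omega> * (B (\<tau> (Suc j)) \<omega> - B (\<tau> j) \<omega>))"

definition progressive :: "(real \<Rightarrow> 'w measure) \<Rightarrow> real \<Rightarrow> (real \<Rightarrow> 'w \<Rightarrow> real) \<Rightarrow> bool" where
  "progressive F t H \<longleftrightarrow>
     (\<forall>u\<in>{0..t}. (\<lambda>(s, \<omega>). H s \<omega>) \<in> borel_measurable (restrict_space borel {0..u} \<Otimes>\<^sub>M F u))"

text \<open>\<open>I = \<integral>\<^sub>0\<^sup>t H\<^sub>s dB\<^sub>s\<close> almost surely, for progressive \<open>H\<close> with \<open>\<integral>\<^sub>0\<^sup>t H\<^sub>s\<^sup>2 ds < \<infinity>\<close> almost surely: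
  simple processes \<open>H\<^sub>k\<close> satisfy \<open>\<integral>\<^sub>0\<^sup>t (H\<^sub>k - H)\<^sup>2 ds \<rightarrow> 0\<close> in probability, and their integrals
  converge to \<open>I\<close> in probability. The time integral is an \<open>ennreal\<close>-valued one, so a process that is
  not square integrable in time has no Ito integral.\<close>

definition has_ito_integral ::
  "'w measure \<Rightarrow> (real \<Rightarrow> 'w measure) \<Rightarrow> (real \<Rightarrow> 'w \<Rightarrow> real) \<Rightarrow> (real \<Rightarrow> 'w \<Rightarrow> real) \<Rightarrow>
     real \<Rightarrow> ('w \<Rightarrow> real) \<Rightarrow> bool" where
  "has_ito_integral M F B H t I \<longleftrightarrow>
     progressive F t H \<and> I \<in> borel_measurable M \<and>
     (\<exists>m \<tau> \<eta>.
        (\<forall>k. is_simple M F t (m k) (\<tau> k) (\<eta> k)) \<and>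
        (\<forall>\<epsilon>>0. (\<lambda>k. measure M {\<omega> \<in> space M.
            (\<integral>\<^sup>+s\<in>{0..t}. ennreal ((simple_val (m k) (\<tau> k) (\<eta> k) s \<omega> - H s \<omega>)\<^sup>2) \<partial>lborel) > ennreal \<epsilon>})
          \<longlonglongrightarrow> 0) \<and>
        (\<forall>\<epsilon>>0. (\<lambda>k. measure M {\<omega> \<in> space M. \<bar>simple_int B (m k) (\<tau> k) (\<eta> k) \<omega> - I \<omega>\<bar> > \<epsilon>})
          \<longlonglongrightarrow> 0))"

text \<open>A weak solution of \<open>dX\<^sub>t = \<alpha>(X\<^sub>t) dt + \<beta>(X\<^sub>t) dB\<^sub>t\<close> with initial law \<open>\<mu>\<close>, values in \<open>S\<close> and
  filtration \<open>\<sigma>(X\<^sub>0, (B\<^sub>s)\<^sub>s\<^sub>\<le>\<^sub>t)\<close>. The stochastic differential equation reads: for every \<open>t\<close>, the random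
  variable \<open>X\<^sub>t - X\<^sub>0 - \<integral>\<^sub>0\<^sup>t \<alpha>(X\<^sub>s) ds\<close> is the Ito integral of \<open>\<beta>(X)\<close> over \<open>[0, t]\<close>.\<close>

definition weak_solution ::
  "real set \<Rightarrow> (real \<Rightarrow> real) \<Rightarrow> (real \<Rightarrow> real) \<Rightarrow> real measure \<Rightarrow>
     'w measure \<Rightarrow> (real \<Rightarrow> 'w \<Rightarrow> real) \<Rightarrow> (real \<Rightarrow> 'w \<Rightarrow> real) \<Rightarrow> bool" where
  "weak_solution S \<alpha> \<beta> \<mu> M B X \<longleftrightarrow>
     prob_space M \<and>
     standard_brownian_motion M B \<and>
     continuous_process M X \<and>
     (\<forall>t\<ge>0. \<forall>\<omega>\<in>space M. X t \<omega> \<in> S) \<and>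
     distr M borel (X 0) = \<mu> \<and>
     indep_alg M (gen_alg M {0} X) (gen_alg M {0..} B) \<and>
     (\<forall>t\<ge>0. X t \<in> borel_measurable (filt M B X t)) \<and>
     (\<forall>t\<ge>0. has_ito_integral M (filt M B X) B (\<lambda>s \<omega>. \<beta> (X s \<omega>)) t
        (\<lambda>\<omega>. X t \<omega> - X 0 \<omega> - (LINT s:{0..t}|lborel. \<alpha> (X s \<omega>))))"

text \<open>The sample space, the Brownian motion and the solution may all depend on \<open>\<theta>\<close>. Given \<open>X\<^sub>0 \<sim> \<mu>\<^sub>\<theta>\<close>,
  stationarity makes \<open>\<mu>\<^sub>\<theta>\<close> the law of every \<open>X\<^sub>t\<close>; this invariance is nevertheless stated.\<close>

definition condition_M ::
  "real set \<Rightarrow> 'p::topological_space set \<Rightarrow> (real \<Rightarrow> 'p \<Rightarrow> real) \<Rightarrow> (real \<Rightarrow> 'p \<Rightarrow> real) \<Rightarrow>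
     ('p \<Rightarrow> real measure) \<Rightarrow>
     ('p \<Rightarrow> 'w measure) \<Rightarrow> ('p \<Rightarrow> real \<Rightarrow> 'w \<Rightarrow> real) \<Rightarrow> ('p \<Rightarrow> real \<Rightarrow> 'w \<Rightarrow> real) \<Rightarrow> bool" where
  "condition_M S \<Theta> a b \<mu> P B X \<longleftrightarrow>
     (\<forall>\<theta>\<in>\<Theta>.
        weak_solution S (\<lambda>x. a x \<theta>) (\<lambda>x. b x \<theta>) (\<mu> \<theta>) (P \<theta>) (B \<theta>) (X \<theta>) \<and>
        (\<forall>t\<ge>0. distr (P \<theta>) borel (X \<theta> t) = \<mu> \<theta>) \<and>
        stationary_process (P \<theta>) (X \<theta>) \<and>
        rho_mixing (P \<theta>) (X \<theta>)) \<and>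
     Cp20 S \<Theta> a \<and> Cp20 S \<Theta> b \<and>
     (\<forall>\<theta>\<in>\<Theta>. \<exists>C>0. \<forall>x\<in>S. \<bar>a x \<theta>\<bar> + \<bar>b x \<theta>\<bar> \<le> C * (1 + \<bar>x\<bar>)) \<and>
     (\<forall>\<theta>\<in>\<Theta>. \<forall>x\<in>S. b x \<theta> > 0) \<and>
     (\<forall>\<theta>\<in>\<Theta>. \<forall>k\<ge>(1::nat). set_integrable (\<mu> \<theta>) S (\<lambda>x. \<bar>x\<bar> ^ k))"

definition integrated_obs :: "(real \<Rightarrow> 'w \<Rightarrow> real) \<Rightarrow> real \<Rightarrow> nat \<Rightarrow> 'w \<Rightarrow> real" where
  "integrated_obs X \<delta> i \<omega> = (LINT s:{(real i - 1) * \<delta>..real i * \<delta>}|lborel. X s \<omega>) / \<delta>"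

end

theory Submission
  imports Defs
begin

text \<open>Let \<open>Y\<close> be the time average of \<open>X\<close> over \<open>[s, s + \<delta>]\<close>. Up to a drift and a martingale part of
  size \<open>\<delta>\<close>, the increment \<open>Y - X\<^sub>s\<close> is \<open>b(X\<^sub>s)\<close> times the time average of \<open>B - B\<^sub>s\<close>, which is Gaussian
  with variance \<open>\<delta>/3\<close> and covariance \<open>\<delta>/2\<close> with the Brownian increment, as one sees on Riemann sums. A
  Taylor expansion of \<open>f\<close> and moment bounds for stochastic integrals, conditional on \<open>\<F>\<^sub>s\<close>, give both
  moments of \<open>\<xi>\<^sub>2\<close> with remainders that are bounded by a polynomial weight of \<open>X\<^sub>s\<close>.

  It remains to see that the conditional moments are functions of \<open>X\<^sub>s\<close> that do not depend on \<open>s\<close>.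
  Uniqueness in law of the stochastic differential equation is not needed for this: on \<open>[s, s + \<delta>]\<close> the
  process \<open>X\<close> is the limit in probability of Euler schemes with clamped coefficients, which start from
  \<open>X\<^sub>s\<close>, are driven by \<open>B - B\<^sub>s\<close>, and have transition functions that do not depend on \<open>s\<close>. The function
  found at time \<open>0\<close> is then transported to time \<open>s\<close>, because \<open>X\<^sub>s\<close> and \<open>X\<^sub>0\<close> have the same law.\<close>

text \<open>The Ito integral is given only through unspecified simple processes that approximate
  \<open>\<beta>(X)\<close> in probability, so nothing can be computed from it directly. Lenglart's
  inequality replaces them by left-point sums on \<open>[s, t]\<close>; after that, moments are
  bounded on sums with constants that do not depend on the mesh and pass to the limit by Fatou,
  while means pass by convergence in \<open>L1\<close>. Conditioning stays in the form
  \<open>E(1_G V)\<close> with \<open>G\<close> in \<open>F s\<close>, which keeps exceptional null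
  sets out of all estimates; almost sure statements are drawn only at the end. Sizes are counted in
  half powers of the step: the conditional mean of \<open>\<xi>2\<close> needs every neglected term
  at order 3, its square at order 4. The Gaussian constants come from the integral of
  \<open>(a + b x)^2\<close> over \<open>[0, 1]\<close>, which is
  \<open>a^2 + a b + b^2 / 3\<close>. The operator \<open>H\<close> reads
  \<open>\<alpha> f' / 2 + \<beta>^2 f'' / 6\<close>: here 1/2 is the mean of \<open>x\<close> on
  \<open>[0, 1]\<close> and 1/6 is half the variance 1/3. This agrees with the form that contains
  1/12, since 1/6 = 1/4 - 1/12.\<close>

section \<open>Convexity and Riemann sums\<close>

lemma sum_power_even_mean_le:
  fixes x :: "nat \<Rightarrow> real"
  assumes "0 < N"
  shows "((\<Sum>j<N. x j) / real N) ^ (2 * k) \<le> (\<Sum>j<N. x j ^ (2 * k)) / real N"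
proof -
  have "(\<Sum>j<N. (1 / real N) *\<^sub>R x j) ^ (2 * k) \<le> (\<Sum>j<N. (1 / real N) * x j ^ (2 * k))"
    using assms by (intro convex_on_sum[OF _ _ convex_power_even]) auto
  then show ?thesis by (simp add: sum_divide_distrib)
qed

text \<open>Jensen's inequality for two points; a factor 1/2 on the right is given away.\<close>

lemma power_even_add_le:
  fixes x y :: real
  shows "(x + y) ^ (2 * k) \<le> 2 ^ (2 * k) * (x ^ (2 * k) + y ^ (2 * k))"
proof -
  have "((x + y) / 2) ^ (2 * k) \<le> (x ^ (2 * k) + y ^ (2 * k)) / 2"
    using sum_power_even_mean_le[of 2 "\<lambda>j. if j = 0 then x else y" k]
    by (simp add: numeral_2_eq_2)
  also have "\<dots> \<le> x ^ (2 * k) + y ^ (2 * k)" by simp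
  finally show ?thesis by (simp add: power_divide field_simps)
qed

abbreviation gridpt :: "real \<Rightarrow> real \<Rightarrow> nat \<Rightarrow> nat \<Rightarrow> real" where
  "gridpt s t N j \<equiv> s + real j * ((t - s) / real N)"

lemma gridpt_bounds:
  assumes "s \<le> t" "j \<le> N"
  shows "s \<le> gridpt s t N j" "gridpt s t N j \<le> t"
proof -
  show "s \<le> gridpt s t N j" using assms by simp
  show "gridpt s t N j \<le> t"
  proof (cases "N = 0")
    case False
    have "real j * (t - s) \<le> real N * (t - s)" using assms by (intro mult_right_mono) auto
    then show ?thesis using False by (simp add: field_simps)
  qed (use assms in simp)
qed

text \<open>The oscillation bound is a hypothesis, so that one path at a time can be inserted with
  its own modulus of continuity. The induction runs over the cells, each of which contributes at
  most \<open>d\<close> times its length.\<close>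

lemma integral_minus_riemann_sum_le:
  fixes g :: "real \<Rightarrow> real"
  assumes g: "continuous_on {s..t} g" and "s < t" "0 < N" and d: "0 \<le> d"
    and osc: "\<And>u v. u \<in> {s..t} \<Longrightarrow> v \<in> {s..t} \<Longrightarrow> \<bar>u - v\<bar> \<le> (t - s) / real N \<Longrightarrow> \<bar>g u - g v\<bar> \<le> d"
  shows "\<bar>integral {s..t} g - (\<Sum>j<N. g (gridpt s t N j)) * ((t - s) / real N)\<bar> \<le> d * (t - s)"
proof -
  define h where "h = (t - s) / real N"
  have h: "h > 0" using assms by (simp add: h_def)
  have *: "\<bar>integral {s..s + real n * h} g - (\<Sum>j<n. g (s + real j * h)) * h\<bar> \<le> d * (real n * h)" if "n \<le> N" for n
    using that
  proof (induction n)
    case (Suc n)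
    let ?u = "s + real n * h" and ?v = "s + real (Suc n) * h"
    have v: "?v \<le> t" using gridpt_bounds(2)[of s t "Suc n" N] assms Suc.prems by (simp add: h_def)
    have v: "?v \<le> t" "?u \<le> ?v" "s \<le> ?u" using v h by (auto simp: distrib_right)
    have int: "g integrable_on {s..?v}"
      using v by (intro integrable_continuous_real continuous_on_subset[OF g]) auto
    have int2: "g integrable_on {?u..?v}"
      using v by (intro integrable_continuous_real continuous_on_subset[OF g]) auto
    have e: "integral {s..?v} g = integral {s..?u} g + integral {?u..?v} g"
      using Henstock_Kurzweil_Integration.integral_combine[OF v(3,2) int] by simp
    have c: "h *\<^sub>R g ?u = integral {?u..?v} (\<lambda>_. g ?u)" using h by (simp add: algebra_simps)
    have "\<bar>integral {?u..?v} g - h * g ?u\<bar> = \<bar>integral {?u..?v} (\<lambda>x. g x - g ?u)\<bar>"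
      using c by (subst Henstock_Kurzweil_Integration.integral_diff[OF int2]) auto
    also have "\<dots> \<le> d * (?v - ?u)"
    proof -
      have "norm (integral {?u..?v} (\<lambda>x. g x - g ?u)) \<le> d * (?v - ?u)"
      proof (rule integral_bound)
        show "continuous_on {?u..?v} (\<lambda>x. g x - g ?u)"
          using v by (intro continuous_intros continuous_on_subset[OF g]) auto
        show "norm (g x - g ?u) \<le> d" if "x \<in> {?u..?v}" for x
        proof -
          have "x \<in> {s..t}" "?u \<in> {s..t}" using that v by auto
          moreover have "\<bar>x - ?u\<bar> \<le> h" using that by (auto simp: distrib_right)
          ultimately show ?thesis using osc by (simp add: h_def)
        qed
      qed (use v in auto)
      then show ?thesis by simp
    qed
    finally have "\<bar>integral {?u..?v} g - h * g ?u\<bar> \<le> d * h" by (simp add: algebra_simps)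
    then show ?case using Suc e by (simp add: algebra_simps)
  qed simp
  have "s + real N * h = t" using assms by (simp add: h_def)
  then show ?thesis using *[of N] assms by (simp add: h_def)
qed

lemma uniform_oscillation:
  fixes g :: "real \<Rightarrow> real"
  assumes g: "continuous_on {s..t} g" and e: "e > 0"
  shows "\<forall>\<^sub>F N in sequentially. \<forall>u\<in>{s..t}. \<forall>v\<in>{s..t}. \<bar>u - v\<bar> \<le> (t - s) / real N \<longrightarrow> \<bar>g u - g v\<bar> \<le> e"
proof -
  have "uniformly_continuous_on {s..t} g" using g by (intro compact_uniformly_continuous) auto
  then obtain d where d: "d > 0" "\<And>u v. u \<in> {s..t} \<Longrightarrow> v \<in> {s..t} \<Longrightarrow> dist v u < d \<Longrightarrow> dist (g v) (g u) < e"
    using e unfolding uniformly_continuous_on_def by metis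
  have "(\<lambda>N. (t - s) / real N) \<longlonglongrightarrow> 0" by (rule lim_const_over_n)
  then have "\<forall>\<^sub>F N in sequentially. (t - s) / real N < d" using d(1) by (rule order_tendstoD(2))
  then show ?thesis
  proof (rule eventually_mono, intro ballI impI)
    fix N u v assume "(t - s) / real N < d" "u \<in> {s..t}" "v \<in> {s..t}" "\<bar>u - v\<bar> \<le> (t - s) / real N"
    then show "\<bar>g u - g v\<bar> \<le> e" using d(2)[of v u] by (auto simp: dist_real_def)
  qed
qed

text \<open>The basic device of the development: a time average of a continuous path is a pointwise
  limit of averages over a grid. Measurability, moments and characteristic functions of time
  averages are read off the grid.\<close>

lemma riemann_mean_tendsto:
  fixes g :: "real \<Rightarrow> real"
  assumes g: "continuous_on {s..t} g" and st: "s < t"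
  shows "(\<lambda>N. (\<Sum>j<N. g (gridpt s t N j)) / real N) \<longlonglongrightarrow> integral {s..t} g / (t - s)"
proof (rule LIMSEQ_I)
  fix e :: real assume e: "e > 0"
  have "\<forall>\<^sub>F N in sequentially. N > 0 \<and> (\<forall>u\<in>{s..t}. \<forall>v\<in>{s..t}. \<bar>u - v\<bar> \<le> (t - s) / real N \<longrightarrow> \<bar>g u - g v\<bar> \<le> e / 2)"
    using e by (intro eventually_conj uniform_oscillation[OF g] eventually_gt_at_top) auto
  then obtain N0 where N0: "\<And>N. N \<ge> N0 \<Longrightarrow> N > 0 \<and> (\<forall>u\<in>{s..t}. \<forall>v\<in>{s..t}. \<bar>u - v\<bar> \<le> (t - s) / real N \<longrightarrow> \<bar>g u - g v\<bar> \<le> e / 2)"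
    by (auto simp: eventually_sequentially)
  show "\<exists>no. \<forall>n\<ge>no. norm ((\<Sum>j<n. g (gridpt s t n j)) / real n - integral {s..t} g / (t - s)) < e"
  proof (intro exI[of _ N0] allI impI)
    fix N assume "N \<ge> N0"
    then have "N > 0" "\<bar>integral {s..t} g - (\<Sum>j<N. g (gridpt s t N j)) * ((t - s) / real N)\<bar> \<le> e / 2 * (t - s)"
      using N0[of N] e by (blast, intro integral_minus_riemann_sum_le[OF g st]) auto
    then have "\<bar>integral {s..t} g - (\<Sum>j<N. g (gridpt s t N j)) * ((t - s) / real N)\<bar> / (t - s) \<le> e / 2"
      using st by (simp add: divide_le_eq)
    moreover have "(integral {s..t} g - (\<Sum>j<N. g (gridpt s t N j)) * ((t - s) / real N)) / (t - s)
        = integral {s..t} g / (t - s) - (\<Sum>j<N. g (gridpt s t N j)) / real N"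
    proof -
      have "c * ((t - s) / real N) / (t - s) = c / real N" for c using st by (metis diff_gt_0_iff_gt less_numeral_extra(3) mult.commute nonzero_mult_div_cancel_left times_divide_eq_left times_divide_eq_right)
      then show ?thesis by (simp only: diff_divide_distrib)
    qed
    ultimately have "\<bar>integral {s..t} g / (t - s) - (\<Sum>j<N. g (gridpt s t N j)) / real N\<bar> \<le> e / 2"
      using st by (metis abs_divide abs_of_pos diff_gt_0_iff_gt)
    then show "norm ((\<Sum>j<N. g (gridpt s t N j)) / real N - integral {s..t} g / (t - s)) < e"
      using e by (simp add: abs_minus_commute)
  qed
qed

section \<open>Polynomial weights and Taylor expansion\<close>

text \<open>The real exponent is rounded up to a natural number and the weight becomes
  \<open>(1 + \<bar>x\<bar>) ^ p\<close>, which is at least 1 and increases with \<open>p\<close>;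
  such weights are easily compared and multiplied.\<close>

lemma polynomial_growthE:
  assumes "polynomial_growth S f"
  obtains C p where "C \<ge> 0" "\<And>x. x \<in> S \<Longrightarrow> \<bar>f x\<bar> \<le> C * (1 + \<bar>x\<bar>) ^ p"
proof -
  obtain C where C: "C > 0" "\<And>x. x \<in> S \<Longrightarrow> \<bar>f x\<bar> \<le> C * (1 + \<bar>x\<bar> powr C)"
    using assms unfolding polynomial_growth_def by blast
  define p where "p = nat \<lceil>C\<rceil>"
  have p: "C \<le> real p" unfolding p_def by linarith
  have "\<bar>f x\<bar> \<le> (2 * C) * (1 + \<bar>x\<bar>) ^ p" if "x \<in> S" for x
  proof -
    have "\<bar>x\<bar> powr C \<le> (1 + \<bar>x\<bar>) powr C" using C by (intro powr_mono2) auto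
    also have "\<dots> \<le> (1 + \<bar>x\<bar>) powr real p" using p by (intro powr_mono) auto
    finally have "\<bar>x\<bar> powr C \<le> (1 + \<bar>x\<bar>) ^ p" by (simp add: powr_realpow)
    moreover have "1 \<le> (1 + \<bar>x\<bar>) ^ p" by simp
    ultimately have "1 + \<bar>x\<bar> powr C \<le> 2 * (1 + \<bar>x\<bar>) ^ p" by linarith
    then have "C * (1 + \<bar>x\<bar> powr C) \<le> C * (2 * (1 + \<bar>x\<bar>) ^ p)" using C by simp
    then show ?thesis using C(2)[OF that] by simp
  qed
  then show ?thesis using that[of "2 * C" p] C by auto
qed

lemma polynomial_growth_weight: "polynomial_growth S (\<lambda>x. C * (1 + \<bar>x\<bar>) ^ p)"
proof -
  \<comment> \<open>One constant has to serve as factor and as exponent, as in the definition of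
    polynomial growth; \<open>Suc p\<close> keeps it positive.\<close>
  define D where "D = max (real (Suc p)) (\<bar>C\<bar> * 2 ^ p)"
  have "\<bar>C * (1 + \<bar>x\<bar>) ^ p\<bar> \<le> D * (1 + \<bar>x\<bar> powr D)" for x :: real
  proof -
    have "(1 + \<bar>x\<bar>) ^ p \<le> 2 ^ p * (1 + \<bar>x\<bar> powr D)"
    proof (cases "\<bar>x\<bar> \<le> 1")
      case True
      then have "(1 + \<bar>x\<bar>) ^ p \<le> 2 ^ p" by (intro power_mono) auto
      also have "\<dots> \<le> 2 ^ p * (1 + \<bar>x\<bar> powr D)" by simp
      finally show ?thesis .
    next
      case False
      then have "(1 + \<bar>x\<bar>) ^ p \<le> (2 * \<bar>x\<bar>) ^ p" by (intro power_mono) auto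
      also have "\<dots> = 2 ^ p * \<bar>x\<bar> powr real p" using False by (simp add: power_mult_distrib powr_realpow)
      also have "\<dots> \<le> 2 ^ p * (1 + \<bar>x\<bar> powr D)"
      proof -
        have "\<bar>x\<bar> powr real p \<le> \<bar>x\<bar> powr D" using False by (intro powr_mono) (auto simp: D_def)
        then show ?thesis by simp
      qed
      finally show ?thesis .
    qed
    then have "\<bar>C\<bar> * (1 + \<bar>x\<bar>) ^ p \<le> \<bar>C\<bar> * (2 ^ p * (1 + \<bar>x\<bar> powr D))" by (intro mult_left_mono) auto
    also have "\<dots> \<le> D * (1 + \<bar>x\<bar> powr D)"
      unfolding mult.assoc[symmetric] by (intro mult_right_mono) (auto simp: D_def)
    finally show ?thesis by (simp add: abs_mult)
  qed
  moreover have "D > 0" by (simp add: D_def)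
  ultimately show ?thesis unfolding polynomial_growth_def by blast
qed

text \<open>Mean value theorem, where the intermediate point satisfies
  \<open>1 + |z| <= (1 + |x|) (1 + |y|)\<close>. The product form separates the two end points, so
  that each weight can be estimated at its own time.\<close>

lemma polynomially_lipschitz:
  fixes g :: "real \<Rightarrow> real"
  assumes S: "is_interval S" and d: "\<And>x. x \<in> S \<Longrightarrow> g field_differentiable at x"
    and C: "C \<ge> 0" "\<And>x. x \<in> S \<Longrightarrow> \<bar>deriv g x\<bar> \<le> C * (1 + \<bar>x\<bar>) ^ p" and "x \<in> S" "y \<in> S"
  shows "\<bar>g x - g y\<bar> \<le> C * ((1 + \<bar>x\<bar>) * (1 + \<bar>y\<bar>)) ^ p * \<bar>x - y\<bar>"
proof -
  have *: "\<bar>g x - g y\<bar> \<le> C * ((1 + \<bar>x\<bar>) * (1 + \<bar>y\<bar>)) ^ p * \<bar>x - y\<bar>" if "x \<in> S" "y \<in> S" "x < y" for x y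
  proof -
    have sub: "z \<in> S" if "x \<le> z" "z \<le> y" for z
      using S \<open>x \<in> S\<close> \<open>y \<in> S\<close> that mem_is_interval_1_I by metis
    obtain z where z: "x < z" "z < y" "g y - g x = (y - x) * deriv g z"
      using MVT2[OF \<open>x < y\<close>, of g "deriv g"] d sub by (metis DERIV_deriv_iff_field_differentiable)
    have "1 + \<bar>z\<bar> \<le> (1 + \<bar>x\<bar>) * (1 + \<bar>y\<bar>)"
    proof -
      have "\<bar>z\<bar> \<le> \<bar>x\<bar> + \<bar>y\<bar>" using z by linarith
      moreover have "0 \<le> \<bar>x\<bar> * \<bar>y\<bar>" by simp
      ultimately show ?thesis unfolding distrib_left distrib_right by linarith
    qed
    then have "\<bar>deriv g z\<bar> \<le> C * ((1 + \<bar>x\<bar>) * (1 + \<bar>y\<bar>)) ^ p"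
      using C(2)[of z] sub[of z] z C(1)
      by (meson less_imp_le mult_left_mono order_trans power_mono abs_ge_zero add_nonneg_nonneg zero_le_one)
    then have "\<bar>(y - x) * deriv g z\<bar> \<le> \<bar>y - x\<bar> * (C * ((1 + \<bar>x\<bar>) * (1 + \<bar>y\<bar>)) ^ p)"
      unfolding abs_mult by (intro mult_left_mono) auto
    then show ?thesis using z by (simp add: abs_minus_commute mult.commute)
  qed
  consider "x < y" | "x = y" | "y < x" by linarith
  then show ?thesis
  proof cases
    case 3
    then show ?thesis using *[of y x] assms by (simp add: abs_minus_commute mult.commute)
  qed (use * assms in auto)
qed

text \<open>Lagrange remainder. The bound on \<open>|z|\<close> is recorded because the growth of
  the last derivative will be evaluated there; equal points are treated apart because Taylor's
  theorem places \<open>z\<close> strictly between distinct ones.\<close>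

lemma taylor_mean_value:
  fixes f :: "real \<Rightarrow> real"
  assumes S: "is_interval S" and d: "\<And>i x. i < n \<Longrightarrow> x \<in> S \<Longrightarrow> (deriv ^^ i) f field_differentiable at x"
    and "n > 0" "x \<in> S" "y \<in> S"
  shows "\<exists>z\<in>S. \<bar>z\<bar> \<le> \<bar>x\<bar> + \<bar>y\<bar> \<and> f y = (\<Sum>m<n. (deriv ^^ m) f x / fact m * (y - x) ^ m) + (deriv ^^ n) f z / fact n * (y - x) ^ n"
proof (cases "x = y")
  case True
  have "(\<Sum>m<n. (deriv ^^ m) f x / fact m * 0 ^ m) = (\<Sum>m\<in>{0}. (deriv ^^ m) f x / fact m * 0 ^ m)"
    using \<open>n > 0\<close> by (intro sum.mono_neutral_right) auto
  then show ?thesis using assms True by (intro bexI[of _ x]) auto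
next
  case False
  have sub: "z \<in> S" if "min x y \<le> z" "z \<le> max x y" for z
    using mem_is_interval_1_I[OF S _ _ that] \<open>x \<in> S\<close> \<open>y \<in> S\<close> by (cases "x \<le> y") (simp_all add: max_def min_def)
  have "\<exists>t. (if y < x then y < t \<and> t < x else x < t \<and> t < y) \<and>
     f y = (\<Sum>m<n. (deriv ^^ m) f x / fact m * (y - x) ^ m) + (deriv ^^ n) f t / fact n * (y - x) ^ n"
  proof (rule Taylor[where a = "min x y" and b = "max x y"])
    show "\<forall>m t. m < n \<and> min x y \<le> t \<and> t \<le> max x y \<longrightarrow> ((deriv ^^ m) f has_real_derivative (deriv ^^ Suc m) f t) (at t)"
      using d sub by (auto simp: DERIV_deriv_iff_field_differentiable)
  qed (use False assms in auto)
  then obtain t where t: "if y < x then y < t \<and> t < x else x < t \<and> t < y"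
     "f y = (\<Sum>m<n. (deriv ^^ m) f x / fact m * (y - x) ^ m) + (deriv ^^ n) f t / fact n * (y - x) ^ n" by blast
  then show ?thesis using sub[of t] by (intro bexI[of _ t]) (auto split: if_splits)
qed

section \<open>Convergence in probability\<close>

context prob_space
begin

text \<open>A metric for convergence in probability. The truncation at 1 makes it finite for all
  random variables, so the triangle inequality costs no integrability.\<close>

definition pdist :: "('a \<Rightarrow> real) \<Rightarrow> ('a \<Rightarrow> real) \<Rightarrow> real" where
  "pdist U V = expectation (\<lambda>w. min 1 \<bar>U w - V w\<bar>)"

lemma integrable_pdist [simp, intro]:
  fixes U V :: "'a \<Rightarrow> real"
  assumes [measurable]: "U \<in> borel_measurable M" "V \<in> borel_measurable M"
  shows "integrable M (\<lambda>w. min 1 \<bar>U w - V w\<bar>)"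
  by (rule integrable_const_bound[where B = 1]) auto

lemma pdist_nonneg [simp]: "0 \<le> pdist U V"
  unfolding pdist_def by (intro Bochner_Integration.integral_nonneg) auto

lemma pdist_triangle:
  assumes [measurable]: "U \<in> borel_measurable M" "V \<in> borel_measurable M" "W \<in> borel_measurable M"
  shows "pdist U W \<le> pdist U V + pdist V W"
proof -
  have "pdist U W \<le> expectation (\<lambda>w. min 1 \<bar>U w - V w\<bar> + min 1 \<bar>V w - W w\<bar>)"
    unfolding pdist_def by (intro integral_mono Bochner_Integration.integrable_add integrable_pdist) auto
  then show ?thesis by (simp add: pdist_def)
qed

text \<open>The link to probabilities of deviations, in terms of which the Ito integral is
  defined.\<close>

lemma pdist_le_prob:
  assumes [measurable]: "U \<in> borel_measurable M" "V \<in> borel_measurable M" and "e \<ge> 0"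
  shows "pdist U V \<le> e + prob {w\<in>space M. \<bar>U w - V w\<bar> > e}"
proof -
  have "pdist U V \<le> expectation (\<lambda>w. e + indicator {w\<in>space M. \<bar>U w - V w\<bar> > e} w)"
    unfolding pdist_def
  proof (rule integral_mono)
    show "integrable M (\<lambda>w. e + indicator {w\<in>space M. \<bar>U w - V w\<bar> > e} w)"
      by (intro Bochner_Integration.integrable_add integrable_real_indicator) (auto simp: emeasure_eq_measure)
  qed (use assms(3) in \<open>auto simp: indicator_def\<close>)
  also have "\<dots> = e + prob {w\<in>space M. \<bar>U w - V w\<bar> > e}"
    by (subst Bochner_Integration.integral_add) (auto simp: prob_space emeasure_eq_measure)
  finally show ?thesis .
qed

lemma AE_tendsto_pdist:
  assumes [measurable]: "\<And>n. Z n \<in> borel_measurable M" "Y \<in> borel_measurable M"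
    and "AE w in M. (\<lambda>n. Z n w) \<longlonglongrightarrow> Y w"
  shows "(\<lambda>n. pdist (Z n) Y) \<longlonglongrightarrow> 0"
proof -
  have "(\<lambda>n. expectation (\<lambda>w. min 1 \<bar>Z n w - Y w\<bar>)) \<longlonglongrightarrow> expectation (\<lambda>w. 0)"
  proof (rule integral_dominated_convergence[where w = "\<lambda>_. 1"])
    show "AE w in M. (\<lambda>n. min 1 \<bar>Z n w - Y w\<bar>) \<longlonglongrightarrow> 0"
      using assms(3)
    proof eventually_elim
      case (elim w)
      then have "(\<lambda>n. min 1 \<bar>Z n w - Y w\<bar>) \<longlonglongrightarrow> min 1 \<bar>Y w - Y w\<bar>" by (intro tendsto_intros)
      then show ?case by simp
    qed
  qed auto
  then show ?thesis by (simp add: pdist_def)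
qed

lemma pdist_AE_subseq:
  assumes [measurable]: "\<And>n. Z n \<in> borel_measurable M" "Y \<in> borel_measurable M"
    and "(\<lambda>n. pdist (Z n) Y) \<longlonglongrightarrow> 0"
  obtains r where "strict_mono r" "AE w in M. (\<lambda>n. Z (r n) w) \<longlonglongrightarrow> Y w"
proof -
  have "\<exists>r::nat\<Rightarrow>nat. strict_mono r \<and> (AE w in M. (\<lambda>n. min 1 \<bar>Z (r n) w - Y w\<bar>) \<longlonglongrightarrow> 0)"
    using assms(3) by (intro tendsto_L1_AE_subseq) (auto simp: pdist_def)
  then obtain r where r: "strict_mono r" "AE w in M. (\<lambda>n. min 1 \<bar>Z (r n) w - Y w\<bar>) \<longlonglongrightarrow> 0" by blast
  from r(2) have "AE w in M. (\<lambda>n. Z (r n) w) \<longlonglongrightarrow> Y w"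
  proof eventually_elim
    case (elim w)
    \<comment> \<open>Once the truncated distance is below 1, the truncation is no longer
      active.\<close>
    have "\<forall>\<^sub>F n in sequentially. min 1 \<bar>Z (r n) w - Y w\<bar> < 1" using order_tendstoD(2)[OF elim, of 1] by simp
    then have "\<forall>\<^sub>F n in sequentially. min 1 \<bar>Z (r n) w - Y w\<bar> = \<bar>Z (r n) w - Y w\<bar>" by eventually_elim auto
    with elim have "(\<lambda>n. \<bar>Z (r n) w - Y w\<bar>) \<longlonglongrightarrow> 0" by (rule Lim_transform_eventually)
    then have "(\<lambda>n. Z (r n) w - Y w) \<longlonglongrightarrow> 0" by (simp only: tendsto_rabs_zero_iff)
    then show ?case by (rule Lim_null[THEN iffD2])
  qed
  with r(1) that show ?thesis by blast
qed

text \<open>Fatou's lemma along an almost surely convergent subsequence. Only an upper bound passes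
  to the limit, but it does so without uniform integrability; the indicator of \<open>G\<close>
  carries the conditioning.\<close>

lemma pdist_integral_le:
  assumes [measurable]: "\<And>n. Z n \<in> borel_measurable M" "Y \<in> borel_measurable M"
    and "(\<lambda>n. pdist (Z n) Y) \<longlonglongrightarrow> 0"
    and c: "continuous_on UNIV \<phi>" "\<And>x. 0 \<le> \<phi> x" and G[measurable]: "G \<in> sets M"
    and i: "\<And>n. integrable M (\<lambda>w. indicator G w * \<phi> (Z n w))"
    and b: "\<forall>\<^sub>F n in sequentially. expectation (\<lambda>w. indicator G w * \<phi> (Z n w)) \<le> (b :: real)"
  shows "integrable M (\<lambda>w. indicator G w * \<phi> (Y w))" "expectation (\<lambda>w. indicator G w * \<phi> (Y w)) \<le> b"
proof -
  have [measurable]: "\<phi> \<in> borel_measurable borel" using c by (intro borel_measurable_continuous_onI)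
  obtain r where r: "strict_mono r" "AE w in M. (\<lambda>n. Z (r n) w) \<longlonglongrightarrow> Y w"
    using pdist_AE_subseq[OF assms(1-3)] by blast
  from b obtain n0 where n0: "\<And>n. n \<ge> n0 \<Longrightarrow> expectation (\<lambda>w. indicator G w * \<phi> (Z n w)) \<le> b"
    by (auto simp: eventually_sequentially)
  have "0 \<le> expectation (\<lambda>w. indicator G w * \<phi> (Z n0 w))"
    using c(2) by (intro Bochner_Integration.integral_nonneg) auto
  then have b0: "0 \<le> b" using n0[of n0] by simp
  have "(\<integral>\<^sup>+w. ennreal (indicator G w * \<phi> (Y w)) \<partial>M) = (\<integral>\<^sup>+w. liminf (\<lambda>n. ennreal (indicator G w * \<phi> (Z (r n) w))) \<partial>M)"
  proof (rule nn_integral_cong_AE)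
    from r(2) show "AE w in M. ennreal (indicator G w * \<phi> (Y w)) = liminf (\<lambda>n. ennreal (indicator G w * \<phi> (Z (r n) w)))"
    proof eventually_elim
      case (elim w)
      have "isCont \<phi> (Y w)" using c(1) by (simp add: continuous_on_eq_continuous_at)
      then have "(\<lambda>n. \<phi> (Z (r n) w)) \<longlonglongrightarrow> \<phi> (Y w)" using elim isCont_tendsto_compose by blast
      then have "(\<lambda>n. ennreal (indicator G w * \<phi> (Z (r n) w))) \<longlonglongrightarrow> ennreal (indicator G w * \<phi> (Y w))"
        by (intro tendsto_intros)
      then show ?case by (intro lim_imp_Liminf[symmetric]) auto
    qed
  qed
  also have "\<dots> \<le> liminf (\<lambda>n. \<integral>\<^sup>+w. ennreal (indicator G w * \<phi> (Z (r n) w)) \<partial>M)"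
    by (intro nn_integral_liminf) auto
  also have "\<dots> \<le> liminf (\<lambda>n. ennreal b)"
  proof (rule Liminf_mono, unfold eventually_sequentially, intro exI[of _ n0] allI impI)
    fix n assume "n0 \<le> n"
    then have "r n \<ge> n0" using seq_suble[OF r(1), of n] by simp
    moreover have "(\<integral>\<^sup>+w. ennreal (indicator G w * \<phi> (Z (r n) w)) \<partial>M) = ennreal (expectation (\<lambda>w. indicator G w * \<phi> (Z (r n) w)))"
      using i c(2) by (intro nn_integral_eq_integral) auto
    ultimately show "(\<integral>\<^sup>+w. ennreal (indicator G w * \<phi> (Z (r n) w)) \<partial>M) \<le> ennreal b"
      using n0 by (auto intro!: ennreal_leI)
  qed
  also have "\<dots> = ennreal b" by (simp add: Liminf_const)
  finally have *: "(\<integral>\<^sup>+w. ennreal (indicator G w * \<phi> (Y w)) \<partial>M) \<le> ennreal b" .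
  show 1: "integrable M (\<lambda>w. indicator G w * \<phi> (Y w))"
    using * c(2) by (intro integrableI_nonneg) (auto simp: le_less_trans less_top[symmetric] top_unique)
  show "expectation (\<lambda>w. indicator G w * \<phi> (Y w)) \<le> b"
    using * b0 c(2) by (subst (asm) nn_integral_eq_integral[OF 1]) auto
qed

text \<open>Boundedness in \<open>L2\<close> makes the sequence uniformly integrable, so convergence
  in probability becomes convergence in \<open>L1\<close>. This is what lets conditional means, and
  not only bounds, pass to the limit.\<close>

lemma pdist_L2_bounded_tendsto_L1:
  assumes [measurable]: "\<And>n. Z n \<in> borel_measurable M" "Y \<in> borel_measurable M"
    and p: "(\<lambda>n. pdist (Z n) Y) \<longlonglongrightarrow> 0"
    and i: "\<And>n. integrable M (\<lambda>w. (Z n w)\<^sup>2)" "\<And>n. expectation (\<lambda>w. (Z n w)\<^sup>2) \<le> c"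
  shows "integrable M (\<lambda>w. (Y w)\<^sup>2)" "expectation (\<lambda>w. (Y w)\<^sup>2) \<le> c"
    "\<And>n. integrable M (\<lambda>w. Z n w)" "integrable M Y"
    "(\<lambda>n. expectation (\<lambda>w. \<bar>Z n w - Y w\<bar>)) \<longlonglongrightarrow> 0"
proof -
  have c: "continuous_on UNIV (\<lambda>x::real. x\<^sup>2)" by (intro continuous_intros)
  have i': "integrable M (\<lambda>w. indicator (space M) w * (Z n w)\<^sup>2)" for n
    using i(1)[of n] by (rule Bochner_Integration.integrable_cong[OF refl, THEN iffD1, rotated]) auto
  have b': "expectation (\<lambda>w. indicator (space M) w * (Z n w)\<^sup>2) \<le> c" for n
    using i(2)[of n] by (subst Bochner_Integration.integral_cong[OF refl, of _ _ "\<lambda>w. (Z n w)\<^sup>2"]) auto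
  note * = pdist_integral_le[OF assms(1,2) p c _ sets.top i' always_eventually[OF allI[OF b']], simplified]
  show Y2: "integrable M (\<lambda>w. (Y w)\<^sup>2)"
    using *(1) by (rule Bochner_Integration.integrable_cong[OF refl, THEN iffD1, rotated]) auto
  show EY2: "expectation (\<lambda>w. (Y w)\<^sup>2) \<le> c"
    using *(2) by (subst (asm) Bochner_Integration.integral_cong[OF refl, of _ _ "\<lambda>w. (Y w)\<^sup>2"]) auto
  have Z1: "integrable M (\<lambda>w. Z n w)" for n
    using assms(1)[of n] i(1)[of n] by (rule square_integrable_imp_integrable)
  then show "integrable M (\<lambda>w. Z n w)" for n .
  show Y1: "integrable M Y" using assms(2) Y2 by (rule square_integrable_imp_integrable)
  have c0: "0 \<le> c" using i(2)[of 0] by (rule order_trans[rotated]) auto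
  \<comment> \<open>Truncation at level \<open>K\<close>: a distance up to 1 is its own minimum with
    1, between 1 and \<open>K\<close> the term \<open>K\<close> dominates, and above
    \<open>K\<close> the square does.\<close>
  have key: "expectation (\<lambda>w. \<bar>Z n w - Y w\<bar>) \<le> K * pdist (Z n) Y + 4 * c / K" if K: "K \<ge> 1" for n K
  proof -
    have "expectation (\<lambda>w. \<bar>Z n w - Y w\<bar>) \<le> expectation (\<lambda>w. K * min 1 \<bar>Z n w - Y w\<bar> + (2 * (Z n w)\<^sup>2 + 2 * (Y w)\<^sup>2) / K)"
    proof (rule integral_mono)
      fix w
      let ?D = "\<bar>Z n w - Y w\<bar>"
      have d: "?D\<^sup>2 \<le> 2 * (Z n w)\<^sup>2 + 2 * (Y w)\<^sup>2"
        using sum_squares_ge_zero[of "Z n w + Y w" 0] by (simp add: power2_eq_square algebra_simps)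
      have "?D \<le> K * min 1 ?D + ?D\<^sup>2 / K"
      proof -
        consider "?D \<le> 1" | "1 < ?D" "?D \<le> K" | "K < ?D" by linarith
        then show ?thesis
        proof cases
          case 1
          have "?D \<le> K * ?D" using K mult_right_mono[of 1 K ?D] by simp
          then show ?thesis using 1 K by (simp add: min_def add_increasing2)
        next
          case 2
          then show ?thesis using K by (simp add: add_increasing2)
        next
          case 3
          then have "K * ?D \<le> ?D * ?D" by (intro mult_right_mono) auto
          then have "?D \<le> ?D\<^sup>2 / K" using K by (simp add: field_simps power2_eq_square)
          then show ?thesis using K by (simp add: add_increasing)
        qed
      qed
      also have "\<dots> \<le> K * min 1 ?D + (2 * (Z n w)\<^sup>2 + 2 * (Y w)\<^sup>2) / K"
        using d K by (intro add_left_mono divide_right_mono) auto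
      finally show "?D \<le> \<dots>" .
    qed (use Z1 Y1 Y2 i in auto)
    also have "\<dots> = K * pdist (Z n) Y + (2 * expectation (\<lambda>w. (Z n w)\<^sup>2) + 2 * expectation (\<lambda>w. (Y w)\<^sup>2)) / K"
      using i Y2 by (simp add: pdist_def)
    also have "\<dots> \<le> K * pdist (Z n) Y + 4 * c / K"
      using i(2)[of n] EY2 K by (intro add_left_mono divide_right_mono) auto
    finally show ?thesis .
  qed
  show "(\<lambda>n. expectation (\<lambda>w. \<bar>Z n w - Y w\<bar>)) \<longlonglongrightarrow> 0"
  proof (rule LIMSEQ_I)
    fix e :: real assume e: "e > 0"
    \<comment> \<open>With this \<open>K\<close> the square term is at most \<open>e / 2\<close>;
      the index \<open>n\<close> then takes care of the other term.\<close>
    define K where "K = max 1 (8 * c / e)"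
    have K: "K \<ge> 1" "4 * c / K \<le> e / 2" using e c0 by (auto simp: K_def field_simps max_def)
    have "\<forall>\<^sub>F n in sequentially. pdist (Z n) Y < e / (2 * K)"
      using p K e by (intro order_tendstoD(2)) auto
    then obtain n0 where n0: "\<And>n. n \<ge> n0 \<Longrightarrow> pdist (Z n) Y < e / (2 * K)" by (auto simp: eventually_sequentially)
    show "\<exists>no. \<forall>n\<ge>no. norm (expectation (\<lambda>w. \<bar>Z n w - Y w\<bar>) - 0) < e"
    proof (intro exI[of _ n0] allI impI)
      fix n assume "n \<ge> n0"
      then have "K * pdist (Z n) Y < K * (e / (2 * K))" using n0 K by (intro mult_strict_left_mono) auto
      then have "K * pdist (Z n) Y < e / 2" using K by simp
      moreover have "0 \<le> expectation (\<lambda>w. \<bar>Z n w - Y w\<bar>)" by simp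
      ultimately show "norm (expectation (\<lambda>w. \<bar>Z n w - Y w\<bar>) - 0) < e" using key[OF K(1), of n] K by simp
    qed
  qed
qed

end

section \<open>Brownian filtrations\<close>

text \<open>A crude form of Young's inequality: both numbers are replaced by the larger one. It
  bounds mixed moments by pure ones.\<close>

lemma power_mult_power_le_sum:
  fixes a b :: real
  assumes "0 \<le> a" "0 \<le> b" "i \<le> n"
  shows "a ^ (n - i) * b ^ i \<le> a ^ n + b ^ n"
proof -
  have "a ^ (n - i) * b ^ i \<le> (max a b) ^ (n - i) * (max a b) ^ i"
    using assms by (intro mult_mono power_mono) auto
  also have "\<dots> = (max a b) ^ n" using assms by (simp add: power_add[symmetric])
  also have "\<dots> \<le> a ^ n + b ^ n" using assms by (simp add: max_def)
  finally show ?thesis .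
qed

text \<open>The moments of the standard normal law; the even ones are the double factorials
  \<open>(i - 1)!!\<close>.\<close>

definition gauss_moment :: "nat \<Rightarrow> real" where
  "gauss_moment i = (if odd i then 0 else fact i / (2 ^ (i div 2) * fact (i div 2)))"

lemma gauss_moment_nonneg [simp]: "0 \<le> gauss_moment i"
  by (simp add: gauss_moment_def)

text \<open>In one of \<open>N\<close> steps of a stochastic sum a moment grows by a factor of at
  most \<open>1 + C / N\<close>, where \<open>C\<close> is the sum in the exponent; \<open>N\<close>
  steps give at most \<open>exp C\<close>, whatever the mesh.\<close>

definition moment_const :: "nat \<Rightarrow> real" where
  "moment_const k = exp (\<Sum>i\<le>2 * k. real (2 * k choose i) * gauss_moment i)"

text \<open>Increments are independent of \<open>F s\<close> and not only of the past of
  \<open>B\<close>, since the weights of stochastic sums also depend on the initial value of the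
  solution. The filtration is kept abstract until the weak solution is inserted.\<close>

locale brownian_filtration = prob_space M for M :: "'w measure" +
  fixes F :: "real \<Rightarrow> 'w measure" and B :: "real \<Rightarrow> 'w \<Rightarrow> real"
  assumes subalg: "0 \<le> t \<Longrightarrow> subalgebra M (F t)"
    and F_mono: "0 \<le> s \<Longrightarrow> s \<le> t \<Longrightarrow> subalgebra (F t) (F s)"
    and B_adapted: "0 \<le> t \<Longrightarrow> B t \<in> borel_measurable (F t)"
    and B_inc: "0 \<le> s \<Longrightarrow> s < t \<Longrightarrow>
      distributed M lborel (\<lambda>w. B t w - B s w) (normal_density 0 (sqrt (t - s)))"
    and B_indep: "0 \<le> s \<Longrightarrow> s < t \<Longrightarrow> indep_of_alg M (\<lambda>w. B t w - B s w) (F s)"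
begin

lemma F_measurable: "0 \<le> s \<Longrightarrow> s \<le> t \<Longrightarrow> V \<in> measurable (F s) N \<Longrightarrow> V \<in> measurable (F t) N"
  by (rule measurable_from_subalg[OF F_mono])

lemma M_measurable: "0 \<le> s \<Longrightarrow> V \<in> measurable (F s) N \<Longrightarrow> V \<in> measurable M N"
  by (rule measurable_from_subalg[OF subalg])

lemma F_sets: "0 \<le> s \<Longrightarrow> s \<le> t \<Longrightarrow> G \<in> sets (F s) \<Longrightarrow> G \<in> sets (F t)"
  using F_mono unfolding subalgebra_def by blast

lemma M_sets: "0 \<le> s \<Longrightarrow> G \<in> sets (F s) \<Longrightarrow> G \<in> sets M"
  using subalg unfolding subalgebra_def by blast

lemma space_F: "0 \<le> s \<Longrightarrow> space (F s) = space M"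
  using subalg unfolding subalgebra_def by blast

lemma B_measurable [measurable]: "0 \<le> t \<Longrightarrow> B t \<in> borel_measurable M"
  using B_adapted M_measurable by blast

lemma increment_prob:
  assumes "0 \<le> s" "s < t" and A: "A \<in> sets (F s)" and E: "E \<in> sets borel"
  shows "prob (A \<inter> ((\<lambda>w. B t w - B s w) -` E \<inter> space M)) = prob A * prob ((\<lambda>w. B t w - B s w) -` E \<inter> space M)"
proof -
  have "(\<lambda>w. B t w - B s w) -` E \<inter> space M \<in> sets (vimage_algebra (space M) (\<lambda>w. B t w - B s w) borel)"
    using E by (rule in_vimage_algebra)
  moreover have "\<forall>a\<in>sets (vimage_algebra (space M) (\<lambda>w. B t w - B s w) borel). \<forall>b\<in>sets (F s). prob (b \<inter> a) = prob b * prob a"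
    using B_indep[OF assms(1,2)] unfolding indep_of_alg_def indep_alg_def indep_sets2_eq
    by (simp only: Int_commute mult.commute) simp
  ultimately show ?thesis using A by blast
qed

text \<open>Both generated sigma-algebras are enlarged: that of \<open>V\<close> to
  \<open>F s\<close>, and that of \<open>\<phi>\<close> of the increment to the preimages of Borel
  sets under the increment. There the product formula is known.\<close>

lemma increment_indep_var:
  assumes "0 \<le> s" "s < t" and V: "V \<in> measurable (F s) N" and \<phi>: "\<phi> \<in> measurable borel N'"
  shows "indep_var N V N' (\<lambda>w. \<phi> (B t w - B s w))"
proof -
  let ?D = "\<lambda>w. B t w - B s w"
  have D[measurable]: "?D \<in> borel_measurable M" using assms by (intro borel_measurable_diff B_measurable) auto
  have V': "V \<in> measurable M N" using assms M_measurable by blast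
  have 1: "sigma_sets (space M) {V -` A \<inter> space M | A. A \<in> sets N} \<subseteq> sets (F s)"
  proof -
    have "sigma_sets (space (F s)) {V -` A \<inter> space (F s) | A. A \<in> sets N} \<subseteq> sets (F s)"
      using V by (intro sets.sigma_sets_subset) (auto intro: measurable_sets)
    then show ?thesis using space_F[OF assms(1)] by simp
  qed
  have 2: "sigma_sets (space M) {(\<lambda>w. \<phi> (?D w)) -` A \<inter> space M | A. A \<in> sets N'} \<subseteq> {?D -` A \<inter> space M | A. A \<in> sets borel}"
  proof -
    have "sigma_sets (space M) {(\<lambda>w. \<phi> (?D w)) -` A \<inter> space M | A. A \<in> sets N'} \<subseteq> sets (vimage_algebra (space M) ?D borel)"
    proof (subst space_vimage_algebra[symmetric, of _ ?D borel], rule sets.sigma_sets_subset)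
      show "{(\<lambda>w. \<phi> (?D w)) -` A \<inter> space M |A. A \<in> sets N'} \<subseteq> sets (vimage_algebra (space M) ?D borel)"
      proof safe
        fix A assume "A \<in> sets N'"
        then have "\<phi> -` A \<inter> space borel \<in> sets borel" using \<phi> by (rule measurable_sets[rotated])
        then have "?D -` (\<phi> -` A) \<inter> space M \<in> sets (vimage_algebra (space M) ?D borel)" by (intro in_vimage_algebra) simp
        moreover have "(\<lambda>w. \<phi> (?D w)) -` A \<inter> space M = ?D -` (\<phi> -` A) \<inter> space M" by auto
        ultimately show "(\<lambda>w. \<phi> (?D w)) -` A \<inter> space M \<in> sets (vimage_algebra (space M) ?D borel)" by simp
      qed
    qed
    then show ?thesis by (subst (asm) sets_vimage_algebra2) auto
  qed
  show ?thesis
    unfolding indep_var_eq indep_sets2_eq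
  proof (intro conjI ballI)
    show "sigma_sets (space M) {V -` A \<inter> space M |A. A \<in> sets N} \<subseteq> events"
      using 1 M_sets[OF assms(1)] by blast
    show "sigma_sets (space M) {(\<lambda>w. \<phi> (?D w)) -` A \<inter> space M |A. A \<in> sets N'} \<subseteq> events"
      using 2 measurable_sets[OF D] by blast
    fix a b assume a: "a \<in> sigma_sets (space M) {V -` A \<inter> space M |A. A \<in> sets N}"
      and b: "b \<in> sigma_sets (space M) {(\<lambda>w. \<phi> (?D w)) -` A \<inter> space M |A. A \<in> sets N'}"
    from b 2 obtain E where "E \<in> sets borel" "b = ?D -` E \<inter> space M" by blast
    with a 1 show "prob (a \<inter> b) = prob a * prob b"
      using increment_prob[OF assms(1,2), of a E] by blast
  qed (use V' \<phi> in auto)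
qed

text \<open>Values in a normed field cover both real moments and complex characteristic
  functions.\<close>

lemma increment_integral_mult:
  fixes V :: "'w \<Rightarrow> 'b :: {real_normed_field, banach, second_countable_topology}"
  assumes "0 \<le> s" "s < t" and V: "V \<in> borel_measurable (F s)" and [measurable]: "\<phi> \<in> borel_measurable borel"
    and i: "integrable M V" "integrable M (\<lambda>w. \<phi> (B t w - B s w))"
  shows "integrable M (\<lambda>w. V w * \<phi> (B t w - B s w))"
    "expectation (\<lambda>w. V w * \<phi> (B t w - B s w)) = expectation V * expectation (\<lambda>w. \<phi> (B t w - B s w))"
proof -
  have ind: "indep_var borel V borel (\<lambda>w. \<phi> (B t w - B s w))"
    by (rule increment_indep_var[OF assms(1,2) V]) auto
  from indep_var_integrable[OF ind i] show "integrable M (\<lambda>w. V w * \<phi> (B t w - B s w))" .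
  from indep_var_lebesgue_integral[OF ind i]
  show "expectation (\<lambda>w. V w * \<phi> (B t w - B s w)) = expectation V * expectation (\<lambda>w. \<phi> (B t w - B s w))" .
qed

lemma increment_moment:
  assumes "0 \<le> s" "s < t"
  shows "integrable M (\<lambda>w. (B t w - B s w) ^ i)"
    "expectation (\<lambda>w. (B t w - B s w) ^ i) = gauss_moment i * sqrt (t - s) ^ i"
proof -
  note d = B_inc[OF assms]
  have s0: "0 < sqrt (t - s)" using assms by simp
  have "integrable lborel (\<lambda>x. normal_density 0 (sqrt (t - s)) x * (x - 0) ^ i)"
    using s0 by (rule integrable_normal_moment)
  then show "integrable M (\<lambda>w. (B t w - B s w) ^ i)"
    using distributed_integrable[OF d, of "\<lambda>x. x ^ i"] by simp
  have "expectation (\<lambda>w. (B t w - B s w) ^ i) = (\<integral>x. normal_density 0 (sqrt (t - s)) x * x ^ i \<partial>lborel)"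
    using distributed_integral[OF d, of "\<lambda>x. x ^ i"] by simp
  also have "\<dots> = gauss_moment i * sqrt (t - s) ^ i"
  proof (cases "odd i")
    case True
    then obtain k where "i = 2 * k + 1" by (elim oddE)
    then show ?thesis using integral_normal_moment_odd[OF s0, of 0 k] True by (simp add: gauss_moment_def)
  next
    case False
    then obtain k where k: "i = 2 * k" by (metis evenE)
    then show ?thesis using integral_normal_moment_even[OF s0, of 0 k] assms
      by (simp add: gauss_moment_def power_divide power_mult)
  qed
  finally show "expectation (\<lambda>w. (B t w - B s w) ^ i) = gauss_moment i * sqrt (t - s) ^ i" .
qed

lemma increment_mean:
  assumes "0 \<le> s" "s < t"
  shows "integrable M (\<lambda>w. B t w - B s w)" "expectation (\<lambda>w. B t w - B s w) = 0"
proof -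
  have "gauss_moment 1 = 0" by (simp add: gauss_moment_def)
  then show "integrable M (\<lambda>w. B t w - B s w)" "expectation (\<lambda>w. B t w - B s w) = 0"
    using increment_moment[OF assms, of 1] by (simp_all only: power_one_right mult_zero_left)
qed

lemma increment_variance:
  assumes "0 \<le> s" "s < t"
  shows "integrable M (\<lambda>w. (B t w - B s w)\<^sup>2)" "expectation (\<lambda>w. (B t w - B s w)\<^sup>2) = t - s"
proof -
  have "gauss_moment 2 = 1" by (simp add: gauss_moment_def)
  then show "integrable M (\<lambda>w. (B t w - B s w)\<^sup>2)" "expectation (\<lambda>w. (B t w - B s w)\<^sup>2) = t - s"
    using increment_moment[OF assms, of 2] assms(2) by (simp_all only:) simp
qed

lemma stochastic_sum_measurable:
  fixes v :: "nat \<Rightarrow> 'w \<Rightarrow> real"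
  assumes "0 \<le> e 0" "\<And>i. i < n \<Longrightarrow> e i \<le> e (Suc i)" "\<And>i. i < n \<Longrightarrow> v i \<in> borel_measurable (F (e i))" "j \<le> n"
  shows "(\<lambda>w. \<Sum>i<j. v i w * (B (e (Suc i)) w - B (e i) w)) \<in> borel_measurable (F (e j))" "0 \<le> e j"
proof -
  have mono: "e i \<le> e j" if "i \<le> j" "j \<le> n" for i j
    using that
  proof (induction j rule: dec_induct)
    case (step m) then show ?case using assms(2)[of m] by simp
  qed simp
  then show "0 \<le> e j" using assms(1,4) order_trans[OF assms(1), of "e j"] by simp
  show "(\<lambda>w. \<Sum>i<j. v i w * (B (e (Suc i)) w - B (e i) w)) \<in> borel_measurable (F (e j))"
  proof (intro borel_measurable_sum borel_measurable_times borel_measurable_diff)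
    fix i assume i: "i \<in> {..<j}"
    have 0: "0 \<le> e i" "0 \<le> e (Suc i)" using mono[of 0 i] mono[of 0 "Suc i"] i assms by auto
    show "v i \<in> borel_measurable (F (e j))" using i assms mono[of i j] 0 by (intro F_measurable[OF _ _ assms(3)]) auto
    show "B (e (Suc i)) \<in> borel_measurable (F (e j))" using i assms mono[of "Suc i" j] 0 by (intro F_measurable[OF _ _ B_adapted]) auto
    show "B (e i) \<in> borel_measurable (F (e j))" using i assms mono[of i j] 0 by (intro F_measurable[OF _ _ B_adapted]) auto
  qed
qed

lemma stochastic_sum_mean:
  fixes v :: "nat \<Rightarrow> 'w \<Rightarrow> real"
  assumes "0 \<le> e 0" "\<And>i. i < n \<Longrightarrow> e i < e (Suc i)" "\<And>i. i < n \<Longrightarrow> v i \<in> borel_measurable (F (e i))"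
    and "\<And>i. i < n \<Longrightarrow> integrable M (v i)"
  shows "integrable M (\<lambda>w. \<Sum>i<n. v i w * (B (e (Suc i)) w - B (e i) w))"
    "expectation (\<lambda>w. \<Sum>i<n. v i w * (B (e (Suc i)) w - B (e i) w)) = 0"
proof -
  have e0: "0 \<le> e i" if "i < n" for i
    using stochastic_sum_measurable(2)[of e n v i] assms that by (simp add: less_imp_le)
  have *: "integrable M (\<lambda>w. v i w * (B (e (Suc i)) w - B (e i) w))"
    "expectation (\<lambda>w. v i w * (B (e (Suc i)) w - B (e i) w)) = 0" if "i < n" for i
    using increment_integral_mult[of "e i" "e (Suc i)" "v i" "\<lambda>x. x"] increment_mean[of "e i" "e (Suc i)"] assms e0 that
    by auto
  then show "integrable M (\<lambda>w. \<Sum>i<n. v i w * (B (e (Suc i)) w - B (e i) w))"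
    by (intro Bochner_Integration.integrable_sum) auto
  show "expectation (\<lambda>w. \<Sum>i<n. v i w * (B (e (Suc i)) w - B (e i) w)) = 0"
    using * by (subst Bochner_Integration.integral_sum) auto
qed

text \<open>Discrete Ito isometry. In the induction the cross term vanishes: the sum so far times
  the next weight is known before the increment, which is independent of it and centred.\<close>

lemma stochastic_sum_isometry:
  fixes v :: "nat \<Rightarrow> 'w \<Rightarrow> real"
  assumes "0 \<le> e 0" "\<And>i. i < n \<Longrightarrow> e i < e (Suc i)" "\<And>i. i < n \<Longrightarrow> v i \<in> borel_measurable (F (e i))"
    and "\<And>i. i < n \<Longrightarrow> integrable M (\<lambda>w. (v i w)\<^sup>2)"
  shows "integrable M (\<lambda>w. (\<Sum>i<n. v i w * (B (e (Suc i)) w - B (e i) w))\<^sup>2) \<and>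
    expectation (\<lambda>w. (\<Sum>i<n. v i w * (B (e (Suc i)) w - B (e i) w))\<^sup>2) = (\<Sum>i<n. expectation (\<lambda>w. (v i w)\<^sup>2) * (e (Suc i) - e i))"
  using assms
proof (induction n)
  case (Suc n)
  let ?S = "\<lambda>w. \<Sum>i<n. v i w * (B (e (Suc i)) w - B (e i) w)"
  let ?D = "\<lambda>w. B (e (Suc n)) w - B (e n) w"
  have IH: "integrable M (\<lambda>w. (?S w)\<^sup>2)" "expectation (\<lambda>w. (?S w)\<^sup>2) = (\<Sum>i<n. expectation (\<lambda>w. (v i w)\<^sup>2) * (e (Suc i) - e i))"
    using Suc by auto
  have m: "?S \<in> borel_measurable (F (e n))" "0 \<le> e n"
    using stochastic_sum_measurable[of e "Suc n" v n] Suc.prems by (simp_all add: less_imp_le)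
  have vm: "v n \<in> borel_measurable (F (e n))" and en: "e n < e (Suc n)" using Suc.prems by auto
  have v2: "integrable M (\<lambda>w. (v n w)\<^sup>2)" using Suc.prems by auto
  have [measurable]: "?S \<in> borel_measurable M" "v n \<in> borel_measurable M"
    using M_measurable[OF m(2) m(1)] M_measurable[OF m(2) vm] by auto
  have iv: "integrable M (\<lambda>w. ?S w * v n w)"
    by (rule Bochner_Integration.integrable_bound[OF Bochner_Integration.integrable_add[OF IH(1) v2]])
       (use power_mult_power_le_sum[OF abs_ge_zero abs_ge_zero, of 1 2] in \<open>auto intro!: always_eventually simp: abs_mult\<close>)
  have a: "integrable M (\<lambda>w. ?S w * v n w * ?D w)" "expectation (\<lambda>w. ?S w * v n w * ?D w) = 0"
    using increment_integral_mult[OF m(2) en borel_measurable_times[OF m(1) vm] _ iv, of "\<lambda>x. x"] increment_mean[OF m(2) en] by simp_all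
  have b: "integrable M (\<lambda>w. (v n w)\<^sup>2 * (?D w)\<^sup>2)" "expectation (\<lambda>w. (v n w)\<^sup>2 * (?D w)\<^sup>2) = expectation (\<lambda>w. (v n w)\<^sup>2) * (e (Suc n) - e n)"
    using increment_integral_mult[OF m(2) en borel_measurable_power[OF vm] _ v2, of "\<lambda>x. x\<^sup>2"] increment_variance[OF m(2) en] by simp_all
  have eq: "(\<Sum>i<Suc n. v i w * (B (e (Suc i)) w - B (e i) w))\<^sup>2 = (?S w)\<^sup>2 + 2 * (?S w * v n w * ?D w) + (v n w)\<^sup>2 * (?D w)\<^sup>2" for w
    by (simp add: power2_eq_square algebra_simps)
  show ?case unfolding eq using IH a b by simp
qed simp

text \<open>A bound for even moments in the manner of Burkholder, uniform in the mesh. The next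
  power is expanded binomially: the term of first order vanishes, each later one carries a factor
  \<open>h = T / N\<close>, and so the moment, after adding a constant, grows by at most
  \<open>1 + C / N\<close> in a step.\<close>

lemma stochastic_sum_moment:
  fixes v :: "nat \<Rightarrow> 'w \<Rightarrow> real"
  assumes s: "0 \<le> s" and h: "0 < h" and N: "0 < N" and k: "0 < k"
    and vm: "\<And>j. j < N \<Longrightarrow> v j \<in> borel_measurable (F (s + real j * h))"
    and vi: "\<And>j. j < N \<Longrightarrow> integrable M (\<lambda>w. v j w ^ (2 * k))"
    and vc: "\<And>j. j < N \<Longrightarrow> expectation (\<lambda>w. v j w ^ (2 * k)) \<le> c"
  shows "integrable M (\<lambda>w. (\<Sum>j<N. v j w * (B (s + real (Suc j) * h) w - B (s + real j * h) w)) ^ (2 * k))"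
    "expectation (\<lambda>w. (\<Sum>j<N. v j w * (B (s + real (Suc j) * h) w - B (s + real j * h) w)) ^ (2 * k))
       \<le> moment_const k * (real N * h) ^ k * c"
proof -
  define T where "T = real N * h"
  define C where "C = (\<Sum>i\<le>2 * k. real (2 * k choose i) * gauss_moment i)"
  define e where "e j = s + real j * h" for j
  define S where "S j w = (\<Sum>i<j. v i w * (B (e (Suc i)) w - B (e i) w))" for j w
  have T: "T > 0" "h \<le> T" using N h by (auto simp: T_def)
  have c0: "0 \<le> c" using vc[OF N] by (rule order_trans[rotated]) (auto intro!: Bochner_Integration.integral_nonneg)
  have C0: "0 \<le> C" unfolding C_def by (intro sum_nonneg) auto
  have e: "0 \<le> e 0" "\<And>i. e i < e (Suc i)" "\<And>i. i < N \<Longrightarrow> v i \<in> borel_measurable (F (e i))"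
    using s h vm by (auto simp: e_def distrib_right)
  \<comment> \<open>Adding \<open>T ^ k * c\<close> absorbs the inhomogeneous part, so that the
    recursion becomes multiplicative.\<close>
  have "integrable M (\<lambda>w. S j w ^ (2 * k)) \<and> expectation (\<lambda>w. S j w ^ (2 * k)) + T ^ k * c \<le> T ^ k * c * (1 + C / real N) ^ j"
    if "j \<le> N" for j
    using that
  proof (induction j)
    case 0
    then show ?case using k by (simp add: S_def power_0_left)
  next
    case (Suc j)
    define n where "n = 2 * k"
    have en: "even n" "0 < n" using k by (auto simp: n_def)
    let ?D = "\<lambda>w. B (e (Suc j)) w - B (e j) w"
    have IH: "integrable M (\<lambda>w. S j w ^ n)" "expectation (\<lambda>w. S j w ^ n) + T ^ k * c \<le> T ^ k * c * (1 + C / real N) ^ j"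
      using Suc by (auto simp: n_def)
    have m: "S j \<in> borel_measurable (F (e j))" "0 \<le> e j"
      using stochastic_sum_measurable[of e N v j] e Suc.prems by (auto simp: less_imp_le S_def[abs_def])
    have vj: "v j \<in> borel_measurable (F (e j))" "integrable M (\<lambda>w. v j w ^ n)" "expectation (\<lambda>w. v j w ^ n) \<le> c"
      using vm vi vc Suc.prems by (auto simp: e_def n_def)
    have [measurable]: "S j \<in> borel_measurable M" "v j \<in> borel_measurable M"
      using M_measurable[OF m(2) m(1)] M_measurable[OF m(2) vj(1)] by auto
    have Vi: "integrable M (\<lambda>w. S j w ^ (n - i) * v j w ^ i)" if "i \<le> n" for i
      using power_mult_power_le_sum[OF abs_ge_zero abs_ge_zero that] en
      by (intro Bochner_Integration.integrable_bound[OF Bochner_Integration.integrable_add[OF IH(1) vj(2)]] always_eventually allI)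
         (auto simp: abs_mult power_abs power_even_abs)
    have trm: "integrable M (\<lambda>w. S j w ^ (n - i) * v j w ^ i * ?D w ^ i)"
      "expectation (\<lambda>w. S j w ^ (n - i) * v j w ^ i * ?D w ^ i) = expectation (\<lambda>w. S j w ^ (n - i) * v j w ^ i) * (gauss_moment i * sqrt h ^ i)"
      if "i \<le> n" for i
      using increment_integral_mult[OF m(2) e(2) _ _ Vi[OF that], of "\<lambda>x. x ^ i"] m(1) vj(1) increment_moment[OF m(2) e(2), of i]
      by (auto simp: e_def distrib_right)
    have eq: "S (Suc j) w ^ n = (\<Sum>i\<le>n. real (n choose i) * (S j w ^ (n - i) * v j w ^ i * ?D w ^ i))" for w
    proof -
      have "S (Suc j) w = v j w * ?D w + S j w" by (simp add: S_def)
      then show ?thesis by (simp only: binomial_ring power_mult_distrib) (simp add: ac_simps)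
    qed
    have int: "integrable M (\<lambda>w. S (Suc j) w ^ n)"
      unfolding eq using trm by (intro Bochner_Integration.integrable_sum integrable_mult_right) auto
    let ?u = "expectation (\<lambda>w. S j w ^ n)"
    have bnd: "expectation (\<lambda>w. S j w ^ (n - i) * v j w ^ i) * (gauss_moment i * sqrt h ^ i) \<le> (if i = 0 then ?u else 0) + gauss_moment i * ((?u + T ^ k * c) / real N)"
      if "i \<le> n" for i
    proof (cases "i = 0")
      case True
      have "0 \<le> ?u" using en by (intro Bochner_Integration.integral_nonneg) auto
      then show ?thesis using True c0 T by (simp add: gauss_moment_def)
    next
      case False
      \<comment> \<open>The first-order term is zero since the increment is centred; from
        \<open>i = 2\<close> on, one full factor \<open>h\<close> is available.\<close>
      show ?thesis
      proof (cases "i = 1")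
        case True then show ?thesis by (simp add: gauss_moment_def)
      next
        case F: False
        \<comment> \<open>Two factors \<open>sqrt h\<close> are kept as \<open>h = T / N\<close>;
          the others are enlarged to \<open>sqrt T\<close>.\<close>
        have s1: "sqrt h ^ i \<le> sqrt T ^ i / real N"
        proof -
          obtain l where l: "i = l + 2" using False F by (metis One_nat_def Suc_1 add.commute le_Suc_ex less_one linorder_not_less nat_neq_iff not_less_eq_eq)
          have "sqrt h ^ i = sqrt h ^ l * h" using h by (simp add: l power_add)
          also have "\<dots> \<le> sqrt T ^ l * h" using h T by (intro mult_right_mono power_mono) auto
          also have "\<dots> = sqrt T ^ l * T / real N" using N by (simp add: T_def)
          also have "\<dots> = sqrt T ^ i / real N" using T by (simp add: l power_add)
          finally show ?thesis .
        qed
        \<comment> \<open>The power of \<open>sqrt T\<close> is attached to the weight, so that both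
          quantities in Young's inequality have the same scaling.\<close>
        have pw: "\<bar>S j w ^ (n - i) * v j w ^ i\<bar> * sqrt T ^ i \<le> S j w ^ n + T ^ k * v j w ^ n" for w
        proof -
          have "\<bar>S j w ^ (n - i) * v j w ^ i\<bar> * sqrt T ^ i = \<bar>S j w\<bar> ^ (n - i) * (sqrt T * \<bar>v j w\<bar>) ^ i"
            by (simp add: abs_mult power_abs power_mult_distrib)
          also have "\<dots> \<le> \<bar>S j w\<bar> ^ n + (sqrt T * \<bar>v j w\<bar>) ^ n"
            using T that by (intro power_mult_power_le_sum) auto
          also have "\<dots> = S j w ^ n + T ^ k * v j w ^ n"
            using en T by (simp add: power_even_abs power_mult_distrib) (simp add: n_def power_mult)
          finally show ?thesis .
        qed
        have "expectation (\<lambda>w. S j w ^ (n - i) * v j w ^ i) * sqrt h ^ i \<le> expectation (\<lambda>w. \<bar>S j w ^ (n - i) * v j w ^ i\<bar>) * (sqrt T ^ i / real N)"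
          using s1 h by (intro mult_mono integral_mono) (auto intro!: Vi that)
        also have "\<dots> = expectation (\<lambda>w. \<bar>S j w ^ (n - i) * v j w ^ i\<bar> * sqrt T ^ i) / real N" by simp
        also have "\<dots> \<le> expectation (\<lambda>w. S j w ^ n + T ^ k * v j w ^ n) / real N"
          using pw IH(1) vj(2) Vi that by (intro divide_right_mono integral_mono) auto
        also have "\<dots> \<le> (?u + T ^ k * c) / real N"
          using IH(1) vj T by (intro divide_right_mono) (auto intro!: mult_left_mono)
        finally have "gauss_moment i * (expectation (\<lambda>w. S j w ^ (n - i) * v j w ^ i) * sqrt h ^ i) \<le> gauss_moment i * ((?u + T ^ k * c) / real N)"
          by (intro mult_left_mono) auto
        then show ?thesis using False by (simp add: ac_simps)
      qed
    qed
    have "expectation (\<lambda>w. S (Suc j) w ^ n) = (\<Sum>i\<le>n. real (n choose i) * (expectation (\<lambda>w. S j w ^ (n - i) * v j w ^ i) * (gauss_moment i * sqrt h ^ i)))"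
      unfolding eq using trm by (subst Bochner_Integration.integral_sum) auto
    also have "\<dots> \<le> (\<Sum>i\<le>n. real (n choose i) * ((if i = 0 then ?u else 0) + gauss_moment i * ((?u + T ^ k * c) / real N)))"
      using bnd by (intro sum_mono mult_left_mono) auto
    also have "\<dots> = (\<Sum>i\<le>n. if i = 0 then ?u else 0) + (\<Sum>i\<le>n. real (n choose i) * gauss_moment i) * ((?u + T ^ k * c) / real N)"
      unfolding sum_distrib_right sum.distrib[symmetric] by (intro sum.cong) (auto simp: algebra_simps)
    also have "\<dots> = ?u + C * ((?u + T ^ k * c) / real N)" by (simp add: C_def n_def)
    finally have "expectation (\<lambda>w. S (Suc j) w ^ n) + T ^ k * c \<le> (?u + T ^ k * c) * (1 + C / real N)"
      by (simp add: algebra_simps add_divide_distrib)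
    also have "\<dots> \<le> T ^ k * c * (1 + C / real N) ^ j * (1 + C / real N)"
      using IH(2) C0 by (intro mult_right_mono) auto
    finally show ?case using int by (simp add: n_def ac_simps)
  qed
  from this[of N] have *: "integrable M (\<lambda>w. S N w ^ (2 * k))" "expectation (\<lambda>w. S N w ^ (2 * k)) + T ^ k * c \<le> T ^ k * c * (1 + C / real N) ^ N"
    by auto
  have "(1 + C / real N) ^ N \<le> exp (C / real N) ^ N" using C0 by (intro power_mono) auto
  also have "\<dots> = exp C" using N by (simp add: exp_of_nat_mult[symmetric])
  finally have "T ^ k * c * (1 + C / real N) ^ N \<le> T ^ k * c * exp C" using c0 T by (intro mult_left_mono) auto
  moreover have "0 \<le> T ^ k * c" using c0 T by simp
  ultimately have "expectation (\<lambda>w. S N w ^ (2 * k)) \<le> moment_const k * (real N * h) ^ k * c"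
  proof -
    have "moment_const k * (real N * h) ^ k * c = T ^ k * c * exp C"
      by (simp add: moment_const_def C_def T_def)
    then show ?thesis using *(2) \<open>0 \<le> T ^ k * c\<close> \<open>T ^ k * c * (1 + C / real N) ^ N \<le> T ^ k * c * exp C\<close> by linarith
  qed
  with *(1) show "integrable M (\<lambda>w. (\<Sum>j<N. v j w * (B (s + real (Suc j) * h) w - B (s + real j * h) w)) ^ (2 * k))"
    "expectation (\<lambda>w. (\<Sum>j<N. v j w * (B (s + real (Suc j) * h) w - B (s + real j * h) w)) ^ (2 * k)) \<le> moment_const k * (real N * h) ^ k * c"
    by (simp_all only: S_def e_def)
qed

end

section \<open>Step processes and Lenglart's inequality\<close>

text \<open>With nonnegative terms the partial sums increase, so the kept terms form an initial
  segment and their total is a partial sum that does not exceed \<open>d\<close>. This is the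
  deterministic side of stopping.\<close>

lemma sum_below_level_le:
  fixes c :: "nat \<Rightarrow> real"
  assumes "\<And>i. i < n \<Longrightarrow> 0 \<le> c i" "0 \<le> d"
  shows "(\<Sum>i<n. if (\<Sum>j<Suc i. c j) \<le> d then c i else 0) \<le> min d (\<Sum>j<n. c j)"
  using assms
proof (induction n)
  case (Suc n)
  then have IH: "(\<Sum>i<n. if (\<Sum>j<Suc i. c j) \<le> d then c i else 0) \<le> min d (\<Sum>j<n. c j)" by simp
  show ?case
  proof (cases "(\<Sum>j<Suc n. c j) \<le> d")
    case True
    then show ?thesis using IH by simp
  next
    case False
    then show ?thesis using IH Suc.prems(1)[of n] by simp
  qed
qed simp

text \<open>A predictable step process as a list of \<open>(s, t, \<eta>)\<close>, standing for the sum of the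
  \<open>\<eta> 1\<^bsub>(s, t]\<^esub>\<close>; the intervals may overlap.\<close>

type_synonym 'w step_list = "(real \<times> real \<times> ('w \<Rightarrow> real)) list"

definition step_val :: "'w step_list \<Rightarrow> real \<Rightarrow> 'w \<Rightarrow> real" where
  "step_val L u w = (\<Sum>(s, t, \<eta>)\<leftarrow>L. \<eta> w * indicator {s<..t} u)"

definition step_int :: "(real \<Rightarrow> 'w \<Rightarrow> real) \<Rightarrow> 'w step_list \<Rightarrow> 'w \<Rightarrow> real" where
  "step_int B L w = (\<Sum>(s, t, \<eta>)\<leftarrow>L. \<eta> w * (B t w - B s w))"

lemma step_simps [simp]:
  "step_val [] u w = 0" "step_int B [] w = 0"
  "step_val ((s, t, \<eta>) # L) u w = \<eta> w * indicator {s<..t} u + step_val L u w"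
  "step_int B ((s, t, \<eta>) # L) w = \<eta> w * (B t w - B s w) + step_int B L w"
  "step_val (L @ L') u w = step_val L u w + step_val L' u w"
  "step_int B (L @ L') w = step_int B L w + step_int B L' w"
  by (simp_all add: step_val_def step_int_def)

text \<open>The indicator is evaluated at the right end of each cell, which decides whether the
  whole cell \<open>(e i, e (i + 1)]\<close> belongs to \<open>(e p, e q]\<close>; what remains
  telescopes.\<close>

lemma sum_indicator_cells:
  fixes e b :: "nat \<Rightarrow> real"
  assumes "\<And>i j. i < j \<Longrightarrow> j \<le> n \<Longrightarrow> e i < e j" "p < q" "q \<le> n"
  shows "(\<Sum>i<n. indicator {e p<..e q} (e (Suc i)) * (b (Suc i) - b i)) = b q - b p"
proof -
  have "indicator {e p<..e q} (e (Suc i)) = (if p \<le> i \<and> i < q then 1 else 0 :: real)" if "i < n" for i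
  proof -
    have "e p < e (Suc i) \<longleftrightarrow> p < Suc i"
      using assms(1)[of p "Suc i"] assms(1)[of "Suc i" p] assms(2,3) that
      by (metis Suc_leI less_irrefl less_le_trans less_or_eq_imp_le linorder_less_linear order_less_imp_not_less)
    moreover have "e (Suc i) \<le> e q \<longleftrightarrow> Suc i \<le> q"
      using assms(1)[of q "Suc i"] assms(1)[of "Suc i" q] assms(2,3) that
      by (metis Suc_leI le_less linorder_not_le)
    ultimately show ?thesis by (auto simp: indicator_def)
  qed
  then have "(\<Sum>i<n. indicator {e p<..e q} (e (Suc i)) * (b (Suc i) - b i)) = (\<Sum>i<n. if i \<in> {p..<q} then b (Suc i) - b i else 0)"
    by (intro sum.cong) auto
  also have "\<dots> = (\<Sum>i\<in>{p..<q}. b (Suc i) - b i)"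
    using assms(3) by (subst sum.inter_restrict[symmetric]) (auto intro!: sum.cong)
  also have "\<dots> = b q - b p" using assms(2) by (intro sum_Suc_diff') simp
  finally show ?thesis .
qed

lemma finite_set_enumeration:
  fixes E :: "real set"
  assumes "finite E" "E \<noteq> {}"
  obtains n :: nat and e where "\<And>i j. i < j \<Longrightarrow> j \<le> n \<Longrightarrow> e i < e j" "E = e ` {..n}"
proof -
  define es where "es = sorted_list_of_set E"
  have es: "sorted_wrt (<) es" "set es = E" using assms by (simp_all add: es_def)
  have "es \<noteq> []" using es assms by auto
  define n where "n = length es - 1"
  have len: "length es = Suc n" using \<open>es \<noteq> []\<close> by (simp add: n_def)
  show ?thesis
  proof (rule that[of n "\<lambda>i. es ! i"])
    show "es ! i < es ! j" if "i < j" "j \<le> n" for i j using sorted_wrt_nth_less[OF es(1)] that len by simp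
    show "E = (!) es ` {..n}" using es(2) len by (metis lessThan_Suc_atMost nth_image order_refl take_all lessThan_atLeast0)
  qed
qed

context brownian_filtration
begin

text \<open>Lenglart's argument: stop the sum once its quadratic variation exceeds \<open>d\<close>.\<close>

lemma stochastic_sum_prob_le:
  fixes v :: "nat \<Rightarrow> 'w \<Rightarrow> real"
  assumes e: "0 \<le> e 0" "\<And>i. i < n \<Longrightarrow> e i < e (Suc i)" and v: "\<And>i. i < n \<Longrightarrow> v i \<in> borel_measurable (F (e i))"
    and "0 < a" "0 < d"
  shows "prob {w\<in>space M. \<bar>\<Sum>i<n. v i w * (B (e (Suc i)) w - B (e i) w)\<bar> > a}
    \<le> prob {w\<in>space M. (\<Sum>i<n. (v i w)\<^sup>2 * (e (Suc i) - e i)) > d} + d / a\<^sup>2"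
proof -
  define Q where "Q i w = (\<Sum>j<i. (v j w)\<^sup>2 * (e (Suc j) - e j))" for i w
  \<comment> \<open>A weight is switched off as soon as the quadratic variation including its own
    cell exceeds \<open>d\<close>. That total is already known at time \<open>e i\<close>, so the
    stopped weights remain predictable.\<close>
  define \<zeta> where "\<zeta> i w = (if Q (Suc i) w \<le> d then v i w else 0)" for i w
  have mono: "e i \<le> e j" if "i \<le> j" "j \<le> n" for i j
    using that
  proof (induction j rule: dec_induct)
    case (step m) then show ?case using e(2)[of m] by simp
  qed simp
  have e0: "0 \<le> e i" if "i \<le> n" for i using mono[of 0 i] e(1) that by simp
  have Qm: "Q i \<in> borel_measurable (F (e j))" if "i \<le> Suc j" "j < n" for i j
    unfolding Q_def[abs_def]
  proof (intro borel_measurable_sum borel_measurable_times borel_measurable_power borel_measurable_const)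
    fix l assume "l \<in> {..<i}"
    then show "v l \<in> borel_measurable (F (e j))"
      using that mono[of l j] e0[of l] by (intro F_measurable[OF _ _ v]) auto
  qed
  have wm: "\<zeta> i \<in> borel_measurable (F (e i))" if "i < n" for i
    unfolding \<zeta>_def[abs_def] using v[OF that] Qm[of "Suc i" i] that by measurable
  have wM[measurable]: "\<zeta> i \<in> borel_measurable M" "v i \<in> borel_measurable M" if "i < n" for i
    using M_measurable[OF _ wm[OF that]] M_measurable[OF _ v[OF that]] e0 that by auto
  have [measurable]: "B (e i) \<in> borel_measurable M" if "i \<le> n" for i using e0 that by auto
  have QM[measurable]: "Q n \<in> borel_measurable M" unfolding Q_def[abs_def] by measurable
  have w2: "(\<zeta> i w)\<^sup>2 * (e (Suc i) - e i) = (if Q (Suc i) w \<le> d then (v i w)\<^sup>2 * (e (Suc i) - e i) else 0)" for i w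
    by (simp add: \<zeta>_def)
  have sum_le: "(\<Sum>i<n. (\<zeta> i w)\<^sup>2 * (e (Suc i) - e i)) \<le> d" for w
    unfolding w2 Q_def using sum_below_level_le[of n "\<lambda>i. (v i w)\<^sup>2 * (e (Suc i) - e i)" d] e assms(5)
    by (simp add: less_imp_le)
  \<comment> \<open>A single term of the stopped quadratic variation is at most \<open>d\<close>;
    the stopped weights are therefore bounded and the isometry applies.\<close>
  have wb: "(\<zeta> i w)\<^sup>2 \<le> d / (e (Suc i) - e i)" if "i < n" for i w
  proof -
    have "(\<zeta> i w)\<^sup>2 * (e (Suc i) - e i) \<le> (\<Sum>i<n. (\<zeta> i w)\<^sup>2 * (e (Suc i) - e i))"
      using that e(2) by (intro member_le_sum) (auto simp: less_imp_le)
    then show ?thesis using sum_le[of w] e(2)[OF that] by (simp add: field_simps)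
  qed
  have wi: "integrable M (\<lambda>w. (\<zeta> i w)\<^sup>2)" if "i < n" for i
    using wb[OF that] that by (intro integrable_const_bound[where B = "d / (e (Suc i) - e i)"]) auto
  let ?S = "\<lambda>w. \<Sum>i<n. \<zeta> i w * (B (e (Suc i)) w - B (e i) w)"
  let ?V = "\<lambda>w. \<Sum>i<n. v i w * (B (e (Suc i)) w - B (e i) w)"
  note iso = stochastic_sum_isometry[of e n \<zeta>, OF e wm wi]
  have "expectation (\<lambda>w. (?S w)\<^sup>2) = expectation (\<lambda>w. \<Sum>i<n. (\<zeta> i w)\<^sup>2 * (e (Suc i) - e i))"
    using iso wi by (subst Bochner_Integration.integral_sum) auto
  also have "\<dots> \<le> expectation (\<lambda>w. d)"
    using sum_le wi by (intro integral_mono) auto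
  finally have ES: "expectation (\<lambda>w. (?S w)\<^sup>2) \<le> d" by (simp add: prob_space)
  have [measurable]: "?S \<in> borel_measurable M" "?V \<in> borel_measurable M"
    using e0 by (auto intro!: borel_measurable_sum borel_measurable_times borel_measurable_diff B_measurable wM)
  \<comment> \<open>If the quadratic variation does not exceed \<open>d\<close>, nothing is switched
    off and both sums agree.\<close>
  have "{w\<in>space M. \<bar>?V w\<bar> > a} \<subseteq> {w\<in>space M. Q n w > d} \<union> {w\<in>space M. \<bar>?S w\<bar> \<ge> a}"
  proof safe
    fix w assume *: "w \<in> space M" "a < \<bar>?V w\<bar>" "\<not> a \<le> \<bar>?S w\<bar>"
    show "d < Q n w"
    proof (rule ccontr)
      assume "\<not> d < Q n w"
      then have "Q (Suc i) w \<le> d" if "i < n" for i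
      proof -
        have "Q (Suc i) w \<le> Q n w" unfolding Q_def
          using that e(2) by (intro sum_mono2) (auto simp: less_imp_le)
        then show ?thesis using \<open>\<not> d < Q n w\<close> by simp
      qed
      then have "?S w = ?V w" by (intro sum.cong) (auto simp: \<zeta>_def)
      then show False using * by simp
    qed
  qed
  then have "prob {w\<in>space M. \<bar>?V w\<bar> > a} \<le> prob ({w\<in>space M. Q n w > d} \<union> {w\<in>space M. \<bar>?S w\<bar> \<ge> a})"
    by (intro finite_measure_mono) auto
  also have "\<dots> \<le> prob {w\<in>space M. Q n w > d} + prob {w\<in>space M. \<bar>?S w\<bar> \<ge> a}"
    by (intro measure_Un_le) auto
  also have "prob {w\<in>space M. \<bar>?S w\<bar> \<ge> a} \<le> expectation (\<lambda>w. (?S w)\<^sup>2) / a\<^sup>2"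
    using iso assms(4) by (intro second_moment_method) auto
  also have "\<dots> \<le> d / a\<^sup>2" using ES by (intro divide_right_mono) auto
  finally show ?thesis by (simp add: Q_def)
qed

text \<open>All end points of the possibly overlapping intervals are merged into one grid, on whose
  cells the step process is constant; Lenglart's bound for sums then applies. The majorant
  \<open>\<Phi>\<close> of the quadratic variation is a free measurable function, so that a
  combination of several errors can be inserted.\<close>

lemma step_int_prob_le:
  fixes L :: "'w step_list" and \<Phi> :: "'w \<Rightarrow> ennreal"
  assumes L: "\<And>s t \<eta>. (s, t, \<eta>) \<in> set L \<Longrightarrow> 0 \<le> s \<and> s < t \<and> t \<le> T \<and> \<eta> \<in> borel_measurable (F s)"
    and [measurable]: "\<Phi> \<in> borel_measurable M"
    and \<Phi>: "\<And>w. w \<in> space M \<Longrightarrow> (\<integral>\<^sup>+u\<in>{0<..T}. ennreal ((step_val L u w)\<^sup>2) \<partial>lborel) \<le> \<Phi> w"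
    and "0 < a" "0 < d"
  shows "prob {w\<in>space M. \<bar>step_int B L w\<bar> > a} \<le> prob {w\<in>space M. \<Phi> w > ennreal d} + d / a\<^sup>2"
proof (cases "L = []")
  case False
  define E where "E = fst ` set L \<union> (fst \<circ> snd) ` set L"
  have E: "finite E" "E \<noteq> {}" using False by (auto simp: E_def)
  obtain n :: nat and e where e: "\<And>i j. i < j \<Longrightarrow> j \<le> n \<Longrightarrow> e i < e j" "E = e ` {..n}"
    using finite_set_enumeration[OF E] by blast
  have Epos: "0 \<le> x \<and> x \<le> T" if x: "x \<in> E" for x
  proof -
    from x obtain s t \<eta> where st: "(s, t, \<eta>) \<in> set L" "x = s \<or> x = t" unfolding E_def by force
    then show ?thesis using L[OF st(1)] by auto
  qed
  have e0: "0 \<le> e i \<and> e i \<le> T" if "i \<le> n" for i using Epos e(2) that by auto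
  have lt: "e i < e (Suc i)" if "i < n" for i using e(1)[of i "Suc i"] that by simp
  have gap: "x \<le> e i \<or> e (Suc i) \<le> x" if "x \<in> E" "i < n" for x i
  proof -
    have "x \<in> e ` {..n}" using that(1) unfolding e(2) .
    then obtain m where m: "m \<le> n" "x = e m" by (rule imageE) (rule that, simp_all)
    show ?thesis
    proof (cases "m \<le> i")
      case True then show ?thesis using e(1)[of m i] m that by (cases "m = i") (auto simp: less_imp_le)
    next
      case False then show ?thesis using e(1)[of "Suc i" m] m that by (cases "m = Suc i") (auto simp: less_imp_le)
    qed
  qed
  \<comment> \<open>The value at the right end of a cell is the value on the whole cell, because the
    intervals are open on the left and closed on the right.\<close>
  define v where "v i w = step_val L (e (Suc i)) w" for i w
  have ends: "s \<in> E" "t \<in> E" if "(s, t, \<eta>) \<in> set L" for s t \<eta> using that by (force simp: E_def)+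
  have const: "step_val L u w = v i w" if "i < n" "e i < u" "u \<le> e (Suc i)" for i u w
  proof -
    have "indicator {s<..t} u = (indicator {s<..t} (e (Suc i)) :: real)" if "(s, t, \<eta>) \<in> set L" for s t \<eta>
      using gap[OF ends(1)[OF that] \<open>i < n\<close>] gap[OF ends(2)[OF that] \<open>i < n\<close>] \<open>e i < u\<close> \<open>u \<le> e (Suc i)\<close>
      by (auto simp: indicator_def)
    then show ?thesis unfolding v_def step_val_def by (intro arg_cong[of _ _ sum_list] map_cong) auto
  qed
  have vm: "v i \<in> borel_measurable (F (e i))" if "i < n" for i
  proof -
    \<comment> \<open>Stated for all lists with elements from \<open>L\<close>, so that induction
      over the list applies while the grid stays fixed.\<close>
    have "(\<lambda>w. \<Sum>x\<leftarrow>L'. case x of (s, t, \<eta>) \<Rightarrow> \<eta> w * indicator {s<..t} (e (Suc i))) \<in> borel_measurable (F (e i))"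
      if "set L' \<subseteq> set L" for L'
      using that
    proof (induction L')
      case (Cons x L')
      obtain s t \<eta> where x: "x = (s, t, \<eta>)" by (cases x)
      have st: "(s, t, \<eta>) \<in> set L" using Cons x by auto
      have "(\<lambda>w. \<eta> w * indicator {s<..t} (e (Suc i))) \<in> borel_measurable (F (e i))"
      proof (cases "s < e (Suc i)")
        case True
        then have "s \<le> e i" using gap[OF ends(1)[OF st] \<open>i < n\<close>] by simp
        then have "\<eta> \<in> borel_measurable (F (e i))" using L[OF st] by (rule_tac F_measurable[of s]) simp_all
        then show ?thesis by measurable
      qed simp
      with Cons show ?case by (simp add: x)
    qed simp
    then show ?thesis unfolding v_def[abs_def] step_val_def by simp
  qed
  have int: "step_int B L w = (\<Sum>i<n. v i w * (B (e (Suc i)) w - B (e i) w))" for w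
  proof -
    have "(\<Sum>x\<leftarrow>L'. case x of (s, t, \<eta>) \<Rightarrow> \<eta> w * (B t w - B s w)) =
      (\<Sum>i<n. (\<Sum>x\<leftarrow>L'. case x of (s, t, \<eta>) \<Rightarrow> \<eta> w * indicator {s<..t} (e (Suc i))) * (B (e (Suc i)) w - B (e i) w))"
      if "set L' \<subseteq> set L" for L'
      using that
    proof (induction L')
      case (Cons x L')
      obtain s t \<eta> where x: "x = (s, t, \<eta>)" by (cases x)
      have st: "(s, t, \<eta>) \<in> set L" using Cons x by auto
      obtain p q where pq: "p \<le> n" "q \<le> n" "s = e p" "t = e q" using ends[OF st] e(2) by auto
      have "p < q" using L[OF st] pq e(1)[of q p] by (metis less_asym linorder_neqE_nat order_less_irrefl)
      have "(\<Sum>i<n. \<eta> w * indicator {s<..t} (e (Suc i)) * (B (e (Suc i)) w - B (e i) w)) = \<eta> w * (B t w - B s w)"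
        using sum_indicator_cells[of n e p q "\<lambda>i. B (e i) w", OF e(1) \<open>p < q\<close> pq(2)] pq
        by (simp add: sum_distrib_left[symmetric] mult.assoc)
      then show ?case using Cons by (simp add: x distrib_right sum.distrib)
    qed simp
    then show ?thesis by (simp add: step_int_def v_def step_val_def)
  qed
  have Q: "ennreal (\<Sum>i<n. (v i w)\<^sup>2 * (e (Suc i) - e i)) \<le> \<Phi> w" if "w \<in> space M" for w
  proof -
    have "ennreal (\<Sum>i<n. (v i w)\<^sup>2 * (e (Suc i) - e i)) = (\<Sum>i<n. ennreal ((v i w)\<^sup>2) * emeasure lborel {e i<..e (Suc i)})"
      using lt by (subst sum_ennreal[symmetric]) (auto simp: less_imp_le ennreal_mult intro!: sum.cong)
    also have "\<dots> = (\<Sum>i<n. \<integral>\<^sup>+u. ennreal ((v i w)\<^sup>2) * indicator {e i<..e (Suc i)} u \<partial>lborel)"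
      by (intro sum.cong) (auto simp: nn_integral_cmult_indicator)
    also have "\<dots> = (\<integral>\<^sup>+u. (\<Sum>i<n. ennreal ((v i w)\<^sup>2) * indicator {e i<..e (Suc i)} u) \<partial>lborel)"
      by (subst nn_integral_sum) auto
    also have "\<dots> \<le> (\<integral>\<^sup>+u\<in>{0<..T}. ennreal ((step_val L u w)\<^sup>2) \<partial>lborel)"
    proof (rule nn_integral_mono)
      fix u
      show "(\<Sum>i<n. ennreal ((v i w)\<^sup>2) * indicator {e i<..e (Suc i)} u) \<le> ennreal ((step_val L u w)\<^sup>2) * indicator {0<..T} u"
      proof (cases "\<exists>i<n. u \<in> {e i<..e (Suc i)}")
        case True
        then obtain i where i: "i < n" "e i < u" "u \<le> e (Suc i)" by auto
        have "u \<notin> {e j<..e (Suc j)}" if "j < n" "j \<noteq> i" for j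
        proof (cases "j < i")
          case True
          then have "e (Suc j) \<le> e i" using e(1)[of "Suc j" i] i by (cases "Suc j = i") (auto simp: less_imp_le)
          then show ?thesis using i by auto
        next
          case False
          then have "e (Suc i) \<le> e j" using e(1)[of "Suc i" j] that by (cases "Suc i = j") (auto simp: less_imp_le)
          then show ?thesis using i by auto
        qed
        then have "(\<Sum>j<n. ennreal ((v j w)\<^sup>2) * indicator {e j<..e (Suc j)} u) = (\<Sum>j\<in>{i}. ennreal ((v j w)\<^sup>2) * indicator {e j<..e (Suc j)} u)"
          using i by (intro sum.mono_neutral_right) (auto simp: indicator_def)
        then show ?thesis using i e0[of i] e0[of "Suc i"] const[OF i] by (simp add: indicator_def)
      next
        case False
        then have "(\<Sum>i<n. ennreal ((v i w)\<^sup>2) * indicator {e i<..e (Suc i)} u) = 0" by (intro sum.neutral) (auto simp: indicator_def)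
        then show ?thesis by simp
      qed
    qed
    also have "\<dots> \<le> \<Phi> w" using \<Phi> that .
    finally show ?thesis .
  qed
  have vM[measurable]: "v i \<in> borel_measurable M" if "i < n" for i
    using M_measurable[OF _ vm[OF that]] e0 that by auto
  have "prob {w\<in>space M. \<bar>step_int B L w\<bar> > a} \<le> prob {w\<in>space M. (\<Sum>i<n. (v i w)\<^sup>2 * (e (Suc i) - e i)) > d} + d / a\<^sup>2"
    unfolding int using e0 lt vm assms(4,5) by (intro stochastic_sum_prob_le) auto
  also have "prob {w\<in>space M. (\<Sum>i<n. (v i w)\<^sup>2 * (e (Suc i) - e i)) > d} \<le> prob {w\<in>space M. \<Phi> w > ennreal d}"
  proof (intro finite_measure_mono subsetI)
    fix w assume "w \<in> {w\<in>space M. (\<Sum>i<n. (v i w)\<^sup>2 * (e (Suc i) - e i)) > d}"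
    then have *: "w \<in> space M" "d < (\<Sum>i<n. (v i w)\<^sup>2 * (e (Suc i) - e i))" by auto
    then have "ennreal d < ennreal (\<Sum>i<n. (v i w)\<^sup>2 * (e (Suc i) - e i))"
      using assms(5) by (intro ennreal_lessI) auto
    also have "\<dots> \<le> \<Phi> w" using Q * by simp
    finally show "w \<in> {w\<in>space M. \<Phi> w > ennreal d}" using * by simp
  qed auto
  finally show ?thesis by simp
qed (use assms in auto)

lemma char_increment:
  assumes "0 \<le> s" "s < t"
  shows "expectation (\<lambda>w. iexp (c * (B t w - B s w))) = complex_of_real (exp (- (c\<^sup>2 * (t - s) / 2)))"
proof -
  let ?D = "\<lambda>w. (B t w - B s w) / sqrt (t - s)"
  have st: "0 < sqrt (t - s)" using assms by simp
  have [measurable]: "B t \<in> borel_measurable M" "B s \<in> borel_measurable M" using assms by auto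
  have "distributed M lborel (\<lambda>w. (B t w - B s w - 0) / sqrt (t - s)) std_normal_density"
    using B_inc[OF assms] normal_standard_normal_convert[OF st, of "\<lambda>w. B t w - B s w" 0] by simp
  then have d: "distr M lborel ?D = std_normal_distribution" by (simp add: distributed_distr_eq_density)
  have "expectation (\<lambda>w. iexp (c * (B t w - B s w))) = expectation (\<lambda>w. iexp (c * sqrt (t - s) * ?D w))"
    using st by simp
  also have "\<dots> = (CLINT x|distr M lborel ?D. iexp (c * sqrt (t - s) * x))"
    by (subst integral_distr) auto
  also have "\<dots> = char std_normal_distribution (c * sqrt (t - s))" by (simp add: d char_def)
  also have "\<dots> = complex_of_real (exp (- (c\<^sup>2 * (t - s) / 2)))"
    using assms unfolding char_std_normal_distribution by (simp add: power_mult_distrib)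
  finally show ?thesis .
qed

text \<open>Keeping the indicator of \<open>G\<close> yields law and independence at once: the
  characteristic function factorises over every event of \<open>F s\<close>. The induction splits
  off the last increment.\<close>

lemma char_increments:
  assumes "0 \<le> s" "0 < h" "G \<in> sets (F s)"
  shows "expectation (\<lambda>w. indicator G w * iexp (\<Sum>j<n. c j * (B (s + real (Suc j) * h) w - B (s + real j * h) w)))
    = complex_of_real (prob G * exp (- ((\<Sum>j<n. (c j)\<^sup>2) * h / 2)))"
proof (induction n)
  case 0
  have [measurable]: "G \<in> sets M" using assms M_sets by blast
  have "expectation (\<lambda>w. indicator G w :: complex) = expectation (\<lambda>w. complex_of_real (indicator G w))"
    by (intro Bochner_Integration.integral_cong) (auto simp: indicator_def)
  then have "expectation (\<lambda>w. indicator G w :: complex) = complex_of_real (prob G)" by simp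
  then show ?case by simp
next
  case (Suc n)
  let ?e = "\<lambda>j. s + real j * h"
  let ?S = "\<lambda>w. \<Sum>j<n. c j * (B (?e (Suc j)) w - B (?e j) w)"
  have e: "0 \<le> ?e n" "?e n < ?e (Suc n)" using assms by (auto simp: distrib_right)
  have "?S \<in> borel_measurable (F (?e n))"
    using stochastic_sum_measurable(1)[of ?e n "\<lambda>i _. c i" n] assms by (auto simp: distrib_right)
  moreover have "G \<in> sets (F (?e n))" using F_sets[of s "?e n" G] assms by auto
  ultimately have V: "(\<lambda>w. indicator G w * iexp (?S w)) \<in> borel_measurable (F (?e n))" by measurable
  have Vi: "integrable M (\<lambda>w. indicator G w * iexp (?S w))"
    using M_measurable[OF e(1) V] by (intro integrable_const_bound[where B = 1]) (auto simp: indicator_def norm_mult)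
  have [measurable]: "B (?e (Suc n)) \<in> borel_measurable M" "B (?e n) \<in> borel_measurable M" using e assms by auto
  have Di: "integrable M (\<lambda>w. iexp (c n * (B (?e (Suc n)) w - B (?e n) w)))"
    by (intro integrable_const_bound[where B = 1] always_eventually allI) (simp, measurable)
  have "expectation (\<lambda>w. indicator G w * iexp (\<Sum>j<Suc n. c j * (B (?e (Suc j)) w - B (?e j) w)))
     = expectation (\<lambda>w. (indicator G w * iexp (?S w)) * iexp (c n * (B (?e (Suc n)) w - B (?e n) w)))"
    by (simp add: distrib_left exp_add mult.assoc)
  also have "\<dots> = expectation (\<lambda>w. indicator G w * iexp (?S w)) * expectation (\<lambda>w. iexp (c n * (B (?e (Suc n)) w - B (?e n) w)))"
    using increment_integral_mult(2)[OF e V _ Vi Di] by simp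
  also have "\<dots> = complex_of_real (prob G * exp (- ((\<Sum>j<n. (c j)\<^sup>2) * h / 2))) * complex_of_real (exp (- ((c n)\<^sup>2 * h / 2)))"
    unfolding Suc using char_increment[OF e, of "c n"] by (simp add: distrib_right)
  also have "\<dots> = complex_of_real (prob G * exp (- ((\<Sum>j<Suc n. (c j)\<^sup>2) * h / 2)))"
    by (simp only: of_real_mult[symmetric] mult.assoc exp_add[symmetric]) (simp add: field_simps)
  finally show ?case .
qed

end

section \<open>Stationary diffusions\<close>

abbreviation wt :: "nat \<Rightarrow> real \<Rightarrow> real" where "wt p x \<equiv> (1 + \<bar>x\<bar>) ^ p"

lemma wt_mono: "p \<le> q \<Longrightarrow> wt p x \<le> wt q x"
  by (intro power_increasing) auto

text \<open>Coefficients and test functions are controlled only on \<open>S\<close>; extending them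
  by 0 outside the open set gives Borel functions without changing the composition.\<close>

lemma measurable_continuous_on_open:
  fixes g :: "real \<Rightarrow> real"
  assumes "continuous_on S g" "open S" and V: "V \<in> borel_measurable N" and S: "\<And>w. w \<in> space N \<Longrightarrow> V w \<in> S"
  shows "(\<lambda>w. g (V w)) \<in> borel_measurable N"
proof -
  have "(\<lambda>x. if x \<in> S then g x else 0) \<in> borel_measurable borel"
    using assms by (intro borel_measurable_continuous_on_if) auto
  then have "(\<lambda>w. if V w \<in> S then g (V w) else 0) \<in> borel_measurable N"
    using V by measurable
  then show ?thesis using S by (subst measurable_cong[where g = "\<lambda>w. if V w \<in> S then g (V w) else 0"]) auto
qed

text \<open>The process is sampled at the last grid point of mesh \<open>1 / (n + 1)\<close> before
  the given time and converges by continuity. The cut at 0 reflects that the process is controlled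
  at nonnegative times.\<close>

lemma measurable_continuous_process:
  fixes g :: "real \<Rightarrow> 'w \<Rightarrow> real"
  assumes g: "\<And>u. 0 \<le> u \<Longrightarrow> g u \<in> borel_measurable M" and c: "\<And>w. w \<in> space M \<Longrightarrow> continuous_on {0..} (\<lambda>u. g u w)"
  shows "(\<lambda>x. g (max 0 (snd x)) (fst x)) \<in> borel_measurable (M \<Otimes>\<^sub>M borel)"
proof (rule borel_measurable_LIMSEQ_real)
  define a where "a n x = nat \<lfloor>real (Suc n) * max 0 (snd x)\<rfloor>" for n and x :: "'w \<times> real"
  show "(\<lambda>x. g (real (a n x) / real (Suc n)) (fst x)) \<in> borel_measurable (M \<Otimes>\<^sub>M borel)" for n
  proof (rule measurable_compose_countable[where f = "\<lambda>i x. g (real i / real (Suc n)) (fst x)" and g = "a n"])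
    show "(\<lambda>x. g (real i / real (Suc n)) (fst x)) \<in> borel_measurable (M \<Otimes>\<^sub>M borel)" for i
      using g[of "real i / real (Suc n)"] by (intro measurable_compose[OF measurable_fst]) auto
    show "a n \<in> measurable (M \<Otimes>\<^sub>M borel) (count_space UNIV)"
      unfolding a_def[abs_def] by measurable
  qed
  fix x assume "x \<in> space (M \<Otimes>\<^sub>M (borel :: real measure))"
  then have x: "fst x \<in> space M" by (auto simp: space_pair_measure)
  let ?u = "max 0 (snd x)"
  have "(\<lambda>n. real (a n x) / real (Suc n)) \<longlonglongrightarrow> ?u"
  proof (rule tendsto_sandwich[of "\<lambda>n. ?u - 1 / real (Suc n)" _ _ "\<lambda>n. ?u"])
    have eq: "real (a n x) = of_int \<lfloor>real (Suc n) * ?u\<rfloor>" for n by (simp add: a_def)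
    have 1: "?u - 1 / real (Suc n) \<le> real (a n x) / real (Suc n) \<and> real (a n x) / real (Suc n) \<le> ?u" for n
    proof -
      have "real (Suc n) * ?u - 1 \<le> real (a n x)" "real (a n x) \<le> real (Suc n) * ?u" unfolding eq by linarith+
      then have "(real (Suc n) * ?u - 1) / real (Suc n) \<le> real (a n x) / real (Suc n)" "real (a n x) / real (Suc n) \<le> real (Suc n) * ?u / real (Suc n)"
        by (intro divide_right_mono; simp)+
      moreover have "real (Suc n) * ?u / real (Suc n) = ?u" by simp
      ultimately show ?thesis by (simp add: diff_divide_distrib)
    qed
    show "\<forall>\<^sub>F n in sequentially. ?u - 1 / real (Suc n) \<le> real (a n x) / real (Suc n)" using 1 by simp
    show "\<forall>\<^sub>F n in sequentially. real (a n x) / real (Suc n) \<le> ?u" using 1 by simp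
    have "(\<lambda>n. ?u - 1 / real (Suc n)) \<longlonglongrightarrow> ?u - 0"
      by (intro tendsto_diff tendsto_const LIMSEQ_Suc[OF lim_1_over_n])
    then show "(\<lambda>n. ?u - 1 / real (Suc n)) \<longlonglongrightarrow> ?u" by simp
  qed simp
  moreover have "((\<lambda>u. g u (fst x)) \<longlongrightarrow> g ?u (fst x)) (at ?u within {0..})"
    using c[OF x] by (simp add: continuous_on)
  ultimately show "(\<lambda>n. g (real (a n x) / real (Suc n)) (fst x)) \<longlonglongrightarrow> g ?u (fst x)"
    using continuous_on_tendsto_compose[OF c[OF x], of "\<lambda>n. real (a n x) / real (Suc n)" ?u sequentially] by simp
qed

lemma step_list_simple:
  "step_val (map (\<lambda>j. (\<tau> j, \<tau> (Suc j), \<eta> j)) [0..<m]) u w = simple_val m \<tau> \<eta> u w"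
  "step_int B (map (\<lambda>j. (\<tau> j, \<tau> (Suc j), \<eta> j)) [0..<m]) w = simple_int B m \<tau> \<eta> w"
  by (simp_all add: step_val_def step_int_def simple_val_def simple_int_def comp_def interv_sum_list_conv_sum_set_nat atLeast0LessThan)

lemma step_list_simple_neg:
  "step_val (map (\<lambda>j. (\<tau> j, \<tau> (Suc j), \<lambda>w. - \<eta> j w)) [0..<m]) u w = - simple_val m \<tau> \<eta> u w"
  "step_int B (map (\<lambda>j. (\<tau> j, \<tau> (Suc j), \<lambda>w. - \<eta> j w)) [0..<m]) w = - simple_int B m \<tau> \<eta> w"
proof -
  have "simple_val m \<tau> (\<lambda>j w. - \<eta> j w) u w = - simple_val m \<tau> \<eta> u w"
    "simple_int B m \<tau> (\<lambda>j w. - \<eta> j w) w = - simple_int B m \<tau> \<eta> w"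
    unfolding simple_val_def simple_int_def mult_minus_left sum_negf by (rule refl)+
  then show "step_val (map (\<lambda>j. (\<tau> j, \<tau> (Suc j), \<lambda>w. - \<eta> j w)) [0..<m]) u w = - simple_val m \<tau> \<eta> u w"
    "step_int B (map (\<lambda>j. (\<tau> j, \<tau> (Suc j), \<lambda>w. - \<eta> j w)) [0..<m]) w = - simple_int B m \<tau> \<eta> w"
    using step_list_simple[where \<tau> = \<tau> and \<eta> = "\<lambda>j w. - \<eta> j w" and m = m] by simp_all
qed

lemma simple_val_cell:
  assumes "\<And>i j. i < j \<Longrightarrow> j \<le> n \<Longrightarrow> \<tau> i < \<tau> j" "i < n" "\<tau> i < u" "u \<le> \<tau> (Suc i)"
  shows "simple_val n \<tau> \<eta> u w = \<eta> i w"
proof -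
  have "u \<notin> {\<tau> j<..\<tau> (Suc j)}" if "j < n" "j \<noteq> i" for j
  proof (cases "j < i")
    case True
    then have "\<tau> (Suc j) \<le> \<tau> i" using assms(1)[of "Suc j" i] assms by (cases "Suc j = i") (auto simp: less_imp_le)
    then show ?thesis using assms by auto
  next
    case False
    then have "\<tau> (Suc i) \<le> \<tau> j" using assms(1)[of "Suc i" j] that by (cases "Suc i = j") (auto simp: less_imp_le)
    then show ?thesis using assms by auto
  qed
  then have "simple_val n \<tau> \<eta> u w = (\<Sum>j\<in>{i}. \<eta> j w * indicator {\<tau> j<..\<tau> (Suc j)} u)"
    unfolding simple_val_def using assms(2) by (intro sum.mono_neutral_right) (auto simp: indicator_def)
  then show ?thesis using assms by simp
qed

lemma gridpt_cell:
  assumes "s < u" "u \<le> t" "0 < N"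
  obtains i where "i < N" "gridpt s t N i < u" "u \<le> gridpt s t N (Suc i)"
proof -
  let ?h = "(t - s) / real N"
  have h: "?h > 0" using assms by simp
  define z where "z = (u - s) / ?h"
  \<comment> \<open>Cells are open on the left and closed on the right, so the index is the ceiling
    minus one and not the floor.\<close>
  define i where "i = nat (\<lceil>z\<rceil> - 1)"
  have "real N * ?h = t - s" using assms by simp
  then have z: "0 < z" "z \<le> real N" using assms h unfolding z_def
    by (auto simp only: pos_divide_le_eq divide_pos_pos diff_gt_0_iff_gt)
  have i: "real i = of_int \<lceil>z\<rceil> - 1" using z by (simp add: i_def)
  have "real i < z" "z \<le> real i + 1" unfolding i by linarith+
  then have "real i * ?h < z * ?h" "z * ?h \<le> (real i + 1) * ?h"
    using h mult_strict_right_mono[of "real i" z ?h] mult_right_mono[of z "real i + 1" ?h] by auto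
  moreover have "z * ?h = u - s"
    unfolding z_def times_divide_eq_left[of "u - s"] using h by (intro nonzero_mult_div_cancel_right) linarith
  ultimately have "gridpt s t N i < u" "u \<le> gridpt s t N (Suc i)" by (auto simp: add.commute[of 1])
  moreover have "i < N" using \<open>real i < z\<close> z by linarith
  ultimately show ?thesis using that by blast
qed

lemma gridpt_strict_mono: "s < t \<Longrightarrow> 0 < N \<Longrightarrow> i < j \<Longrightarrow> gridpt s t N i < gridpt s t N j"
  by (simp add: mult_strict_right_mono divide_strict_right_mono)

text \<open>The parameter is frozen. \<open>CG\<close> is the constant of linear growth;
  \<open>CL\<close> and \<open>pL\<close> describe the local Lipschitz bound that first derivatives
  of polynomial growth provide. Stationarity enters through the equality of the laws of
  \<open>X t\<close> and \<open>X 0\<close>.\<close>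

locale stationary_diffusion = brownian_filtration M F B for M :: "'w measure" and F B +
  fixes X :: "real \<Rightarrow> 'w \<Rightarrow> real" and \<alpha> \<beta> :: "real \<Rightarrow> real" and S :: "real set" and CG CL :: real and pL :: nat
  assumes S_interval: "is_interval S" and S_open: "open S"
    and B_cont: "w \<in> space M \<Longrightarrow> continuous_on {0..} (\<lambda>t. B t w)"
    and X_adapted: "0 \<le> t \<Longrightarrow> X t \<in> borel_measurable (F t)"
    and X_cont: "w \<in> space M \<Longrightarrow> continuous_on {0..} (\<lambda>t. X t w)"
    and X_S: "0 \<le> t \<Longrightarrow> w \<in> space M \<Longrightarrow> X t w \<in> S"
    and X_ito: "0 \<le> t \<Longrightarrow> has_ito_integral M F B (\<lambda>s w. \<beta> (X s w)) t
        (\<lambda>w. X t w - X 0 w - (LINT s:{0..t}|lborel. \<alpha> (X s w)))"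
    and X_law: "0 \<le> t \<Longrightarrow> distr M borel (X t) = distr M borel (X 0)"
    and X_moment: "integrable M (\<lambda>w. \<bar>X 0 w\<bar> ^ k)"
    and \<alpha>_cont: "continuous_on S \<alpha>" and \<beta>_cont: "continuous_on S \<beta>"
    and CG: "0 \<le> CG" and \<alpha>_growth: "x \<in> S \<Longrightarrow> \<bar>\<alpha> x\<bar> \<le> CG * (1 + \<bar>x\<bar>)" and \<beta>_growth: "x \<in> S \<Longrightarrow> \<bar>\<beta> x\<bar> \<le> CG * (1 + \<bar>x\<bar>)"
    and CL: "0 \<le> CL"
    and \<alpha>_lip: "x \<in> S \<Longrightarrow> y \<in> S \<Longrightarrow> \<bar>\<alpha> x - \<alpha> y\<bar> \<le> CL * ((1 + \<bar>x\<bar>) * (1 + \<bar>y\<bar>)) ^ pL * \<bar>x - y\<bar>"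
    and \<beta>_lip: "x \<in> S \<Longrightarrow> y \<in> S \<Longrightarrow> \<bar>\<beta> x - \<beta> y\<bar> \<le> CL * ((1 + \<bar>x\<bar>) * (1 + \<bar>y\<bar>)) ^ pL * \<bar>x - y\<bar>"
begin

lemma X_measurable [measurable]: "0 \<le> t \<Longrightarrow> X t \<in> borel_measurable M"
  using X_adapted M_measurable by blast

lemma X_cont_on: "w \<in> space M \<Longrightarrow> 0 \<le> s \<Longrightarrow> continuous_on {s..t} (\<lambda>u. X u w)"
  by (rule continuous_on_subset[OF X_cont]) auto

lemma fX_cont_on: "continuous_on S f \<Longrightarrow> w \<in> space M \<Longrightarrow> T \<subseteq> {0..} \<Longrightarrow> continuous_on T (\<lambda>u. f (X u w))"
  by (rule continuous_on_compose2[of S f]) (auto intro: continuous_on_subset[OF X_cont] X_S)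

lemma fX_adapted:
  fixes f :: "real \<Rightarrow> real"
  shows "continuous_on S f \<Longrightarrow> 0 \<le> t \<Longrightarrow> (\<lambda>w. f (X t w)) \<in> borel_measurable (F t)"
  by (rule measurable_continuous_on_open[OF _ S_open X_adapted]) (auto simp: space_F X_S)

lemma fX_measurable:
  fixes f :: "real \<Rightarrow> real"
  shows "continuous_on S f \<Longrightarrow> 0 \<le> t \<Longrightarrow> (\<lambda>w. f (X t w)) \<in> borel_measurable M"
  by (rule measurable_continuous_on_open[OF _ S_open X_measurable]) (auto simp: X_S)

lemma X_integral_law:
  fixes g :: "real \<Rightarrow> real"
  assumes "0 \<le> t" and [measurable]: "g \<in> borel_measurable borel"
  shows "integrable M (\<lambda>w. g (X t w)) \<longleftrightarrow> integrable M (\<lambda>w. g (X 0 w))"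
    "expectation (\<lambda>w. g (X t w)) = expectation (\<lambda>w. g (X 0 w))"
proof -
  have [measurable]: "X t \<in> borel_measurable M" "X 0 \<in> borel_measurable M" using assms by auto
  show "integrable M (\<lambda>w. g (X t w)) \<longleftrightarrow> integrable M (\<lambda>w. g (X 0 w))"
    using X_law[OF assms(1)] integrable_distr_eq[of "X t" M borel g] integrable_distr_eq[of "X 0" M borel g] by simp
  show "expectation (\<lambda>w. g (X t w)) = expectation (\<lambda>w. g (X 0 w))"
    using X_law[OF assms(1)] integral_distr[of "X t" M borel g] integral_distr[of "X 0" M borel g] by simp
qed

lemma wt_integrable: "0 \<le> t \<Longrightarrow> integrable M (\<lambda>w. wt k (X t w))"
proof -
  assume t: "0 \<le> t"
  have [measurable]: "X 0 \<in> borel_measurable M" by simp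
  have "wt k x \<le> 2 ^ k * (1 + \<bar>x\<bar> ^ k)" for x :: real
  proof (cases "\<bar>x\<bar> \<le> 1")
    case True
    then have "wt k x \<le> 2 ^ k" by (intro power_mono) auto
    also have "\<dots> \<le> 2 ^ k * (1 + \<bar>x\<bar> ^ k)" by simp
    finally show ?thesis .
  next
    case False
    then have "wt k x \<le> (2 * \<bar>x\<bar>) ^ k" by (intro power_mono) auto
    also have "\<dots> \<le> 2 ^ k * (1 + \<bar>x\<bar> ^ k)" by (simp add: power_mult_distrib)
    finally show ?thesis .
  qed
  then have "integrable M (\<lambda>w. wt k (X 0 w))"
    using X_moment[of k] by (intro Bochner_Integration.integrable_bound[OF integrable_mult_right[OF Bochner_Integration.integrable_add[OF integrable_const X_moment[of k]], of "2 ^ k" 1]])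
     auto
  then show ?thesis using X_integral_law(1)[OF t, of "wt k"] by simp
qed

lemma wt_integrable_on: "0 \<le> t \<Longrightarrow> G \<in> sets M \<Longrightarrow> integrable M (\<lambda>w. indicator G w * wt k (X t w))"
  using integrable_mult_indicator[OF _ wt_integrable, of G] by simp

definition drift :: "real \<Rightarrow> real \<Rightarrow> 'w \<Rightarrow> real" where
  "drift s t w = integral {s..t} (\<lambda>u. \<alpha> (X u w))"

text \<open>The martingale part is the defect of the drift. By the equation it is the increment of
  the Ito integrals over \<open>[0, s]\<close> and \<open>[0, t]\<close>, so no integral over
  \<open>[s, t]\<close> has to be introduced.\<close>

definition mart :: "real \<Rightarrow> real \<Rightarrow> 'w \<Rightarrow> real" where
  "mart s t w = X t w - X s w - drift s t w"

text \<open>The equation is stated with the Lebesgue integral; from here on the Henstock-Kurzweil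
  integral of continuous paths is used.\<close>

lemma drift_lebesgue: "w \<in> space M \<Longrightarrow> 0 \<le> s \<Longrightarrow> (LINT u:{s..t}|lborel. \<alpha> (X u w)) = drift s t w"
  unfolding drift_def
  by (intro set_borel_integral_eq_integral borel_integrable_atLeastAtMost' fX_cont_on \<alpha>_cont) auto

lemma drift_combine: "w \<in> space M \<Longrightarrow> 0 \<le> s \<Longrightarrow> s \<le> t \<Longrightarrow> t \<le> r \<Longrightarrow> drift s t w + drift t r w = drift s r w"
  unfolding drift_def
  by (rule Henstock_Kurzweil_Integration.integral_combine) (auto intro!: integrable_continuous_real fX_cont_on \<alpha>_cont)

lemma integral_mean_tendsto:
  assumes "s < t" "continuous_on {s..t} (\<lambda>u. g u w)"
  shows "(\<lambda>N. (\<Sum>j<Suc N. g (gridpt s t (Suc N) j) w) / real (Suc N)) \<longlonglongrightarrow> integral {s..t} (\<lambda>u. g u w :: real) / (t - s)"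
  using LIMSEQ_Suc[OF riemann_mean_tendsto[OF assms(2,1)]] by simp

text \<open>The measurable space is arbitrary because time averages are needed as functions on
  \<open>M\<close> and on \<open>F t\<close>.\<close>

lemma integral_mean_measurable:
  assumes "0 \<le> s" "s < t" and g: "\<And>u. s \<le> u \<Longrightarrow> u \<le> t \<Longrightarrow> g u \<in> borel_measurable N"
    and c: "\<And>w. w \<in> space N \<Longrightarrow> continuous_on {s..t} (\<lambda>u. g u w :: real)"
  shows "(\<lambda>w. integral {s..t} (\<lambda>u. g u w) / (t - s)) \<in> borel_measurable N"
proof (rule borel_measurable_LIMSEQ_real[OF integral_mean_tendsto[OF assms(2) c]])
  show "(\<lambda>w. (\<Sum>j<Suc n. g (gridpt s t (Suc n) j) w) / real (Suc n)) \<in> borel_measurable N" for n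
    using gridpt_bounds[of s t _ "Suc n"] assms(1,2)
    by (intro borel_measurable_divide borel_measurable_sum borel_measurable_const g) auto
qed

text \<open>Jensen's inequality on the grid, then Fatou's lemma. Working on the grid avoids an
  exchange of expectation and time integral.\<close>

lemma integral_mean_moment:
  assumes st: "0 \<le> s" "s < t" and g: "\<And>u. s \<le> u \<Longrightarrow> u \<le> t \<Longrightarrow> g u \<in> borel_measurable M"
    and c: "\<And>w. w \<in> space M \<Longrightarrow> continuous_on {s..t} (\<lambda>u. g u w :: real)"
    and G[measurable]: "G \<in> sets M"
    and i: "\<And>u. s \<le> u \<Longrightarrow> u \<le> t \<Longrightarrow> integrable M (\<lambda>w. indicator G w * g u w ^ (2 * k))"
    and b: "\<And>u. s \<le> u \<Longrightarrow> u \<le> t \<Longrightarrow> expectation (\<lambda>w. indicator G w * g u w ^ (2 * k)) \<le> b"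
  shows "integrable M (\<lambda>w. indicator G w * (integral {s..t} (\<lambda>u. g u w) / (t - s)) ^ (2 * k))"
    "expectation (\<lambda>w. indicator G w * (integral {s..t} (\<lambda>u. g u w) / (t - s)) ^ (2 * k)) \<le> b"
proof -
  let ?Z = "\<lambda>N w. (\<Sum>j<Suc N. g (gridpt s t (Suc N) j) w) / real (Suc N)"
  have gp: "s \<le> gridpt s t (Suc N) j" "gridpt s t (Suc N) j \<le> t" if "j < Suc N" for N j
    using gridpt_bounds[of s t j "Suc N"] st that by auto
  have Zm[measurable]: "?Z N \<in> borel_measurable M" for N
    using gp by (intro borel_measurable_divide borel_measurable_sum borel_measurable_const g) auto
  have Vm: "(\<lambda>w. integral {s..t} (\<lambda>u. g u w) / (t - s)) \<in> borel_measurable M"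
    by (rule integral_mean_measurable[OF st g c])
  have p: "(\<lambda>N. pdist (?Z N) (\<lambda>w. integral {s..t} (\<lambda>u. g u w) / (t - s))) \<longlonglongrightarrow> 0"
    using c st by (intro AE_tendsto_pdist Zm Vm AE_I2 integral_mean_tendsto) auto
  have i2: "integrable M (\<lambda>w. (\<Sum>j<Suc N. indicator G w * g (gridpt s t (Suc N) j) w ^ (2 * k)) / real (Suc N))" for N
    using gp by (intro integrable_divide Bochner_Integration.integrable_sum i) auto
  have le: "indicator G w * ?Z N w ^ (2 * k) \<le> (\<Sum>j<Suc N. indicator G w * g (gridpt s t (Suc N) j) w ^ (2 * k)) / real (Suc N)" for N w
    using sum_power_even_mean_le[of "Suc N" "\<lambda>j. g (gridpt s t (Suc N) j) w" k]
    by (cases "w \<in> G") auto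
  have nn: "0 \<le> indicator G w * ?Z N w ^ (2 * k)" for N w by simp
  have i3: "integrable M (\<lambda>w. indicator G w * ?Z N w ^ (2 * k))" for N
  proof (rule Bochner_Integration.integrable_bound[OF i2[of N]])
    show "AE w in M. norm (indicator G w * ?Z N w ^ (2 * k)) \<le> norm ((\<Sum>j<Suc N. indicator G w * g (gridpt s t (Suc N) j) w ^ (2 * k)) / real (Suc N))"
    proof (rule AE_I2)
      fix w
      show "norm (indicator G w * ?Z N w ^ (2 * k)) \<le> norm ((\<Sum>j<Suc N. indicator G w * g (gridpt s t (Suc N) j) w ^ (2 * k)) / real (Suc N))"
        unfolding real_norm_def using le[of w N] nn[of w N] by linarith
    qed
  qed (use Zm in measurable)
  have "expectation (\<lambda>w. indicator G w * ?Z N w ^ (2 * k)) \<le> b" for N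
  proof -
    have "expectation (\<lambda>w. indicator G w * ?Z N w ^ (2 * k)) \<le> expectation (\<lambda>w. (\<Sum>j<Suc N. indicator G w * g (gridpt s t (Suc N) j) w ^ (2 * k)) / real (Suc N))"
      using i3 i2 le by (intro integral_mono) auto
    also have "\<dots> = (\<Sum>j<Suc N. expectation (\<lambda>w. indicator G w * g (gridpt s t (Suc N) j) w ^ (2 * k))) / real (Suc N)"
      using i gp by (subst integral_divide_zero, subst Bochner_Integration.integral_sum) auto
    also have "\<dots> \<le> (\<Sum>j<Suc N. b) / real (Suc N)"
      using b gp by (intro divide_right_mono sum_mono) auto
    finally show ?thesis by simp
  qed
  then have ev: "\<forall>\<^sub>F N in sequentially. expectation (\<lambda>w. indicator G w * ?Z N w ^ (2 * k)) \<le> b" by simp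
  have cont: "continuous_on UNIV (\<lambda>x::real. x ^ (2 * k))" by (intro continuous_intros)
  from pdist_integral_le[OF Zm Vm p cont _ G i3 ev]
  show "integrable M (\<lambda>w. indicator G w * (integral {s..t} (\<lambda>u. g u w) / (t - s)) ^ (2 * k))"
    "expectation (\<lambda>w. indicator G w * (integral {s..t} (\<lambda>u. g u w) / (t - s)) ^ (2 * k)) \<le> b" by auto
qed

lemma drift_measurable: "0 \<le> s \<Longrightarrow> s \<le> t \<Longrightarrow> drift s t \<in> borel_measurable (F t)"
proof (cases "s = t")
  case True
  then have "drift s t = (\<lambda>_. 0)" by (auto simp: drift_def)
  then show ?thesis by simp
next
  case False
  assume st: "0 \<le> s" "s \<le> t"
  have "(\<lambda>w. integral {s..t} (\<lambda>u. \<alpha> (X u w)) / (t - s)) \<in> borel_measurable (F t)"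
  proof (rule integral_mean_measurable)
    show "(\<lambda>w. \<alpha> (X u w)) \<in> borel_measurable (F t)" if "s \<le> u" "u \<le> t" for u
      using that st by (intro F_measurable[OF _ _ fX_adapted[OF \<alpha>_cont]]) auto
    show "continuous_on {s..t} (\<lambda>u. \<alpha> (X u w))" if "w \<in> space (F t)" for w
      using that st space_F[of t] by (intro fX_cont_on \<alpha>_cont) auto
  qed (use st False in auto)
  then have "(\<lambda>w. (t - s) * (integral {s..t} (\<lambda>u. \<alpha> (X u w)) / (t - s))) \<in> borel_measurable (F t)" by measurable
  then show ?thesis using False st by (simp add: drift_def[abs_def])
qed

lemma mart_measurable: "0 \<le> s \<Longrightarrow> s \<le> t \<Longrightarrow> mart s t \<in> borel_measurable (F t)"
  unfolding mart_def[abs_def]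
  by (intro borel_measurable_diff drift_measurable X_adapted F_measurable[OF _ _ X_adapted, of s t]) auto

lemma mart_measurable_M: "0 \<le> s \<Longrightarrow> s \<le> t \<Longrightarrow> mart s t \<in> borel_measurable M"
  using mart_measurable[of s t] M_measurable[of t] by simp

section \<open>Left-point sums and the Ito integral\<close>

definition ito_sum :: "real \<Rightarrow> real \<Rightarrow> nat \<Rightarrow> 'w \<Rightarrow> real" where
  "ito_sum s t N w = (\<Sum>j<N. \<beta> (X (gridpt s t N j) w) * (B (gridpt s t N (Suc j)) w - B (gridpt s t N j) w))"

lemma ito_sum_measurable: "0 \<le> s \<Longrightarrow> s \<le> t \<Longrightarrow> ito_sum s t N \<in> borel_measurable M"
  unfolding ito_sum_def[abs_def]
  using gridpt_bounds(1)[of s t _ N]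
  by (intro borel_measurable_sum borel_measurable_times borel_measurable_diff fX_measurable \<beta>_cont B_measurable) auto

text \<open>The squared error from the definition of the Ito integral, over a general interval so
  that it also measures the error of a grid process on \<open>[s, t]\<close>.\<close>

definition sq_err :: "real \<Rightarrow> real \<Rightarrow> nat \<Rightarrow> (nat \<Rightarrow> real) \<Rightarrow> (nat \<Rightarrow> 'w \<Rightarrow> real) \<Rightarrow> 'w \<Rightarrow> ennreal" where
  "sq_err s t m \<tau> \<eta> w = (\<integral>\<^sup>+u\<in>{s..t}. ennreal ((simple_val m \<tau> \<eta> u w - \<beta> (X u w))\<^sup>2) \<partial>lborel)"

lemma \<beta>X_joint_measurable: "(\<lambda>x. \<beta> (X (max 0 (snd x)) (fst x))) \<in> borel_measurable (M \<Otimes>\<^sub>M borel)"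
  by (rule measurable_continuous_process[of "\<lambda>u w. \<beta> (X u w)"]) (auto intro!: fX_measurable fX_cont_on \<beta>_cont)

lemma sq_err_measurable:
  assumes "0 \<le> s" and \<eta>[measurable]: "\<And>j. j < m \<Longrightarrow> \<eta> j \<in> borel_measurable M"
  shows "sq_err s t m \<tau> \<eta> \<in> borel_measurable M"
proof -
  have [measurable]: "(\<lambda>x. simple_val m \<tau> \<eta> (snd x) (fst x)) \<in> borel_measurable (M \<Otimes>\<^sub>M borel)"
    unfolding simple_val_def
  proof (intro borel_measurable_sum borel_measurable_times)
    fix j assume "j \<in> {..<m}"
    then show "(\<lambda>x. \<eta> j (fst x)) \<in> borel_measurable (M \<Otimes>\<^sub>M borel)"
      by (intro measurable_compose[OF measurable_fst] \<eta>) simp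
  qed measurable
  note \<beta>X_joint_measurable[measurable]
  \<comment> \<open>With \<open>max 0 u\<close> the integrand is jointly measurable on the whole
    line; on \<open>{s..t}\<close> nothing changes as \<open>0 \<le> s\<close>.\<close>
  have "(\<lambda>w. \<integral>\<^sup>+u. ennreal ((simple_val m \<tau> \<eta> u w - \<beta> (X (max 0 u) w))\<^sup>2) * indicator {s..t} u \<partial>lborel) \<in> borel_measurable M"
  proof (rule lborel.borel_measurable_nn_integral)
    show "(\<lambda>(w, u). ennreal ((simple_val m \<tau> \<eta> u w - \<beta> (X (max 0 u) w))\<^sup>2) * indicator {s..t} u) \<in> borel_measurable (M \<Otimes>\<^sub>M lborel)"
      by (simp add: split_beta cong: measurable_cong_sets)
  qed
  also have "(\<lambda>w. \<integral>\<^sup>+u. ennreal ((simple_val m \<tau> \<eta> u w - \<beta> (X (max 0 u) w))\<^sup>2) * indicator {s..t} u \<partial>lborel) = sq_err s t m \<tau> \<eta>"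
    unfolding sq_err_def[abs_def] using assms(1) by (intro ext nn_integral_cong) (auto simp: indicator_def)
  finally show ?thesis .
qed

text \<open>Along each path \<open>\<beta>(X)\<close> is uniformly continuous on
  \<open>[s, t]\<close>, so on fine grids the squared error is at most \<open>d\<close>; dominated
  convergence is applied to the indicators of the exceptional events.\<close>

lemma sq_err_grid_tendsto:
  assumes "0 \<le> s" "s < t" "0 < (d::real)"
  shows "(\<lambda>N. prob {w\<in>space M. sq_err s t (Suc N) (gridpt s t (Suc N)) (\<lambda>j w. \<beta> (X (gridpt s t (Suc N) j) w)) w > ennreal d}) \<longlonglongrightarrow> 0"
proof -
  let ?D = "\<lambda>N. sq_err s t (Suc N) (gridpt s t (Suc N)) (\<lambda>j w. \<beta> (X (gridpt s t (Suc N) j) w))"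
  have [measurable]: "?D N \<in> borel_measurable M" for N
    using assms by (intro sq_err_measurable fX_measurable \<beta>_cont) auto
  have "(\<lambda>N. expectation (\<lambda>w. indicator {w\<in>space M. ?D N w > ennreal d} w :: real)) \<longlonglongrightarrow> expectation (\<lambda>w. 0)"
  proof (rule integral_dominated_convergence[where w = "\<lambda>_. 1"])
    show "AE w in M. (\<lambda>N. indicator {w\<in>space M. ?D N w > ennreal d} w :: real) \<longlonglongrightarrow> 0"
    proof (rule AE_I2)
      fix w assume w: "w \<in> space M"
      \<comment> \<open>A uniform error \<open>e\<close> contributes exactly \<open>d\<close> when
        its square is integrated over \<open>[s, t]\<close>.\<close>
      define e where "e = sqrt (d / (t - s))"
      have e: "e > 0" "e\<^sup>2 * (t - s) = d" using assms by (auto simp: e_def)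
      have c: "continuous_on {s..t} (\<lambda>u. \<beta> (X u w))" using w assms by (intro fX_cont_on \<beta>_cont) auto
      have "\<forall>\<^sub>F N in sequentially. \<forall>u\<in>{s..t}. \<forall>v\<in>{s..t}. \<bar>u - v\<bar> \<le> (t - s) / real (Suc N) \<longrightarrow> \<bar>\<beta> (X u w) - \<beta> (X v w)\<bar> \<le> e"
        using uniform_oscillation[OF c e(1)] by (rule eventually_sequentially_Suc[THEN iffD2])
      then have "\<forall>\<^sub>F N in sequentially. indicator {w\<in>space M. ?D N w > ennreal d} w = (0 :: real)"
      proof eventually_elim
        case (elim N)
        have "?D N w \<le> (\<integral>\<^sup>+u. ennreal (e\<^sup>2) * indicator {s<..t} u \<partial>lborel)"
          unfolding sq_err_def
        proof (rule nn_integral_mono_AE)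
          \<comment> \<open>The point \<open>s\<close> lies in \<open>{s..t}\<close> but in no
            half-open cell; it is discarded as a null set.\<close>
          show "AE u in lborel. ennreal ((simple_val (Suc N) (gridpt s t (Suc N)) (\<lambda>j w. \<beta> (X (gridpt s t (Suc N) j) w)) u w - \<beta> (X u w))\<^sup>2) * indicator {s..t} u \<le> ennreal (e\<^sup>2) * indicator {s<..t} u"
            using AE_lborel_singleton[of s]
          proof eventually_elim
            case (elim u)
            show ?case
            proof (cases "u \<in> {s<..t}")
              case True
              then obtain i where i: "i < Suc N" "gridpt s t (Suc N) i < u" "u \<le> gridpt s t (Suc N) (Suc i)"
                using gridpt_cell[of s u t "Suc N"] by auto
              have sv: "simple_val (Suc N) (gridpt s t (Suc N)) (\<lambda>j w. \<beta> (X (gridpt s t (Suc N) j) w)) u w = \<beta> (X (gridpt s t (Suc N) i) w)"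
                using i by (intro simple_val_cell gridpt_strict_mono[OF assms(2)]) auto
              have "gridpt s t (Suc N) i \<in> {s..t}" using i gridpt_bounds[of s t i "Suc N"] assms by auto
              moreover have "\<bar>gridpt s t (Suc N) i - u\<bar> \<le> (t - s) / real (Suc N)" using i by (auto simp: distrib_right add_divide_distrib)
              ultimately have "\<bar>\<beta> (X (gridpt s t (Suc N) i) w) - \<beta> (X u w)\<bar> \<le> e"
                using \<open>\<forall>u\<in>{s..t}. \<forall>v\<in>{s..t}. _\<close> True by auto
              then have "(\<beta> (X (gridpt s t (Suc N) i) w) - \<beta> (X u w))\<^sup>2 \<le> e\<^sup>2" by (metis abs_ge_zero power2_abs power_mono)
              then show ?thesis using sv True by (simp add: ennreal_leI)
            qed (use elim in \<open>auto simp: indicator_def\<close>)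
          qed
        qed
        also have "\<dots> = ennreal d" using e assms by (simp add: nn_integral_cmult_indicator ennreal_mult[symmetric])
        finally show ?case by (auto simp: indicator_def)
      qed
      then show "(\<lambda>N. indicator {w\<in>space M. ?D N w > ennreal d} w :: real) \<longlonglongrightarrow> 0"
        by (rule tendsto_eventually)
    qed
    show "(\<lambda>w. indicator {w\<in>space M. ?D N w > ennreal d} w :: real) \<in> borel_measurable M" for N
      by (intro borel_measurable_indicator) measurable
  qed (auto simp: indicator_def)
  then show ?thesis by (simp add: Int_absorb2[OF Collect_restrict])
qed

lemma ito_at:
  assumes "0 \<le> t"
  shows "\<exists>m \<tau> \<eta>. (\<forall>k. is_simple M F t (m k) (\<tau> k) (\<eta> k)) \<and>
    (\<forall>d>0. (\<lambda>k. prob {w\<in>space M. sq_err 0 t (m k) (\<tau> k) (\<eta> k) w > ennreal d}) \<longlonglongrightarrow> 0) \<and>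
    (\<forall>a>0. (\<lambda>k. prob {w\<in>space M. \<bar>simple_int B (m k) (\<tau> k) (\<eta> k) w - mart 0 t w\<bar> > a}) \<longlonglongrightarrow> 0)"
proof -
  obtain m \<tau> \<eta> where *: "\<And>k. is_simple M F t (m k) (\<tau> k) (\<eta> k)"
    "\<And>d. d > 0 \<Longrightarrow> (\<lambda>k. prob {w\<in>space M. sq_err 0 t (m k) (\<tau> k) (\<eta> k) w > ennreal d}) \<longlonglongrightarrow> 0"
    "\<And>a. a > 0 \<Longrightarrow> (\<lambda>k. prob {w\<in>space M. \<bar>simple_int B (m k) (\<tau> k) (\<eta> k) w - (X t w - X 0 w - (LINT s:{0..t}|lborel. \<alpha> (X s w)))\<bar> > a}) \<longlonglongrightarrow> 0"
    using X_ito[OF assms] unfolding has_ito_integral_def sq_err_def by blast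
  have "{w\<in>space M. \<bar>simple_int B (m k) (\<tau> k) (\<eta> k) w - (X t w - X 0 w - (LINT s:{0..t}|lborel. \<alpha> (X s w)))\<bar> > a} =
    {w\<in>space M. \<bar>simple_int B (m k) (\<tau> k) (\<eta> k) w - mart 0 t w\<bar> > a}" for k a
    by (intro Collect_cong conj_cong refl) (simp add: mart_def drift_lebesgue)
  then show ?thesis using * by (intro exI[of _ m] exI[of _ \<tau>] exI[of _ \<eta>]) simp
qed

lemma is_simple_measurable:
  assumes "is_simple M F t m \<tau> \<eta>" "j < m"
  shows "\<eta> j \<in> borel_measurable M"
  using assms M_measurable[of "\<tau> j" "\<eta> j"] unfolding is_simple_def by (meson less_imp_le)

lemma simple_int_measurable:
  assumes "is_simple M F t m \<tau> \<eta>"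
  shows "simple_int B m \<tau> \<eta> \<in> borel_measurable M"
  unfolding simple_int_def[abs_def]
proof (intro borel_measurable_sum borel_measurable_times borel_measurable_diff)
  fix j assume j: "j \<in> {..<m}"
  show "\<eta> j \<in> borel_measurable M" using j is_simple_measurable[OF assms] by simp
  show "B (\<tau> (Suc j)) \<in> borel_measurable M" "B (\<tau> j) \<in> borel_measurable M"
    using j assms unfolding is_simple_def by (auto intro!: B_measurable)
qed

text \<open>The partition points do not exceed \<open>s\<close>; an approximation for the integral
  up to \<open>s\<close> therefore leaves \<open>(s, t]\<close> untouched.\<close>

lemma simple_val_zero:
  assumes "is_simple M F s m \<tau> \<eta>" "s < u"
  shows "simple_val m \<tau> \<eta> u w = 0"
  unfolding simple_val_def using assms unfolding is_simple_def
  by (intro sum.neutral) (auto simp: indicator_def Suc_le_eq dest!: spec[of _ "Suc _"])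

lemma sq_add3_le:
  fixes x y z :: real
  shows "(x + y + z)\<^sup>2 \<le> 3 * x\<^sup>2 + 3 * y\<^sup>2 + 3 * z\<^sup>2"
proof -
  have "3 * x\<^sup>2 + 3 * y\<^sup>2 + 3 * z\<^sup>2 - (x + y + z)\<^sup>2 = (x - y)\<^sup>2 + (y - z)\<^sup>2 + (x - z)\<^sup>2"
    by (simp add: power2_eq_square algebra_simps)
  moreover have "0 \<le> (x - y)\<^sup>2 + (y - z)\<^sup>2 + (x - z)\<^sup>2" by simp
  ultimately show ?thesis by linarith
qed

text \<open>The approximation up to \<open>t\<close> minus the one up to \<open>s\<close> minus the
  grid process is one step process. On \<open>(0, s]\<close> the first two both approximate
  \<open>\<beta>(X)\<close>, on \<open>(s, t]\<close> the first and the third do; hence its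
  quadratic variation is small, and Lenglart's bound makes its integral small.\<close>

lemma ito_sum_prob_le:
  assumes s: "0 \<le> s" "s < t" and "0 < N" and H: "is_simple M F t m \<tau> \<eta>" and H': "is_simple M F s m' \<tau>' \<eta>'"
    and a: "0 < a" and d: "0 < d"
  shows "prob {w\<in>space M. \<bar>simple_int B m \<tau> \<eta> w - simple_int B m' \<tau>' \<eta>' w - ito_sum s t N w\<bar> > a}
    \<le> prob {w\<in>space M. sq_err 0 t m \<tau> \<eta> w > ennreal d} + prob {w\<in>space M. sq_err 0 s m' \<tau>' \<eta>' w > ennreal d}
      + prob {w\<in>space M. sq_err s t N (gridpt s t N) (\<lambda>j w. \<beta> (X (gridpt s t N j) w)) w > ennreal d} + 9 * d / a\<^sup>2"
proof -
  let ?\<zeta> = "\<lambda>j w. \<beta> (X (gridpt s t N j) w)"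
  let ?A = "sq_err 0 t m \<tau> \<eta>" and ?A' = "sq_err 0 s m' \<tau>' \<eta>'" and ?D = "sq_err s t N (gridpt s t N) ?\<zeta>"
  define L where "L = map (\<lambda>j. (\<tau> j, \<tau> (Suc j), \<eta> j)) [0..<m] @ map (\<lambda>j. (\<tau>' j, \<tau>' (Suc j), \<lambda>w. - \<eta>' j w)) [0..<m']
    @ map (\<lambda>j. (gridpt s t N j, gridpt s t N (Suc j), \<lambda>w. - ?\<zeta> j w)) [0..<N]"
  have gz: "?\<zeta> j \<in> borel_measurable (F (gridpt s t N j))" if "j < N" for j
    using gridpt_bounds(1)[of s t j N] that s by (intro fX_adapted \<beta>_cont) auto
  have gzM: "?\<zeta> j \<in> borel_measurable M" if "j < N" for j
    using gridpt_bounds(1)[of s t j N] that s by (intro fX_measurable \<beta>_cont) auto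
  have [measurable]: "?A \<in> borel_measurable M" "?A' \<in> borel_measurable M" "?D \<in> borel_measurable M"
    using s gzM is_simple_measurable[OF H] is_simple_measurable[OF H'] by (auto intro!: sq_err_measurable)
  have int: "step_int B L w = simple_int B m \<tau> \<eta> w - simple_int B m' \<tau>' \<eta>' w - ito_sum s t N w" for w
    unfolding L_def step_simps step_list_simple step_list_simple_neg(2)[where \<tau> = \<tau>']
      step_list_simple_neg(2)[where \<tau> = "gridpt s t N" and \<eta> = "?\<zeta>"] by (simp add: ito_sum_def simple_int_def)
  have val: "step_val L u w = simple_val m \<tau> \<eta> u w - simple_val m' \<tau>' \<eta>' u w - simple_val N (gridpt s t N) ?\<zeta> u w" for u w
    unfolding L_def step_simps step_list_simple step_list_simple_neg(1)[where \<tau> = \<tau>']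
      step_list_simple_neg(1)[where \<tau> = "gridpt s t N" and \<eta> = "?\<zeta>"] by simp
  have g0: "simple_val N (gridpt s t N) ?\<zeta> u w = 0" if "u \<le> s" for u w
    unfolding simple_val_def
  proof (intro sum.neutral ballI)
    fix j assume "j \<in> {..<N}"
    then have "s \<le> gridpt s t N j" using gridpt_bounds(1)[of s t j N] s by auto
    then show "?\<zeta> j w * indicator {gridpt s t N j<..gridpt s t N (Suc j)} u = 0" using that by auto
  qed
  have pt: "ennreal ((step_val L u w)\<^sup>2) * indicator {0<..t} u \<le>
     3 * (ennreal ((simple_val m \<tau> \<eta> u w - \<beta> (X u w))\<^sup>2) * indicator {0..t} u)
     + 3 * (ennreal ((simple_val m' \<tau>' \<eta>' u w - \<beta> (X u w))\<^sup>2) * indicator {0..s} u)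
     + 3 * (ennreal ((simple_val N (gridpt s t N) ?\<zeta> u w - \<beta> (X u w))\<^sup>2) * indicator {s..t} u)" for u w
  proof (cases "u \<in> {0<..t}")
    case True
    define x where "x = simple_val m \<tau> \<eta> u w - \<beta> (X u w)"
    \<comment> \<open>At each time one of \<open>y\<close> and \<open>z\<close> is 0: the second
      approximation acts up to \<open>s\<close>, the grid process after \<open>s\<close>.\<close>
    define y where "y = (if u \<le> s then simple_val m' \<tau>' \<eta>' u w - \<beta> (X u w) else 0)"
    define z where "z = (if u \<le> s then 0 else simple_val N (gridpt s t N) ?\<zeta> u w - \<beta> (X u w))"
    have "step_val L u w = x + (- y) + (- z)"
      unfolding val x_def y_def z_def using g0[of u w] simple_val_zero[OF H', of u w] by auto
    then have "(step_val L u w)\<^sup>2 \<le> 3 * x\<^sup>2 + 3 * y\<^sup>2 + 3 * z\<^sup>2" using sq_add3_le[of x "- y" "- z"] by simp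
    then have "ennreal ((step_val L u w)\<^sup>2) \<le> ennreal (3 * x\<^sup>2 + 3 * y\<^sup>2 + 3 * z\<^sup>2)" by (rule ennreal_leI)
    also have "\<dots> = 3 * ennreal (x\<^sup>2) + 3 * ennreal (y\<^sup>2) + 3 * ennreal (z\<^sup>2)"
      by (simp add: ennreal_plus ennreal_mult)
    also have "\<dots> \<le> 3 * (ennreal ((simple_val m \<tau> \<eta> u w - \<beta> (X u w))\<^sup>2) * indicator {0..t} u)
     + 3 * (ennreal ((simple_val m' \<tau>' \<eta>' u w - \<beta> (X u w))\<^sup>2) * indicator {0..s} u)
     + 3 * (ennreal ((simple_val N (gridpt s t N) ?\<zeta> u w - \<beta> (X u w))\<^sup>2) * indicator {s..t} u)"
      using True by (intro add_mono mult_left_mono) (auto simp: x_def y_def z_def)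
    finally show ?thesis using True by simp
  qed simp
  have \<Phi>: "(\<integral>\<^sup>+u\<in>{0<..t}. ennreal ((step_val L u w)\<^sup>2) \<partial>lborel) \<le> 3 * ?A w + 3 * ?A' w + 3 * ?D w" if "w \<in> space M" for w
  proof -
    have [measurable]: "(\<lambda>u. \<beta> (X (max 0 u) w)) \<in> borel_measurable borel"
      using measurable_compose[OF measurable_Pair1'[OF that] \<beta>X_joint_measurable] by simp
    have sv[measurable]: "(\<lambda>u. simple_val m \<tau> \<eta> u w) \<in> borel_measurable borel" for m :: nat and \<tau> :: "nat \<Rightarrow> real" and \<eta> :: "nat \<Rightarrow> 'w \<Rightarrow> real"
      unfolding simple_val_def by measurable
    have alt: "sq_err s' t' m \<tau> \<eta> w = (\<integral>\<^sup>+u. ennreal ((simple_val m \<tau> \<eta> u w - \<beta> (X (max 0 u) w))\<^sup>2) * indicator {s'..t'} u \<partial>lborel)"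
      if "0 \<le> s'" for s' t' m \<tau> \<eta>
      unfolding sq_err_def using that by (intro nn_integral_cong) (auto simp: indicator_def)
    have "(\<integral>\<^sup>+u\<in>{0<..t}. ennreal ((step_val L u w)\<^sup>2) \<partial>lborel) \<le> (\<integral>\<^sup>+u.
       3 * (ennreal ((simple_val m \<tau> \<eta> u w - \<beta> (X (max 0 u) w))\<^sup>2) * indicator {0..t} u)
     + 3 * (ennreal ((simple_val m' \<tau>' \<eta>' u w - \<beta> (X (max 0 u) w))\<^sup>2) * indicator {0..s} u)
     + 3 * (ennreal ((simple_val N (gridpt s t N) ?\<zeta> u w - \<beta> (X (max 0 u) w))\<^sup>2) * indicator {s..t} u) \<partial>lborel)"
    proof (rule nn_integral_mono)
      fix u
      have "ennreal ((step_val L u w)\<^sup>2) * indicator {0<..t} u = ennreal ((step_val L (max 0 u) w)\<^sup>2) * indicator {0<..t} u"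
        by (auto simp: indicator_def max_def)
      then show "ennreal ((step_val L u w)\<^sup>2) * indicator {0<..t} u \<le>
       3 * (ennreal ((simple_val m \<tau> \<eta> u w - \<beta> (X (max 0 u) w))\<^sup>2) * indicator {0..t} u)
     + 3 * (ennreal ((simple_val m' \<tau>' \<eta>' u w - \<beta> (X (max 0 u) w))\<^sup>2) * indicator {0..s} u)
     + 3 * (ennreal ((simple_val N (gridpt s t N) ?\<zeta> u w - \<beta> (X (max 0 u) w))\<^sup>2) * indicator {s..t} u)"
        using pt[of u w] by (cases "0 < u") (auto simp: max_def)
    qed
    also have "\<dots> = 3 * ?A w + 3 * ?A' w + 3 * ?D w"
      unfolding alt[OF order_refl] alt[OF s(1)]
      by (subst nn_integral_add, measurable, subst nn_integral_add, measurable, subst (1 2 3) nn_integral_cmult, measurable)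
    finally show ?thesis .
  qed
  \<comment> \<open>The 9 is 3 from the square of a sum of three terms, times 3 for three errors of
    size \<open>d\<close>.\<close>
  have "prob {w\<in>space M. \<bar>step_int B L w\<bar> > a} \<le> prob {w\<in>space M. 3 * ?A w + 3 * ?A' w + 3 * ?D w > ennreal (9 * d)} + 9 * d / a\<^sup>2"
  proof (rule step_int_prob_le[where T = t and d = "9 * d" and \<Phi> = "\<lambda>w. 3 * ?A w + 3 * ?A' w + 3 * ?D w"])
    fix s' t' \<eta>'' assume "(s', t', \<eta>'') \<in> set L"
    then consider (1) j where "j < m" "s' = \<tau> j" "t' = \<tau> (Suc j)" "\<eta>'' = \<eta> j"
      | (2) j where "j < m'" "s' = \<tau>' j" "t' = \<tau>' (Suc j)" "\<eta>'' = (\<lambda>w. - \<eta>' j w)"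
      | (3) j where "j < N" "s' = gridpt s t N j" "t' = gridpt s t N (Suc j)" "\<eta>'' = (\<lambda>w. - ?\<zeta> j w)"
      unfolding L_def by auto
    then show "0 \<le> s' \<and> s' < t' \<and> t' \<le> t \<and> \<eta>'' \<in> borel_measurable (F s')"
    proof cases
      case 1 then show ?thesis using H unfolding is_simple_def by (auto simp: Suc_le_eq)
    next
      case 2
      then have "0 \<le> s' \<and> s' < t' \<and> t' \<le> s \<and> \<eta>' j \<in> borel_measurable (F s')"
        using H' unfolding is_simple_def by (auto simp: Suc_le_eq)
      then show ?thesis using 2 s by (auto intro: borel_measurable_uminus)
    next
      case 3
      have "s \<le> s'" "t' \<le> t" using gridpt_bounds[of s t j N] gridpt_bounds[of s t "Suc j" N] 3 s by auto
      moreover have "s' < t'" using 3 gridpt_strict_mono[OF s(2) \<open>0 < N\<close>, of j "Suc j"] by simp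
      moreover have "\<eta>'' \<in> borel_measurable (F s')" unfolding 3(2,4) by (intro borel_measurable_uminus gz 3)
      ultimately show ?thesis using s by auto
    qed
  next
    show "(\<lambda>w. 3 * ?A w + 3 * ?A' w + 3 * ?D w) \<in> borel_measurable M" by measurable
    show "0 < 9 * d" using d by simp
    show "0 < a" by fact
  qed (rule \<Phi>)
  also have "prob {w\<in>space M. 3 * ?A w + 3 * ?A' w + 3 * ?D w > ennreal (9 * d)} \<le>
    prob ({w\<in>space M. ?A w > ennreal d} \<union> {w\<in>space M. ?A' w > ennreal d} \<union> {w\<in>space M. ?D w > ennreal d})"
  proof (intro finite_measure_mono subsetI)
    fix w assume *: "w \<in> {w\<in>space M. 3 * ?A w + 3 * ?A' w + 3 * ?D w > ennreal (9 * d)}"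
    show "w \<in> {w\<in>space M. ?A w > ennreal d} \<union> {w\<in>space M. ?A' w > ennreal d} \<union> {w\<in>space M. ?D w > ennreal d}"
    proof (rule ccontr)
      assume "\<not> ?thesis"
      then have "?A w \<le> ennreal d" "?A' w \<le> ennreal d" "?D w \<le> ennreal d" using * by auto
      then have "3 * ?A w + 3 * ?A' w + 3 * ?D w \<le> 3 * ennreal d + 3 * ennreal d + 3 * ennreal d"
        by (intro add_mono mult_left_mono) auto
      also have "\<dots> = ennreal (9 * d)"
      proof -
        have h: "3 * ennreal d = ennreal (3 * d)" using d by (simp add: ennreal_mult)
        have "ennreal (3 * d) + ennreal (3 * d) + ennreal (3 * d) = ennreal (3 * d + 3 * d + 3 * d)"
          using d by (simp only: ennreal_plus[symmetric])
        also have "3 * d + 3 * d + 3 * d = 9 * d" by simp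
        finally show ?thesis unfolding h .
      qed
      finally show False using * by (simp add: not_less[symmetric])
    qed
  qed measurable
  also have "\<dots> \<le> prob {w\<in>space M. ?A w > ennreal d} + prob {w\<in>space M. ?A' w > ennreal d} + prob {w\<in>space M. ?D w > ennreal d}"
    by (intro order_trans[OF measure_Un_le] add_right_mono measure_Un_le) measurable
  finally show ?thesis unfolding int by simp
qed

lemma mart_combine: "w \<in> space M \<Longrightarrow> 0 \<le> s \<Longrightarrow> s \<le> t \<Longrightarrow> t \<le> r \<Longrightarrow> mart s t w + mart t r w = mart s r w"
  using drift_combine[of w s t r] by (simp add: mart_def)

text \<open>The definition of the Ito integral provides some approximating simple processes on
  \<open>[0, t]\<close> and some on \<open>[0, s]\<close>; comparison with the difference of both
  shows that the left-point sums on \<open>[s, t]\<close> have the right limit.\<close>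

lemma ito_sum_tendsto:
  assumes s: "0 \<le> s" "s < t"
  shows "(\<lambda>N. pdist (ito_sum s t (Suc N)) (mart s t)) \<longlonglongrightarrow> 0"
proof -
  have t0: "0 \<le> t" using s by simp
  obtain m \<tau> \<eta> where H: "\<forall>k. is_simple M F t (m k) (\<tau> k) (\<eta> k)"
    "\<forall>d>0. (\<lambda>k. prob {w\<in>space M. sq_err 0 t (m k) (\<tau> k) (\<eta> k) w > ennreal d}) \<longlonglongrightarrow> 0"
    "\<forall>a>0. (\<lambda>k. prob {w\<in>space M. \<bar>simple_int B (m k) (\<tau> k) (\<eta> k) w - mart 0 t w\<bar> > a}) \<longlonglongrightarrow> 0"
    using ito_at[OF t0] by (elim exE conjE) (rule that)
  note H = H[rule_format]
  obtain m' \<tau>' \<eta>' where H': "\<forall>k. is_simple M F s (m' k) (\<tau>' k) (\<eta>' k)"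
    "\<forall>d>0. (\<lambda>k. prob {w\<in>space M. sq_err 0 s (m' k) (\<tau>' k) (\<eta>' k) w > ennreal d}) \<longlonglongrightarrow> 0"
    "\<forall>a>0. (\<lambda>k. prob {w\<in>space M. \<bar>simple_int B (m' k) (\<tau>' k) (\<eta>' k) w - mart 0 s w\<bar> > a}) \<longlonglongrightarrow> 0"
    using ito_at[OF s(1)] by (elim exE conjE) (rule that)
  note H' = H'[rule_format]
  show ?thesis
  proof (rule LIMSEQ_I)
    fix e :: real assume e: "e > 0"
    \<comment> \<open>The budget: \<open>3 * a = e / 6\<close> for the distance and six
      probabilities or bounds of size \<open>e / 12\<close>, one of them being
      \<open>9 * d / a\<^sup>2\<close>; together less than \<open>e\<close>.\<close>
    define a where "a = e / 18"
    define d where "d = a\<^sup>2 * e / 108"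
    have ad: "0 < a" "0 < d" using e by (auto simp: a_def d_def)
    have e12: "0 < e / 12" using e by simp
    have "\<forall>\<^sub>F k in sequentially. prob {w\<in>space M. sq_err 0 t (m k) (\<tau> k) (\<eta> k) w > ennreal d} < e / 12 \<and>
      prob {w\<in>space M. sq_err 0 s (m' k) (\<tau>' k) (\<eta>' k) w > ennreal d} < e / 12 \<and>
      prob {w\<in>space M. \<bar>simple_int B (m k) (\<tau> k) (\<eta> k) w - mart 0 t w\<bar> > a} < e / 12 \<and>
      prob {w\<in>space M. \<bar>simple_int B (m' k) (\<tau>' k) (\<eta>' k) w - mart 0 s w\<bar> > a} < e / 12"
      using H(2,3) H'(2,3) ad e12 by (intro eventually_conj order_tendstoD(2)) auto
    then obtain k where k: "prob {w\<in>space M. sq_err 0 t (m k) (\<tau> k) (\<eta> k) w > ennreal d} < e / 12"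
      "prob {w\<in>space M. sq_err 0 s (m' k) (\<tau>' k) (\<eta>' k) w > ennreal d} < e / 12"
      "prob {w\<in>space M. \<bar>simple_int B (m k) (\<tau> k) (\<eta> k) w - mart 0 t w\<bar> > a} < e / 12"
      "prob {w\<in>space M. \<bar>simple_int B (m' k) (\<tau>' k) (\<eta>' k) w - mart 0 s w\<bar> > a} < e / 12"
      using eventually_happens'[OF sequentially_bot] by blast
    have "\<forall>\<^sub>F N in sequentially. prob {w\<in>space M. sq_err s t (Suc N) (gridpt s t (Suc N)) (\<lambda>j w. \<beta> (X (gridpt s t (Suc N) j) w)) w > ennreal d} < e / 12"
      using sq_err_grid_tendsto[OF s ad(2)] e12 by (rule order_tendstoD(2))
    then obtain N0 where N0: "\<And>N. N \<ge> N0 \<Longrightarrow> prob {w\<in>space M. sq_err s t (Suc N) (gridpt s t (Suc N)) (\<lambda>j w. \<beta> (X (gridpt s t (Suc N) j) w)) w > ennreal d} < e / 12"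
      by (auto simp: eventually_sequentially)
    show "\<exists>no. \<forall>n\<ge>no. norm (pdist (ito_sum s t (Suc n)) (mart s t) - 0) < e"
    proof (intro exI[of _ N0] allI impI)
      fix N assume N: "N \<ge> N0"
      let ?H = "simple_int B (m k) (\<tau> k) (\<eta> k)" and ?H' = "simple_int B (m' k) (\<tau>' k) (\<eta>' k)" and ?Z = "ito_sum s t (Suc N)"
      have [measurable]: "?H \<in> borel_measurable M" "?H' \<in> borel_measurable M" "?Z \<in> borel_measurable M"
         "mart s t \<in> borel_measurable M" "mart 0 s \<in> borel_measurable M" "mart 0 t \<in> borel_measurable M"
        using simple_int_measurable[OF H(1)] simple_int_measurable[OF H'(1)] s
        by (auto intro!: ito_sum_measurable mart_measurable_M)
      have da: "9 * d / a\<^sup>2 = e / 12" using ad by (simp add: d_def)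
      have 1: "prob {w\<in>space M. \<bar>?H w - ?H' w - ?Z w\<bar> > a} \<le> e / 12 + e / 12 + e / 12 + e / 12"
        using ito_sum_prob_le[OF s zero_less_Suc H(1)[of k] H'(1)[of k] ad, of N] N0[OF N] k unfolding da by linarith
      have "prob {w\<in>space M. \<bar>?Z w - mart s t w\<bar> > 3 * a} \<le>
        prob ({w\<in>space M. \<bar>?H w - ?H' w - ?Z w\<bar> > a} \<union> {w\<in>space M. \<bar>?H w - mart 0 t w\<bar> > a} \<union> {w\<in>space M. \<bar>?H' w - mart 0 s w\<bar> > a})"
      proof (intro finite_measure_mono subsetI)
        fix w assume *: "w \<in> {w\<in>space M. \<bar>?Z w - mart s t w\<bar> > 3 * a}"
        then have "mart s t w = mart 0 t w - mart 0 s w" using mart_combine[of w 0 s t] s by simp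
        with * show "w \<in> {w\<in>space M. \<bar>?H w - ?H' w - ?Z w\<bar> > a} \<union> {w\<in>space M. \<bar>?H w - mart 0 t w\<bar> > a} \<union> {w\<in>space M. \<bar>?H' w - mart 0 s w\<bar> > a}"
          by (simp; linarith)
      qed measurable
      also have "\<dots> \<le> prob {w\<in>space M. \<bar>?H w - ?H' w - ?Z w\<bar> > a} + prob {w\<in>space M. \<bar>?H w - mart 0 t w\<bar> > a} + prob {w\<in>space M. \<bar>?H' w - mart 0 s w\<bar> > a}"
        by (intro order_trans[OF measure_Un_le] add_right_mono measure_Un_le) measurable
      finally have "prob {w\<in>space M. \<bar>?Z w - mart s t w\<bar> > 3 * a} \<le> e / 2" using 1 k by linarith
      moreover have "pdist ?Z (mart s t) \<le> 3 * a + prob {w\<in>space M. \<bar>?Z w - mart s t w\<bar> > 3 * a}"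
        using ad by (intro pdist_le_prob) auto
      ultimately show "norm (pdist ?Z (mart s t) - 0) < e" using e by (simp add: a_def)
    qed
  qed
qed

end

section \<open>Integration over events of the past\<close>

context prob_space
begin

text \<open>An unnormalised conditional expectation: its values for all \<open>G\<close> in
  \<open>F s\<close> determine the conditional expectation given \<open>F s\<close>. As the
  filtration increases, bounds at successive times can be chained with the same event.\<close>

abbreviation EG :: "'a set \<Rightarrow> ('a \<Rightarrow> real) \<Rightarrow> real" where
  "EG G V \<equiv> expectation (\<lambda>w. indicator G w * V w)"

abbreviation integrable_on_event :: "'a set \<Rightarrow> ('a \<Rightarrow> real) \<Rightarrow> bool" where
  "integrable_on_event G V \<equiv> integrable M (\<lambda>w. indicator G w * V w)"

lemma EG_dominated:
  assumes [measurable]: "V \<in> borel_measurable M" "G \<in> sets M"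
    and V: "\<And>w. w \<in> space M \<Longrightarrow> 0 \<le> V w" "\<And>w. w \<in> space M \<Longrightarrow> V w \<le> W w"
    and W: "integrable_on_event G W"
  shows "integrable_on_event G V" "EG G V \<le> EG G W"
proof -
  show 1: "integrable_on_event G V"
  proof (rule Bochner_Integration.integrable_bound[OF W])
    show "AE w in M. norm (indicator G w * V w) \<le> norm (indicator G w * W w)"
      using V by (intro AE_I2) (force simp: indicator_def)
  qed measurable
  show "EG G V \<le> EG G W"
    using V by (intro integral_mono[OF 1 W] mult_left_mono) auto
qed

lemma EG_linear:
  assumes "integrable_on_event G V" "integrable_on_event G W"
  shows "integrable_on_event G (\<lambda>w. a * V w + b * W w)" "EG G (\<lambda>w. a * V w + b * W w) = a * EG G V + b * EG G W"
proof -
  have eq: "indicator G w * (a * V w + b * W w) = a * (indicator G w * V w) + b * (indicator G w * W w)" for w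
    by (simp add: algebra_simps)
  show "integrable_on_event G (\<lambda>w. a * V w + b * W w)" "EG G (\<lambda>w. a * V w + b * W w) = a * EG G V + b * EG G W"
    unfolding eq using assms by simp_all
qed

lemma EG_cmult:
  assumes "integrable_on_event G V"
  shows "integrable_on_event G (\<lambda>w. a * V w)" "EG G (\<lambda>w. a * V w) = a * EG G V"
  using EG_linear[OF assms assms, of a 0] by simp_all

lemma integrable_imp_on_event:
  assumes "integrable M (V :: 'a \<Rightarrow> real)" "G \<in> sets M" shows "integrable_on_event G V"
  using integrable_mult_indicator[OF assms(2,1)] by simp

lemma EG_le_expectation:
  assumes "integrable M V" "G \<in> sets M" "\<And>w. 0 \<le> V w" shows "EG G V \<le> expectation V"
  using assms integrable_imp_on_event[OF assms(1,2)] by (intro integral_mono) (auto simp: indicator_def)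

end

context brownian_filtration
begin

lemma cond_exp_subalgebra: "0 \<le> s \<Longrightarrow> sigma_finite_subalgebra M (F s)"
  by (rule finite_measure_subalgebra_is_sigma_finite)
     (unfold_locales, rule subalg)

text \<open>Vanishing integrals over all events of \<open>F s\<close> mean that \<open>V\<close> has
  conditional expectation 0, and an \<open>F s\<close>-measurable factor can be pulled out. Square
  integrability of both factors makes the product integrable.\<close>

lemma orthogonalI:
  assumes s: "0 \<le> s" and U: "U \<in> borel_measurable (F s)" and U2: "integrable M (\<lambda>w. (U w)\<^sup>2)"
    and V[measurable]: "V \<in> borel_measurable M" and V2: "integrable M (\<lambda>w. (V w)\<^sup>2)"
    and 0: "\<And>G. G \<in> sets (F s) \<Longrightarrow> EG G V = 0"
  shows "integrable M (\<lambda>w. U w * V w :: real)" "expectation (\<lambda>w. U w * V w) = 0"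
proof -
  interpret sf: sigma_finite_subalgebra M "F s" by (rule cond_exp_subalgebra[OF s])
  have Um[measurable]: "U \<in> borel_measurable M" using M_measurable[OF s U] .
  show i: "integrable M (\<lambda>w. U w * V w)"
  proof (rule Bochner_Integration.integrable_bound[OF Bochner_Integration.integrable_add[OF U2 V2]])
    show "AE w in M. norm (U w * V w) \<le> norm ((U w)\<^sup>2 + (V w)\<^sup>2)"
      using power_mult_power_le_sum[OF abs_ge_zero abs_ge_zero, of 1 2] by (intro AE_I2) (auto simp: abs_mult)
  qed measurable
  have m1: "integrable M V" using V V2 by (rule square_integrable_imp_integrable)
  have "AE w in M. real_cond_exp M (F s) V w = 0"
    using 0 m1 by (intro sf.real_cond_exp_charact) (auto simp: set_lebesgue_integral_def)
  then have "expectation (\<lambda>w. U w * real_cond_exp M (F s) V w) = expectation (\<lambda>w. 0)"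
    by (intro integral_cong_AE) (auto intro: measurable_from_subalg[OF subalg[OF s] borel_measurable_cond_exp])
  then show "expectation (\<lambda>w. U w * V w) = 0"
    using sf.real_cond_exp_intg(2)[OF i U V] by simp
qed

end

section \<open>Moments of the martingale part and of the solution\<close>

context stationary_diffusion
begin

text \<open>As \<open>y\<close> and the event are known at time \<open>s\<close>,
  \<open>y * (B t - B s)\<close> is a stochastic sum over the same grid and the indicator can be
  moved into the weights. With \<open>y = 0\<close> this gives plain moments, with
  \<open>y = \<beta>(X s)\<close> the local error.\<close>

lemma ito_sum_shift_moment:
  assumes s: "0 \<le> s" "s < t" and G: "G \<in> sets (F s)" and k: "0 < k" and y: "y \<in> borel_measurable (F s)"
    and i: "\<And>u. s \<le> u \<Longrightarrow> u \<le> t \<Longrightarrow> integrable_on_event G (\<lambda>w. (\<beta> (X u w) - y w) ^ (2 * k))"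
    and c: "\<And>u. s \<le> u \<Longrightarrow> u \<le> t \<Longrightarrow> EG G (\<lambda>w. (\<beta> (X u w) - y w) ^ (2 * k)) \<le> c"
  shows "integrable_on_event G (\<lambda>w. (ito_sum s t (Suc N) w - y w * (B t w - B s w)) ^ (2 * k))"
    "EG G (\<lambda>w. (ito_sum s t (Suc N) w - y w * (B t w - B s w)) ^ (2 * k)) \<le> moment_const k * (t - s) ^ k * c"
proof -
  define h where "h = (t - s) / real (Suc N)"
  have h: "0 < h" using s by (simp add: h_def)
  define v where "v j w = indicator G w * (\<beta> (X (s + real j * h) w) - y w)" for j w
  have gb: "s \<le> s + real j * h" "s + real j * h \<le> t" if "j < Suc N" for j
    using gridpt_bounds[of s t j "Suc N"] that s by (auto simp: h_def)
  have k2: "2 * k \<noteq> 0" using k by simp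
  have ip: "(indicator G w * x) ^ (2 * k) = indicator G w * x ^ (2 * k)" for w and x :: real
    using k2 by (cases "w \<in> G") (auto simp: power_0_left)
  have vm: "v j \<in> borel_measurable (F (s + real j * h))" if "j < Suc N" for j
  proof -
    have "G \<in> sets (F (s + real j * h))" using F_sets[OF s(1) gb(1)[OF that] G] .
    moreover have "(\<lambda>w. \<beta> (X (s + real j * h) w)) \<in> borel_measurable (F (s + real j * h))"
      using gb[OF that] s by (intro fX_adapted \<beta>_cont) auto
    moreover have "y \<in> borel_measurable (F (s + real j * h))" using F_measurable[OF s(1) gb(1)[OF that] y] .
    ultimately show ?thesis unfolding v_def[abs_def] by measurable
  qed
  have tel: "(\<Sum>j<n. B (s + real (Suc j) * h) w - B (s + real j * h) w) = B (s + real n * h) w - B s w" for n w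
    by (induction n) auto
  have end_eq: "s + real (Suc N) * h = t" by (simp add: h_def del: of_nat_Suc)
  have eq: "(\<Sum>j<Suc N. v j w * (B (s + real (Suc j) * h) w - B (s + real j * h) w)) ^ (2 * k) =
     indicator G w * (ito_sum s t (Suc N) w - y w * (B t w - B s w)) ^ (2 * k)" for w
  proof -
    have "(\<Sum>j<Suc N. v j w * (B (s + real (Suc j) * h) w - B (s + real j * h) w)) =
      indicator G w * ((\<Sum>j<Suc N. \<beta> (X (s + real j * h) w) * (B (s + real (Suc j) * h) w - B (s + real j * h) w)) - y w * (\<Sum>j<Suc N. B (s + real (Suc j) * h) w - B (s + real j * h) w))"
      unfolding v_def sum_distrib_left sum_subtractf[symmetric] by (intro sum.cong refl) (simp only: algebra_simps)
    also have "\<dots> = indicator G w * (ito_sum s t (Suc N) w - y w * (B t w - B s w))"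
      unfolding tel end_eq ito_sum_def h_def[symmetric] ..
    finally show ?thesis by (simp only: ip)
  qed
  have vi: "integrable M (\<lambda>w. v j w ^ (2 * k))" "expectation (\<lambda>w. v j w ^ (2 * k)) \<le> c" if "j < Suc N" for j
    unfolding v_def ip using i c gb[OF that] by auto
  have N0: "0 < Suc N" by simp
  have Nh: "real (Suc N) * h = t - s" by (simp add: h_def del: of_nat_Suc)
  note * = stochastic_sum_moment[OF s(1) h N0 k vm vi, unfolded eq Nh]
  show "integrable_on_event G (\<lambda>w. (ito_sum s t (Suc N) w - y w * (B t w - B s w)) ^ (2 * k))"
    "EG G (\<lambda>w. (ito_sum s t (Suc N) w - y w * (B t w - B s w)) ^ (2 * k)) \<le> moment_const k * (t - s) ^ k * c"
    using * by blast+
qed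

text \<open>The bound for the sums does not depend on \<open>N\<close>, so Fatou's lemma carries it
  over to the martingale part.\<close>

lemma mart_shift_moment:
  assumes s: "0 \<le> s" "s < t" and G: "G \<in> sets (F s)" and k: "0 < k" and y: "y \<in> borel_measurable (F s)"
    and i: "\<And>u. s \<le> u \<Longrightarrow> u \<le> t \<Longrightarrow> integrable_on_event G (\<lambda>w. (\<beta> (X u w) - y w) ^ (2 * k))"
    and c: "\<And>u. s \<le> u \<Longrightarrow> u \<le> t \<Longrightarrow> EG G (\<lambda>w. (\<beta> (X u w) - y w) ^ (2 * k)) \<le> c"
  shows "integrable_on_event G (\<lambda>w. (mart s t w - y w * (B t w - B s w)) ^ (2 * k))"
    "EG G (\<lambda>w. (mart s t w - y w * (B t w - B s w)) ^ (2 * k)) \<le> moment_const k * (t - s) ^ k * c"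
proof -
  let ?Z = "\<lambda>N w. ito_sum s t (Suc N) w - y w * (B t w - B s w)"
  let ?Y = "\<lambda>w. mart s t w - y w * (B t w - B s w)"
  have st: "s \<le> t" "0 \<le> t" using s by auto
  have [measurable]: "y \<in> borel_measurable M" "B t \<in> borel_measurable M" "B s \<in> borel_measurable M"
    using M_measurable[OF s(1) y] s by auto
  have Zm: "?Z N \<in> borel_measurable M" for N using ito_sum_measurable[OF s(1) st(1), of "Suc N"] by measurable
  have Ym: "?Y \<in> borel_measurable M" using mart_measurable_M[OF s(1) st(1)] by measurable
  have p: "(\<lambda>N. pdist (?Z N) ?Y) \<longlonglongrightarrow> 0" using ito_sum_tendsto[OF s] by (simp add: pdist_def)
  note Z = ito_sum_shift_moment[OF s G k y i c]
  have cont: "continuous_on UNIV (\<lambda>x::real. x ^ (2 * k))" by (intro continuous_intros)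
  have "\<And>x::real. 0 \<le> x ^ (2 * k)" by simp
  from pdist_integral_le[OF Zm Ym p cont this M_sets[OF s(1) G] Z(1) always_eventually[OF allI[OF Z(2)]]]
  show "integrable_on_event G (\<lambda>w. (mart s t w - y w * (B t w - B s w)) ^ (2 * k))"
    "EG G (\<lambda>w. (mart s t w - y w * (B t w - B s w)) ^ (2 * k)) \<le> moment_const k * (t - s) ^ k * c" by blast+
qed

lemma \<beta>_power_bound:
  assumes "x \<in> S" shows "\<beta> x ^ (2 * k) \<le> CG ^ (2 * k) * wt (2 * k) x" "\<alpha> x ^ (2 * k) \<le> CG ^ (2 * k) * wt (2 * k) x"
proof -
  have "\<bar>\<beta> x\<bar> ^ (2 * k) \<le> (CG * (1 + \<bar>x\<bar>)) ^ (2 * k)" "\<bar>\<alpha> x\<bar> ^ (2 * k) \<le> (CG * (1 + \<bar>x\<bar>)) ^ (2 * k)"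
    using assms by (auto intro!: power_mono \<beta>_growth \<alpha>_growth)
  then show "\<beta> x ^ (2 * k) \<le> CG ^ (2 * k) * wt (2 * k) x" "\<alpha> x ^ (2 * k) \<le> CG ^ (2 * k) * wt (2 * k) x"
    by (simp_all add: power_even_abs power_mult_distrib)
qed

lemma coeff_power_EG:
  assumes u: "0 \<le> u" and G: "G \<in> sets M" and c: "EG G (\<lambda>w. wt (2 * k) (X u w)) \<le> c"
  shows "integrable_on_event G (\<lambda>w. \<beta> (X u w) ^ (2 * k))" "EG G (\<lambda>w. \<beta> (X u w) ^ (2 * k)) \<le> CG ^ (2 * k) * c"
    "integrable_on_event G (\<lambda>w. \<alpha> (X u w) ^ (2 * k))" "EG G (\<lambda>w. \<alpha> (X u w) ^ (2 * k)) \<le> CG ^ (2 * k) * c"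
proof -
  note w = EG_cmult[OF wt_integrable_on[OF u G, of "2 * k"], of "CG ^ (2 * k)"]
  have [measurable]: "(\<lambda>w. \<beta> (X u w)) \<in> borel_measurable M" "(\<lambda>w. \<alpha> (X u w)) \<in> borel_measurable M"
    using u by (auto intro!: fX_measurable \<alpha>_cont \<beta>_cont)
  have cc: "CG ^ (2 * k) * EG G (\<lambda>w. wt (2 * k) (X u w)) \<le> CG ^ (2 * k) * c" using c by (intro mult_left_mono) auto
  have b: "integrable_on_event G (\<lambda>w. \<beta> (X u w) ^ (2 * k))" "EG G (\<lambda>w. \<beta> (X u w) ^ (2 * k)) \<le> EG G (\<lambda>w. CG ^ (2 * k) * wt (2 * k) (X u w))"
    by (rule EG_dominated[OF _ G _ _ w(1)]; use u X_S \<beta>_power_bound in \<open>simp; fail\<close>)+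
  have a: "integrable_on_event G (\<lambda>w. \<alpha> (X u w) ^ (2 * k))" "EG G (\<lambda>w. \<alpha> (X u w) ^ (2 * k)) \<le> EG G (\<lambda>w. CG ^ (2 * k) * wt (2 * k) (X u w))"
    by (rule EG_dominated[OF _ G _ _ w(1)]; use u X_S \<beta>_power_bound in \<open>simp; fail\<close>)+
  show "integrable_on_event G (\<lambda>w. \<beta> (X u w) ^ (2 * k))" "EG G (\<lambda>w. \<beta> (X u w) ^ (2 * k)) \<le> CG ^ (2 * k) * c"
    "integrable_on_event G (\<lambda>w. \<alpha> (X u w) ^ (2 * k))" "EG G (\<lambda>w. \<alpha> (X u w) ^ (2 * k)) \<le> CG ^ (2 * k) * c"
    using a b cc unfolding w(2) by linarith+
qed

lemma mart_moment:
  assumes s: "0 \<le> s" "s < t" and G: "G \<in> sets (F s)" and k: "0 < k"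
    and c: "\<And>u. s \<le> u \<Longrightarrow> u \<le> t \<Longrightarrow> EG G (\<lambda>w. wt (2 * k) (X u w)) \<le> c"
  shows "integrable_on_event G (\<lambda>w. mart s t w ^ (2 * k))"
    "EG G (\<lambda>w. mart s t w ^ (2 * k)) \<le> moment_const k * (t - s) ^ k * (CG ^ (2 * k) * c)"
proof -
  have "integrable_on_event G (\<lambda>w. (\<beta> (X u w) - 0) ^ (2 * k))" "EG G (\<lambda>w. (\<beta> (X u w) - 0) ^ (2 * k)) \<le> CG ^ (2 * k) * c"
    if "s \<le> u" "u \<le> t" for u
    using coeff_power_EG(1,2)[OF order_trans[OF s(1) that(1)] M_sets[OF s(1) G] c[OF that]] by simp_all
  from mart_shift_moment[OF s G k _ this]
  show "integrable_on_event G (\<lambda>w. mart s t w ^ (2 * k))"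
    "EG G (\<lambda>w. mart s t w ^ (2 * k)) \<le> moment_const k * (t - s) ^ k * (CG ^ (2 * k) * c)" by simp_all
qed

lemma mart_square_integrable:
  assumes s: "0 \<le> s" "s < t"
  shows "integrable M (\<lambda>w. (mart s t w)\<^sup>2)"
proof -
  have "integrable_on_event (space M) (\<lambda>w. mart s t w ^ (2 * 1))"
  proof (rule mart_moment(1)[OF s])
    show "space M \<in> sets (F s)" using sets.top[of "F s"] space_F[OF s(1)] by simp
    fix u assume "s \<le> u" "u \<le> t"
    then show "EG (space M) (\<lambda>w. wt (2 * 1) (X u w)) \<le> expectation (\<lambda>w. wt 2 (X 0 w))"
      using X_integral_law(2)[of u "wt 2"] s by (simp cong: Bochner_Integration.integral_cong)
  qed simp
  then show ?thesis by (rule Bochner_Integration.integrable_cong[OF refl, THEN iffD1, rotated]) simp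
qed

text \<open>The left-point sums have mean 0 on every event of \<open>F s\<close>. They are bounded
  in \<open>L2\<close>, so the mean passes to the limit in \<open>L1\<close>.\<close>

lemma mart_mean:
  assumes s: "0 \<le> s" "s < t" and G: "G \<in> sets (F s)"
  shows "EG G (mart s t) = 0"
proof -
  have st: "s \<le> t" using s by simp
  let ?c = "expectation (\<lambda>w. wt 2 (X 0 w))"
  have sp: "space M \<in> sets (F s)" using sets.top[of "F s"] space_F[OF s(1)] by simp
  have w: "EG (space M) (\<lambda>w. wt (2 * 1) (X u w)) \<le> ?c" if "s \<le> u" "u \<le> t" for u
    using X_integral_law(2)[of u "wt 2"] s that by (simp cong: Bochner_Integration.integral_cong)
  have b: "integrable_on_event (space M) (\<lambda>w. (\<beta> (X u w) - 0) ^ (2 * 1))" "EG (space M) (\<lambda>w. (\<beta> (X u w) - 0) ^ (2 * 1)) \<le> CG ^ (2 * 1) * ?c"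
    if "s \<le> u" "u \<le> t" for u
    using coeff_power_EG(1,2)[OF order_trans[OF s(1) that(1)] sets.top w[OF that]] by simp_all
  have Z2: "integrable_on_event (space M) (\<lambda>w. ito_sum s t (Suc N) w ^ 2)"
    "EG (space M) (\<lambda>w. ito_sum s t (Suc N) w ^ 2) \<le> moment_const 1 * (t - s) ^ 1 * (CG ^ (2 * 1) * ?c)" for N
    using ito_sum_shift_moment[OF s sp _ _ b, where N = N] by simp_all
  have sq: "integrable M (\<lambda>w. ito_sum s t (Suc N) w ^ 2)" for N
    using Z2(1)[of N] by (rule Bochner_Integration.integrable_cong[OF refl, THEN iffD1, rotated]) simp
  have sqb: "expectation (\<lambda>w. ito_sum s t (Suc N) w ^ 2) \<le> moment_const 1 * (t - s) ^ 1 * (CG ^ (2 * 1) * ?c)" for N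
  proof -
    have "expectation (\<lambda>w. ito_sum s t (Suc N) w ^ 2) = EG (space M) (\<lambda>w. ito_sum s t (Suc N) w ^ 2)"
      by (rule Bochner_Integration.integral_cong) auto
    then show ?thesis using Z2(2)[of N] by simp
  qed
  note L1 = pdist_L2_bounded_tendsto_L1[OF ito_sum_measurable[OF s(1) st] mart_measurable_M[OF s(1) st] ito_sum_tendsto[OF s] sq sqb]
  have GM: "G \<in> sets M" using M_sets[OF s(1) G] .
  have Z0: "EG G (ito_sum s t (Suc N)) = 0" for N
  proof -
    let ?e = "gridpt s t (Suc N)"
    have gb: "s \<le> ?e j" "?e j \<le> t" if "j < Suc N" for j
      using gridpt_bounds[of s t j "Suc N"] that s by auto
    have e0: "0 \<le> ?e 0" using s by simp
    have mono: "?e i < ?e (Suc i)" for i using gridpt_strict_mono[OF s(2), of "Suc N" i "Suc i"] by simp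
    have m: "(\<lambda>w. indicator G w * \<beta> (X (?e i) w)) \<in> borel_measurable (F (?e i))" if "i < Suc N" for i
    proof -
      have "G \<in> sets (F (?e i))" using F_sets[OF s(1) gb(1)[OF that] G] .
      moreover have "(\<lambda>w. \<beta> (X (?e i) w)) \<in> borel_measurable (F (?e i))" using gb[OF that] s by (intro fX_adapted \<beta>_cont) auto
      ultimately show ?thesis by measurable
    qed
    have int: "integrable M (\<lambda>w. indicator G w * \<beta> (X (?e i) w))" if "i < Suc N" for i
    proof (rule integrable_imp_on_event[OF _ GM])
      have m: "(\<lambda>w. \<beta> (X (?e i) w)) \<in> borel_measurable M" using gb[OF that] s by (intro fX_measurable \<beta>_cont) auto
      have "integrable M (\<lambda>w. (\<beta> (X (?e i) w))\<^sup>2)"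
        using b(1)[OF gb[OF that]] by (rule Bochner_Integration.integrable_cong[OF refl, THEN iffD1, rotated]) simp
      then show "integrable M (\<lambda>w. \<beta> (X (?e i) w))" by (rule square_integrable_imp_integrable[OF m])
    qed
    have "expectation (\<lambda>w. \<Sum>i<Suc N. indicator G w * \<beta> (X (?e i) w) * (B (?e (Suc i)) w - B (?e i) w)) = 0"
      by (rule stochastic_sum_mean(2)[OF e0 mono m int])
    then show ?thesis unfolding ito_sum_def by (simp only: sum_distrib_left mult.assoc)
  qed
  have iG: "integrable_on_event G (mart s t)" using L1(4) GM by (rule integrable_imp_on_event)
  have "\<bar>EG G (mart s t)\<bar> \<le> expectation (\<lambda>w. \<bar>ito_sum s t (Suc N) w - mart s t w\<bar>)" for N
  proof -
    have iZ: "integrable_on_event G (ito_sum s t (Suc N))" using L1(3) GM by (intro integrable_imp_on_event) auto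
    have "EG G (mart s t) = expectation (\<lambda>w. indicator G w * mart s t w - indicator G w * ito_sum s t (Suc N) w)"
      using iG iZ Z0[of N] by simp
    then have "\<bar>EG G (mart s t)\<bar> = \<bar>expectation (\<lambda>w. indicator G w * mart s t w - indicator G w * ito_sum s t (Suc N) w)\<bar>"
      by (rule arg_cong)
    also have "\<dots> \<le> expectation (\<lambda>w. \<bar>indicator G w * mart s t w - indicator G w * ito_sum s t (Suc N) w\<bar>)"
      by (rule integral_abs_bound)
    also have "\<dots> \<le> expectation (\<lambda>w. \<bar>ito_sum s t (Suc N) w - mart s t w\<bar>)"
    proof (rule integral_mono)
      show "integrable M (\<lambda>w. \<bar>indicator G w * mart s t w - indicator G w * ito_sum s t (Suc N) w\<bar>)"
        by (intro integrable_abs Bochner_Integration.integrable_diff iG iZ)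
      show "integrable M (\<lambda>w. \<bar>ito_sum s t (Suc N) w - mart s t w\<bar>)"
        by (intro integrable_abs Bochner_Integration.integrable_diff L1(3,4))
      show "\<bar>indicator G w * mart s t w - indicator G w * ito_sum s t (Suc N) w\<bar> \<le> \<bar>ito_sum s t (Suc N) w - mart s t w\<bar>" for w
        by (simp add: indicator_def abs_minus_commute)
    qed
    finally show ?thesis .
  qed
  then have "\<bar>EG G (mart s t)\<bar> \<le> 0" by (intro LIMSEQ_le_const[OF L1(5)]) auto
  then show ?thesis by simp
qed

lemma mart_orthogonal:
  assumes s: "0 \<le> s" "s < t" and U: "U \<in> borel_measurable (F s)" and U2: "integrable M (\<lambda>w. (U w)\<^sup>2)"
  shows "integrable M (\<lambda>w. U w * mart s t w)" "expectation (\<lambda>w. U w * mart s t w) = 0"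
  using s by (intro orthogonalI[OF s(1) U U2 _ mart_square_integrable[OF s] mart_mean[OF s]] mart_measurable_M; simp)+

lemma indicator_wt_bound:
  assumes "0 \<le> u" "G \<in> sets M"
  shows "EG G (\<lambda>w. wt k (X u w)) \<le> expectation (\<lambda>w. wt k (X 0 w))"
  using EG_le_expectation[OF wt_integrable[OF assms(1)] assms(2), of k] X_integral_law(2)[OF assms(1), of "wt k"] by simp

lemma EG_wt_nonneg: "0 \<le> EG G (\<lambda>w. wt k (X u w))"
  by (intro Bochner_Integration.integral_nonneg) simp

lemma EG_wt_mono:
  assumes "0 \<le> u" "G \<in> sets M" "p \<le> q"
  shows "EG G (\<lambda>w. wt p (X u w)) \<le> EG G (\<lambda>w. wt q (X u w))"
  using assms by (intro integral_mono wt_integrable_on mult_left_mono wt_mono) auto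

text \<open>Stationarity makes all moments of \<open>X\<close> finite in advance; for powers of
  increments only the size of the conditional moments remains to be found.\<close>

lemma increment_power_integrable:
  assumes "0 \<le> s" "0 \<le> t"
  shows "integrable M (\<lambda>w. (X t w - X s w) ^ (2 * k))"
proof -
  have [measurable]: "X t \<in> borel_measurable M" "X s \<in> borel_measurable M" using assms by auto
  show ?thesis
  proof (rule Bochner_Integration.integrable_bound)
    show "integrable M (\<lambda>w. 2 ^ (2 * k) * (wt (2 * k) (X t w) + wt (2 * k) (X s w)))"
      using assms by (intro integrable_mult_right Bochner_Integration.integrable_add wt_integrable)
    show "AE w in M. norm ((X t w - X s w) ^ (2 * k)) \<le> norm (2 ^ (2 * k) * (wt (2 * k) (X t w) + wt (2 * k) (X s w)))"
    proof (rule AE_I2)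
      fix w
      have "(X t w + (- X s w)) ^ (2 * k) \<le> 2 ^ (2 * k) * (X t w ^ (2 * k) + (- X s w) ^ (2 * k))"
        by (rule power_even_add_le)
      also have "\<dots> = 2 ^ (2 * k) * (\<bar>X t w\<bar> ^ (2 * k) + \<bar>X s w\<bar> ^ (2 * k))" by (simp add: power_even_abs)
      also have "\<dots> \<le> 2 ^ (2 * k) * (wt (2 * k) (X t w) + wt (2 * k) (X s w))"
        by (intro mult_left_mono add_mono power_mono) auto
      finally show "norm ((X t w - X s w) ^ (2 * k)) \<le> norm (2 ^ (2 * k) * (wt (2 * k) (X t w) + wt (2 * k) (X s w)))"
        by simp
    qed
  qed measurable
qed

lemma drift_moment:
  assumes s: "0 \<le> s" "s < t" and G: "G \<in> sets M"
    and c: "\<And>u. s \<le> u \<Longrightarrow> u \<le> t \<Longrightarrow> EG G (\<lambda>w. wt (2 * k) (X u w)) \<le> c"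
  shows "integrable_on_event G (\<lambda>w. drift s t w ^ (2 * k))"
    "EG G (\<lambda>w. drift s t w ^ (2 * k)) \<le> (t - s) ^ (2 * k) * (CG ^ (2 * k) * c)"
proof -
  have m: "(\<lambda>w. \<alpha> (X u w)) \<in> borel_measurable M" if "s \<le> u" "u \<le> t" for u
    using that s by (intro fX_measurable \<alpha>_cont) auto
  have cc: "continuous_on {s..t} (\<lambda>u. \<alpha> (X u w))" if "w \<in> space M" for w
    using that s by (intro fX_cont_on \<alpha>_cont) auto
  have i: "integrable_on_event G (\<lambda>w. \<alpha> (X u w) ^ (2 * k))" "EG G (\<lambda>w. \<alpha> (X u w) ^ (2 * k)) \<le> CG ^ (2 * k) * c"
    if "s \<le> u" "u \<le> t" for u
    using coeff_power_EG(3,4)[OF order_trans[OF s(1) that(1)] G c[OF that]] by blast+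
  have *: "integrable_on_event G (\<lambda>w. (integral {s..t} (\<lambda>u. \<alpha> (X u w)) / (t - s)) ^ (2 * k))"
    "EG G (\<lambda>w. (integral {s..t} (\<lambda>u. \<alpha> (X u w)) / (t - s)) ^ (2 * k)) \<le> CG ^ (2 * k) * c"
    by (rule integral_mean_moment[OF s m cc G i]; assumption)+
  have eq: "drift s t w ^ (2 * k) = (t - s) ^ (2 * k) * (integral {s..t} (\<lambda>u. \<alpha> (X u w)) / (t - s)) ^ (2 * k)" for w
    unfolding power_mult_distrib[symmetric] using s by (simp add: drift_def)
  show "integrable_on_event G (\<lambda>w. drift s t w ^ (2 * k))" unfolding eq by (rule EG_cmult(1)[OF *(1)])
  show "EG G (\<lambda>w. drift s t w ^ (2 * k)) \<le> (t - s) ^ (2 * k) * (CG ^ (2 * k) * c)"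
    unfolding eq EG_cmult(2)[OF *(1)] using *(2) by (intro mult_left_mono) auto
qed

text \<open>From a provisional bound \<open>c\<close> on the weights during \<open>[s, t]\<close> to
  a bound on the increment; the result is fed back to improve \<open>c\<close>.\<close>

lemma increment_moment_step:
  assumes s: "0 \<le> s" "s \<le> t" and G: "G \<in> sets (F s)" and k: "0 < k"
    and c: "\<And>u. s \<le> u \<Longrightarrow> u \<le> t \<Longrightarrow> EG G (\<lambda>w. wt (2 * k) (X u w)) \<le> c"
  shows "EG G (\<lambda>w. (X t w - X s w) ^ (2 * k)) \<le> 2 ^ (2 * k) * CG ^ (2 * k) * ((t - s) ^ k + moment_const k) * (t - s) ^ k * c"
proof (cases "s = t")
  case True then show ?thesis using k by (simp add: power_0_left)
next
  case False
  then have st: "s < t" using s by simp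
  have GM: "G \<in> sets M" using M_sets[OF s(1) G] .
  note d = drift_moment[OF s(1) st GM c] and m = mart_moment[OF s(1) st G k c]
  have "EG G (\<lambda>w. (X t w - X s w) ^ (2 * k)) \<le> EG G (\<lambda>w. 2 ^ (2 * k) * drift s t w ^ (2 * k) + 2 ^ (2 * k) * mart s t w ^ (2 * k))"
  proof (rule integral_mono)
    show "integrable_on_event G (\<lambda>w. (X t w - X s w) ^ (2 * k))"
      using s by (intro integrable_imp_on_event increment_power_integrable GM) auto
    show "integrable_on_event G (\<lambda>w. 2 ^ (2 * k) * drift s t w ^ (2 * k) + 2 ^ (2 * k) * mart s t w ^ (2 * k))"
      by (rule EG_linear(1)[OF d(1) m(1)])
    fix w
    have "X t w - X s w = drift s t w + mart s t w" by (simp add: mart_def)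
    then show "indicator G w * (X t w - X s w) ^ (2 * k) \<le> indicator G w * (2 ^ (2 * k) * drift s t w ^ (2 * k) + 2 ^ (2 * k) * mart s t w ^ (2 * k))"
      using power_even_add_le[of "drift s t w" "mart s t w" k] by (intro mult_left_mono) (auto simp: distrib_left)
  qed
  also have "\<dots> = 2 ^ (2 * k) * EG G (\<lambda>w. drift s t w ^ (2 * k)) + 2 ^ (2 * k) * EG G (\<lambda>w. mart s t w ^ (2 * k))"
    by (rule EG_linear(2)[OF d(1) m(1)])
  also have "\<dots> \<le> 2 ^ (2 * k) * ((t - s) ^ (2 * k) * (CG ^ (2 * k) * c)) + 2 ^ (2 * k) * (moment_const k * (t - s) ^ k * (CG ^ (2 * k) * c))"
    using d(2) m(2) by (intro add_mono mult_left_mono) auto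
  also have "(t - s) ^ (2 * k) = (t - s) ^ k * (t - s) ^ k" by (simp add: mult_2 power_add)
  finally show ?thesis by (simp add: algebra_simps)
qed

lemma moment_const_pos: "0 < moment_const k" by (simp add: moment_const_def)

text \<open>A substitute for Gronwall's inequality that works at each time separately. On a short
  interval, the bound \<open>A + m / 2 ^ n\<close> for the weighted moment implies
  \<open>A + m / 2 ^ (n + 1)\<close>; the iteration starts from the unconditional moment
  \<open>m\<close>, which stationarity makes the same at all times.\<close>

lemma wt_moment_short:
  assumes k: "0 < k"
  obtains T where "T > 0" "\<And>s u G. 0 \<le> s \<Longrightarrow> s \<le> u \<Longrightarrow> u \<le> s + T \<Longrightarrow> G \<in> sets (F s) \<Longrightarrow>
    EG G (\<lambda>w. wt (2 * k) (X u w)) \<le> 2 * 2 ^ (2 * k) * EG G (\<lambda>w. wt (2 * k) (X s w))"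
proof -
  define K where "K = 2 ^ (2 * k) * (2 ^ (2 * k) * CG ^ (2 * k) * (1 + moment_const k))"
  have K: "0 \<le> K" unfolding K_def using CG moment_const_pos[of k] by (intro mult_nonneg_nonneg) auto
  \<comment> \<open>Small enough for \<open>K * T \<le> 1 / 2\<close>, which halves the excess in
    each round.\<close>
  define T where "T = 1 / (2 * (K + 1))"
  have T: "0 < T" "T \<le> 1" "K * T \<le> 1 / 2" using K by (auto simp: T_def field_simps)
  show ?thesis
  proof (rule that[OF T(1)])
    fix s u G assume s: "0 \<le> s" "s \<le> u" "u \<le> s + T" and G: "G \<in> sets (F s)"
    let ?a = "EG G (\<lambda>w. wt (2 * k) (X s w))"
    \<comment> \<open>The fixed point of the map that sends \<open>x\<close> to
      \<open>2 ^ (2 * k) * ?a + x / 2\<close>.\<close>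
    let ?A = "2 * 2 ^ (2 * k) * ?a"
    let ?m = "expectation (\<lambda>w. wt (2 * k) (X 0 w))"
    have GM: "G \<in> sets M" using M_sets[OF s(1) G] .
    have a0: "0 \<le> ?a" by (rule EG_wt_nonneg)
    have m0: "0 \<le> ?m" by (intro Bochner_Integration.integral_nonneg) simp
    have it: "EG G (\<lambda>w. wt (2 * k) (X u w)) \<le> ?A + ?m / 2 ^ n" if "s \<le> u" "u \<le> s + T" for u n
      using that
    proof (induction n arbitrary: u)
      case 0
      have "0 \<le> u" using 0 s(1) by simp
      moreover have "0 \<le> ?A" by (intro mult_nonneg_nonneg a0) auto
      ultimately show ?case using indicator_wt_bound[OF _ GM, of u "2 * k"] unfolding power_0 div_by_1 by linarith
    next
      case (Suc n)
      let ?c = "?A + ?m / 2 ^ n"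
      have "0 \<le> ?c" using a0 m0 by simp
      have us: "0 \<le> u" using Suc s by simp
      have "EG G (\<lambda>w. (X u w - X s w) ^ (2 * k)) \<le> 2 ^ (2 * k) * CG ^ (2 * k) * ((u - s) ^ k + moment_const k) * (u - s) ^ k * ?c"
        by (rule increment_moment_step[OF s(1) Suc.prems(1) G k]) (rule Suc.IH; use Suc.prems in simp)
      also have "\<dots> \<le> 2 ^ (2 * k) * CG ^ (2 * k) * (1 + moment_const k) * T * ?c"
      proof (intro mult_right_mono mult_mono add_right_mono mult_nonneg_nonneg)
        have us1: "0 \<le> u - s" "u - s \<le> T" "u - s \<le> 1" using Suc.prems T by auto
        show "(u - s) ^ k \<le> 1" using us1 by (simp add: power_le_one)
        have "(u - s) ^ k \<le> (u - s) ^ 1" using us1 k by (intro power_decreasing) auto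
        then show "(u - s) ^ k \<le> T" using us1 by simp
        show "0 \<le> (u - s) ^ k" using us1 by simp
      qed (use \<open>0 \<le> ?c\<close> moment_const_pos[of k] CG Suc.prems in \<open>auto intro: add_nonneg_nonneg\<close>)
      finally have D: "2 ^ (2 * k) * EG G (\<lambda>w. (X u w - X s w) ^ (2 * k)) \<le> 2 ^ (2 * k) * (2 ^ (2 * k) * CG ^ (2 * k) * (1 + moment_const k) * T * ?c)"
        by (intro mult_left_mono) auto
      also have "\<dots> = K * T * ?c" by (simp add: K_def)
      also have "\<dots> \<le> 1 / 2 * ?c" using T(3) \<open>0 \<le> ?c\<close> by (intro mult_right_mono) auto
      finally have D: "2 ^ (2 * k) * EG G (\<lambda>w. (X u w - X s w) ^ (2 * k)) \<le> 1 / 2 * ?c" .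
      have i1: "integrable_on_event G (\<lambda>w. wt (2 * k) (X s w))" by (rule wt_integrable_on[OF s(1) GM])
      have i2: "integrable_on_event G (\<lambda>w. (X u w - X s w) ^ (2 * k))"
        by (intro integrable_imp_on_event increment_power_integrable GM us s(1))
      have "EG G (\<lambda>w. wt (2 * k) (X u w)) \<le> EG G (\<lambda>w. 2 ^ (2 * k) * wt (2 * k) (X s w) + 2 ^ (2 * k) * (X u w - X s w) ^ (2 * k))"
      proof (rule integral_mono[OF wt_integrable_on[OF us GM] EG_linear(1)[OF i1 i2]], rule mult_left_mono)
        fix w
        have "wt (2 * k) (X u w) \<le> ((1 + \<bar>X s w\<bar>) + \<bar>X u w - X s w\<bar>) ^ (2 * k)" by (intro power_mono) auto
        also have "\<dots> \<le> 2 ^ (2 * k) * (wt (2 * k) (X s w) + \<bar>X u w - X s w\<bar> ^ (2 * k))" by (rule power_even_add_le)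
        finally show "wt (2 * k) (X u w) \<le> 2 ^ (2 * k) * wt (2 * k) (X s w) + 2 ^ (2 * k) * (X u w - X s w) ^ (2 * k)"
          by (simp add: distrib_left power_even_abs)
      qed simp
      also have "\<dots> = 2 ^ (2 * k) * ?a + 2 ^ (2 * k) * EG G (\<lambda>w. (X u w - X s w) ^ (2 * k))"
        by (rule EG_linear(2)[OF i1 i2])
      also have "\<dots> \<le> 2 ^ (2 * k) * ?a + 1 / 2 * ?c" using D by simp
      also have "\<dots> = ?A + ?m / 2 ^ Suc n" by (simp add: field_simps)
      finally show ?case .
    qed
    have lim: "(\<lambda>n. ?A + ?m / 2 ^ n) \<longlonglongrightarrow> ?A + 0"
      by (intro tendsto_intros LIMSEQ_divide_realpow_zero) simp
    have "EG G (\<lambda>w. wt (2 * k) (X u w)) \<le> ?A + 0"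
      by (rule LIMSEQ_le_const[OF lim]) (use it[OF s(2,3)] in blast)
    then show "EG G (\<lambda>w. wt (2 * k) (X u w)) \<le> ?A" by simp
  qed
qed

text \<open>Short intervals are chained: an event of \<open>F s\<close> is also one of
  \<open>F (s + T)\<close>, so the estimate can be applied again from there. The constant depends on
  the horizon \<open>Tm\<close> but not on \<open>s\<close>, \<open>u\<close> or
  \<open>G\<close>.\<close>

lemma wt_moment:
  assumes k: "0 < k"
  obtains C where "C \<ge> 0" "\<And>s u G. 0 \<le> s \<Longrightarrow> s \<le> u \<Longrightarrow> u \<le> s + Tm \<Longrightarrow> G \<in> sets (F s) \<Longrightarrow>
    EG G (\<lambda>w. wt (2 * k) (X u w)) \<le> C * EG G (\<lambda>w. wt (2 * k) (X s w))"
proof -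
  obtain T where T: "T > 0" "\<And>s u G. 0 \<le> s \<Longrightarrow> s \<le> u \<Longrightarrow> u \<le> s + T \<Longrightarrow> G \<in> sets (F s) \<Longrightarrow>
    EG G (\<lambda>w. wt (2 * k) (X u w)) \<le> 2 * 2 ^ (2 * k) * EG G (\<lambda>w. wt (2 * k) (X s w))"
    using wt_moment_short[OF k] by blast
  define D :: real where "D = 2 * 2 ^ (2 * k)"
  have D: "1 \<le> D" unfolding D_def using one_le_power[of "2::real" "2 * k"] by linarith
  have it: "EG G (\<lambda>w. wt (2 * k) (X u w)) \<le> D ^ n * EG G (\<lambda>w. wt (2 * k) (X s w))"
    if "0 \<le> s" "s \<le> u" "u \<le> s + real n * T" "G \<in> sets (F s)" for s u G n
    using that
  proof (induction n arbitrary: s)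
    case 0
    then have "u = s" by simp
    then show ?case by simp
  next
    case (Suc n)
    let ?a = "EG G (\<lambda>w. wt (2 * k) (X s w))"
    have a0: "0 \<le> ?a" by (rule EG_wt_nonneg)
    show ?case
    proof (cases "u \<le> s + T")
      case True
      have "EG G (\<lambda>w. wt (2 * k) (X u w)) \<le> D * ?a" using T(2)[OF Suc.prems(1,2) True Suc.prems(4)] by (simp add: D_def)
      also have "\<dots> \<le> D ^ Suc n * ?a"
        using D a0 power_increasing[of 1 "Suc n" D] by (intro mult_right_mono) auto
      finally show ?thesis .
    next
      case False
      have sT: "0 \<le> s + T" "s \<le> s + T" using T(1) Suc.prems by auto
      have "EG G (\<lambda>w. wt (2 * k) (X u w)) \<le> D ^ n * EG G (\<lambda>w. wt (2 * k) (X (s + T) w))"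
        using Suc.prems False sT by (intro Suc.IH F_sets[OF Suc.prems(1) sT(2)]) (auto simp: algebra_simps)
      also have "\<dots> \<le> D ^ n * (D * ?a)"
        using T(2)[OF Suc.prems(1) sT(2) order_refl Suc.prems(4)] D by (intro mult_left_mono) (auto simp: D_def)
      finally show ?thesis by (simp add: ac_simps)
    qed
  qed
  obtain n where n: "Tm \<le> real n * T" using T(1) by (metis ex_less_of_nat_mult less_imp_le)
  show ?thesis
  proof (rule that[of "D ^ n"])
    fix s u G assume "0 \<le> s" "s \<le> u" "u \<le> s + Tm" "G \<in> sets (F s)"
    then show "EG G (\<lambda>w. wt (2 * k) (X u w)) \<le> D ^ n * EG G (\<lambda>w. wt (2 * k) (X s w))"
      using n by (intro it) auto
  qed (use D in simp)
qed

text \<open>The final weight bound takes the place of the provisional one in the estimate of the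
  increment.\<close>

lemma increment_moment_bound:
  assumes k: "0 < k"
  obtains C where "C \<ge> 0"
    "\<And>s u G. 0 \<le> s \<Longrightarrow> s \<le> u \<Longrightarrow> u \<le> s + Tm \<Longrightarrow> G \<in> sets (F s) \<Longrightarrow>
      EG G (\<lambda>w. wt (2 * k) (X u w)) \<le> C * EG G (\<lambda>w. wt (2 * k) (X s w))"
    "\<And>s u G. 0 \<le> s \<Longrightarrow> s \<le> u \<Longrightarrow> u \<le> s + Tm \<Longrightarrow> G \<in> sets (F s) \<Longrightarrow>
      EG G (\<lambda>w. (X u w - X s w) ^ (2 * k)) \<le> C * (u - s) ^ k * EG G (\<lambda>w. wt (2 * k) (X s w))"
proof -
  obtain C where C: "C \<ge> 0" "\<And>s u G. 0 \<le> s \<Longrightarrow> s \<le> u \<Longrightarrow> u \<le> s + Tm \<Longrightarrow> G \<in> sets (F s) \<Longrightarrow>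
    EG G (\<lambda>w. wt (2 * k) (X u w)) \<le> C * EG G (\<lambda>w. wt (2 * k) (X s w))"
    using wt_moment[OF k] by blast
  define K where "K = 2 ^ (2 * k) * CG ^ (2 * k) * (\<bar>Tm\<bar> ^ k + moment_const k)"
  have K: "0 \<le> K" unfolding K_def using CG moment_const_pos[of k] by simp
  show ?thesis
  proof (rule that[of "C + K * C"])
    show "0 \<le> C + K * C" using C K by simp
    fix s u G assume s: "0 \<le> s" "s \<le> u" "u \<le> s + Tm" and G: "G \<in> sets (F s)"
    let ?a = "EG G (\<lambda>w. wt (2 * k) (X s w))"
    have a0: "0 \<le> ?a" by (rule EG_wt_nonneg)
    have "C * ?a \<le> (C + K * C) * ?a" using C K a0 by (intro mult_right_mono) auto
    then show "EG G (\<lambda>w. wt (2 * k) (X u w)) \<le> (C + K * C) * ?a" using C(2)[OF s G] by linarith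
    have "EG G (\<lambda>w. (X u w - X s w) ^ (2 * k)) \<le> 2 ^ (2 * k) * CG ^ (2 * k) * ((u - s) ^ k + moment_const k) * (u - s) ^ k * (C * ?a)"
      by (rule increment_moment_step[OF s(1,2) G k]) (rule C(2); use s G in simp)
    also have "\<dots> \<le> K * (u - s) ^ k * (C * ?a)"
      unfolding K_def using s C(1) a0 CG
      by (intro mult_right_mono mult_left_mono add_right_mono power_mono) auto
    also have "\<dots> = K * C * (u - s) ^ k * ?a" by simp
    also have "\<dots> \<le> (C + K * C) * (u - s) ^ k * ?a" using s C a0 by (intro mult_right_mono) auto
    finally show "EG G (\<lambda>w. (X u w - X s w) ^ (2 * k)) \<le> (C + K * C) * (u - s) ^ k * ?a" .
  qed
qed

section \<open>Conditional moment bounds\<close>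

text \<open>\<open>moment_est T e V C p\<close>: conditionally on \<open>\<F>\<^sub>s\<close>, the variable \<open>V s u\<close> has expectation at most
  \<open>C (u - s)\<^bsup>e/2\<^esup> (1 + |X\<^sub>s|)\<^bsup>p\<^esup>\<close>; conditioning is expressed by integration over events of \<open>\<F>\<^sub>s\<close>.\<close>

definition moment_est :: "real \<Rightarrow> nat \<Rightarrow> (real \<Rightarrow> real \<Rightarrow> 'w \<Rightarrow> real) \<Rightarrow> real \<Rightarrow> nat \<Rightarrow> bool" where
  "moment_est T e V C p \<longleftrightarrow> 0 \<le> C \<and> (\<forall>s u G. 0 \<le> s \<longrightarrow> s < u \<longrightarrow> u \<le> s + T \<longrightarrow> G \<in> sets (F s) \<longrightarrow>
     integrable_on_event G (V s u) \<and> EG G (V s u) \<le> C * sqrt (u - s) ^ e * EG G (\<lambda>w. wt p (X s w)))"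

text \<open>Constant and weight are hidden by the quantifier; only the order \<open>e\<close>,
  counted in half powers of \<open>u - s\<close>, is tracked.\<close>

definition moment_bound :: "real \<Rightarrow> nat \<Rightarrow> (real \<Rightarrow> real \<Rightarrow> 'w \<Rightarrow> real) \<Rightarrow> bool" where
  "moment_bound T e V \<longleftrightarrow> (\<exists>C p. moment_est T e V C p)"

lemma moment_boundI:
  assumes "0 \<le> C" "\<And>s u G. 0 \<le> s \<Longrightarrow> s < u \<Longrightarrow> u \<le> s + T \<Longrightarrow> G \<in> sets (F s) \<Longrightarrow>
     integrable_on_event G (V s u) \<and> EG G (V s u) \<le> C * sqrt (u - s) ^ e * EG G (\<lambda>w. wt p (X s w))"
  shows "moment_bound T e V"
  unfolding moment_bound_def moment_est_def using assms by (intro exI[of _ C] exI[of _ p]) simp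

lemma moment_boundE:
  assumes "moment_bound T e V" obtains C p where "moment_est T e V C p"
  using assms unfolding moment_bound_def by (elim exE) (rule that)

lemma moment_estD:
  assumes "moment_est T e V C p"
  shows "0 \<le> C" "0 \<le> s \<Longrightarrow> s < u \<Longrightarrow> u \<le> s + T \<Longrightarrow> G \<in> sets (F s) \<Longrightarrow> integrable_on_event G (V s u)"
    "0 \<le> s \<Longrightarrow> s < u \<Longrightarrow> u \<le> s + T \<Longrightarrow> G \<in> sets (F s) \<Longrightarrow> p \<le> q \<Longrightarrow>
     EG G (V s u) \<le> C * sqrt (u - s) ^ e * EG G (\<lambda>w. wt q (X s w))"
proof -
  have C: "0 \<le> C" "\<forall>s u G. 0 \<le> s \<longrightarrow> s < u \<longrightarrow> u \<le> s + T \<longrightarrow> G \<in> sets (F s) \<longrightarrow>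
     integrable_on_event G (V s u) \<and> EG G (V s u) \<le> C * sqrt (u - s) ^ e * EG G (\<lambda>w. wt p (X s w))"
    using assms unfolding moment_est_def by (rule conjunct1, rule conjunct2)
  show "0 \<le> C" by (rule C(1))
  assume *: "0 \<le> s" "s < u" "u \<le> s + T" "G \<in> sets (F s)"
  show "integrable_on_event G (V s u)" using C(2) * by simp
  assume "p \<le> q"
  then have "EG G (\<lambda>w. wt p (X s w)) \<le> EG G (\<lambda>w. wt q (X s w))"
    using * by (intro EG_wt_mono M_sets[OF *(1)]) auto
  then have "C * sqrt (u - s) ^ e * EG G (\<lambda>w. wt p (X s w)) \<le> C * sqrt (u - s) ^ e * EG G (\<lambda>w. wt q (X s w))"
    using C(1) * by (intro mult_left_mono) auto
  then show "EG G (V s u) \<le> C * sqrt (u - s) ^ e * EG G (\<lambda>w. wt q (X s w))" using C(2) * by (meson order_trans)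
qed

lemma moment_bound_integrable:
  assumes "moment_bound T e V" "0 \<le> s" "s < u" "u \<le> s + T"
  shows "integrable M (V s u)"
proof -
  have "space M \<in> sets (F s)" using sets.top[of "F s"] space_F[OF assms(2)] by simp
  then have "integrable_on_event (space M) (V s u)"
    using assms unfolding moment_bound_def moment_est_def by blast
  then show ?thesis by (rule Bochner_Integration.integrable_cong[OF refl, THEN iffD1, rotated]) simp
qed

lemma moment_bound_dominated:
  assumes W: "moment_bound T e W"
    and m: "\<And>s u. 0 \<le> s \<Longrightarrow> s < u \<Longrightarrow> u \<le> s + T \<Longrightarrow> V s u \<in> borel_measurable M"
    and le: "\<And>s u w. 0 \<le> s \<Longrightarrow> s < u \<Longrightarrow> u \<le> s + T \<Longrightarrow> w \<in> space M \<Longrightarrow> 0 \<le> V s u w \<and> V s u w \<le> W s u w"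
  shows "moment_bound T e V"
proof -
  obtain C p where "moment_est T e W C p" by (rule moment_boundE[OF W])
  note C = moment_estD[OF this]
  show ?thesis
  proof (rule moment_boundI[OF C(1)])
    fix s u G assume *: "0 \<le> s" "s < u" "u \<le> s + T" and G: "G \<in> sets (F s)"
    have "integrable_on_event G (V s u)" "EG G (V s u) \<le> EG G (W s u)"
      by (rule EG_dominated[OF m[OF *] M_sets[OF *(1) G] _ _ C(2)[OF * G]]; use le[OF *] in simp)+
    then show "integrable_on_event G (V s u) \<and> EG G (V s u) \<le> C * sqrt (u - s) ^ e * EG G (\<lambda>w. wt p (X s w))"
      using C(3)[OF * G order_refl] by auto
  qed
qed

lemma moment_bound_add:
  assumes V: "moment_bound T e V" and W: "moment_bound T e W"
  shows "moment_bound T e (\<lambda>s u w. V s u w + W s u w)"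
proof -
  obtain C p where "moment_est T e V C p" by (rule moment_boundE[OF V])
  note C = moment_estD[OF this]
  obtain C' p' where "moment_est T e W C' p'" by (rule moment_boundE[OF W])
  note C' = moment_estD[OF this]
  show ?thesis
  proof (rule moment_boundI[of "C + C'" T _ e "max p p'"])
    fix s u G assume *: "0 \<le> s" "s < u" "u \<le> s + T" and G: "G \<in> sets (F s)"
    show "integrable_on_event G (\<lambda>w. V s u w + W s u w) \<and> EG G (\<lambda>w. V s u w + W s u w) \<le> (C + C') * sqrt (u - s) ^ e * EG G (\<lambda>w. wt (max p p') (X s w))"
      using EG_linear[OF C(2)[OF * G] C'(2)[OF * G], of 1 1] C(3)[OF * G, of "max p p'"] C'(3)[OF * G, of "max p p'"]
      unfolding mult_1 by (simp add: distrib_right)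
  qed (use C C' in simp)
qed

lemma moment_bound_cmult:
  assumes V: "moment_bound T e V" and "0 \<le> a"
  shows "moment_bound T e (\<lambda>s u w. a * V s u w)"
proof -
  obtain C p where "moment_est T e V C p" by (rule moment_boundE[OF V])
  note C = moment_estD[OF this]
  show ?thesis
  proof (rule moment_boundI[of "a * C" T _ e p])
    fix s u G assume *: "0 \<le> s" "s < u" "u \<le> s + T" and G: "G \<in> sets (F s)"
    show "integrable_on_event G (\<lambda>w. a * V s u w) \<and> EG G (\<lambda>w. a * V s u w) \<le> a * C * sqrt (u - s) ^ e * EG G (\<lambda>w. wt p (X s w))"
      using EG_cmult[OF C(2)[OF * G], of a] mult_left_mono[OF C(3)[OF * G order_refl] assms(2)] by (simp add: mult.assoc)
  qed (use C assms in simp)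
qed

text \<open>Surplus factors \<open>sqrt (u - s)\<close> are at most \<open>sqrt T\<close> and go
  into the constant.\<close>

lemma moment_bound_weaken:
  assumes V: "moment_bound T e V" and "e' \<le> e" "0 \<le> T"
  shows "moment_bound T e' V"
proof -
  obtain C p where "moment_est T e V C p" by (rule moment_boundE[OF V])
  note C = moment_estD[OF this]
  show ?thesis
  proof (rule moment_boundI[of "C * sqrt T ^ (e - e')" T _ e' p])
    fix s u G assume *: "0 \<le> s" "s < u" "u \<le> s + T" and G: "G \<in> sets (F s)"
    have "sqrt (u - s) ^ e = sqrt (u - s) ^ (e - e') * sqrt (u - s) ^ e'" using assms(2) by (simp add: power_add[symmetric])
    also have "\<dots> \<le> sqrt T ^ (e - e') * sqrt (u - s) ^ e'" using * by (intro mult_right_mono power_mono) auto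
    finally have "C * sqrt (u - s) ^ e * EG G (\<lambda>w. wt p (X s w)) \<le> C * (sqrt T ^ (e - e') * sqrt (u - s) ^ e') * EG G (\<lambda>w. wt p (X s w))"
      using C(1) by (intro mult_right_mono mult_left_mono EG_wt_nonneg)
    then show "integrable_on_event G (V s u) \<and> EG G (V s u) \<le> C * sqrt T ^ (e - e') * sqrt (u - s) ^ e' * EG G (\<lambda>w. wt p (X s w))"
      using C(2)[OF * G] C(3)[OF * G order_refl] by (simp add: mult.assoc)
  qed (use C assms in simp)
qed

text \<open>Conditional Cauchy-Schwarz, in the guise of the weighted inequality of the arithmetic and the
  geometric mean.\<close>

lemma moment_bound_mult:
  assumes V: "moment_bound T (2 * a) (\<lambda>s u w. (V s u w)\<^sup>2)" and W: "moment_bound T (2 * b) (\<lambda>s u w. (W s u w)\<^sup>2)"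
    and m: "\<And>s u. 0 \<le> s \<Longrightarrow> s < u \<Longrightarrow> u \<le> s + T \<Longrightarrow> V s u \<in> borel_measurable M"
     "\<And>s u. 0 \<le> s \<Longrightarrow> s < u \<Longrightarrow> u \<le> s + T \<Longrightarrow> W s u \<in> borel_measurable M"
  shows "moment_bound T (a + b) (\<lambda>s u w. \<bar>V s u w * W s u w\<bar>)"
proof -
  obtain C p where "moment_est T (2 * a) (\<lambda>s u. \<lambda>w. (V s u w)\<^sup>2) C p" by (rule moment_boundE[OF V])
  note C = moment_estD[OF this]
  obtain C' p' where "moment_est T (2 * b) (\<lambda>s u. \<lambda>w. (W s u w)\<^sup>2) C' p'" by (rule moment_boundE[OF W])
  note C' = moment_estD[OF this]
  show ?thesis
  proof (rule moment_boundI[of "C + C'" T _ "a + b" "max p p'"])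
    fix s u G assume *: "0 \<le> s" "s < u" "u \<le> s + T" and G: "G \<in> sets (F s)"
    let ?w = "EG G (\<lambda>w. wt (max p p') (X s w))"
    define r where "r = sqrt (u - s)"
    have r: "0 < r" using * by (simp add: r_def)
    \<comment> \<open>The weights balance the two squares: both summands become of size
      \<open>r ^ (a + b)\<close>.\<close>
    let ?R = "\<lambda>w. (r ^ b / r ^ a) * (V s u w)\<^sup>2 + (r ^ a / r ^ b) * (W s u w)\<^sup>2"
    note R = EG_linear[OF C(2)[OF * G] C'(2)[OF * G], of "r ^ b / r ^ a" "r ^ a / r ^ b"]
    have le: "\<bar>V s u w * W s u w\<bar> \<le> ?R w" for w
    proof -
      define x y z where "x = \<bar>V s u w\<bar>" "y = \<bar>W s u w\<bar>" "z = sqrt (r ^ b / r ^ a)"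
      have z: "0 < z" "z\<^sup>2 = r ^ b / r ^ a" "1 / z\<^sup>2 = r ^ a / r ^ b" using r by (auto simp: x_y_z_def)
      have xy: "0 \<le> x" "0 \<le> y" by (auto simp: x_y_z_def)
      have "0 \<le> (z * x - y / z)\<^sup>2" by simp
      also have "\<dots> = z\<^sup>2 * x\<^sup>2 + 1 / z\<^sup>2 * y\<^sup>2 - 2 * (x * y)" using z(1) by (simp add: power2_eq_square algebra_simps)
      finally have "x * y \<le> z\<^sup>2 * x\<^sup>2 + 1 / z\<^sup>2 * y\<^sup>2" using mult_nonneg_nonneg[OF xy] by linarith
      then show ?thesis unfolding z by (simp add: x_y_z_def abs_mult)
    qed
    have "integrable_on_event G (\<lambda>w. \<bar>V s u w * W s u w\<bar>)" "EG G (\<lambda>w. \<bar>V s u w * W s u w\<bar>) \<le> EG G ?R"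
      by (rule EG_dominated[OF _ M_sets[OF *(1) G] _ le R(1)]; use m[OF *] in measurable)+
    moreover have "EG G ?R \<le> (r ^ b / r ^ a) * (C * r ^ (2 * a) * ?w) + (r ^ a / r ^ b) * (C' * r ^ (2 * b) * ?w)"
      unfolding R(2) r_def[symmetric] using C(3)[OF * G, of "max p p'"] C'(3)[OF * G, of "max p p'"] r
      by (intro add_mono mult_left_mono) (auto simp: r_def)
    moreover have "(r ^ b / r ^ a) * (C * r ^ (2 * a) * ?w) + (r ^ a / r ^ b) * (C' * r ^ (2 * b) * ?w) = (C + C') * r ^ (a + b) * ?w"
    proof -
      have *: "r ^ (2 * n) = r ^ n * r ^ n" for n by (simp only: mult_2 power_add)
      have "(r ^ b / r ^ a) * (C * r ^ (2 * a) * ?w) = C * r ^ (a + b) * ?w" "(r ^ a / r ^ b) * (C' * r ^ (2 * b) * ?w) = C' * r ^ (a + b) * ?w"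
        unfolding * power_add using r by simp_all
      then show ?thesis by (simp add: distrib_right)
    qed
    ultimately show "integrable_on_event G (\<lambda>w. \<bar>V s u w * W s u w\<bar>) \<and> EG G (\<lambda>w. \<bar>V s u w * W s u w\<bar>) \<le> (C + C') * sqrt (u - s) ^ (a + b) * ?w"
      by (simp add: r_def)
  qed (use C C' in simp)
qed

text \<open>Jensen's inequality preserves the order under averaging in time. The estimates concern
  \<open>s < u\<close>; at the start \<open>u = s\<close> the integrand is 0.\<close>

lemma moment_bound_mean:
  assumes V: "moment_bound T e (\<lambda>s u w. g s u w ^ (2 * k))" and k: "0 < k"
    and m: "\<And>s u. 0 \<le> s \<Longrightarrow> s \<le> u \<Longrightarrow> g s u \<in> borel_measurable M"
    and c: "\<And>s t w. 0 \<le> s \<Longrightarrow> s < t \<Longrightarrow> w \<in> space M \<Longrightarrow> continuous_on {s..t} (\<lambda>u. g s u w)"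
    and z: "\<And>s w. 0 \<le> s \<Longrightarrow> g s s w = 0"
  shows "moment_bound T e (\<lambda>s t w. (integral {s..t} (\<lambda>u. g s u w) / (t - s)) ^ (2 * k))"
proof -
  obtain C p where "moment_est T e (\<lambda>s u. \<lambda>w. g s u w ^ (2 * k)) C p" by (rule moment_boundE[OF V])
  note C = moment_estD[OF this]
  show ?thesis
  proof (rule moment_boundI[OF C(1)])
    fix s t G assume *: "0 \<le> s" "s < t" "t \<le> s + T" and G: "G \<in> sets (F s)"
    let ?w = "EG G (\<lambda>w. wt p (X s w))"
    have i: "integrable_on_event G (\<lambda>w. g s u w ^ (2 * k)) \<and> EG G (\<lambda>w. g s u w ^ (2 * k)) \<le> C * sqrt (t - s) ^ e * ?w" if "s \<le> u" "u \<le> t" for u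
    proof (cases "s = u")
      case True
      have "0 \<le> C * sqrt (t - s) ^ e * ?w" using C(1) * by (intro mult_nonneg_nonneg EG_wt_nonneg) auto
      then show ?thesis using True z[OF *(1)] k by (simp add: power_0_left)
    next
      case False
      then have su: "s < u" "u \<le> s + T" using that * by auto
      have "sqrt (u - s) ^ e \<le> sqrt (t - s) ^ e" using su that by (intro power_mono) auto
      then have "C * sqrt (u - s) ^ e * ?w \<le> C * sqrt (t - s) ^ e * ?w"
        using C(1) by (intro mult_right_mono mult_left_mono EG_wt_nonneg) auto
      then show ?thesis using C(2)[OF *(1) su G] C(3)[OF *(1) su G order_refl] by auto
    qed
    show "integrable_on_event G (\<lambda>w. (integral {s..t} (\<lambda>u. g s u w) / (t - s)) ^ (2 * k)) \<and>
       EG G (\<lambda>w. (integral {s..t} (\<lambda>u. g s u w) / (t - s)) ^ (2 * k)) \<le> C * sqrt (t - s) ^ e * ?w"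
      using i by (intro conjI integral_mean_moment[OF *(1,2) m[OF *(1)] c[OF *(1,2)] M_sets[OF *(1) G]]) auto
  qed
qed

lemma moment_bound_wt_start: "moment_bound T 0 (\<lambda>s u w. wt p (X s w))"
  by (rule moment_boundI[of 1 _ _ _ p]) (auto intro!: wt_integrable_on M_sets)

lemma moment_bound_wt_end: "moment_bound T 0 (\<lambda>s u w. wt p (X u w))"
proof -
  \<comment> \<open>The exponent is raised to a positive even number, to which the moment bound for
    weights applies.\<close>
  have "moment_bound T 0 (\<lambda>s u w. wt (2 * Suc p) (X u w))"
  proof -
    obtain C where C: "C \<ge> 0" "\<And>s u G. 0 \<le> s \<Longrightarrow> s \<le> u \<Longrightarrow> u \<le> s + T \<Longrightarrow> G \<in> sets (F s) \<Longrightarrow>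
      EG G (\<lambda>w. wt (2 * Suc p) (X u w)) \<le> C * EG G (\<lambda>w. wt (2 * Suc p) (X s w))"
      by (rule wt_moment[where k = "Suc p" and Tm = T, OF zero_less_Suc]) (rule that; assumption)
    show ?thesis
    proof (rule moment_boundI[OF C(1)])
      fix s u G assume *: "0 \<le> s" "s < u" "u \<le> s + T" and G: "G \<in> sets (F s)"
      show "integrable_on_event G (\<lambda>w. wt (2 * Suc p) (X u w)) \<and> EG G (\<lambda>w. wt (2 * Suc p) (X u w)) \<le> C * sqrt (u - s) ^ 0 * EG G (\<lambda>w. wt (2 * Suc p) (X s w))"
      proof
        show "integrable_on_event G (\<lambda>w. wt (2 * Suc p) (X u w))"
          using * by (intro wt_integrable_on M_sets[OF *(1) G]) simp
        show "EG G (\<lambda>w. wt (2 * Suc p) (X u w)) \<le> C * sqrt (u - s) ^ 0 * EG G (\<lambda>w. wt (2 * Suc p) (X s w))"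
          using C(2)[OF *(1) less_imp_le[OF *(2)] *(3) G] by (simp only: power_0 mult_1_right)
      qed
    qed
  qed
  then show ?thesis
  proof (rule moment_bound_dominated)
    show "(\<lambda>w. wt p (X u w)) \<in> borel_measurable M" if "0 \<le> s" "s < u" for s u
    proof -
      have [measurable]: "X u \<in> borel_measurable M" using that by auto
      show ?thesis by measurable
    qed
    show "0 \<le> wt p (X u w) \<and> wt p (X u w) \<le> wt (2 * Suc p) (X u w)" for u w
      by (intro conjI wt_mono) auto
  qed
qed

lemma moment_bound_increment: "moment_bound T (2 * k) (\<lambda>s u w. (X u w - X s w) ^ (2 * k))"
proof (cases "k = 0")
  case True
  have "moment_bound T 0 (\<lambda>s u w. wt 0 (X s w))" by (rule moment_bound_wt_start)
  then show ?thesis using True by simp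
next
  case False
  obtain C where C: "C \<ge> 0" "\<And>s u G. 0 \<le> s \<Longrightarrow> s \<le> u \<Longrightarrow> u \<le> s + T \<Longrightarrow> G \<in> sets (F s) \<Longrightarrow>
      EG G (\<lambda>w. wt (2 * k) (X u w)) \<le> C * EG G (\<lambda>w. wt (2 * k) (X s w))"
     "\<And>s u G. 0 \<le> s \<Longrightarrow> s \<le> u \<Longrightarrow> u \<le> s + T \<Longrightarrow> G \<in> sets (F s) \<Longrightarrow>
      EG G (\<lambda>w. (X u w - X s w) ^ (2 * k)) \<le> C * (u - s) ^ k * EG G (\<lambda>w. wt (2 * k) (X s w))"
    by (rule increment_moment_bound[where k = k and Tm = T, OF neq0_conv[THEN iffD1, OF False]]) (rule that; assumption)
  show ?thesis
  proof (rule moment_boundI[OF C(1)])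
    fix s u G assume *: "0 \<le> s" "s < u" "u \<le> s + T" and G: "G \<in> sets (F s)"
    have "sqrt (u - s) ^ (2 * k) = (u - s) ^ k" using * by (simp add: power_mult)
    then show "integrable_on_event G (\<lambda>w. (X u w - X s w) ^ (2 * k)) \<and> EG G (\<lambda>w. (X u w - X s w) ^ (2 * k)) \<le> C * sqrt (u - s) ^ (2 * k) * EG G (\<lambda>w. wt (2 * k) (X s w))"
      using C(3)[OF *(1) less_imp_le[OF *(2)] *(3) G] * M_sets[OF *(1) G] by (auto intro!: integrable_imp_on_event increment_power_integrable)
  qed
qed

text \<open>The polynomial Lipschitz bound produces weights at both times and a power of the
  increment; conditional Cauchy-Schwarz separates them. The weights have order 0, so the order is
  that of the increment of \<open>X\<close>.\<close>

lemma moment_bound_coeff_increment: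
  fixes \<gamma> :: "real \<Rightarrow> real"
  assumes \<gamma>: "\<And>x y. x \<in> S \<Longrightarrow> y \<in> S \<Longrightarrow> \<bar>\<gamma> x - \<gamma> y\<bar> \<le> CL * ((1 + \<bar>x\<bar>) * (1 + \<bar>y\<bar>)) ^ pL * \<bar>x - y\<bar>" and c: "continuous_on S \<gamma>"
  shows "moment_bound T (2 * k) (\<lambda>s u w. (\<gamma> (X u w) - \<gamma> (X s w)) ^ (2 * k))"
proof -
  let ?q = "pL * (2 * k)"
  let ?A = "\<lambda>(s::real) (u::real) w. wt ?q (X s w) * wt ?q (X u w)"
  let ?D = "\<lambda>(s::real) (u::real) w. (X u w - X s w) ^ (2 * k)"
  have Xm: "X s \<in> borel_measurable M" "X u \<in> borel_measurable M" if "0 \<le> s" "s < u" for s :: real and u :: real using that by auto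
  have wm: "(\<lambda>w. wt q (X s w)) \<in> borel_measurable M" "(\<lambda>w. wt q (X u w)) \<in> borel_measurable M" if "0 \<le> s" "s < u" for s u :: real and q
    using Xm[OF that] by measurable
  have "moment_bound T (0 + 0) (\<lambda>s u w. \<bar>wt (2 * ?q) (X s w) * wt (2 * ?q) (X u w)\<bar> :: real)"
    by (rule moment_bound_mult) (simp_all add: power_mult[symmetric] moment_bound_wt_start moment_bound_wt_end wm)
  then have A: "moment_bound T (2 * 0) (\<lambda>s u w. (?A s u w)\<^sup>2)"
    by (simp add: power_mult_distrib power_mult[symmetric] mult.commute abs_mult)
  have D: "moment_bound T (2 * (2 * k)) (\<lambda>s u w. (?D s u w)\<^sup>2)"
    using moment_bound_increment[of T "2 * k"] by (simp add: power_mult[symmetric] mult.commute mult.left_commute)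
  have AD: "moment_bound T (0 + 2 * k) (\<lambda>s u w. \<bar>?A s u w * ?D s u w\<bar>)"
    by (rule moment_bound_mult[OF A D]) (use wm Xm in measurable)
  have "moment_bound T (2 * k) (\<lambda>s u w. CL ^ (2 * k) * \<bar>?A s u w * ?D s u w\<bar>)"
    using moment_bound_cmult[OF AD, of "CL ^ (2 * k)"] CL by simp
  then show ?thesis
  proof (rule moment_bound_dominated)
    show "(\<lambda>w. (\<gamma> (X u w) - \<gamma> (X s w)) ^ (2 * k)) \<in> borel_measurable M" if "0 \<le> s" "s < u" for s u :: real
      using that by (intro borel_measurable_power borel_measurable_diff fX_measurable c) auto
    fix s u :: real and w assume *: "0 \<le> s" "s < u" "w \<in> space M"
    then have S: "X s w \<in> S" "X u w \<in> S" by (auto intro!: X_S)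
    have "\<bar>\<gamma> (X u w) - \<gamma> (X s w)\<bar> ^ (2 * k) \<le> (CL * ((1 + \<bar>X u w\<bar>) * (1 + \<bar>X s w\<bar>)) ^ pL * \<bar>X u w - X s w\<bar>) ^ (2 * k)"
      by (rule power_mono[OF \<gamma>[OF S(2,1)]]) simp
    also have "\<dots> = CL ^ (2 * k) * \<bar>?A s u w * ?D s u w\<bar>"
    proof -
      have "\<bar>?A s u w * ?D s u w\<bar> = ?A s u w * ?D s u w" by (intro abs_of_nonneg mult_nonneg_nonneg) auto
      moreover have "\<bar>X u w - X s w\<bar> ^ (2 * k) = ?D s u w" by (simp add: power_even_abs)
      ultimately show ?thesis by (simp only: power_mult_distrib power_mult[symmetric] ac_simps)
    qed
    finally show "0 \<le> (\<gamma> (X u w) - \<gamma> (X s w)) ^ (2 * k) \<and> (\<gamma> (X u w) - \<gamma> (X s w)) ^ (2 * k) \<le> CL ^ (2 * k) * \<bar>?A s u w * ?D s u w\<bar>"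
      by (simp add: power_even_abs)
  qed
qed

end

section \<open>The time average of Brownian motion\<close>

context brownian_filtration
begin

definition bm_mean :: "real \<Rightarrow> real \<Rightarrow> 'w \<Rightarrow> real" where
  "bm_mean s t w = integral {s..t} (\<lambda>u. B u w - B s w) / (t - s)"

text \<open>Summation by parts: it writes the grid average of \<open>B\<close> as a weighted sum of
  independent increments.\<close>

lemma sum_of_partial_sums:
  fixes d :: "nat \<Rightarrow> real"
  shows "(\<Sum>j<n. \<Sum>i<j. d i) = (\<Sum>i<n. real (n - Suc i) * d i)"
proof (induction n)
  case (Suc n)
  have "(\<Sum>i<Suc n. real (Suc n - Suc i) * d i) = (\<Sum>i<n. real (n - Suc i) * d i + d i)"
    by (auto simp: Suc_diff_Suc algebra_simps intro!: sum.cong)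
  then show ?case using Suc by (simp add: sum.distrib)
qed simp

text \<open>On the grid the exponent is a sum of increments with coefficients
  \<open>a + b * x\<close>, where \<open>x\<close> is the fraction of the interval that is left. The
  normalised sum of squares tends to the integral of \<open>(a + b * x)^2\<close> over
  \<open>[0, 1]\<close>, that is \<open>a^2 + a * b + b^2 / 3\<close>.\<close>

lemma char_bm_mean:
  assumes B_cont: "\<And>w. w \<in> space M \<Longrightarrow> continuous_on {0..} (\<lambda>t. B t w)" and s: "0 \<le> s" "s < t" and G: "G \<in> sets (F s)"
  shows "expectation (\<lambda>w. indicator G w * iexp (a * (B t w - B s w) + b * bm_mean s t w))
    = complex_of_real (prob G * exp (- ((a\<^sup>2 + a * b + b\<^sup>2 / 3) * (t - s) / 2)))"
proof -
  have GM[measurable]: "G \<in> sets M" using M_sets[OF s(1) G] .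
  have [measurable]: "B t \<in> borel_measurable M" "B s \<in> borel_measurable M" using s by auto
  let ?g = "\<lambda>N j. gridpt s t (Suc N) j"
  let ?h = "\<lambda>N. (t - s) / real (Suc N)"
  define Z where "Z N w = (\<Sum>j<Suc N. B (?g N j) w - B s w) / real (Suc N)" for N w
  have gp: "0 \<le> ?g N j" for N j using s by simp
  have Zm[measurable]: "Z N \<in> borel_measurable M" for N
    unfolding Z_def[abs_def] using gp s by (intro borel_measurable_divide borel_measurable_sum borel_measurable_diff B_measurable borel_measurable_const) auto
  have Zlim: "(\<lambda>N. Z N w) \<longlonglongrightarrow> bm_mean s t w" if "w \<in> space M" for w
  proof -
    have "continuous_on {s..t} (\<lambda>u. B u w - B s w)"
      using s by (intro continuous_intros continuous_on_subset[OF B_cont[OF that]]) auto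
    from LIMSEQ_Suc[OF riemann_mean_tendsto[OF this s(2)]] show ?thesis by (simp add: Z_def bm_mean_def)
  qed
  have Nm[measurable]: "bm_mean s t \<in> borel_measurable M" by (rule borel_measurable_LIMSEQ_real[OF Zlim Zm])
  \<comment> \<open>Increment number \<open>i\<close> enters the \<open>Suc N - Suc i\<close> later
    grid values of \<open>B\<close>.\<close>
  define c where "c N i = a + b * (real (Suc N - Suc i) / real (Suc N))" for N i
  have eq: "a * (B t w - B s w) + b * Z N w = (\<Sum>i<Suc N. c N i * (B (s + real (Suc i) * ?h N) w - B (s + real i * ?h N) w))" for N w
  proof -
    define d where "d i = B (s + real (Suc i) * ?h N) w - B (s + real i * ?h N) w" for i
    have tel: "(\<Sum>i<n. d i) = B (s + real n * ?h N) w - B s w" for n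
      unfolding d_def by (induction n) auto
    have end_eq: "s + real (Suc N) * ?h N = t" by (simp del: of_nat_Suc)
    have "B t w - B s w = (\<Sum>i<Suc N. d i)" unfolding tel end_eq ..
    moreover have "Z N w = (\<Sum>i<Suc N. real (Suc N - Suc i) / real (Suc N) * d i)"
      unfolding Z_def tel[symmetric] sum_of_partial_sums by (simp add: sum_divide_distrib)
    ultimately show ?thesis
      unfolding d_def[symmetric] c_def by (simp only: distrib_right sum.distrib sum_distrib_left mult.assoc)
  qed
  have h: "0 < ?h N" for N using s by simp
  have "(\<lambda>N. expectation (\<lambda>w. indicator G w * iexp (a * (B t w - B s w) + b * Z N w))) \<longlonglongrightarrow>
    expectation (\<lambda>w. indicator G w * iexp (a * (B t w - B s w) + b * bm_mean s t w))"
  proof (rule integral_dominated_convergence[where w = "\<lambda>_. 1"])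
    show "AE w in M. (\<lambda>N. indicator G w * iexp (a * (B t w - B s w) + b * Z N w)) \<longlonglongrightarrow> indicator G w * iexp (a * (B t w - B s w) + b * bm_mean s t w)"
      using Zlim by (intro AE_I2 tendsto_intros) auto
    show "AE w in M. norm (indicator G w * iexp (a * (B t w - B s w) + b * Z N w)) \<le> 1" for N
      by (intro AE_I2) (simp only: norm_mult norm_exp_i_times, simp add: indicator_def)
  qed measurable
  moreover have "expectation (\<lambda>w. indicator G w * iexp (a * (B t w - B s w) + b * Z N w)) =
      complex_of_real (prob G * exp (- ((\<Sum>j<Suc N. (c N j)\<^sup>2) * ?h N / 2)))" for N
    unfolding eq by (rule char_increments[OF s(1) h G])
  moreover have "(\<lambda>N. complex_of_real (prob G * exp (- ((\<Sum>j<Suc N. (c N j)\<^sup>2) * ?h N / 2)))) \<longlonglongrightarrow> complex_of_real (prob G * exp (- ((a\<^sup>2 + a * b + b\<^sup>2 / 3) * (t - s) / 2)))"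
  proof -
    have ci: "((\<lambda>x. (a + b * x)\<^sup>2) has_integral (a\<^sup>2 * 1 + a * b * 1\<^sup>2 + b\<^sup>2 * 1^3 / 3) - (a\<^sup>2 * 0 + a * b * 0\<^sup>2 + b\<^sup>2 * 0^3 / 3)) {0..1}"
      by (rule fundamental_theorem_of_calculus)
         (auto intro!: derivative_eq_intros simp: has_real_derivative_iff_has_vector_derivative[symmetric] power2_eq_square algebra_simps)
    have "continuous_on {0..1} (\<lambda>x. (a + b * x)\<^sup>2)" by (intro continuous_intros)
    from LIMSEQ_Suc[OF riemann_mean_tendsto[OF this]] integral_unique[OF ci]
    have lim: "(\<lambda>N. (\<Sum>j<Suc N. (a + b * (real j * (1 / real (Suc N))))\<^sup>2) / real (Suc N)) \<longlonglongrightarrow> a\<^sup>2 + a * b + b\<^sup>2 / 3"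
      by simp
    \<comment> \<open>Reversing the order of summation turns this into a left Riemann sum on
      \<open>[0, 1]\<close>.\<close>
    have "(\<Sum>j<Suc N. (c N j)\<^sup>2) = (\<Sum>j<Suc N. (a + b * (real j * (1 / real (Suc N))))\<^sup>2)" for N
      using sum.nat_diff_reindex[of "\<lambda>j. (a + b * (real j * (1 / real (Suc N))))\<^sup>2" "Suc N"] by (simp add: c_def)
    then have "(\<Sum>j<Suc N. (c N j)\<^sup>2) * ?h N / 2 = (\<Sum>j<Suc N. (a + b * (real j * (1 / real (Suc N))))\<^sup>2) / real (Suc N) * (t - s) / 2" for N
      by simp
    then show ?thesis using lim by (simp only:) (intro tendsto_intros; simp)
  qed
  ultimately show ?thesis using LIMSEQ_unique by (simp only:) blast
qed

lemma bm_mean_measurable: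
  assumes B_cont: "\<And>w. w \<in> space M \<Longrightarrow> continuous_on {0..} (\<lambda>t. B t w)" and s: "0 \<le> s" "s < t"
  shows "bm_mean s t \<in> borel_measurable (F t)"
proof -
  let ?Z = "\<lambda>N w. (\<Sum>j<Suc N. B (gridpt s t (Suc N) j) w - B s w) / real (Suc N)"
  show ?thesis
  proof (rule borel_measurable_LIMSEQ_real)
    fix w assume "w \<in> space (F t)"
    then have "w \<in> space M" using space_F[of t] s by simp
    then have "continuous_on {s..t} (\<lambda>u. B u w - B s w)"
      using s by (intro continuous_intros continuous_on_subset[OF B_cont]) auto
    from LIMSEQ_Suc[OF riemann_mean_tendsto[OF this s(2)]]
    show "(\<lambda>N. ?Z N w) \<longlonglongrightarrow> bm_mean s t w" by (simp add: bm_mean_def)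
  next
    show "?Z N \<in> borel_measurable (F t)" for N
      using s gridpt_bounds[of s t _ "Suc N"]
      by (intro borel_measurable_divide borel_measurable_sum borel_measurable_diff borel_measurable_const F_measurable[OF _ _ B_adapted]) auto
  qed
qed

text \<open>Under the probability conditioned on \<open>G\<close>, the variable has the
  characteristic function of the normal law, hence this law by Levy's uniqueness theorem, whatever
  \<open>G\<close>. Law and independence follow together.\<close>

lemma gaussian_by_char:
  assumes V[measurable]: "V \<in> borel_measurable M" and s: "0 \<le> s" and v: "0 < v"
    and ch: "\<And>G u. G \<in> sets (F s) \<Longrightarrow> expectation (\<lambda>w. indicator G w * iexp (u * V w)) = complex_of_real (prob G * exp (- (u\<^sup>2 * v / 2)))"
  shows "distributed M lborel V (normal_density 0 (sqrt v))" "indep_of_alg M V (F s)"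
proof -
  let ?N = "density lborel (\<lambda>x. ennreal (normal_density 0 (sqrt v) x))"
  have sv: "0 < sqrt v" using v by simp
  interpret N: prob_space ?N by (rule prob_space_normal_density[OF sv])
  have Nreal: "real_distribution ?N" by (simp add: real_distribution_def real_distribution_axioms_def N.prob_space_axioms)
  have charN: "char ?N u = complex_of_real (exp (- (u\<^sup>2 * v / 2)))" for u
  proof -
    have "distributed ?N lborel (\<lambda>x. x) (normal_density 0 (sqrt v))"
      unfolding distributed_def by (simp add: distr_id2 distr_id[unfolded id_def])
    then have "distributed ?N lborel (\<lambda>x. (x - 0) / sqrt v) std_normal_density"
      using N.normal_standard_normal_convert[OF sv, of "\<lambda>x. x" 0] by simp
    then have d: "distr ?N lborel (\<lambda>x. x / sqrt v) = std_normal_distribution" by (simp add: distributed_distr_eq_density)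
    have "char ?N u = (CLINT x|?N. iexp (u * sqrt v * (x / sqrt v)))" using v by (simp add: char_def)
    also have "\<dots> = (CLINT x|distr ?N lborel (\<lambda>x. x / sqrt v). iexp (u * sqrt v * x))"
      by (subst integral_distr) auto
    also have "\<dots> = char std_normal_distribution (u * sqrt v)" by (simp add: d char_def)
    also have "\<dots> = complex_of_real (exp (- (u\<^sup>2 * v / 2)))"
      using v unfolding char_std_normal_distribution by (simp add: power_mult_distrib)
    finally show ?thesis .
  qed
  have law: "prob (G \<inter> (V -` A \<inter> space M)) = prob G * measure ?N A" if G: "G \<in> sets (F s)" and A: "A \<in> sets borel" for G A
  proof (cases "prob G = 0")
    case True
    have [measurable]: "G \<in> sets M" "V -` A \<inter> space M \<in> sets M" using M_sets[OF s G] A by auto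
    have "prob (G \<inter> (V -` A \<inter> space M)) \<le> prob G" by (intro finite_measure_mono) auto
    then show ?thesis using True measure_nonneg[of M] by (metis mult_zero_left order_antisym)
  next
    case False
    have GM[measurable]: "G \<in> sets M" using M_sets[OF s G] .
    have pG: "0 < prob G" using False by (simp add: less_le)
    \<comment> \<open>The measure \<open>M\<close> conditioned on \<open>G\<close>; the case
      \<open>prob G = 0\<close> has been settled above.\<close>
    define Q where "Q = density M (\<lambda>w. ennreal (indicator G w / prob G))"
    have Q1: "emeasure Q (space Q) = 1"
    proof -
      have "emeasure Q (space Q) = (\<integral>\<^sup>+w. ennreal (indicator G w / prob G) \<partial>M)"
        unfolding Q_def by (subst emeasure_density) (auto intro!: nn_integral_cong)
      also have "\<dots> = ennreal (expectation (\<lambda>w. indicator G w / prob G))"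
        using pG by (intro nn_integral_eq_integral) (auto simp: emeasure_eq_measure)
      finally show ?thesis using pG by simp
    qed
    interpret Q: prob_space Q by (rule prob_spaceI[OF Q1])
    have [measurable]: "V \<in> borel_measurable Q" unfolding Q_def by simp
    have intQ: "integral\<^sup>L Q g = expectation (\<lambda>w. indicator G w * g w) / prob G" if [measurable]: "g \<in> borel_measurable M" for g :: "'w \<Rightarrow> complex"
    proof -
      have "integral\<^sup>L Q g = expectation (\<lambda>w. (indicator G w / prob G) *\<^sub>R g w)"
        unfolding Q_def using pG by (subst integral_density) auto
      also have "\<dots> = expectation (\<lambda>w. (indicator G w * g w) / prob G)"
        by (intro Bochner_Integration.integral_cong) (auto simp: indicator_def scaleR_conv_of_real)
      finally show ?thesis by simp
    qed
    have D: "real_distribution (distr Q borel V)"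
      by (simp add: real_distribution_def real_distribution_axioms_def Q.prob_space_distr)
    have "char (distr Q borel V) = char ?N"
    proof
      fix u
      have "char (distr Q borel V) u = integral\<^sup>L Q (\<lambda>w. iexp (u * V w))"
        unfolding char_def by (subst integral_distr) auto
      also have "\<dots> = complex_of_real (exp (- (u\<^sup>2 * v / 2)))"
      proof -
        have "integral\<^sup>L Q (\<lambda>w. iexp (u * V w)) = expectation (\<lambda>w. indicator G w * iexp (u * V w)) / prob G"
          by (rule intQ) measurable
        then show ?thesis unfolding ch[OF G] using pG by simp
      qed
      finally show "char (distr Q borel V) u = char ?N u" by (simp add: charN)
    qed
    then have eq: "distr Q borel V = ?N" by (rule Levy_uniqueness[OF D Nreal])
    have "measure ?N A = measure Q (V -` A \<inter> space M)"
      unfolding eq[symmetric] using A by (subst measure_distr) (auto simp: Q_def)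
    also have "\<dots> = prob (G \<inter> (V -` A \<inter> space M)) / prob G"
    proof -
      have A': "V -` A \<inter> space M \<in> sets M" using A by auto
      have "emeasure Q (V -` A \<inter> space M) = (\<integral>\<^sup>+w. ennreal (indicator (G \<inter> (V -` A \<inter> space M)) w / prob G) \<partial>M)"
        unfolding Q_def using A' by (subst emeasure_density) (auto intro!: nn_integral_cong simp: indicator_def)
      also have "\<dots> = ennreal (expectation (\<lambda>w. indicator (G \<inter> (V -` A \<inter> space M)) w / prob G))"
        using pG A' by (intro nn_integral_eq_integral) (auto simp: emeasure_eq_measure)
      finally have "emeasure Q (V -` A \<inter> space M) = ennreal (prob (G \<inter> (V -` A \<inter> space M)) / prob G)"
        using A' GM by (simp add: Int_absorb2 sets.sets_into_space le_infI1)
      then show ?thesis by (simp add: measure_def)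
    qed
    finally show ?thesis using pG by (simp add: field_simps)
  qed
  have sp: "space M \<in> sets (F s)" using sets.top[of "F s"] space_F[OF s] by simp
  \<comment> \<open>The case \<open>G = space M\<close>.\<close>
  have law1: "prob (V -` A \<inter> space M) = measure ?N A" if "A \<in> sets borel" for A
  proof -
    have "space M \<inter> (V -` A \<inter> space M) = V -` A \<inter> space M" by auto
    then show ?thesis using law[OF sp that] by (simp add: prob_space)
  qed
  show "distributed M lborel V (normal_density 0 (sqrt v))"
    unfolding distributed_def
  proof (intro conjI)
    show "distr M lborel V = ?N"
    proof (rule measure_eqI)
      fix A assume "A \<in> sets (distr M lborel V)"
      then have A: "A \<in> sets borel" by simp
      have "emeasure (distr M lborel V) A = ennreal (prob (V -` A \<inter> space M))"
        using A by (subst emeasure_distr) (auto simp: emeasure_eq_measure)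
      then show "emeasure (distr M lborel V) A = emeasure ?N A" using law1[OF A] by (simp add: N.emeasure_eq_measure)
    qed simp
  qed auto
  show "indep_of_alg M V (F s)"
    unfolding indep_of_alg_def indep_alg_def indep_sets2_eq
  proof (intro conjI ballI)
    show "sets (vimage_algebra (space M) V borel) \<subseteq> events"
      by (subst sets_vimage_algebra2) auto
    show "sets (F s) \<subseteq> events" using M_sets[OF s] by blast
    fix a b assume a: "a \<in> sets (vimage_algebra (space M) V borel)" and b: "b \<in> sets (F s)"
    from a obtain A where A: "A \<in> sets borel" "a = V -` A \<inter> space M" by (subst (asm) sets_vimage_algebra2) auto
    show "prob (a \<inter> b) = prob a * prob b"
      using law[OF b A(1)] law1[OF A(1)] A(2) by (simp add: Int_commute mult.commute)
  qed
qed

lemma gaussian_moments: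
  assumes "distributed M lborel V (normal_density 0 (sqrt v))" "0 < v"
  shows "integrable M (\<lambda>w. V w ^ i)" "expectation (\<lambda>w. (V w)\<^sup>2) = v"
proof -
  have sv: "0 < sqrt v" using assms by simp
  show "integrable M (\<lambda>w. V w ^ i)"
    using distributed_integrable[OF assms(1), of "\<lambda>x. x ^ i"] integrable_normal_moment[OF sv, of 0 i] by simp
  show "expectation (\<lambda>w. (V w)\<^sup>2) = v"
    using distributed_integral[OF assms(1), of "\<lambda>x. x ^ 2"] integral_normal_moment_even[OF sv, of 0 1] assms(2) by simp
qed

text \<open>Polarisation turns the three Gaussian laws into the covariance of \<open>B t - B s\<close> and its time average.\<close>

lemma bm_mean_gaussian:
  assumes B_cont: "\<And>w. w \<in> space M \<Longrightarrow> continuous_on {0..} (\<lambda>t. B t w)" and s: "0 \<le> s" "s < t"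
  defines "\<xi> \<equiv> \<lambda>w. bm_mean s t w / sqrt (t - s)"
  shows "\<xi> \<in> borel_measurable (F t)" "distributed M lborel \<xi> (normal_density 0 (sqrt (1 / 3)))" "indep_of_alg M \<xi> (F s)"
    "expectation (\<lambda>w. (B t w - B s w) / sqrt (t - s) * \<xi> w) = 1 / 2"
proof -
  have t: "0 \<le> t" using s by simp
  let ?r = "sqrt (t - s)"
  have r: "0 < ?r" "?r\<^sup>2 = t - s" using s by auto
  show \<xi>F: "\<xi> \<in> borel_measurable (F t)" unfolding \<xi>_def using bm_mean_measurable[OF B_cont s] by measurable
  have \<xi>m[measurable]: "\<xi> \<in> borel_measurable M" using M_measurable[OF t \<xi>F] .
  have [measurable]: "B t \<in> borel_measurable M" "B s \<in> borel_measurable M" using s by auto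
  let ?\<epsilon> = "\<lambda>w. (B t w - B s w) / ?r"
  \<comment> \<open>Division by \<open>sqrt (t - s)\<close> removes the length of the interval. The
    directions \<open>(0, 1)\<close>, \<open>(1, 0)\<close> and \<open>(1, 1)\<close> will be
    used.\<close>
  have ch: "expectation (\<lambda>w. indicator G w * iexp (u * (a * ?\<epsilon> w + b * \<xi> w))) = complex_of_real (prob G * exp (- (u\<^sup>2 * (a\<^sup>2 + a * b + b\<^sup>2 / 3) / 2)))"
    if "G \<in> sets (F s)" for G u a b
  proof -
    have "u * (a * ?\<epsilon> w + b * \<xi> w) = (u * a / ?r) * (B t w - B s w) + (u * b / ?r) * bm_mean s t w" for w
      using r by (simp add: \<xi>_def field_simps)
    moreover have "((u * a / ?r)\<^sup>2 + (u * a / ?r) * (u * b / ?r) + (u * b / ?r)\<^sup>2 / 3) * (t - s) / 2 = u\<^sup>2 * (a\<^sup>2 + a * b + b\<^sup>2 / 3) / 2"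
    proof -
      have "((u * a / ?r)\<^sup>2 + (u * a / ?r) * (u * b / ?r) + (u * b / ?r)\<^sup>2 / 3) = u\<^sup>2 * (a\<^sup>2 + a * b + b\<^sup>2 / 3) / ?r\<^sup>2"
        by (simp add: power2_eq_square add_divide_distrib algebra_simps)
      then show ?thesis unfolding r(2) using s by simp
    qed
    ultimately show ?thesis using char_bm_mean[OF B_cont s that, of "u * a / ?r" "u * b / ?r"] by simp
  qed
  have ch\<xi>: "expectation (\<lambda>w. indicator G w * iexp (u * \<xi> w)) = complex_of_real (prob G * exp (- (u\<^sup>2 * (1 / 3) / 2)))" if "G \<in> sets (F s)" for G u
    using ch[OF that, of u 0 1] by simp
  show d\<xi>: "distributed M lborel \<xi> (normal_density 0 (sqrt (1 / 3)))" and "indep_of_alg M \<xi> (F s)"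
    using gaussian_by_char[OF \<xi>m s(1) _ ch\<xi>] by simp_all
  have ch\<epsilon>: "expectation (\<lambda>w. indicator G w * iexp (u * ?\<epsilon> w)) = complex_of_real (prob G * exp (- (u\<^sup>2 * 1 / 2)))" if "G \<in> sets (F s)" for G u
    using ch[OF that, of u 1 0] by simp
  have \<epsilon>m: "?\<epsilon> \<in> borel_measurable M" by measurable
  have d\<epsilon>: "distributed M lborel ?\<epsilon> (normal_density 0 (sqrt 1))" by (rule gaussian_by_char(1)[OF \<epsilon>m s(1) _ ch\<epsilon>]) simp_all
  \<comment> \<open>For \<open>a = b = 1\<close> the variance is 1 + 1 + 1/3.\<close>
  have chs: "expectation (\<lambda>w. indicator G w * iexp (u * (?\<epsilon> w + \<xi> w))) = complex_of_real (prob G * exp (- (u\<^sup>2 * (7 / 3) / 2)))" if "G \<in> sets (F s)" for G u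
    using ch[OF that, of u 1 1] by simp
  have sm: "(\<lambda>w. ?\<epsilon> w + \<xi> w) \<in> borel_measurable M" by measurable
  have ds: "distributed M lborel (\<lambda>w. ?\<epsilon> w + \<xi> w) (normal_density 0 (sqrt (7 / 3)))" by (rule gaussian_by_char(1)[OF sm s(1) _ chs]) simp_all
  have m\<xi>: "integrable M (\<lambda>w. (\<xi> w)\<^sup>2)" "expectation (\<lambda>w. (\<xi> w)\<^sup>2) = 1 / 3"
    "integrable M (\<lambda>w. (?\<epsilon> w)\<^sup>2)" "expectation (\<lambda>w. (?\<epsilon> w)\<^sup>2) = 1"
    "integrable M (\<lambda>w. (?\<epsilon> w + \<xi> w)\<^sup>2)" "expectation (\<lambda>w. (?\<epsilon> w + \<xi> w)\<^sup>2) = 7 / 3"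
    by (rule gaussian_moments[OF d\<xi>] gaussian_moments[OF d\<epsilon>] gaussian_moments[OF ds]; simp)+
  have "?\<epsilon> w * \<xi> w = ((?\<epsilon> w + \<xi> w)\<^sup>2 - (?\<epsilon> w)\<^sup>2 - (\<xi> w)\<^sup>2) / 2" for w
  proof -
    have "x * y = ((x + y)\<^sup>2 - x\<^sup>2 - y\<^sup>2) / 2" for x y :: real by (simp add: power2_sum)
    then show ?thesis .
  qed
  then have "expectation (\<lambda>w. ?\<epsilon> w * \<xi> w) = expectation (\<lambda>w. ((?\<epsilon> w + \<xi> w)\<^sup>2 - (?\<epsilon> w)\<^sup>2 - (\<xi> w)\<^sup>2) / 2)" by (simp only:)
  also have "\<dots> = (7 / 3 - 1 - 1 / 3) / 2"
    using m\<xi> by (simp only: integral_divide_zero Bochner_Integration.integral_diff Bochner_Integration.integrable_diff)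
  also have "\<dots> = 1 / 2" by simp
  finally show "expectation (\<lambda>w. ?\<epsilon> w * \<xi> w) = 1 / 2" .
qed

end

section \<open>The time average of the diffusion\<close>

context stationary_diffusion
begin

lemma moment_bound_cong:
  assumes "moment_bound T e V"
    and "\<And>s u w. 0 \<le> s \<Longrightarrow> s < u \<Longrightarrow> u \<le> s + T \<Longrightarrow> w \<in> space M \<Longrightarrow> V s u w = W s u w"
  shows "moment_bound T e W"
proof -
  have "integrable_on_event G (V s u) \<longleftrightarrow> integrable_on_event G (W s u)" "EG G (V s u) = EG G (W s u)"
    if "0 \<le> s" "s < u" "u \<le> s + T" for s u G
    using assms(2)[OF that] by (intro Bochner_Integration.integrable_cong Bochner_Integration.integral_cong refl; simp)+
  then show ?thesis using assms(1) unfolding moment_bound_def moment_est_def by simp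
qed

lemma moment_bound_scale:
  assumes V: "moment_bound T e V"
  shows "moment_bound T (e + 2 * j) (\<lambda>s u w. (u - s) ^ j * V s u w)"
proof -
  obtain C p where "moment_est T e V C p" by (rule moment_boundE[OF V])
  note C = moment_estD[OF this]
  show ?thesis
  proof (rule moment_boundI[OF C(1)])
    fix s u G assume *: "0 \<le> s" "s < u" "u \<le> s + T" and G: "G \<in> sets (F s)"
    have r: "(u - s) ^ j = sqrt (u - s) ^ (2 * j)" using * by (simp add: power_mult)
    have "(u - s) ^ j * EG G (V s u) \<le> (u - s) ^ j * (C * sqrt (u - s) ^ e * EG G (\<lambda>w. wt p (X s w)))"
      using * by (intro mult_left_mono C(3)[OF * G order_refl]) auto
    then show "integrable_on_event G (\<lambda>w. (u - s) ^ j * V s u w) \<and> EG G (\<lambda>w. (u - s) ^ j * V s u w) \<le> C * sqrt (u - s) ^ (e + 2 * j) * EG G (\<lambda>w. wt p (X s w))"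
      using EG_cmult[OF C(2)[OF * G], of "(u - s) ^ j"] unfolding r power_add by (simp add: ac_simps)
  qed
qed

lemma moment_bound_power_add:
  assumes V: "moment_bound T e (\<lambda>s u w. V s u w ^ (2 * k))" and W: "moment_bound T e (\<lambda>s u w. W s u w ^ (2 * k))"
    and m: "\<And>s u. 0 \<le> s \<Longrightarrow> s < u \<Longrightarrow> u \<le> s + T \<Longrightarrow> V s u \<in> borel_measurable M"
     "\<And>s u. 0 \<le> s \<Longrightarrow> s < u \<Longrightarrow> u \<le> s + T \<Longrightarrow> W s u \<in> borel_measurable M"
  shows "moment_bound T e (\<lambda>s u w. (V s u w + W s u w) ^ (2 * k))"
proof (rule moment_bound_dominated[OF moment_bound_cmult[OF moment_bound_add[OF V W], of "2 ^ (2 * k)"]])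
  show "(\<lambda>w. (V s u w + W s u w) ^ (2 * k)) \<in> borel_measurable M" if "0 \<le> s" "s < u" "u \<le> s + T" for s u
    using m[OF that] by measurable
qed (use power_even_add_le in auto)

lemma moment_bound_start:
  fixes \<phi> :: "real \<Rightarrow> real"
  assumes c: "continuous_on S \<phi>" and b: "\<And>x. x \<in> S \<Longrightarrow> \<bar>\<phi> x\<bar> \<le> C * wt p x"
  shows "moment_bound T 0 (\<lambda>s u w. \<bar>\<phi> (X s w)\<bar> ^ k)"
proof (rule moment_bound_dominated[OF moment_bound_cmult[OF moment_bound_wt_start[of T "p * k"], of "\<bar>C\<bar> ^ k"]])
  show "(\<lambda>w. \<bar>\<phi> (X s w)\<bar> ^ k) \<in> borel_measurable M" if "0 \<le> s" for s
    using fX_measurable[OF c that] by measurable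
  fix s u :: real and w assume "0 \<le> s" "w \<in> space M"
  then have "\<bar>\<phi> (X s w)\<bar> \<le> \<bar>C\<bar> * wt p (X s w)"
    using b[of "X s w"] X_S by (meson abs_ge_self mult_right_mono order_trans zero_le_power abs_ge_zero add_nonneg_nonneg zero_le_one)
  then have "\<bar>\<phi> (X s w)\<bar> ^ k \<le> (\<bar>C\<bar> * wt p (X s w)) ^ k" by (intro power_mono) auto
  then show "0 \<le> \<bar>\<phi> (X s w)\<bar> ^ k \<and> \<bar>\<phi> (X s w)\<bar> ^ k \<le> \<bar>C\<bar> ^ k * wt (p * k) (X s w)"
    by (simp add: power_mult_distrib power_mult)
qed simp

definition X_mean :: "real \<Rightarrow> real \<Rightarrow> 'w \<Rightarrow> real" where
  "X_mean s t w = integral {s..t} (\<lambda>u. X u w) / (t - s)"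

lemma X_mean_adapted: "0 \<le> s \<Longrightarrow> s < t \<Longrightarrow> X_mean s t \<in> borel_measurable (F t)"
  unfolding X_mean_def[abs_def]
  using space_F[of t] by (intro integral_mean_measurable F_measurable[OF _ _ X_adapted] X_cont_on) auto

lemma X_mean_measurable: "0 \<le> s \<Longrightarrow> s < t \<Longrightarrow> X_mean s t \<in> borel_measurable M"
  using X_mean_adapted[of s t] M_measurable[of t] by simp

lemma bm_mean_measurable_M: "0 \<le> s \<Longrightarrow> s < t \<Longrightarrow> bm_mean s t \<in> borel_measurable M"
  using bm_mean_measurable[of s t] B_cont M_measurable[of t] by simp

lemma drift_continuous: "w \<in> space M \<Longrightarrow> 0 \<le> s \<Longrightarrow> continuous_on {s..t} (\<lambda>u. drift s u w)"
  unfolding drift_def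
  by (intro indefinite_integral_continuous_1 integrable_continuous_real fX_cont_on \<alpha>_cont) auto

lemma B_cont_on: "w \<in> space M \<Longrightarrow> 0 \<le> s \<Longrightarrow> continuous_on {s..t} (\<lambda>u. B u w)"
  by (rule continuous_on_subset[OF B_cont]) auto

lemma drift_measurable_M: "0 \<le> s \<Longrightarrow> s \<le> t \<Longrightarrow> drift s t \<in> borel_measurable M"
  using drift_measurable[of s t] M_measurable[of t] by simp

text \<open>The time average of \<open>\<alpha>(X u) - \<alpha>(X s)\<close> has order
  \<open>2 * k\<close> when raised to the power \<open>2 * k\<close>, and the factor
  \<open>(u - s) ^ (2 * k)\<close> adds \<open>4 * k\<close>.\<close>

lemma moment_bound_drift_error:
  assumes k: "0 < k"
  shows "moment_bound T (6 * k) (\<lambda>s u w. (drift s u w - (u - s) * \<alpha> (X s w)) ^ (2 * k))"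
proof -
  have "moment_bound T (2 * k) (\<lambda>s t w. (integral {s..t} (\<lambda>u. \<alpha> (X u w) - \<alpha> (X s w)) / (t - s)) ^ (2 * k))"
    by (rule moment_bound_mean[OF moment_bound_coeff_increment[OF \<alpha>_lip \<alpha>_cont] k])
       (auto intro!: borel_measurable_diff fX_measurable \<alpha>_cont continuous_on_diff continuous_on_const fX_cont_on[OF \<alpha>_cont])
  from moment_bound_scale[OF this, of "2 * k"]
  have "moment_bound T (2 * k + 2 * (2 * k)) (\<lambda>s t w. (t - s) ^ (2 * k) * (integral {s..t} (\<lambda>u. \<alpha> (X u w) - \<alpha> (X s w)) / (t - s)) ^ (2 * k))" .
  moreover have "2 * k + 2 * (2 * k) = 6 * k" by simp
  ultimately have "moment_bound T (6 * k) (\<lambda>s t w. (t - s) ^ (2 * k) * (integral {s..t} (\<lambda>u. \<alpha> (X u w) - \<alpha> (X s w)) / (t - s)) ^ (2 * k))"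
    by (simp only:)
  then show ?thesis
  proof (rule moment_bound_cong)
    fix s u :: real and w assume *: "0 \<le> s" "s < u" "w \<in> space M"
    have "integral {s..u} (\<lambda>v. \<alpha> (X v w) - \<alpha> (X s w)) = drift s u w - (u - s) * \<alpha> (X s w)"
    proof -
      have i: "(\<lambda>v. \<alpha> (X v w)) integrable_on {s..u}"
        using * by (intro integrable_continuous_real fX_cont_on \<alpha>_cont) auto
      show ?thesis unfolding drift_def using *
        by (subst Henstock_Kurzweil_Integration.integral_diff[OF i]) auto
    qed
    then show "(u - s) ^ (2 * k) * (integral {s..u} (\<lambda>u. \<alpha> (X u w) - \<alpha> (X s w)) / (u - s)) ^ (2 * k) = (drift s u w - (u - s) * \<alpha> (X s w)) ^ (2 * k)"
      using * by (simp add: power_mult_distrib[symmetric])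
  qed
qed

lemma moment_bound_drift:
  assumes k: "0 < k" and T: "0 \<le> T"
  shows "moment_bound T (4 * k) (\<lambda>s u w. drift s u w ^ (2 * k))"
proof -
  have "moment_bound T (0 + 2 * (2 * k)) (\<lambda>s u w. (u - s) ^ (2 * k) * \<bar>\<alpha> (X s w)\<bar> ^ (2 * k))"
    by (rule moment_bound_scale[OF moment_bound_start[OF \<alpha>_cont, where C = CG and p = 1]]) (use \<alpha>_growth in simp)
  then have 1: "moment_bound T (4 * k) (\<lambda>s u w. ((u - s) * \<alpha> (X s w)) ^ (2 * k))"
    by (simp add: power_mult_distrib power_even_abs)
  have 2: "moment_bound T (4 * k) (\<lambda>s u w. (drift s u w - (u - s) * \<alpha> (X s w)) ^ (2 * k))"
    by (rule moment_bound_weaken[OF moment_bound_drift_error[OF k] _ T]) simp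
  have "moment_bound T (4 * k) (\<lambda>s u w. ((drift s u w - (u - s) * \<alpha> (X s w)) + (u - s) * \<alpha> (X s w)) ^ (2 * k))"
    by (rule moment_bound_power_add[OF 2 1])
       (auto intro!: borel_measurable_diff borel_measurable_times fX_measurable continuous_intros \<alpha>_cont drift_measurable_M)
  then show ?thesis by simp
qed

text \<open>The martingale bound with \<open>y = \<beta>(X s)\<close>: the increment of the
  coefficient contributes order \<open>2 * k\<close>, and the stochastic integration another
  \<open>2 * k\<close>.\<close>

lemma moment_bound_mart_error:
  assumes k: "0 < k"
  shows "moment_bound T (4 * k) (\<lambda>s u w. (mart s u w - \<beta> (X s w) * (B u w - B s w)) ^ (2 * k))"
proof -
  let ?V = "\<lambda>(s::real) (u::real) w. (\<beta> (X u w) - \<beta> (X s w)) ^ (2 * k)"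
  have V: "moment_bound T (2 * k) ?V" by (rule moment_bound_coeff_increment[OF \<beta>_lip \<beta>_cont])
  obtain C p where "moment_est T (2 * k) ?V C p" by (rule moment_boundE[OF V])
  note C = moment_estD[OF this]
  show ?thesis
  proof (rule moment_boundI)
    show "0 \<le> moment_const k * C" using C(1) moment_const_pos[of k] by simp
    fix s t G assume *: "0 \<le> s" "s < t" "t \<le> s + T" and G: "G \<in> sets (F s)"
    let ?w = "EG G (\<lambda>w. wt p (X s w))"
    have i: "integrable_on_event G (?V s u) \<and> EG G (?V s u) \<le> C * sqrt (t - s) ^ (2 * k) * ?w" if "s \<le> u" "u \<le> t" for u
    proof (cases "s = u")
      case True
      have "0 \<le> C * sqrt (t - s) ^ (2 * k) * ?w" using C(1) * by (intro mult_nonneg_nonneg EG_wt_nonneg) auto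
      then show ?thesis using True k by (simp add: power_0_left)
    next
      case False
      then have su: "s < u" "u \<le> s + T" using that * by auto
      have "sqrt (u - s) ^ (2 * k) \<le> sqrt (t - s) ^ (2 * k)" using su that by (intro power_mono) auto
      then have "C * sqrt (u - s) ^ (2 * k) * ?w \<le> C * sqrt (t - s) ^ (2 * k) * ?w"
        using C(1) by (intro mult_right_mono mult_left_mono EG_wt_nonneg) auto
      then show ?thesis using C(2)[OF *(1) su G] C(3)[OF *(1) su G order_refl] by auto
    qed
    have "integrable_on_event G (\<lambda>w. (mart s t w - \<beta> (X s w) * (B t w - B s w)) ^ (2 * k))"
      "EG G (\<lambda>w. (mart s t w - \<beta> (X s w) * (B t w - B s w)) ^ (2 * k)) \<le> moment_const k * (t - s) ^ k * (C * sqrt (t - s) ^ (2 * k) * ?w)"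
      by (rule mart_shift_moment[OF *(1,2) G k fX_adapted[OF \<beta>_cont *(1)] i[THEN conjunct1] i[THEN conjunct2]]; assumption)+
    moreover have "moment_const k * (t - s) ^ k * (C * sqrt (t - s) ^ (2 * k) * ?w) = moment_const k * C * sqrt (t - s) ^ (4 * k) * ?w"
    proof -
      have "(t - s) ^ k = sqrt (t - s) ^ (2 * k)" using * by (simp add: power_mult)
      moreover have "sqrt (t - s) ^ (4 * k) = sqrt (t - s) ^ (2 * k) * sqrt (t - s) ^ (2 * k)" by (simp add: power_add[symmetric])
      ultimately show ?thesis by simp
    qed
    ultimately show "integrable_on_event G (\<lambda>w. (mart s t w - \<beta> (X s w) * (B t w - B s w)) ^ (2 * k)) \<and>
      EG G (\<lambda>w. (mart s t w - \<beta> (X s w) * (B t w - B s w)) ^ (2 * k)) \<le> moment_const k * C * sqrt (t - s) ^ (4 * k) * ?w"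
      by simp
  qed
qed

text \<open>The drift is as small as the error of freezing the diffusion coefficient, so it is left
  inside the error at this order.\<close>

lemma moment_bound_euler_error:
  assumes k: "0 < k" and T: "0 \<le> T"
  shows "moment_bound T (4 * k) (\<lambda>s u w. (X u w - X s w - \<beta> (X s w) * (B u w - B s w)) ^ (2 * k))"
proof -
  have "moment_bound T (4 * k) (\<lambda>s u w. (drift s u w + (mart s u w - \<beta> (X s w) * (B u w - B s w))) ^ (2 * k))"
    by (rule moment_bound_power_add[OF moment_bound_drift[OF k T] moment_bound_mart_error[OF k]])
       (auto intro!: borel_measurable_diff borel_measurable_times fX_measurable \<beta>_cont drift_measurable_M mart_measurable_M B_measurable)
  then show ?thesis by (simp add: mart_def algebra_simps)
qed

text \<open>Independence of \<open>F s\<close> makes the conditional moment a constant, which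
  corresponds to the weight \<open>wt 0\<close>.\<close>

lemma moment_bound_B: "moment_bound T (2 * k) (\<lambda>s u w. (B u w - B s w) ^ (2 * k))"
proof (rule moment_boundI)
  show "0 \<le> gauss_moment (2 * k)" by simp
  fix s t G assume *: "0 \<le> s" "s < t" "t \<le> s + T" and G: "G \<in> sets (F s)"
  have GM: "G \<in> sets M" using M_sets[OF *(1) G] .
  have i: "integrable M (indicator G :: 'w \<Rightarrow> real)" using GM by (simp add: emeasure_eq_measure)
  have "integrable M (\<lambda>w. indicator G w * (B t w - B s w) ^ (2 * k))"
    "EG G (\<lambda>w. (B t w - B s w) ^ (2 * k)) = expectation (indicator G) * expectation (\<lambda>w. (B t w - B s w) ^ (2 * k))"
    by (rule increment_integral_mult[OF *(1,2) _ _ i, of "\<lambda>x. x ^ (2 * k)"]; use G increment_moment(1)[OF *(1,2)] in simp)+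
  then show "integrable_on_event G (\<lambda>w. (B t w - B s w) ^ (2 * k)) \<and> EG G (\<lambda>w. (B t w - B s w) ^ (2 * k)) \<le> gauss_moment (2 * k) * sqrt (t - s) ^ (2 * k) * EG G (\<lambda>w. wt 0 (X s w))"
    unfolding increment_moment(2)[OF *(1,2)] by simp
qed

lemma X_mean_diff:
  assumes "0 \<le> s" "s < t" "w \<in> space M"
  shows "integral {s..t} (\<lambda>u. X u w - X s w) / (t - s) = X_mean s t w - X s w"
    "integral {s..t} (\<lambda>u. X u w - X s w - c * (B u w - B s w)) / (t - s) = X_mean s t w - X s w - c * bm_mean s t w"
proof -
  have i: "(\<lambda>u. X u w) integrable_on {s..t}" "(\<lambda>u. X u w - X s w) integrable_on {s..t}" "(\<lambda>u. c * (B u w - B s w)) integrable_on {s..t}"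
    using assms by (auto intro!: integrable_continuous_real continuous_intros X_cont_on B_cont_on)
  have 1: "integral {s..t} (\<lambda>u. X u w - X s w) = integral {s..t} (\<lambda>u. X u w) - (t - s) * X s w"
    using assms i by (subst Henstock_Kurzweil_Integration.integral_diff) auto
  then show "integral {s..t} (\<lambda>u. X u w - X s w) / (t - s) = X_mean s t w - X s w"
    using assms by (simp add: X_mean_def diff_divide_distrib)
  then show "integral {s..t} (\<lambda>u. X u w - X s w - c * (B u w - B s w)) / (t - s) = X_mean s t w - X s w - c * bm_mean s t w"
    by (subst Henstock_Kurzweil_Integration.integral_diff[OF i(2,3)]) (simp add: bm_mean_def diff_divide_distrib)
qed

lemma moment_bound_X_mean:
  assumes k: "0 < k"
  shows "moment_bound T (2 * k) (\<lambda>s t w. (X_mean s t w - X s w) ^ (2 * k))"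
proof (rule moment_bound_cong)
  show "moment_bound T (2 * k) (\<lambda>s t w. (integral {s..t} (\<lambda>u. X u w - X s w) / (t - s)) ^ (2 * k))"
    by (rule moment_bound_mean[OF moment_bound_increment k])
       (auto intro!: borel_measurable_diff X_measurable continuous_intros X_cont_on)
qed (simp add: X_mean_diff)

text \<open>Averaging in time keeps the order, so the leading term of the average of
  \<open>X - X s\<close> is \<open>\<beta>(X s)\<close> times the average of
  \<open>B - B s\<close>.\<close>

lemma moment_bound_mean_error:
  assumes k: "0 < k" and T: "0 \<le> T"
  shows "moment_bound T (4 * k) (\<lambda>s t w. (X_mean s t w - X s w - \<beta> (X s w) * bm_mean s t w) ^ (2 * k))"
proof (rule moment_bound_cong)
  show "moment_bound T (4 * k) (\<lambda>s t w. (integral {s..t} (\<lambda>u. X u w - X s w - \<beta> (X s w) * (B u w - B s w)) / (t - s)) ^ (2 * k))"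
    by (rule moment_bound_mean[OF moment_bound_euler_error[OF k T] k])
       (auto intro!: borel_measurable_diff borel_measurable_times B_measurable fX_measurable \<beta>_cont X_measurable continuous_intros X_cont_on B_cont_on)
qed (simp add: X_mean_diff)

lemma moment_bound_bm_mean:
  assumes k: "0 < k"
  shows "moment_bound T (2 * k) (\<lambda>s t w. bm_mean s t w ^ (2 * k))"
  unfolding bm_mean_def
  by (rule moment_bound_mean[OF moment_bound_B k])
     (auto intro!: borel_measurable_diff B_measurable continuous_intros B_cont_on)

text \<open>Triangle inequality through \<open>X s\<close>, from which the average differs by a term
  of known moments.\<close>

lemma moment_bound_wt_mean:
  assumes T: "0 \<le> T"
  shows "moment_bound T 0 (\<lambda>s t w. wt p (X_mean s t w))"
proof -
  let ?k = "Suc p"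
  have 1: "moment_bound T 0 (\<lambda>s t w. (X_mean s t w - X s w) ^ (2 * ?k))"
    by (rule moment_bound_weaken[OF moment_bound_X_mean _ T]) simp_all
  note 2 = moment_bound_cmult[OF moment_bound_add[OF moment_bound_wt_start[of T "2 * ?k"] 1], of "2 ^ (2 * ?k)"]
  show ?thesis
  proof (rule moment_bound_dominated[OF 2])
    show "(\<lambda>w. wt p (X_mean s t w)) \<in> borel_measurable M" if "0 \<le> s" "s < t" for s t
      using X_mean_measurable[OF that] by measurable
    fix s t w
    have "wt p (X_mean s t w) \<le> wt (2 * ?k) (X_mean s t w)" by (intro wt_mono) simp
    also have "\<dots> \<le> ((1 + \<bar>X s w\<bar>) + \<bar>X_mean s t w - X s w\<bar>) ^ (2 * ?k)" by (intro power_mono) auto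
    also have "\<dots> \<le> 2 ^ (2 * ?k) * (wt (2 * ?k) (X s w) + \<bar>X_mean s t w - X s w\<bar> ^ (2 * ?k))" by (rule power_even_add_le)
    also have "\<bar>X_mean s t w - X s w\<bar> ^ (2 * ?k) = (X_mean s t w - X s w) ^ (2 * ?k)" by (rule power_even_abs) simp
    finally have "wt p (X_mean s t w) \<le> 2 ^ (2 * ?k) * (wt (2 * ?k) (X s w) + (X_mean s t w - X s w) ^ (2 * ?k))" .
    then show "0 \<le> wt p (X_mean s t w) \<and> wt p (X_mean s t w) \<le> 2 ^ (2 * ?k) * (wt (2 * ?k) (X s w) + (X_mean s t w - X s w) ^ (2 * ?k))"
      by (intro conjI) simp_all
  qed simp
qed

text \<open>The averaged drift without its frozen leading part
  \<open>(t - s) / 2 * \<alpha>(X s)\<close>.\<close>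

definition drift_mean_error :: "real \<Rightarrow> real \<Rightarrow> 'w \<Rightarrow> real" where
  "drift_mean_error s t w = integral {s..t} (\<lambda>u. drift s u w - (u - s) * \<alpha> (X s w)) / (t - s)"

text \<open>Kept as a whole: its conditional mean given \<open>F s\<close> is exactly 0, so its size
  is harmless for the first conditional moment of \<open>\<xi>2\<close>.\<close>

definition mart_mean_path :: "real \<Rightarrow> real \<Rightarrow> 'w \<Rightarrow> real" where
  "mart_mean_path s t w = integral {s..t} (\<lambda>u. mart s u w) / (t - s)"

lemma drift_same [simp]: "drift s s w = 0" "mart s s w = 0"
  by (simp_all add: drift_def mart_def)

lemma moment_bound_drift_mean_error: "moment_bound T 6 (\<lambda>s t w. (drift_mean_error s t w)\<^sup>2)"
proof -
  have "moment_bound T (6 * 1) (\<lambda>s t w. drift_mean_error s t w ^ (2 * 1))"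
    unfolding drift_mean_error_def
    by (rule moment_bound_mean[OF moment_bound_drift_error[of 1]])
       (auto intro!: borel_measurable_diff borel_measurable_times drift_measurable_M fX_measurable \<alpha>_cont continuous_intros drift_continuous)
  then show ?thesis by simp
qed

lemma mart_continuous: "w \<in> space M \<Longrightarrow> 0 \<le> s \<Longrightarrow> continuous_on {s..t} (\<lambda>u. mart s u w)"
  unfolding mart_def by (intro continuous_intros drift_continuous X_cont_on)

text \<open>The martingale part is the increment of \<open>X\<close> minus the drift, and both have
  been estimated.\<close>

lemma moment_bound_mart:
  assumes T: "0 \<le> T" shows "moment_bound T 2 (\<lambda>s u w. mart s u w ^ (2 * 1))"
proof -
  have i1: "moment_bound T 2 (\<lambda>s u w. (X u w - X s w) ^ (2 * 1))" using moment_bound_increment[of T 1] by simp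
  have d1: "moment_bound T 2 (\<lambda>s u w. (- drift s u w) ^ (2 * 1))"
    using moment_bound_weaken[OF moment_bound_drift[OF _ T, of 1], of 2] T by simp
  have "moment_bound T 2 (\<lambda>s u w. ((X u w - X s w) + - drift s u w) ^ (2 * 1))"
    by (rule moment_bound_power_add[OF i1 d1])
       (auto intro!: borel_measurable_diff X_measurable borel_measurable_uminus drift_measurable_M)
  then show ?thesis by (simp add: mart_def)
qed

lemma moment_bound_mart_mean_path:
  assumes T: "0 \<le> T" shows "moment_bound T 2 (\<lambda>s t w. (mart_mean_path s t w)\<^sup>2)"
proof -
  have "moment_bound T 2 (\<lambda>s t w. mart_mean_path s t w ^ (2 * 1))"
    unfolding mart_mean_path_def
    by (rule moment_bound_mean[OF moment_bound_mart[OF T]])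
       (auto intro!: mart_measurable_M mart_continuous)
  then show ?thesis by simp
qed

text \<open>The average of \<open>u - s\<close> over \<open>[s, t]\<close> is
  \<open>(t - s) / 2\<close>; this is the origin of the drift term with factor 1/2 in
  \<open>H\<close>.\<close>

lemma X_mean_decomposition:
  assumes s: "0 \<le> s" "s < t" "w \<in> space M"
  shows "X_mean s t w - X s w = drift_mean_error s t w + mart_mean_path s t w + (t - s) / 2 * \<alpha> (X s w)"
proof -
  have i: "(\<lambda>u. drift s u w - (u - s) * \<alpha> (X s w)) integrable_on {s..t}" "(\<lambda>u. mart s u w) integrable_on {s..t}" "(\<lambda>u. (u - s) * \<alpha> (X s w)) integrable_on {s..t}"
    using s by (auto intro!: integrable_continuous_real continuous_intros drift_continuous mart_continuous)
  have q: "((\<lambda>u. (u - s) * \<alpha> (X s w)) has_integral ((t - s)\<^sup>2 / 2 * \<alpha> (X s w) - (s - s)\<^sup>2 / 2 * \<alpha> (X s w))) {s..t}"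
    using s by (intro fundamental_theorem_of_calculus)
     (auto intro!: derivative_eq_intros simp: has_real_derivative_iff_has_vector_derivative[symmetric])
  have "(\<lambda>u. X u w - X s w) = (\<lambda>u. (drift s u w - (u - s) * \<alpha> (X s w)) + mart s u w + (u - s) * \<alpha> (X s w))"
    by (simp add: mart_def)
  then have "integral {s..t} (\<lambda>u. X u w - X s w) = integral {s..t} (\<lambda>u. drift s u w - (u - s) * \<alpha> (X s w)) + integral {s..t} (\<lambda>u. mart s u w) + (t - s)\<^sup>2 / 2 * \<alpha> (X s w)"
    using i integral_unique[OF q] by (simp only: Henstock_Kurzweil_Integration.integral_add integrable_add) simp
  then have "X_mean s t w - X s w = (integral {s..t} (\<lambda>u. drift s u w - (u - s) * \<alpha> (X s w)) + integral {s..t} (\<lambda>u. mart s u w) + (t - s)\<^sup>2 / 2 * \<alpha> (X s w)) / (t - s)"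
    using X_mean_diff(1)[OF s] by simp
  also have "\<dots> = drift_mean_error s t w + mart_mean_path s t w + (t - s) / 2 * \<alpha> (X s w)"
  proof -
    have "d\<^sup>2 / 2 * c / d = d / 2 * c" if "d \<noteq> 0" for c d :: real using that by (simp add: power2_eq_square)
    from this[of "t - s" "\<alpha> (X s w)"] show ?thesis
      using s by (simp add: drift_mean_error_def mart_mean_path_def add_divide_distrib)
  qed
  finally show ?thesis .
qed

text \<open>Grid averages of centred variables are centred on \<open>G\<close>; boundedness in
  \<open>L2\<close> allows the passage to the limit in \<open>L1\<close>, as for the martingale part
  itself.\<close>

lemma mart_mean_path_mean:
  assumes s: "0 \<le> s" "s < t" and G: "G \<in> sets (F s)"
  shows "EG G (mart_mean_path s t) = 0"
proof -
  have GM: "G \<in> sets M" using M_sets[OF s(1) G] .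
  have sp: "space M \<in> sets (F s)" using sets.top[of "F s"] space_F[OF s(1)] by simp
  let ?g = "gridpt s t"
  define Z where "Z N w = (\<Sum>j<Suc N. mart s (?g (Suc N) j) w) / real (Suc N)" for N w
  have gp: "s \<le> ?g (Suc N) j" "?g (Suc N) j \<le> t" if "j < Suc N" for N j
    using gridpt_bounds[of s t j "Suc N"] s that by auto
  have mm: "mart s u \<in> borel_measurable M" "integrable M (\<lambda>w. (mart s u w)\<^sup>2)" "EG G (mart s u) = 0" if "s \<le> u" for u
  proof -
    show "mart s u \<in> borel_measurable M" using that s by (intro mart_measurable_M) auto
    show "integrable M (\<lambda>w. (mart s u w)\<^sup>2)" using that mart_square_integrable[OF s(1), of u] by (cases "s = u") auto
    show "EG G (mart s u) = 0" using that mart_mean[OF s(1) _ G, of u] by (cases "s = u") auto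
  qed
  have m1: "integrable M (mart s u)" if "s \<le> u" for u
    using mm(1,2)[OF that] by (rule square_integrable_imp_integrable)
  have Zm: "Z N \<in> borel_measurable M" for N
    unfolding Z_def[abs_def] using gp by (intro borel_measurable_divide borel_measurable_sum borel_measurable_const mm) auto
  have Jm: "mart_mean_path s t \<in> borel_measurable M"
    unfolding mart_mean_path_def[abs_def] using s by (intro integral_mean_measurable mm mart_continuous) auto
  have p: "(\<lambda>N. pdist (Z N) (mart_mean_path s t)) \<longlonglongrightarrow> 0"
    using s unfolding Z_def[abs_def] mart_mean_path_def[abs_def]
    by (intro AE_tendsto_pdist Zm[unfolded Z_def[abs_def]] Jm[unfolded mart_mean_path_def[abs_def]] AE_I2 integral_mean_tendsto mart_continuous) auto
  have le: "(Z N w)\<^sup>2 \<le> (\<Sum>j<Suc N. (mart s (?g (Suc N) j) w)\<^sup>2) / real (Suc N)" for N w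
    using sum_power_even_mean_le[of "Suc N" "\<lambda>j. mart s (?g (Suc N) j) w" 1] unfolding Z_def by simp
  have iS: "integrable M (\<lambda>w. (\<Sum>j<Suc N. (mart s (?g (Suc N) j) w)\<^sup>2) / real (Suc N))" for N
    using gp by (intro integrable_divide Bochner_Integration.integrable_sum mm) auto
  have Z2: "integrable M (\<lambda>w. (Z N w)\<^sup>2)" for N
  proof (rule Bochner_Integration.integrable_bound[OF iS[of N]])
    show "AE w in M. norm ((Z N w)\<^sup>2) \<le> norm ((\<Sum>j<Suc N. (mart s (?g (Suc N) j) w)\<^sup>2) / real (Suc N))"
      using order_trans[OF le abs_ge_self] by (intro AE_I2) (simp only: real_norm_def abs_power2)
    show "(\<lambda>w. (Z N w)\<^sup>2) \<in> borel_measurable M" using Zm by measurable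
  qed
  have ts: "0 \<le> t - s" using s by simp
  obtain C p where "moment_est (t - s) 2 (\<lambda>s' u. \<lambda>w. mart s' u w ^ (2 * 1)) C p" by (rule moment_boundE[OF moment_bound_mart[OF ts]])
  note C = moment_estD[OF this]
  define b where "b = C * (t - s) * EG (space M) (\<lambda>w. wt p (X s w))"
  have b0: "0 \<le> b" unfolding b_def using C(1) s by (intro mult_nonneg_nonneg EG_wt_nonneg) auto
  have mb: "expectation (\<lambda>w. (mart s u w)\<^sup>2) \<le> b" if "s \<le> u" "u \<le> t" for u
  proof (cases "s = u")
    case False
    then have u: "s < u" "u \<le> s + (t - s)" using that by auto
    have "expectation (\<lambda>w. (mart s u w)\<^sup>2) = EG (space M) (\<lambda>w. mart s u w ^ (2 * 1))"
      by (intro Bochner_Integration.integral_cong) auto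
    also have "\<dots> \<le> C * sqrt (u - s) ^ 2 * EG (space M) (\<lambda>w. wt p (X s w))" by (rule C(3)[OF s(1) u sp order_refl])
    also have "\<dots> \<le> b" unfolding b_def using u C(1) by (intro mult_right_mono mult_left_mono EG_wt_nonneg) auto
    finally show ?thesis .
  qed (use b0 in simp)
  have Z2b: "expectation (\<lambda>w. (Z N w)\<^sup>2) \<le> b" for N
  proof -
    have "expectation (\<lambda>w. (Z N w)\<^sup>2) \<le> expectation (\<lambda>w. (\<Sum>j<Suc N. (mart s (?g (Suc N) j) w)\<^sup>2) / real (Suc N))"
      by (intro integral_mono Z2 iS le)
    also have "\<dots> = (\<Sum>j<Suc N. expectation (\<lambda>w. (mart s (?g (Suc N) j) w)\<^sup>2)) / real (Suc N)"
      using gp mm by (subst integral_divide_zero, subst Bochner_Integration.integral_sum) auto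
    also have "\<dots> \<le> (\<Sum>j<Suc N. b) / real (Suc N)" using gp by (intro divide_right_mono sum_mono mb) auto
    finally show ?thesis by simp
  qed
  note L1 = pdist_L2_bounded_tendsto_L1[OF Zm Jm p Z2 Z2b]
  have Z0: "EG G (Z N) = 0" for N
  proof -
    have eq: "indicator G w * Z N w = (\<Sum>j<Suc N. indicator G w * mart s (?g (Suc N) j) w) / real (Suc N)" for w
      unfolding Z_def by (simp only: sum_distrib_left times_divide_eq_right)
    show ?thesis unfolding eq using gp mm(3) integrable_imp_on_event[OF m1 GM]
      by (subst integral_divide_zero, subst Bochner_Integration.integral_sum) auto
  qed
  have iG: "integrable_on_event G (mart_mean_path s t)" "integrable_on_event G (Z N)" for N
    using L1(3,4) GM by (auto intro: integrable_imp_on_event)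
  have "\<bar>EG G (mart_mean_path s t)\<bar> \<le> expectation (\<lambda>w. \<bar>Z N w - mart_mean_path s t w\<bar>)" for N
  proof -
    have "EG G (mart_mean_path s t) = expectation (\<lambda>w. indicator G w * mart_mean_path s t w - indicator G w * Z N w)"
      using iG Z0[of N] by simp
    then have "\<bar>EG G (mart_mean_path s t)\<bar> = \<bar>expectation (\<lambda>w. indicator G w * mart_mean_path s t w - indicator G w * Z N w)\<bar>"
      by (rule arg_cong)
    also have "\<dots> \<le> expectation (\<lambda>w. \<bar>indicator G w * mart_mean_path s t w - indicator G w * Z N w\<bar>)"
      by (rule integral_abs_bound)
    also have "\<dots> \<le> expectation (\<lambda>w. \<bar>Z N w - mart_mean_path s t w\<bar>)"
    proof (rule integral_mono)
      show "integrable M (\<lambda>w. \<bar>indicator G w * mart_mean_path s t w - indicator G w * Z N w\<bar>)"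
        by (intro integrable_abs Bochner_Integration.integrable_diff iG)
      show "integrable M (\<lambda>w. \<bar>Z N w - mart_mean_path s t w\<bar>)"
        by (intro integrable_abs Bochner_Integration.integrable_diff L1(3,4))
      show "\<bar>indicator G w * mart_mean_path s t w - indicator G w * Z N w\<bar> \<le> \<bar>Z N w - mart_mean_path s t w\<bar>" for w
        by (simp add: indicator_def abs_minus_commute)
    qed
    finally show ?thesis .
  qed
  then have "\<bar>EG G (mart_mean_path s t)\<bar> \<le> 0" by (intro LIMSEQ_le_const[OF L1(5)]) auto
  then show ?thesis by simp
qed

end

context prob_space
begin

text \<open>Independence is known for the sigma-algebra of \<open>\<xi>\<close> and for
  \<open>A\<close>; those generated by \<open>\<phi>\<close> of \<open>\<xi>\<close> and by the
  indicator of \<open>G\<close> are contained in them.\<close>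

lemma indep_of_alg_integral:
  fixes \<phi> :: "real \<Rightarrow> real"
  assumes ind: "indep_of_alg M \<xi> A" and sub: "subalgebra M A" and G: "G \<in> sets A" and \<xi>[measurable]: "\<xi> \<in> borel_measurable M"
    and \<phi>[measurable]: "\<phi> \<in> borel_measurable borel" and i: "integrable M (\<lambda>w. \<phi> (\<xi> w))"
  shows "EG G (\<lambda>w. \<phi> (\<xi> w)) = prob G * expectation (\<lambda>w. \<phi> (\<xi> w))"
proof -
  have GM[measurable]: "G \<in> sets M" and sp: "space A = space M" using G sub unfolding subalgebra_def by auto
  have 1: "sigma_sets (space M) {(indicator G :: 'a \<Rightarrow> real) -` E \<inter> space M | E. E \<in> sets borel} \<subseteq> sets A"
  proof -
    have "(indicator G :: 'a \<Rightarrow> real) \<in> borel_measurable A" using G by simp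
    then have "sigma_sets (space A) {(indicator G :: 'a \<Rightarrow> real) -` E \<inter> space A | E. E \<in> sets borel} \<subseteq> sets A"
      by (intro sets.sigma_sets_subset) (auto intro: measurable_sets)
    then show ?thesis using sp by simp
  qed
  have 2: "sigma_sets (space M) {(\<lambda>w. \<phi> (\<xi> w)) -` E \<inter> space M | E. E \<in> sets borel} \<subseteq> sets (vimage_algebra (space M) \<xi> borel)"
  proof (subst space_vimage_algebra[symmetric, of _ \<xi> borel], rule sets.sigma_sets_subset)
    show "{(\<lambda>w. \<phi> (\<xi> w)) -` E \<inter> space M |E. E \<in> sets borel} \<subseteq> sets (vimage_algebra (space M) \<xi> borel)"
    proof safe
      fix E :: "real set" assume "E \<in> sets borel"
      then have "\<phi> -` E \<inter> space borel \<in> sets borel" by measurable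
      then have "\<xi> -` (\<phi> -` E) \<inter> space M \<in> sets (vimage_algebra (space M) \<xi> borel)" by (intro in_vimage_algebra) simp
      moreover have "(\<lambda>w. \<phi> (\<xi> w)) -` E \<inter> space M = \<xi> -` (\<phi> -` E) \<inter> space M" by auto
      ultimately show "(\<lambda>w. \<phi> (\<xi> w)) -` E \<inter> space M \<in> sets (vimage_algebra (space M) \<xi> borel)" by simp
    qed
  qed
  have ind': "\<forall>a\<in>sets (vimage_algebra (space M) \<xi> borel). \<forall>b\<in>sets A. prob (a \<inter> b) = prob a * prob b"
    "sets (vimage_algebra (space M) \<xi> borel) \<subseteq> events" "sets A \<subseteq> events"
    using ind unfolding indep_of_alg_def indep_alg_def indep_sets2_eq by auto
  have "indep_var borel (indicator G :: 'a \<Rightarrow> real) borel (\<lambda>w. \<phi> (\<xi> w))"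
    unfolding indep_var_eq indep_sets2_eq
  proof (intro conjI ballI)
    show "sigma_sets (space M) {(indicator G :: 'a \<Rightarrow> real) -` E \<inter> space M | E. E \<in> sets borel} \<subseteq> events"
      using 1 ind'(3) by (rule subset_trans)
    show "sigma_sets (space M) {(\<lambda>w. \<phi> (\<xi> w)) -` E \<inter> space M | E. E \<in> sets borel} \<subseteq> events"
      using 2 ind'(2) by (rule subset_trans)
    fix a b assume a: "a \<in> sigma_sets (space M) {(indicator G :: 'a \<Rightarrow> real) -` E \<inter> space M | E. E \<in> sets borel}"
      and b: "b \<in> sigma_sets (space M) {(\<lambda>w. \<phi> (\<xi> w)) -` E \<inter> space M | E. E \<in> sets borel}"
    have "prob (b \<inter> a) = prob b * prob a" using ind'(1) subsetD[OF 1 a] subsetD[OF 2 b] by blast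
    then show "prob (a \<inter> b) = prob a * prob b" by (simp only: Int_commute mult.commute)
  qed auto
  from indep_var_lebesgue_integral[OF this _ i] show ?thesis by (simp add: emeasure_eq_measure)
qed

end

context stationary_diffusion
begin

text \<open>The path attains its extremes on the compact time interval and the average lies between
  them. As \<open>S\<close> is an interval, the growth and Taylor bounds for \<open>f\<close> are
  available at the average.\<close>

lemma X_mean_S:
  assumes s: "0 \<le> s" "s < t" "w \<in> space M"
  shows "X_mean s t w \<in> S"
proof -
  have c: "continuous_on {s..t} (\<lambda>u. X u w)" using s by (intro X_cont_on) auto
  have i: "(\<lambda>u. X u w) integrable_on {s..t}" by (rule integrable_continuous_real[OF c])
  have ne: "{s..t} \<noteq> {}" using s by simp
  obtain a where a: "a \<in> {s..t}" "\<And>u. u \<in> {s..t} \<Longrightarrow> X a w \<le> X u w"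
    using continuous_attains_inf[OF compact_Icc ne c] by blast
  obtain b where b: "b \<in> {s..t}" "\<And>u. u \<in> {s..t} \<Longrightarrow> X u w \<le> X b w"
    using continuous_attains_sup[OF compact_Icc ne c] by blast
  have "integral {s..t} (\<lambda>_. X a w) \<le> integral {s..t} (\<lambda>u. X u w)"
    using a i by (intro integral_le) auto
  then have "(t - s) * X a w \<le> integral {s..t} (\<lambda>u. X u w)" using s by simp
  then have 1: "X a w \<le> X_mean s t w" using s by (simp add: X_mean_def field_simps)
  have "integral {s..t} (\<lambda>u. X u w) \<le> integral {s..t} (\<lambda>_. X b w)"
    using b i by (intro integral_le) auto
  then have "integral {s..t} (\<lambda>u. X u w) \<le> (t - s) * X b w" using s by simp
  then have 2: "X_mean s t w \<le> X b w" using s by (simp add: X_mean_def field_simps)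
  have "X a w \<in> S" "X b w \<in> S" using a b s by (auto intro!: X_S)
  then show ?thesis using mem_is_interval_1_I[OF S_interval _ _ 1 2] by blast
qed

text \<open>All three follow from the law \<open>N(0, 1/3)\<close> of the normalised average and its
  independence of \<open>F s\<close>.\<close>

lemma bm_mean_facts:
  assumes s: "0 \<le> s" "s < t"
  shows "integrable M (\<lambda>w. bm_mean s t w ^ i)" "G \<in> sets (F s) \<Longrightarrow> EG G (bm_mean s t) = 0"
    "G \<in> sets (F s) \<Longrightarrow> EG G (\<lambda>w. (bm_mean s t w)\<^sup>2 - (t - s) / 3) = 0"
proof -
  let ?\<xi> = "\<lambda>w. bm_mean s t w / sqrt (t - s)"
  have r: "sqrt (t - s) \<noteq> 0" "(sqrt (t - s))\<^sup>2 = t - s" using s by auto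
  note \<xi> = bm_mean_gaussian[OF B_cont s]
  have [measurable]: "bm_mean s t \<in> borel_measurable M" by (rule bm_mean_measurable_M[OF s])
  have \<xi>m: "?\<xi> \<in> borel_measurable M" by measurable
  have eq: "bm_mean s t w ^ i = sqrt (t - s) ^ i * ?\<xi> w ^ i" for w i
    using r by (simp add: power_mult_distrib[symmetric])
  have third: "0 < (1 / 3 :: real)" by simp
  have i: "integrable M (\<lambda>w. ?\<xi> w ^ i)" for i by (rule gaussian_moments(1)[OF \<xi>(2) third])
  show int: "integrable M (\<lambda>w. bm_mean s t w ^ i)" for i unfolding eq by (rule integrable_mult_right[OF i])
  have E2: "expectation (\<lambda>w. (?\<xi> w)\<^sup>2) = 1 / 3" by (rule gaussian_moments(2)[OF \<xi>(2) third])
  have E1: "expectation ?\<xi> = 0"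
  proof -
    have "expectation (\<lambda>w. ?\<xi> w ^ (2 * 0 + 1)) = (\<integral>x. normal_density 0 (sqrt (1 / 3)) x * (x - 0) ^ (2 * 0 + 1) \<partial>lborel)"
      using distributed_integral[OF \<xi>(2), of "\<lambda>x. x ^ (2 * 0 + 1)"] by simp
    also have "\<dots> = 0" by (rule integral_normal_moment_odd) simp
    finally show ?thesis by simp
  qed
  assume G: "G \<in> sets (F s)"
  have GM: "G \<in> sets M" using M_sets[OF s(1) G] .
  have i1: "integrable M ?\<xi>" using i[of 1] by (simp only: power_one_right)
  have "EG G ?\<xi> = prob G * expectation ?\<xi>"
    using i1
    by (intro indep_of_alg_integral[OF \<xi>(3) subalg[OF s(1)] G \<xi>m, where \<phi> = "\<lambda>x. x"]) auto
  then have "EG G (\<lambda>w. sqrt (t - s) * ?\<xi> w) = 0"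
    using EG_cmult(2)[OF integrable_imp_on_event[OF i1 GM], of "sqrt (t - s)"] unfolding E1 by (simp only: mult_zero_right)
  moreover have "t \<noteq> s" using s by simp
  ultimately show "EG G (bm_mean s t) = 0" by simp
  have "EG G (\<lambda>w. (?\<xi> w)\<^sup>2) = prob G * expectation (\<lambda>w. (?\<xi> w)\<^sup>2)"
    by (rule indep_of_alg_integral[OF \<xi>(3) subalg[OF s(1)] G \<xi>m, where \<phi> = "\<lambda>x. x\<^sup>2"]) (use i[of 2] in auto)
  then have 2: "EG G (\<lambda>w. (bm_mean s t w)\<^sup>2) = (t - s) * (prob G / 3)"
    unfolding eq using EG_cmult(2)[OF integrable_imp_on_event[OF i[of 2] GM], of "sqrt (t - s) ^ 2"] unfolding E2 r(2) by simp
  have 3: "EG G (\<lambda>w. 1) = prob G" using GM by simp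
  have "EG G (\<lambda>w. 1 * (bm_mean s t w)\<^sup>2 + (- ((t - s) / 3)) * 1) = 1 * EG G (\<lambda>w. (bm_mean s t w)\<^sup>2) + (- ((t - s) / 3)) * EG G (\<lambda>w. 1)"
    by (rule EG_linear(2)) (rule integrable_imp_on_event[OF int GM], rule integrable_imp_on_event[OF _ GM], simp)
  then show "EG G (\<lambda>w. (bm_mean s t w)\<^sup>2 - (t - s) / 3) = 0" unfolding 2 3 by simp
qed

end

section \<open>Expansion of the test function at the time average\<close>

text \<open>\<open>f1\<close> and \<open>f2\<close> stand for the first two derivatives and enter
  through their growth and two Taylor estimates, with a weight at each of the two points.
  \<open>T\<close> bounds the step size, and the constants are uniform up to it.\<close>

locale diffusion_expansion = stationary_diffusion M F B X \<alpha> \<beta> S CG CL pL for M :: "'w measure" and F B X \<alpha> \<beta> S CG CL pL +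
  fixes f f1 f2 :: "real \<Rightarrow> real" and C :: real and p :: nat and T :: real
  assumes T: "0 \<le> T" and C0: "0 \<le> C"
    and f_cont: "continuous_on S f" and f1_cont: "continuous_on S f1" and f2_cont: "continuous_on S f2"
    and f1_bound: "x \<in> S \<Longrightarrow> \<bar>f1 x\<bar> \<le> C * wt p x" and f2_bound: "x \<in> S \<Longrightarrow> \<bar>f2 x\<bar> \<le> C * wt p x"
    and taylor2: "x \<in> S \<Longrightarrow> y \<in> S \<Longrightarrow> \<bar>f y - f x - f1 x * (y - x)\<bar> \<le> C * (wt p x * wt p y) * \<bar>y - x\<bar> ^ 2"
    and taylor3: "x \<in> S \<Longrightarrow> y \<in> S \<Longrightarrow> \<bar>f y - f x - f1 x * (y - x) - f2 x / 2 * (y - x)\<^sup>2\<bar> \<le> C * (wt p x * wt p y) * \<bar>y - x\<bar> ^ 3"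
begin

text \<open>This is \<open>\<xi>2\<close>: the defect that makes the expansion an identity.\<close>

definition rem_term :: "real \<Rightarrow> real \<Rightarrow> 'w \<Rightarrow> real" where
  "rem_term s t w = f (X_mean s t w) - f (X s w) - f1 (X s w) * \<beta> (X s w) * bm_mean s t w"

text \<open>The operator \<open>H\<close> with its terms collected: the coefficient of
  \<open>\<beta>\<^sup>2 * f2\<close> is 1/4 - 1/12 = 1/6, half the variance 1/3 of
  \<open>\<xi>1\<close>.\<close>

definition H_op :: "real \<Rightarrow> real" where
  "H_op x = \<alpha> x * f1 x / 2 + (\<beta> x)\<^sup>2 * f2 x / 6"

abbreviation mean_err :: "real \<Rightarrow> real \<Rightarrow> 'w \<Rightarrow> real" where
  "mean_err s t w \<equiv> X_mean s t w - X s w - \<beta> (X s w) * bm_mean s t w"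

lemma meas:
  assumes "0 \<le> s" "s < t"
  shows "(\<lambda>w. f1 (X s w)) \<in> borel_measurable M" "(\<lambda>w. f2 (X s w)) \<in> borel_measurable M" "(\<lambda>w. \<beta> (X s w)) \<in> borel_measurable M"
    "(\<lambda>w. f (X s w)) \<in> borel_measurable M" "(\<lambda>w. f (X_mean s t w)) \<in> borel_measurable M"
    "X s \<in> borel_measurable M" "X_mean s t \<in> borel_measurable M" "bm_mean s t \<in> borel_measurable M"
    "drift_mean_error s t \<in> borel_measurable M" "mart_mean_path s t \<in> borel_measurable M" "rem_term s t \<in> borel_measurable M"
proof -
  show 1: "(\<lambda>w. f1 (X s w)) \<in> borel_measurable M" "(\<lambda>w. f2 (X s w)) \<in> borel_measurable M" "(\<lambda>w. \<beta> (X s w)) \<in> borel_measurable M"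
    "(\<lambda>w. f (X s w)) \<in> borel_measurable M" "X s \<in> borel_measurable M"
    using assms by (auto intro!: fX_measurable f_cont f1_cont f2_cont \<beta>_cont)
  show 2: "(\<lambda>w. f (X_mean s t w)) \<in> borel_measurable M"
    by (rule measurable_continuous_on_open[OF f_cont S_open X_mean_measurable[OF assms] X_mean_S[OF assms]])
  show 3: "X_mean s t \<in> borel_measurable M" "bm_mean s t \<in> borel_measurable M"
    using assms X_mean_measurable bm_mean_measurable_M by auto
  show "drift_mean_error s t \<in> borel_measurable M"
    unfolding drift_mean_error_def[abs_def] using assms
    by (intro integral_mean_measurable borel_measurable_diff borel_measurable_times drift_measurable_M fX_measurable \<alpha>_cont borel_measurable_const
      continuous_on_diff drift_continuous continuous_on_mult continuous_on_id continuous_on_const) auto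
  show "mart_mean_path s t \<in> borel_measurable M"
    unfolding mart_mean_path_def[abs_def] using assms
    by (intro integral_mean_measurable mart_measurable_M mart_continuous) auto
  show "rem_term s t \<in> borel_measurable M"
    unfolding rem_term_def[abs_def] by (intro borel_measurable_diff borel_measurable_times 1 2 3)
qed

lemma f\<beta>_cont: "continuous_on S (\<lambda>x. f2 x * \<beta> x)" by (intro continuous_intros f2_cont \<beta>_cont)

lemma f\<beta>_bound: "x \<in> S \<Longrightarrow> \<bar>f2 x * \<beta> x\<bar> \<le> (C * CG) * wt (p + 1) x"
proof -
  assume x: "x \<in> S"
  have "\<bar>f2 x\<bar> * \<bar>\<beta> x\<bar> \<le> (C * wt p x) * (CG * (1 + \<bar>x\<bar>))"
    using C0 f2_bound[OF x] \<beta>_growth[OF x] by (intro mult_mono) auto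
  then show ?thesis by (simp add: abs_mult ac_simps)
qed

lemma moment_bound_start_sq:
  assumes "continuous_on S (\<phi> :: real \<Rightarrow> real)" "\<And>x. x \<in> S \<Longrightarrow> \<bar>\<phi> x\<bar> \<le> D * wt q x"
  shows "moment_bound T (2 * 0) (\<lambda>s u w. (\<phi> (X s w))\<^sup>2)" "moment_bound T (2 * 0) (\<lambda>s u w. ((\<phi> (X s w))\<^sup>2)\<^sup>2)"
  using moment_bound_start[OF assms, of T 2] moment_bound_start[OF assms, of T 4] by simp_all

lemma mean_err_sq: "moment_bound T (2 * 2) (\<lambda>s t w. (mean_err s t w)\<^sup>2)" "moment_bound T (2 * 4) (\<lambda>s t w. ((mean_err s t w)\<^sup>2)\<^sup>2)"
proof -
  show "moment_bound T (2 * 2) (\<lambda>s t w. (mean_err s t w)\<^sup>2)" using moment_bound_mean_error[OF _ T, of 1] by simp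
  show "moment_bound T (2 * 4) (\<lambda>s t w. ((mean_err s t w)\<^sup>2)\<^sup>2)" using moment_bound_mean_error[OF _ T, of 2] by simp
qed

text \<open>The averaged drift error has order 3 and the factor \<open>f1(X s)\<close> order
  0.\<close>

lemma f1_drift_bound: "moment_bound T 3 (\<lambda>s t w. \<bar>f1 (X s w) * drift_mean_error s t w\<bar>)"
proof -
  have "moment_bound T (0 + 3) (\<lambda>s t w. \<bar>f1 (X s w) * drift_mean_error s t w\<bar>)"
    by (rule moment_bound_mult[OF moment_bound_start_sq(1)[OF f1_cont f1_bound]])
       (use moment_bound_drift_mean_error[of T] meas in auto)
  then show ?thesis by simp
qed

text \<open>The cross term in the square of \<open>\<beta>(X s) * bm_mean + mean_err\<close>: order
  1 for the Brownian average, order 2 for the error.\<close>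

lemma cross_bound: "moment_bound T 3 (\<lambda>s t w. \<bar>(f2 (X s w) * \<beta> (X s w) * bm_mean s t w) * mean_err s t w\<bar>)"
proof -
  have "moment_bound T (2 * 2) (\<lambda>s t w. ((bm_mean s t w)\<^sup>2)\<^sup>2)" using moment_bound_bm_mean[of 2 T] by simp
  then have "moment_bound T (0 + 2) (\<lambda>s t w. \<bar>(f2 (X s w) * \<beta> (X s w))\<^sup>2 * (bm_mean s t w)\<^sup>2\<bar>)"
    by (intro moment_bound_mult[OF moment_bound_start_sq(2)[OF f\<beta>_cont f\<beta>_bound]] borel_measurable_power borel_measurable_times meas)
  moreover have "\<bar>(f2 (X s w) * \<beta> (X s w))\<^sup>2 * (bm_mean s t w)\<^sup>2\<bar> = (f2 (X s w) * \<beta> (X s w) * bm_mean s t w)\<^sup>2" for s t w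
    by (simp add: power_mult_distrib abs_mult)
  moreover have "0 + 2 = 2 * (1 :: nat)" by simp
  ultimately have V: "moment_bound T (2 * 1) (\<lambda>s t w. (f2 (X s w) * \<beta> (X s w) * bm_mean s t w)\<^sup>2)"
    by (simp only:)
  have "moment_bound T (1 + 2) (\<lambda>s t w. \<bar>(f2 (X s w) * \<beta> (X s w) * bm_mean s t w) * mean_err s t w\<bar>)"
    by (intro moment_bound_mult[OF V mean_err_sq(1)] borel_measurable_diff borel_measurable_times meas)
  moreover have "1 + 2 = (3 :: nat)" by simp
  ultimately show ?thesis by (simp only:)
qed

lemma f2_err_bound: "moment_bound T 3 (\<lambda>s t w. \<bar>f2 (X s w) * (mean_err s t w)\<^sup>2\<bar>)"
proof -
  have "moment_bound T (0 + 4) (\<lambda>s t w. \<bar>f2 (X s w) * (mean_err s t w)\<^sup>2\<bar>)"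
    by (intro moment_bound_mult[OF moment_bound_start_sq(1)[OF f2_cont f2_bound] mean_err_sq(2)] borel_measurable_power borel_measurable_diff borel_measurable_times meas)
  then show ?thesis by (rule moment_bound_weaken[OF _ _ T]) simp
qed

lemma weights_bound: "moment_bound T (2 * 0) (\<lambda>s t w. (wt q (X s w) * wt q (X_mean s t w))\<^sup>2)"
proof -
  have wm: "(\<lambda>w. wt q (X s w)) \<in> borel_measurable M" "(\<lambda>w. wt q (X_mean s t w)) \<in> borel_measurable M" if "0 \<le> s" "s < t" for s t q
    using meas(6,7)[OF that] by measurable
  have "moment_bound T (0 + 0) (\<lambda>s t w. \<bar>wt (2 * q) (X s w) * wt (2 * q) (X_mean s t w)\<bar> :: real)"
    by (rule moment_bound_mult) (simp_all add: power_mult[symmetric] moment_bound_wt_start moment_bound_wt_mean[OF T] wm)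
  then show ?thesis
    by (simp add: power_mult_distrib power_mult[symmetric] mult.commute abs_mult)
qed

text \<open>The \<open>k\<close>-th power of the difference gives order \<open>k\<close>; the
  weights at \<open>X s\<close> and at the average have order 0.\<close>

lemma taylor_bound: "moment_bound T k (\<lambda>s t w. C * \<bar>(wt p (X s w) * wt p (X_mean s t w)) * (X_mean s t w - X s w) ^ k\<bar>)" if "0 < k"
proof (rule moment_bound_cmult[OF _ C0])
  have wm: "(\<lambda>w. wt q (X s w)) \<in> borel_measurable M" "(\<lambda>w. wt q (X_mean s t w)) \<in> borel_measurable M" if "0 \<le> s" "s < t" for s t q
    using meas(6,7)[OF that] by measurable
  have D: "moment_bound T (2 * k) (\<lambda>s t w. ((X_mean s t w - X s w) ^ k)\<^sup>2)"
    using moment_bound_X_mean[OF that, of T] by (simp only: power_mult[symmetric] mult.commute)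
  have "moment_bound T (0 + k) (\<lambda>s t w. \<bar>(wt p (X s w) * wt p (X_mean s t w)) * (X_mean s t w - X s w) ^ k\<bar>)"
    by (intro moment_bound_mult[OF weights_bound D] borel_measurable_times borel_measurable_power borel_measurable_diff wm meas)
  then show "moment_bound T k (\<lambda>s t w. \<bar>(wt p (X s w) * wt p (X_mean s t w)) * (X_mean s t w - X s w) ^ k\<bar>)" by simp
qed

text \<open>What remains after removing \<open>H\<close> and the terms of conditional mean 0. The
  last summand has a plus sign because it undoes a subtraction in \<open>rem_term\<close>; it, too,
  has conditional mean 0.\<close>

definition expansion_rest :: "real \<Rightarrow> real \<Rightarrow> 'w \<Rightarrow> real" where
  "expansion_rest s t w = rem_term s t w - (t - s) * H_op (X s w) - f1 (X s w) * mart_mean_path s t w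
     - f2 (X s w) * (\<beta> (X s w))\<^sup>2 / 2 * ((bm_mean s t w)\<^sup>2 - (t - s) / 3) + f1 (X s w) * \<beta> (X s w) * bm_mean s t w"

text \<open>Two decompositions of the same difference are used: in the linear Taylor term the one
  into drift error, martingale average and \<open>(t - s) / 2 * \<alpha>\<close>, in the quadratic
  term the one into \<open>\<beta> * N\<close> and \<open>e\<close>. The leading parts cancel
  against \<open>H\<close> and the centred terms, and each of the four terms left has order
  3.\<close>

lemma expansion_rest_bound: "moment_bound T 3 (\<lambda>s t w. \<bar>expansion_rest s t w\<bar>)"
proof -
  note b = moment_bound_add[OF moment_bound_add[OF moment_bound_add[OF f1_drift_bound cross_bound] f2_err_bound] taylor_bound[of 3, simplified]]
  show ?thesis
  proof (rule moment_bound_dominated[OF b])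
    show "(\<lambda>w. \<bar>expansion_rest s t w\<bar>) \<in> borel_measurable M" if "0 \<le> s" "s < t" for s t
    proof -
      have "(\<lambda>w. H_op (X s w)) \<in> borel_measurable M" unfolding H_op_def using that
        by (intro fX_measurable continuous_intros \<alpha>_cont \<beta>_cont f1_cont f2_cont) auto
      then show ?thesis unfolding expansion_rest_def using meas[OF that] by measurable
    qed
    fix s t :: real and w assume s: "0 \<le> s" "s < t" "w \<in> space M"
    define x y N e D where "x = X s w" "y = X_mean s t w" "N = bm_mean s t w" "e = mean_err s t w" "D = drift_mean_error s t w"
    note defs = x_y_N_e_D_def
    define r where "r = f y - f x - f1 x * (y - x) - f2 x / 2 * (y - x)\<^sup>2"
    have xy: "x \<in> S" "y \<in> S" using s X_mean_S X_S by (auto simp: defs)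
    have dec: "y - x = D + mart_mean_path s t w + (t - s) / 2 * \<alpha> x" unfolding defs by (rule X_mean_decomposition[OF s])
    have ye: "y - x = \<beta> x * N + e" by (simp add: defs)
    have "expansion_rest s t w = f y - f x - (t - s) * H_op x - f1 x * mart_mean_path s t w - f2 x * (\<beta> x)\<^sup>2 / 2 * (N\<^sup>2 - (t - s) / 3)"
      by (simp add: expansion_rest_def rem_term_def defs)
    also have "f y - f x = r + f1 x * (D + mart_mean_path s t w + (t - s) / 2 * \<alpha> x) + f2 x / 2 * (\<beta> x * N + e)\<^sup>2"
      unfolding dec[symmetric] ye[symmetric] by (simp add: r_def)
    finally have eq: "expansion_rest s t w = f1 x * D + (f2 x * \<beta> x * N) * e + f2 x * e\<^sup>2 / 2 + r"
      by (simp add: H_op_def power2_eq_square algebra_simps diff_divide_distrib add_divide_distrib)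
    have "\<bar>r\<bar> \<le> C * \<bar>(wt p x * wt p y) * (y - x) ^ 3\<bar>"
      unfolding r_def using taylor3[OF xy] by (simp add: abs_mult power_abs mult.assoc)
    moreover have "\<bar>f2 x * e\<^sup>2 / 2\<bar> \<le> \<bar>f2 x * e\<^sup>2\<bar>" by simp
    ultimately have "\<bar>expansion_rest s t w\<bar> \<le> \<bar>f1 x * D\<bar> + \<bar>(f2 x * \<beta> x * N) * e\<bar> + \<bar>f2 x * e\<^sup>2\<bar> + C * \<bar>(wt p x * wt p y) * (y - x) ^ 3\<bar>"
      unfolding eq by linarith
    then show "0 \<le> \<bar>expansion_rest s t w\<bar> \<and> \<bar>expansion_rest s t w\<bar> \<le> \<bar>f1 (X s w) * drift_mean_error s t w\<bar> + \<bar>(f2 (X s w) * \<beta> (X s w) * bm_mean s t w) * mean_err s t w\<bar>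
      + \<bar>f2 (X s w) * (mean_err s t w)\<^sup>2\<bar> + C * \<bar>(wt p (X s w) * wt p (X_mean s t w)) * (X_mean s t w - X s w) ^ 3\<bar>"
      by (simp add: defs)
  qed
qed

text \<open>Taylor expansion to first order suffices here: \<open>rem_term\<close> is
  \<open>f1 * e\<close> plus a quadratic remainder, both of order 2, so the square has order
  4.\<close>

lemma rem_term_square_bound: "moment_bound T 4 (\<lambda>s t w. (rem_term s t w)\<^sup>2)"
proof -
  have wm: "(\<lambda>w. wt q (X s w)) \<in> borel_measurable M" "(\<lambda>w. wt q (X_mean s t w)) \<in> borel_measurable M" if "0 \<le> s" "s < t" for s t q
    using meas(6,7)[OF that] by measurable
  have 1: "moment_bound T (0 + 4) (\<lambda>s t w. \<bar>(f1 (X s w))\<^sup>2 * (mean_err s t w)\<^sup>2\<bar>)"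
    by (intro moment_bound_mult[OF moment_bound_start_sq(2)[OF f1_cont f1_bound] mean_err_sq(2)] borel_measurable_power borel_measurable_diff borel_measurable_times meas)
  have w: "moment_bound T (2 * 0) (\<lambda>s t w. ((wt (2 * p) (X s w) * wt (2 * p) (X_mean s t w)))\<^sup>2)" by (rule weights_bound)
  have D: "moment_bound T (2 * 4) (\<lambda>s t w. ((X_mean s t w - X s w) ^ 4)\<^sup>2)"
    using moment_bound_X_mean[of 4 T] by simp
  have 2: "moment_bound T (0 + 4) (\<lambda>s t w. \<bar>(wt (2 * p) (X s w) * wt (2 * p) (X_mean s t w)) * (X_mean s t w - X s w) ^ 4\<bar>)"
    by (intro moment_bound_mult[OF w D] borel_measurable_times borel_measurable_power borel_measurable_diff wm meas)
  have b: "moment_bound T 4 (\<lambda>s t w. 2 * \<bar>(f1 (X s w))\<^sup>2 * (mean_err s t w)\<^sup>2\<bar> + 2 * C\<^sup>2 * \<bar>(wt (2 * p) (X s w) * wt (2 * p) (X_mean s t w)) * (X_mean s t w - X s w) ^ 4\<bar>)"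
    using 1 2 by (intro moment_bound_add moment_bound_cmult) auto
  show ?thesis
  proof (rule moment_bound_dominated[OF b])
    show "(\<lambda>w. (rem_term s t w)\<^sup>2) \<in> borel_measurable M" if "0 \<le> s" "s < t" for s t
      using meas(11)[OF that] by measurable
    fix s t :: real and w assume s: "0 \<le> s" "s < t" "w \<in> space M"
    define x y e where "x = X s w" "y = X_mean s t w" "e = mean_err s t w"
    note defs = x_y_e_def
    define r where "r = f y - f x - f1 x * (y - x)"
    have xy: "x \<in> S" "y \<in> S" using s X_mean_S X_S by (auto simp: defs)
    have eq: "rem_term s t w = f1 x * e + r" by (simp add: rem_term_def r_def defs algebra_simps)
    have "\<bar>r\<bar> ^ 2 \<le> (C * (wt p x * wt p y) * \<bar>y - x\<bar> ^ 2) ^ 2" unfolding r_def by (intro power_mono taylor2 xy) simp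
    also have "\<dots> = C\<^sup>2 * \<bar>(wt (2 * p) x * wt (2 * p) y) * (y - x) ^ 4\<bar>"
    proof -
      have "\<bar>(wt (2 * p) x * wt (2 * p) y) * (y - x) ^ 4\<bar> = (wt (2 * p) x * wt (2 * p) y) * (y - x) ^ 4" by (intro abs_of_nonneg) simp
      moreover have "(\<bar>y - x\<bar> ^ 2) ^ 2 = (y - x) ^ 4" by simp
      moreover have "wt (2 * p) z = (wt p z)\<^sup>2" for z by (simp add: power_mult[symmetric] mult.commute)
      ultimately show ?thesis by (simp only: power_mult_distrib mult.assoc)
    qed
    finally have r2: "r\<^sup>2 \<le> C\<^sup>2 * \<bar>(wt (2 * p) x * wt (2 * p) y) * (y - x) ^ 4\<bar>" by simp
    have "(f1 x * e + r)\<^sup>2 \<le> 2 * (f1 x * e)\<^sup>2 + 2 * r\<^sup>2"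
      using sum_squares_ge_zero[of "f1 x * e - r" 0] by (simp add: power2_eq_square algebra_simps)
    then have "(rem_term s t w)\<^sup>2 \<le> 2 * \<bar>(f1 x)\<^sup>2 * e\<^sup>2\<bar> + 2 * C\<^sup>2 * \<bar>(wt (2 * p) x * wt (2 * p) y) * (y - x) ^ 4\<bar>"
      unfolding eq using r2 by (simp add: power_mult_distrib)
    then show "0 \<le> (rem_term s t w)\<^sup>2 \<and> (rem_term s t w)\<^sup>2 \<le> 2 * \<bar>(f1 (X s w))\<^sup>2 * (mean_err s t w)\<^sup>2\<bar> + 2 * C\<^sup>2 * \<bar>(wt (2 * p) (X s w) * wt (2 * p) (X_mean s t w)) * (X_mean s t w - X s w) ^ 4\<bar>"
      by (simp add: defs)
  qed
qed

lemma start_square_integrable: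
  assumes s: "0 \<le> s" and c: "continuous_on S (\<phi> :: real \<Rightarrow> real)" "\<And>x. x \<in> S \<Longrightarrow> \<bar>\<phi> x\<bar> \<le> D * wt q x" and G: "G \<in> sets (F s)"
  shows "integrable M (\<lambda>w. (indicator G w * \<phi> (X s w))\<^sup>2)" "(\<lambda>w. indicator G w * \<phi> (X s w)) \<in> borel_measurable (F s)"
proof -
  have GM: "G \<in> sets M" using M_sets[OF s G] .
  have "integrable M (\<lambda>w. \<bar>\<phi> (X s w)\<bar> ^ 2)"
    using moment_bound_integrable[OF moment_bound_start[OF c, of 1 2], of s "s + 1"] s by simp
  from integrable_imp_on_event[OF this GM]
  show "integrable M (\<lambda>w. (indicator G w * \<phi> (X s w))\<^sup>2)"
    by (rule Bochner_Integration.integrable_cong[OF refl, THEN iffD1, rotated]) (simp add: power_mult_distrib power2_eq_square indicator_def)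
  show "(\<lambda>w. indicator G w * \<phi> (X s w)) \<in> borel_measurable (F s)"
    using fX_adapted[OF c(1) s] G by measurable
qed

text \<open>The martingale average, the Brownian average and its centred square are orthogonal to
  functions of \<open>X s\<close> on every event of \<open>F s\<close>; only
  \<open>expansion_rest\<close> contributes.\<close>

lemma rem_term_expansion:
  obtains D q where "0 \<le> D" "\<And>s t G. 0 \<le> s \<Longrightarrow> s < t \<Longrightarrow> t \<le> s + T \<Longrightarrow> G \<in> sets (F s) \<Longrightarrow>
     \<bar>EG G (\<lambda>w. rem_term s t w - (t - s) * H_op (X s w))\<bar> \<le> D * sqrt (t - s) ^ 3 * EG G (\<lambda>w. wt q (X s w))"
proof -
  obtain D q where "moment_est T 3 (\<lambda>s t. \<lambda>w. \<bar>expansion_rest s t w\<bar>) D q" by (rule moment_boundE[OF expansion_rest_bound])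
  note D = moment_estD[OF this]
  show ?thesis
  proof (rule that[OF D(1)])
    fix s t G assume s: "0 \<le> s" "s < t" "t \<le> s + T" and G: "G \<in> sets (F s)"
    have GM[measurable]: "G \<in> sets M" using M_sets[OF s(1) G] .
    note m[measurable] = meas[OF s(1,2)]
    let ?g = "\<lambda>x. f2 x * (\<beta> x)\<^sup>2 / 2" and ?h = "\<lambda>x. f1 x * \<beta> x"
    have gb: "\<bar>?g x\<bar> \<le> (C * CG\<^sup>2) * wt (p + 2) x" "\<bar>?h x\<bar> \<le> (C * CG) * wt (p + 1) x" if x: "x \<in> S" for x
    proof -
      have b: "\<bar>\<beta> x\<bar> ^ 2 \<le> (CG * (1 + \<bar>x\<bar>)) ^ 2" using \<beta>_growth[OF x] by (intro power_mono) auto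
      have "\<bar>f2 x\<bar> * \<bar>\<beta> x\<bar> ^ 2 \<le> (C * wt p x) * (CG * (1 + \<bar>x\<bar>)) ^ 2"
        using C0 f2_bound[OF x] b by (intro mult_mono) auto
      moreover have "(C * wt p x) * (CG * (1 + \<bar>x\<bar>)) ^ 2 = (C * CG\<^sup>2) * wt (p + 2) x"
        by (simp only: power_add power_mult_distrib ac_simps)
      moreover have "\<bar>?g x\<bar> \<le> \<bar>f2 x\<bar> * \<bar>\<beta> x\<bar> ^ 2" by (simp add: abs_mult)
      ultimately show "\<bar>?g x\<bar> \<le> (C * CG\<^sup>2) * wt (p + 2) x" by linarith
      have "\<bar>f1 x\<bar> * \<bar>\<beta> x\<bar> \<le> (C * wt p x) * (CG * (1 + \<bar>x\<bar>))"
        using C0 f1_bound[OF x] \<beta>_growth[OF x] by (intro mult_mono) auto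
      then show "\<bar>?h x\<bar> \<le> (C * CG) * wt (p + 1) x" by (simp add: abs_mult ac_simps)
    qed
    have gc: "continuous_on S ?g" "continuous_on S ?h" by (intro continuous_intros f1_cont f2_cont \<beta>_cont; simp)+
    have J2: "integrable M (\<lambda>w. (mart_mean_path s t w)\<^sup>2)"
      by (rule moment_bound_integrable[OF moment_bound_mart_mean_path[OF T] s])
    have N2: "integrable M (\<lambda>w. (bm_mean s t w)\<^sup>2)" by (rule bm_mean_facts(1)[OF s(1,2)])
    have V2: "integrable M (\<lambda>w. ((bm_mean s t w)\<^sup>2 - (t - s) / 3)\<^sup>2)"
    proof -
      have "((bm_mean s t w)\<^sup>2 - (t - s) / 3)\<^sup>2 = bm_mean s t w ^ 4 - 2 * ((t - s) / 3) * (bm_mean s t w)\<^sup>2 + ((t - s) / 3)\<^sup>2" for w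
        by (simp add: power2_eq_square power4_eq_xxxx algebra_simps diff_divide_distrib)
      then show ?thesis using bm_mean_facts(1)[OF s(1,2), of 4] N2 by simp
    qed
    note o = orthogonalI[OF s(1)]
    have z1: "integrable_on_event G (\<lambda>w. f1 (X s w) * mart_mean_path s t w)" "EG G (\<lambda>w. f1 (X s w) * mart_mean_path s t w) = 0"
      using o[OF start_square_integrable(2,1)[OF s(1) f1_cont f1_bound G] m(10) J2 mart_mean_path_mean[OF s(1,2)]]
      by (simp_all add: mult.assoc)
    have z2: "integrable_on_event G (\<lambda>w. ?g (X s w) * ((bm_mean s t w)\<^sup>2 - (t - s) / 3))" "EG G (\<lambda>w. ?g (X s w) * ((bm_mean s t w)\<^sup>2 - (t - s) / 3)) = 0"
    proof -
      have Vm: "(\<lambda>w. (bm_mean s t w)\<^sup>2 - (t - s) / 3) \<in> borel_measurable M" by measurable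
      show "integrable_on_event G (\<lambda>w. ?g (X s w) * ((bm_mean s t w)\<^sup>2 - (t - s) / 3))" "EG G (\<lambda>w. ?g (X s w) * ((bm_mean s t w)\<^sup>2 - (t - s) / 3)) = 0"
        using o[OF start_square_integrable(2,1)[OF s(1) gc(1) gb(1) G] Vm V2 bm_mean_facts(3)[OF s(1,2)]]
        by (simp_all only: mult.assoc)
    qed
    have z3: "integrable_on_event G (\<lambda>w. ?h (X s w) * bm_mean s t w)" "EG G (\<lambda>w. ?h (X s w) * bm_mean s t w) = 0"
      using o[OF start_square_integrable(2,1)[OF s(1) gc(2) gb(2) G] m(8) N2 bm_mean_facts(2)[OF s(1,2)]]
      by (simp_all only: mult.assoc)
    have Rm[measurable]: "expansion_rest s t \<in> borel_measurable M"
    proof -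
      have "(\<lambda>w. H_op (X s w)) \<in> borel_measurable M" unfolding H_op_def using s
        by (intro fX_measurable continuous_intros \<alpha>_cont \<beta>_cont f1_cont f2_cont) auto
      then show ?thesis unfolding expansion_rest_def[abs_def] by measurable
    qed
    have zR: "integrable_on_event G (expansion_rest s t)"
      using D(2)[OF s G] by (rule Bochner_Integration.integrable_bound) (auto simp: abs_mult)
    have eq: "indicator G w * (rem_term s t w - (t - s) * H_op (X s w)) = indicator G w * expansion_rest s t w + indicator G w * (f1 (X s w) * mart_mean_path s t w)
       + indicator G w * (?g (X s w) * ((bm_mean s t w)\<^sup>2 - (t - s) / 3)) - indicator G w * (?h (X s w) * bm_mean s t w)" for w
      by (simp add: expansion_rest_def algebra_simps)
    have "EG G (\<lambda>w. rem_term s t w - (t - s) * H_op (X s w)) = EG G (expansion_rest s t)"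
      unfolding eq using zR z1 z2 z3 by (simp only: Bochner_Integration.integral_add Bochner_Integration.integral_diff Bochner_Integration.integrable_add Bochner_Integration.integrable_diff)
    then have "\<bar>EG G (\<lambda>w. rem_term s t w - (t - s) * H_op (X s w))\<bar> = \<bar>EG G (expansion_rest s t)\<bar>" by (rule arg_cong)
    also have "\<dots> \<le> expectation (\<lambda>w. \<bar>indicator G w * expansion_rest s t w\<bar>)" by (rule integral_abs_bound)
    also have "\<dots> = EG G (\<lambda>w. \<bar>expansion_rest s t w\<bar>)" by (simp add: abs_mult)
    also have "\<dots> \<le> D * sqrt (t - s) ^ 3 * EG G (\<lambda>w. wt q (X s w))" by (rule D(3)[OF s G order_refl])
    finally show "\<bar>EG G (\<lambda>w. rem_term s t w - (t - s) * H_op (X s w))\<bar> \<le> D * sqrt (t - s) ^ 3 * EG G (\<lambda>w. wt q (X s w))" .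
  qed
qed

end

section \<open>The Euler scheme and time homogeneity\<close>

text \<open>The projection onto \<open>[p, q]\<close>. It confines the arguments of the coefficients
  to a compact part of \<open>S\<close>, and it also serves to truncate values.\<close>

definition clamp_to :: "real \<Rightarrow> real \<Rightarrow> real \<Rightarrow> real" where
  "clamp_to p q x = max p (min q x)"

lemma clamp_to_simps:
  assumes "p \<le> q"
  shows "clamp_to p q x \<in> {p..q}" "x \<in> {p..q} \<Longrightarrow> clamp_to p q x = x" "\<bar>clamp_to p q x - clamp_to p q y\<bar> \<le> \<bar>x - y\<bar>"
    "\<bar>clamp_to p q x\<bar> \<le> max \<bar>p\<bar> \<bar>q\<bar>"
  using assms by (auto simp: clamp_to_def max_def min_def abs_if)

lemma clamp_to_measurable [measurable]: "clamp_to p q \<in> borel_measurable borel"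
  unfolding clamp_to_def[abs_def] by measurable

text \<open>The factor \<open>i * b\<close> is crude, but with \<open>b\<close> of order
  \<open>h^2\<close> and at most \<open>d / h\<close> steps it gives an error of order
  \<open>h\<close>.\<close>

lemma discrete_gronwall:
  fixes e :: "nat \<Rightarrow> real"
  assumes "e 0 \<le> 0" "\<And>i. i < n \<Longrightarrow> e (Suc i) \<le> (1 + a) * e i + b" "0 \<le> a" "0 \<le> b" "i \<le> n"
  shows "e i \<le> real i * b * (1 + a) ^ i"
  using assms(5)
proof (induction i)
  case (Suc i)
  have "e (Suc i) \<le> (1 + a) * (real i * b * (1 + a) ^ i) + b"
  proof -
    have "(1 + a) * e i \<le> (1 + a) * (real i * b * (1 + a) ^ i)" using Suc assms(3) by (intro mult_left_mono) auto
    then show ?thesis using assms(2)[of i] Suc by simp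
  qed
  moreover have "b * 1 \<le> b * (1 + a) ^ Suc i" using assms(3,4) by (intro mult_left_mono one_le_power) auto
  moreover have "(1 + a) * (real i * b * (1 + a) ^ i) + b * (1 + a) ^ Suc i = real (Suc i) * b * (1 + a) ^ Suc i"
    by (simp add: algebra_simps)
  ultimately show ?case by linarith
qed (use assms in simp)

context stationary_diffusion
begin

text \<open>A compact interval inside \<open>S\<close> turns the polynomial bounds into global ones:
  with \<open>R\<close> the larger modulus of its end points, each factor \<open>1 + |x|\<close> is
  at most \<open>1 + R\<close>.\<close>

lemma clamp_coeff:
  assumes pq: "p \<le> q" "{p..q} \<subseteq> S"
  obtains L K where "0 \<le> L" "0 \<le> K"
    "\<And>x y. \<bar>\<alpha> (clamp_to p q x) - \<alpha> (clamp_to p q y)\<bar> \<le> L * \<bar>x - y\<bar>" "\<And>x y. \<bar>\<beta> (clamp_to p q x) - \<beta> (clamp_to p q y)\<bar> \<le> L * \<bar>x - y\<bar>"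
    "\<And>x. \<bar>\<alpha> (clamp_to p q x)\<bar> \<le> K" "\<And>x. \<bar>\<beta> (clamp_to p q x)\<bar> \<le> K"
proof -
  define R where "R = max \<bar>p\<bar> \<bar>q\<bar>"
  have R: "0 \<le> R" by (simp add: R_def)
  have cS: "clamp_to p q x \<in> S" for x using clamp_to_simps(1)[OF pq(1)] pq(2) by blast
  have cR: "\<bar>clamp_to p q x\<bar> \<le> R" for x unfolding R_def by (rule clamp_to_simps(4)[OF pq(1)])
  have lip: "CL * ((1 + \<bar>clamp_to p q x\<bar>) * (1 + \<bar>clamp_to p q y\<bar>)) ^ pL * \<bar>clamp_to p q x - clamp_to p q y\<bar> \<le> CL * ((1 + R) * (1 + R)) ^ pL * \<bar>x - y\<bar>" for x y
    using R cR[of x] cR[of y] clamp_to_simps(3)[OF pq(1)] CL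
    by (intro mult_mono mult_left_mono power_mono) auto
  show ?thesis
  proof (rule that[of "CL * ((1 + R) * (1 + R)) ^ pL" "CG * (1 + R)"])
    show "0 \<le> CL * ((1 + R) * (1 + R)) ^ pL" "0 \<le> CG * (1 + R)" using CL CG R by auto
    show "\<bar>\<alpha> (clamp_to p q x) - \<alpha> (clamp_to p q y)\<bar> \<le> CL * ((1 + R) * (1 + R)) ^ pL * \<bar>x - y\<bar>" for x y
      using \<alpha>_lip[OF cS cS] lip by (rule order_trans)
    show "\<bar>\<beta> (clamp_to p q x) - \<beta> (clamp_to p q y)\<bar> \<le> CL * ((1 + R) * (1 + R)) ^ pL * \<bar>x - y\<bar>" for x y
      using \<beta>_lip[OF cS cS] lip by (rule order_trans)
    have "CG * (1 + \<bar>clamp_to p q x\<bar>) \<le> CG * (1 + R)" for x using CG cR[of x] by (intro mult_left_mono) auto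
    then show "\<bar>\<alpha> (clamp_to p q x)\<bar> \<le> CG * (1 + R)" "\<bar>\<beta> (clamp_to p q x)\<bar> \<le> CG * (1 + R)" for x
      using \<alpha>_growth[OF cS] \<beta>_growth[OF cS] order_trans by blast+
  qed
qed

lemma clamp_coeff_measurable:
  assumes pq: "p \<le> q" "{p..q} \<subseteq> S"
  shows "(\<lambda>x. \<alpha> (clamp_to p q x)) \<in> borel_measurable borel" "(\<lambda>x. \<beta> (clamp_to p q x)) \<in> borel_measurable borel"
  using clamp_to_simps(1)[OF pq(1)] pq(2)
  by (auto intro!: measurable_continuous_on_open[OF \<alpha>_cont S_open] measurable_continuous_on_open[OF \<beta>_cont S_open])

text \<open>The scheme starts from the solution at time \<open>s\<close>, so it depends on the past
  only through \<open>X s\<close> and is otherwise driven by increments of \<open>B\<close> after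
  \<open>s\<close>.\<close>

fun euler :: "real \<Rightarrow> real \<Rightarrow> real \<Rightarrow> real \<Rightarrow> nat \<Rightarrow> 'w \<Rightarrow> real" where
  "euler p q h s 0 w = X s w"
| "euler p q h s (Suc j) w = euler p q h s j w + \<alpha> (clamp_to p q (euler p q h s j w)) * h
     + \<beta> (clamp_to p q (euler p q h s j w)) * (B (s + real (Suc j) * h) w - B (s + real j * h) w)"

text \<open>The condition concerns the solution and not the scheme: on this event the clamped
  coefficients agree with the true ones along \<open>X\<close>, and the event is known at its last
  grid time.\<close>

definition stay :: "real \<Rightarrow> real \<Rightarrow> real \<Rightarrow> real \<Rightarrow> nat \<Rightarrow> 'w set" where
  "stay p q h s i = {w \<in> space M. \<forall>j\<le>i. X (s + real j * h) w \<in> {p..q}}"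

lemma euler_facts:
  assumes pq: "p \<le> q" "{p..q} \<subseteq> S" and s: "0 \<le> s" and h: "0 < h"
  shows "euler p q h s j \<in> borel_measurable (F (s + real j * h))" "integrable M (\<lambda>w. (euler p q h s j w)\<^sup>2)"
proof -
  obtain L K where K: "0 \<le> L" "0 \<le> K"
    "\<And>x y. \<bar>\<alpha> (clamp_to p q x) - \<alpha> (clamp_to p q y)\<bar> \<le> L * \<bar>x - y\<bar>" "\<And>x y. \<bar>\<beta> (clamp_to p q x) - \<beta> (clamp_to p q y)\<bar> \<le> L * \<bar>x - y\<bar>"
    "\<And>x. \<bar>\<alpha> (clamp_to p q x)\<bar> \<le> K" "\<And>x. \<bar>\<beta> (clamp_to p q x)\<bar> \<le> K"
    by (rule clamp_coeff[OF pq]) (rule that; assumption)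
  note cm[measurable] = clamp_coeff_measurable[OF pq]
  have m: "euler p q h s j \<in> borel_measurable (F (s + real j * h))" for j
  proof (induction j)
    case 0 then show ?case using X_adapted[OF s] by simp
  next
    case (Suc j)
    let ?u = "s + real j * h" and ?v = "s + real (Suc j) * h"
    have u: "0 \<le> ?u" "?u \<le> ?v" "0 \<le> ?v" using s h by (auto simp: distrib_right)
    have [measurable]: "euler p q h s j \<in> borel_measurable (F ?v)" "B ?u \<in> borel_measurable (F ?v)" "B ?v \<in> borel_measurable (F ?v)"
      using F_measurable[OF u(1,2) Suc] F_measurable[OF u(1,2) B_adapted[OF u(1)]] B_adapted[OF u(3)] by auto
    have "(\<lambda>w. euler p q h s j w + \<alpha> (clamp_to p q (euler p q h s j w)) * h + \<beta> (clamp_to p q (euler p q h s j w)) * (B ?v w - B ?u w)) \<in> borel_measurable (F ?v)"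
      by measurable
    then show ?case by (simp add: fun_eq_iff[symmetric] del: of_nat_Suc)
  qed
  then show "euler p q h s j \<in> borel_measurable (F (s + real j * h))" .
  show "integrable M (\<lambda>w. (euler p q h s j w)\<^sup>2)"
  proof (induction j)
    case 0
    have "integrable M (\<lambda>w. (X s w)\<^sup>2)"
    proof (rule Bochner_Integration.integrable_bound[OF wt_integrable[OF s, of 2]])
      show "(\<lambda>w. (X s w)\<^sup>2) \<in> borel_measurable M" using X_measurable[OF s] by measurable
      have "x\<^sup>2 \<le> wt 2 x" for x :: real by (simp add: power2_sum)
      then show "AE w in M. norm ((X s w)\<^sup>2) \<le> norm (wt 2 (X s w))" by (intro AE_I2) simp
    qed
    then show ?case by simp
  next
    case (Suc j)
    let ?u = "s + real j * h" and ?v = "s + real (Suc j) * h"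
    have u: "0 \<le> ?u" "?u < ?v" "0 \<le> ?v" using s h by (auto simp: distrib_right)
    have [measurable]: "euler p q h s j \<in> borel_measurable M" "euler p q h s (Suc j) \<in> borel_measurable M"
      using M_measurable[OF u(1) m] M_measurable[OF u(3) m] by auto
    show ?case
    proof (rule Bochner_Integration.integrable_bound)
      show "integrable M (\<lambda>w. 3 * (euler p q h s j w)\<^sup>2 + 3 * (K * h)\<^sup>2 + 3 * (K\<^sup>2 * (B ?v w - B ?u w)\<^sup>2))"
        using Suc increment_variance(1)[OF u(1,2)] by (intro Bochner_Integration.integrable_add integrable_mult_right) auto
      show "AE w in M. norm ((euler p q h s (Suc j) w)\<^sup>2) \<le> norm (3 * (euler p q h s j w)\<^sup>2 + 3 * (K * h)\<^sup>2 + 3 * (K\<^sup>2 * (B ?v w - B ?u w)\<^sup>2))"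
      proof (rule AE_I2)
        fix w
        let ?z = "euler p q h s j w"
        have "(\<alpha> (clamp_to p q ?z) * h)\<^sup>2 \<le> (K * h)\<^sup>2"
          using K(5)[of ?z] h by (intro abs_le_square_iff[THEN iffD1]) (auto simp: abs_mult K(2))
        moreover have "(\<beta> (clamp_to p q ?z) * (B ?v w - B ?u w))\<^sup>2 \<le> K\<^sup>2 * (B ?v w - B ?u w)\<^sup>2"
          unfolding power_mult_distrib using K(6)[of ?z] K(2) by (intro mult_right_mono abs_le_square_iff[THEN iffD1]) auto
        ultimately have "(euler p q h s (Suc j) w)\<^sup>2 \<le> 3 * ?z\<^sup>2 + 3 * (K * h)\<^sup>2 + 3 * (K\<^sup>2 * (B ?v w - B ?u w)\<^sup>2)"
          using sq_add3_le[of ?z "\<alpha> (clamp_to p q ?z) * h" "\<beta> (clamp_to p q ?z) * (B ?v w - B ?u w)"] by simp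
        then show "norm ((euler p q h s (Suc j) w)\<^sup>2) \<le> norm (3 * ?z\<^sup>2 + 3 * (K * h)\<^sup>2 + 3 * (K\<^sup>2 * (B ?v w - B ?u w)\<^sup>2))"
          by simp
      qed
    qed measurable
  qed
qed

lemma stay_measurable:
  assumes "0 \<le> s" "0 < h"
  shows "stay p q h s i \<in> sets (F (s + real i * h))"
proof -
  have sp: "space (F (s + real i * h)) = space M" using space_F assms by simp
  have *: "{w \<in> space (F (s + real i * h)). X (s + real j * h) w \<in> {p..q}} \<in> sets (F (s + real i * h))" if "j \<in> {..i}" for j
  proof -
    have "X (s + real j * h) \<in> borel_measurable (F (s + real i * h))"
      using that assms by (intro F_measurable[OF _ _ X_adapted]) (auto intro!: mult_right_mono)
    from measurable_sets[OF this, of "{p..q}"] show ?thesis by (simp add: vimage_def Int_def conj_commute)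
  qed
  have "{w \<in> space (F (s + real i * h)). \<forall>j\<in>{..i}. X (s + real j * h) w \<in> {p..q}} \<in> sets (F (s + real i * h))"
    by (rule sets.sets_Collect_finite_All[OF * finite_atMost])
  then show ?thesis unfolding stay_def sp by (simp only: Ball_def atMost_iff)
qed

text \<open>The local error of the Euler scheme splits into a drift part of size \<open>h\<^bsup>3/2\<^esup>\<close> and a martingale
  part of size \<open>h\<close> that is orthogonal to the past, so that the squared errors add up to \<open>O(h)\<close>.
  Restricting to the decreasing events \<open>stay\<close> makes the local Lipschitz bounds global.\<close>

lemma euler_error_step:
  assumes pq: "p \<le> q" "{p..q} \<subseteq> S" and d: "0 < d"
  obtains a b where "0 \<le> a" "0 \<le> b" "\<And>s h i. 0 \<le> s \<Longrightarrow> 0 < h \<Longrightarrow> h \<le> d \<Longrightarrow>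
    EG (stay p q h s (Suc i)) (\<lambda>w. (X (s + real (Suc i) * h) w - euler p q h s (Suc i) w)\<^sup>2) \<le>
    (1 + a * h) * EG (stay p q h s i) (\<lambda>w. (X (s + real i * h) w - euler p q h s i w)\<^sup>2) + b * h\<^sup>2"
proof -
  obtain L K where K: "0 \<le> L" "0 \<le> K"
    "\<And>x y. \<bar>\<alpha> (clamp_to p q x) - \<alpha> (clamp_to p q y)\<bar> \<le> L * \<bar>x - y\<bar>" "\<And>x y. \<bar>\<beta> (clamp_to p q x) - \<beta> (clamp_to p q y)\<bar> \<le> L * \<bar>x - y\<bar>"
    "\<And>x. \<bar>\<alpha> (clamp_to p q x)\<bar> \<le> K" "\<And>x. \<bar>\<beta> (clamp_to p q x)\<bar> \<le> K"
    by (rule clamp_coeff[OF pq]) (rule that; assumption)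
  have one: "0 < (1 :: nat)" by simp
  obtain C1 q1 where "moment_est d (6 * 1) (\<lambda>s u. \<lambda>w. (drift s u w - (u - s) * \<alpha> (X s w)) ^ (2 * 1)) C1 q1" by (rule moment_boundE[OF moment_bound_drift_error[OF one]])
  note C1 = moment_estD[OF this]
  obtain C2 q2 where "moment_est d (4 * 1) (\<lambda>s u. \<lambda>w. (mart s u w - \<beta> (X s w) * (B u w - B s w)) ^ (2 * 1)) C2 q2" by (rule moment_boundE[OF moment_bound_mart_error[OF one]])
  note C2 = moment_estD[OF this]
  define m where "m = expectation (\<lambda>w. wt (max q1 q2) (X 0 w))"
  have m0: "0 \<le> m" unfolding m_def by (intro Bochner_Integration.integral_nonneg) simp
  \<comment> \<open>Collected from the one-step estimate below; higher powers of \<open>h\<close>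
    are reduced by means of \<open>h \<le> d\<close>.\<close>
  define a where "a = 1 + (2 * L + L\<^sup>2 * d) * (1 + d) + 4 * L\<^sup>2"
  define b where "b = 4 * (C2 * m) + (2 * d + 1) * (C1 * m)"
  show ?thesis
  proof (rule that[of a b])
    show "0 \<le> a" "0 \<le> b" unfolding a_def b_def using K(1) d C1(1) C2(1) m0 by auto
    fix s h :: real and i :: nat assume s: "0 \<le> s" and h: "0 < h" "h \<le> d"
    let ?u = "s + real i * h" and ?v = "s + real (Suc i) * h"
    have u: "0 \<le> ?u" "?u < ?v" "?v \<le> ?u + d" "?v - ?u = h" "0 \<le> ?v" using s h by (auto simp: distrib_right)
    let ?A = "stay p q h s i" and ?A' = "stay p q h s (Suc i)"
    have AF: "?A \<in> sets (F ?u)" by (rule stay_measurable[OF s h(1)])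
    have AM[measurable]: "?A \<in> sets M" "?A' \<in> sets M" using M_sets[OF u(1) AF] M_sets[OF u(5) stay_measurable[OF s h(1)]] by auto
    let ?Z = "euler p q h s i"
    \<comment> \<open>\<open>D\<close> is the old error, \<open>P\<close> its image under the drift
      step, \<open>ra\<close> and \<open>rm\<close> are the local errors of drift and martingale
      part, and \<open>bZ\<close> is the diffusion coefficient that the scheme uses.\<close>
    define D P \<Delta>B ra rm bZ where "D w = X ?u w - ?Z w" "P w = D w + (\<alpha> (X ?u w) - \<alpha> (clamp_to p q (?Z w))) * h"
      "\<Delta>B w = B ?v w - B ?u w" "ra w = drift ?u ?v w - h * \<alpha> (X ?u w)" "rm w = mart ?u ?v w - \<beta> (X ?u w) * (B ?v w - B ?u w)"
      "bZ w = \<beta> (clamp_to p q (?Z w))" for w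
    note defs = D_P_\<Delta>B_ra_rm_bZ_def
    have next_eq: "X ?v w - euler p q h s (Suc i) w = P w + (mart ?u ?v w - bZ w * \<Delta>B w) + ra w" for w
      by (simp add: defs mart_def algebra_simps del: of_nat_Suc)
    have Zf: "?Z \<in> borel_measurable (F ?u)" "integrable M (\<lambda>w. (?Z w)\<^sup>2)" by (rule euler_facts[OF pq s h(1)])+
    note cm[measurable] = clamp_coeff_measurable[OF pq]
    have Xf: "X ?u \<in> borel_measurable (F ?u)" "(\<lambda>w. \<alpha> (X ?u w)) \<in> borel_measurable (F ?u)" "(\<lambda>w. \<beta> (X ?u w)) \<in> borel_measurable (F ?u)"
      using u by (auto intro!: X_adapted fX_adapted \<alpha>_cont \<beta>_cont)
    have bZF: "bZ \<in> borel_measurable (F ?u)" unfolding defs using Zf(1) by measurable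
    have PF: "P \<in> borel_measurable (F ?u)" and DF: "D \<in> borel_measurable (F ?u)" unfolding defs using Zf(1) Xf by measurable
    have [measurable]: "P \<in> borel_measurable M" "bZ \<in> borel_measurable M" "D \<in> borel_measurable M" "(\<lambda>w. \<beta> (X ?u w)) \<in> borel_measurable M"
      using M_measurable[OF u(1) PF] M_measurable[OF u(1) bZF] M_measurable[OF u(1) DF] M_measurable[OF u(1) Xf(3)] by auto
    have mM[measurable]: "mart ?u ?v \<in> borel_measurable M" "drift ?u ?v \<in> borel_measurable M" "B ?u \<in> borel_measurable M" "B ?v \<in> borel_measurable M"
      using u by (auto intro!: mart_measurable_M drift_measurable_M simp del: of_nat_Suc)
    have raM[measurable]: "ra \<in> borel_measurable M" "rm \<in> borel_measurable M" "\<Delta>B \<in> borel_measurable M"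
      unfolding defs using M_measurable[OF u(1) Xf(2)] by measurable
    have inA: "\<alpha> (X ?u w) = \<alpha> (clamp_to p q (X ?u w)) \<and> \<beta> (X ?u w) = \<beta> (clamp_to p q (X ?u w))" if "w \<in> ?A" for w
      using that clamp_to_simps(2)[OF pq(1), of "X ?u w"] by (auto simp: stay_def)
    have D2: "integrable M (\<lambda>w. (D w)\<^sup>2)"
    proof (rule Bochner_Integration.integrable_bound)
      show "integrable M (\<lambda>w. 2 * wt 2 (X ?u w) + 2 * (?Z w)\<^sup>2)"
        using Zf(2) wt_integrable[OF u(1), of 2] by simp
      show "AE w in M. norm ((D w)\<^sup>2) \<le> norm (2 * wt 2 (X ?u w) + 2 * (?Z w)\<^sup>2)"
      proof (rule AE_I2)
        fix w
        have "(D w)\<^sup>2 \<le> 2 * (X ?u w)\<^sup>2 + 2 * (?Z w)\<^sup>2"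
          using sum_squares_ge_zero[of "X ?u w + ?Z w" 0] unfolding defs by (simp add: power2_eq_square algebra_simps)
        also have "(X ?u w)\<^sup>2 \<le> wt 2 (X ?u w)" by (simp add: power2_sum)
        finally show "norm ((D w)\<^sup>2) \<le> norm (2 * wt 2 (X ?u w) + 2 * (?Z w)\<^sup>2)" by simp
      qed
    qed measurable
    have Pb: "(P w)\<^sup>2 \<le> (1 + L * h)\<^sup>2 * (D w)\<^sup>2" "(\<beta> (X ?u w) - bZ w)\<^sup>2 \<le> L\<^sup>2 * (D w)\<^sup>2" if "w \<in> ?A" for w
    proof -
      have "\<bar>\<alpha> (X ?u w) - \<alpha> (clamp_to p q (?Z w))\<bar> \<le> L * \<bar>D w\<bar>" using inA[OF that] K(3) by (simp add: defs)
      then have "\<bar>\<alpha> (X ?u w) - \<alpha> (clamp_to p q (?Z w))\<bar> * h \<le> L * \<bar>D w\<bar> * h" using h by (intro mult_right_mono) auto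
      then have "\<bar>P w\<bar> \<le> \<bar>(1 + L * h) * D w\<bar>"
      proof -
        have "\<bar>P w\<bar> \<le> \<bar>D w\<bar> + \<bar>(\<alpha> (X ?u w) - \<alpha> (clamp_to p q (?Z w))) * h\<bar>" unfolding defs(2) by (rule abs_triangle_ineq)
        also have "\<bar>(\<alpha> (X ?u w) - \<alpha> (clamp_to p q (?Z w))) * h\<bar> \<le> L * \<bar>D w\<bar> * h"
          using \<open>_ * h \<le> L * \<bar>D w\<bar> * h\<close> h by (simp only: abs_mult abs_of_pos)
        also have "\<bar>D w\<bar> + L * \<bar>D w\<bar> * h = (1 + L * h) * \<bar>D w\<bar>" by (simp add: algebra_simps)
        also have "\<dots> = \<bar>(1 + L * h) * D w\<bar>" using h K(1) by (simp add: abs_mult)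
        finally show ?thesis by simp
      qed
      then have "(P w)\<^sup>2 \<le> ((1 + L * h) * D w)\<^sup>2" by (simp only: abs_le_square_iff)
      then show "(P w)\<^sup>2 \<le> (1 + L * h)\<^sup>2 * (D w)\<^sup>2" by (simp only: power_mult_distrib)
      have "\<bar>\<beta> (X ?u w) - bZ w\<bar> \<le> \<bar>L * D w\<bar>" using inA[OF that] K(1,4) by (simp add: defs abs_mult)
      then have "(\<beta> (X ?u w) - bZ w)\<^sup>2 \<le> (L * D w)\<^sup>2" by (simp only: abs_le_square_iff)
      then show "(\<beta> (X ?u w) - bZ w)\<^sup>2 \<le> L\<^sup>2 * (D w)\<^sup>2" by (simp only: power_mult_distrib)
    qed
    let ?e = "EG ?A (\<lambda>w. (D w)\<^sup>2)"
    have iD: "integrable_on_event ?A (\<lambda>w. (D w)\<^sup>2)" by (rule integrable_imp_on_event[OF D2 AM(1)])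
    have e0: "0 \<le> ?e" by (intro Bochner_Integration.integral_nonneg) simp
    \<comment> \<open>The Lipschitz estimates against \<open>D\<close> are available on
      \<open>?A\<close>, so domination is formulated on that event.\<close>
    have dom: "integrable_on_event ?A V \<and> EG ?A V \<le> c * ?e" if [measurable]: "V \<in> borel_measurable M" and "\<And>w. w \<in> ?A \<Longrightarrow> 0 \<le> V w \<and> V w \<le> c * (D w)\<^sup>2" for V c
    proof -
      have le: "indicator ?A w * V w \<le> indicator ?A w * (c * (D w)\<^sup>2)" "0 \<le> indicator ?A w * V w" for w using that(2)[of w] by (auto simp: indicator_def)
      have i: "integrable_on_event ?A V"
      proof (rule Bochner_Integration.integrable_bound[OF EG_cmult(1)[OF iD, of c]])
        show "AE w in M. norm (indicator ?A w * V w) \<le> norm (indicator ?A w * (c * (D w)\<^sup>2))"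
        proof (rule AE_I2)
          fix w
          show "norm (indicator ?A w * V w) \<le> norm (indicator ?A w * (c * (D w)\<^sup>2))"
            unfolding real_norm_def using le[of w] by linarith
        qed
      qed measurable
      moreover have "EG ?A V \<le> EG ?A (\<lambda>w. c * (D w)\<^sup>2)" by (rule integral_mono[OF i EG_cmult(1)[OF iD] le(1)])
      ultimately show ?thesis unfolding EG_cmult(2)[OF iD] by blast
    qed
    have P2: "integrable_on_event ?A (\<lambda>w. (P w)\<^sup>2)" "EG ?A (\<lambda>w. (P w)\<^sup>2) \<le> (1 + L * h)\<^sup>2 * ?e"
      using dom[of "\<lambda>w. (P w)\<^sup>2" "(1 + L * h)\<^sup>2"] Pb(1) by auto
    have b2: "integrable_on_event ?A (\<lambda>w. (\<beta> (X ?u w) - bZ w)\<^sup>2)" "EG ?A (\<lambda>w. (\<beta> (X ?u w) - bZ w)\<^sup>2) \<le> L\<^sup>2 * ?e"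
      using dom[of "\<lambda>w. (\<beta> (X ?u w) - bZ w)\<^sup>2" "L\<^sup>2"] Pb(2) by auto
    have bB: "integrable_on_event ?A (\<lambda>w. ((\<beta> (X ?u w) - bZ w) * \<Delta>B w)\<^sup>2)" "EG ?A (\<lambda>w. ((\<beta> (X ?u w) - bZ w) * \<Delta>B w)\<^sup>2) = h * EG ?A (\<lambda>w. (\<beta> (X ?u w) - bZ w)\<^sup>2)"
    proof -
      have VF: "(\<lambda>w. indicator ?A w * (\<beta> (X ?u w) - bZ w)\<^sup>2) \<in> borel_measurable (F ?u)" using AF Xf(3) bZF by measurable
      have eq: "indicator ?A w * ((\<beta> (X ?u w) - bZ w) * \<Delta>B w)\<^sup>2 = indicator ?A w * (\<beta> (X ?u w) - bZ w)\<^sup>2 * (B ?v w - B ?u w)\<^sup>2" for w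
        by (simp add: defs(3) power_mult_distrib mult.assoc)
      note i = increment_integral_mult[OF u(1,2) VF _ b2(1), of "\<lambda>x. x\<^sup>2"]
      show "integrable_on_event ?A (\<lambda>w. ((\<beta> (X ?u w) - bZ w) * \<Delta>B w)\<^sup>2)" "EG ?A (\<lambda>w. ((\<beta> (X ?u w) - bZ w) * \<Delta>B w)\<^sup>2) = h * EG ?A (\<lambda>w. (\<beta> (X ?u w) - bZ w)\<^sup>2)"
        unfolding eq using i increment_variance[OF u(1,2)] u(4) by (simp_all add: mult.commute del: of_nat_Suc)
    qed
    have w: "EG ?A (\<lambda>w. wt (max q1 q2) (X ?u w)) \<le> m" unfolding m_def by (rule indicator_wt_bound[OF u(1) AM(1)])
    have ra2: "integrable_on_event ?A (\<lambda>w. (ra w)\<^sup>2)" "EG ?A (\<lambda>w. (ra w)\<^sup>2) \<le> C1 * m * h ^ 3"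
    proof -
      have "sqrt h ^ 6 = h ^ 3" using h power_mult[of "sqrt h" 2 3] by simp
      then have "C1 * sqrt (?v - ?u) ^ (6 * 1) * EG ?A (\<lambda>w. wt (max q1 q2) (X ?u w)) \<le> C1 * m * h ^ 3"
        unfolding u(4) using w C1(1) h mult_left_mono[OF w, of "C1 * h ^ 3"] by (simp add: ac_simps)
      then show "integrable_on_event ?A (\<lambda>w. (ra w)\<^sup>2)" "EG ?A (\<lambda>w. (ra w)\<^sup>2) \<le> C1 * m * h ^ 3"
        using C1(2)[OF u(1-3) AF] C1(3)[OF u(1-3) AF, of "max q1 q2"] unfolding defs(4) u(4) by auto
    qed
    have rm2: "integrable_on_event ?A (\<lambda>w. (rm w)\<^sup>2)" "EG ?A (\<lambda>w. (rm w)\<^sup>2) \<le> C2 * m * h\<^sup>2"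
    proof -
      have "sqrt h ^ 4 = h\<^sup>2" using h power_mult[of "sqrt h" 2 2] by simp
      then have "C2 * sqrt (?v - ?u) ^ (4 * 1) * EG ?A (\<lambda>w. wt (max q1 q2) (X ?u w)) \<le> C2 * m * h\<^sup>2"
        unfolding u(4) using w C2(1) h mult_left_mono[OF w, of "C2 * h\<^sup>2"] by (simp add: ac_simps)
      then show "integrable_on_event ?A (\<lambda>w. (rm w)\<^sup>2)" "EG ?A (\<lambda>w. (rm w)\<^sup>2) \<le> C2 * m * h\<^sup>2"
        using C2(2)[OF u(1-3) AF] C2(3)[OF u(1-3) AF, of "max q1 q2"] unfolding defs(5) by auto
    qed
    have UF: "(\<lambda>w. indicator ?A w * P w) \<in> borel_measurable (F ?u)" using AF PF by measurable
    have U2: "integrable M (\<lambda>w. (indicator ?A w * P w)\<^sup>2)"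
      using P2(1) by (rule Bochner_Integration.integrable_cong[OF refl, THEN iffD1, rotated]) (simp add: indicator_def)
    have o1: "integrable_on_event ?A (\<lambda>w. P w * mart ?u ?v w)" "EG ?A (\<lambda>w. P w * mart ?u ?v w) = 0"
      using mart_orthogonal[OF u(1,2) UF U2] by (simp_all only: mult.assoc)
    \<comment> \<open>\<open>bZ\<close> is bounded by \<open>K\<close>, so \<open>P * bZ\<close> is
      integrable on \<open>?A\<close>; the increment after \<open>?u\<close> is independent of it
      and centred.\<close>
    have o2: "integrable_on_event ?A (\<lambda>w. P w * (bZ w * \<Delta>B w))" "EG ?A (\<lambda>w. P w * (bZ w * \<Delta>B w)) = 0"
    proof -
      have UM: "(\<lambda>w. indicator ?A w * P w) \<in> borel_measurable M" by measurable
      have iU: "integrable M (\<lambda>w. indicator ?A w * P w)" by (rule square_integrable_imp_integrable[OF UM U2])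
      have VF: "(\<lambda>w. indicator ?A w * P w * bZ w) \<in> borel_measurable (F ?u)" using UF bZF by measurable
      have iV: "integrable M (\<lambda>w. indicator ?A w * P w * bZ w)"
      proof (rule Bochner_Integration.integrable_bound[OF integrable_mult_right[OF iU, of K]])
        show "AE w in M. norm (indicator ?A w * P w * bZ w) \<le> norm (K * (indicator ?A w * P w))"
        proof (rule AE_I2)
          fix w
          have "\<bar>bZ w\<bar> \<le> K" unfolding defs(6) by (rule K(6))
          then have "\<bar>bZ w\<bar> * \<bar>indicator ?A w * P w\<bar> \<le> K * \<bar>indicator ?A w * P w\<bar>" by (rule mult_right_mono) simp
          then show "norm (indicator ?A w * P w * bZ w) \<le> norm (K * (indicator ?A w * P w))"
            unfolding real_norm_def abs_mult[of _ "bZ w"] abs_mult[of K] abs_of_nonneg[OF K(2)] by (simp only: mult.commute)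
        qed
      qed measurable
      note i = increment_integral_mult[OF u(1,2) VF _ iV, of "\<lambda>x. x"]
      show "integrable_on_event ?A (\<lambda>w. P w * (bZ w * \<Delta>B w))" "EG ?A (\<lambda>w. P w * (bZ w * \<Delta>B w)) = 0"
        using i increment_mean[OF u(1,2)] unfolding defs(3) by (simp_all add: mult.assoc del: of_nat_Suc)
    qed
    \<comment> \<open>Products of \<open>P\<close> with martingale parts are kept since their mean
      is 0. The product with \<open>ra\<close> is split with weights \<open>h\<close> and
      \<open>1 / h\<close>, which is affordable because the square of \<open>ra\<close> has mean of
      order \<open>h ^ 3\<close>.\<close>
    have pw: "(P w + (mart ?u ?v w - bZ w * \<Delta>B w) + ra w)\<^sup>2 \<le> (1 + h) * (P w)\<^sup>2 + 2 * (P w * mart ?u ?v w) - 2 * (P w * (bZ w * \<Delta>B w))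
        + 4 * ((\<beta> (X ?u w) - bZ w) * \<Delta>B w)\<^sup>2 + 4 * (rm w)\<^sup>2 + (2 + 1 / h) * (ra w)\<^sup>2" for w
    proof -
      define x y z y1 y2 where "x = P w" "y = mart ?u ?v w - bZ w * \<Delta>B w" "z = ra w" "y1 = (\<beta> (X ?u w) - bZ w) * \<Delta>B w" "y2 = rm w"
      note dd = this
      have y: "y = y1 + y2" unfolding dd defs(3,5) by (simp add: algebra_simps)
      have "0 \<le> (sqrt h * x - z / sqrt h)\<^sup>2" by simp
      also have "\<dots> = h * x\<^sup>2 + 1 / h * z\<^sup>2 - 2 * (x * z)" using h by (simp add: power2_eq_square algebra_simps)
      finally have 1: "2 * (x * z) \<le> h * x\<^sup>2 + 1 / h * z\<^sup>2" by simp
      have 2: "2 * (y * z) \<le> y\<^sup>2 + z\<^sup>2" using sum_squares_ge_zero[of "y - z" 0] by (simp add: power2_eq_square algebra_simps)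
      have 3: "y\<^sup>2 \<le> 2 * y1\<^sup>2 + 2 * y2\<^sup>2" using sum_squares_ge_zero[of "y1 - y2" 0] unfolding y by (simp add: power2_eq_square algebra_simps)
      have "(x + y + z)\<^sup>2 = x\<^sup>2 + y\<^sup>2 + z\<^sup>2 + 2 * (x * y) + 2 * (x * z) + 2 * (y * z)" by (simp add: power2_eq_square algebra_simps)
      also have "\<dots> \<le> (1 + h) * x\<^sup>2 + 2 * (x * y) + 4 * y1\<^sup>2 + 4 * y2\<^sup>2 + (2 + 1 / h) * z\<^sup>2"
        using 1 2 3 by (simp add: distrib_right)
      also have "2 * (x * y) = 2 * (P w * mart ?u ?v w) - 2 * (P w * (bZ w * \<Delta>B w))" unfolding dd by (simp add: algebra_simps)
      finally show ?thesis unfolding dd by simp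
    qed
    let ?R = "\<lambda>w. (1 + h) * (indicator ?A w * (P w)\<^sup>2) + 2 * (indicator ?A w * (P w * mart ?u ?v w)) - 2 * (indicator ?A w * (P w * (bZ w * \<Delta>B w)))
        + 4 * (indicator ?A w * ((\<beta> (X ?u w) - bZ w) * \<Delta>B w)\<^sup>2) + 4 * (indicator ?A w * (rm w)\<^sup>2) + (2 + 1 / h) * (indicator ?A w * (ra w)\<^sup>2)"
    have iR: "integrable M ?R"
      by (intro Bochner_Integration.integrable_add Bochner_Integration.integrable_diff integrable_mult_right P2(1) o1(1) o2(1) bB(1) rm2(1) ra2(1))
    \<comment> \<open>The event is enlarged to the one known at time \<open>?u\<close>, on which the
      orthogonality relations hold.\<close>
    have le: "indicator ?A' w * (X ?v w - euler p q h s (Suc i) w)\<^sup>2 \<le> ?R w" for w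
    proof -
      have "indicator ?A' w \<le> (indicator ?A w :: real)" by (auto simp: stay_def indicator_def)
      then have "indicator ?A' w * (X ?v w - euler p q h s (Suc i) w)\<^sup>2 \<le> indicator ?A w * (P w + (mart ?u ?v w - bZ w * \<Delta>B w) + ra w)\<^sup>2"
        unfolding next_eq by (intro mult_right_mono) auto
      also have "\<dots> \<le> indicator ?A w * ((1 + h) * (P w)\<^sup>2 + 2 * (P w * mart ?u ?v w) - 2 * (P w * (bZ w * \<Delta>B w))
        + 4 * ((\<beta> (X ?u w) - bZ w) * \<Delta>B w)\<^sup>2 + 4 * (rm w)\<^sup>2 + (2 + 1 / h) * (ra w)\<^sup>2)"
        by (intro mult_left_mono pw) simp
      also have "\<dots> = ?R w" by (simp add: indicator_def)
      finally show ?thesis .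
    qed
    have "EG ?A' (\<lambda>w. (X ?v w - euler p q h s (Suc i) w)\<^sup>2) \<le> integral\<^sup>L M ?R"
    proof (rule integral_mono[OF _ iR le])
      show "integrable M (\<lambda>w. indicator ?A' w * (X ?v w - euler p q h s (Suc i) w)\<^sup>2)"
      proof (rule Bochner_Integration.integrable_bound[OF iR])
        have [measurable]: "X ?v \<in> borel_measurable M" "euler p q h s (Suc i) \<in> borel_measurable M"
          using X_measurable[OF u(5)] M_measurable[OF u(5) euler_facts(1)[OF pq s h(1)]] by auto
        show "(\<lambda>w. indicator ?A' w * (X ?v w - euler p q h s (Suc i) w)\<^sup>2) \<in> borel_measurable M" by measurable
        show "AE w in M. norm (indicator ?A' w * (X ?v w - euler p q h s (Suc i) w)\<^sup>2) \<le> norm (?R w)"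
          unfolding real_norm_def
        proof (rule AE_I2)
          fix w
          have "0 \<le> indicator ?A' w * (X ?v w - euler p q h s (Suc i) w)\<^sup>2" by simp
          then show "\<bar>indicator ?A' w * (X ?v w - euler p q h s (Suc i) w)\<^sup>2\<bar> \<le> \<bar>?R w\<bar>" using le[of w] by linarith
        qed
      qed
    qed
    also have "\<dots> = (1 + h) * EG ?A (\<lambda>w. (P w)\<^sup>2) + 2 * EG ?A (\<lambda>w. P w * mart ?u ?v w) - 2 * EG ?A (\<lambda>w. P w * (bZ w * \<Delta>B w))
        + 4 * EG ?A (\<lambda>w. ((\<beta> (X ?u w) - bZ w) * \<Delta>B w)\<^sup>2) + 4 * EG ?A (\<lambda>w. (rm w)\<^sup>2) + (2 + 1 / h) * EG ?A (\<lambda>w. (ra w)\<^sup>2)"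
      using P2(1) o1(1) o2(1) bB(1) rm2(1) ra2(1)
      by (simp only: Bochner_Integration.integral_add Bochner_Integration.integral_diff Bochner_Integration.integrable_add Bochner_Integration.integrable_diff integrable_mult_right integral_mult_right_zero)
    also have "\<dots> \<le> (1 + h) * ((1 + L * h)\<^sup>2 * ?e) + 4 * (h * (L\<^sup>2 * ?e)) + 4 * (C2 * m * h\<^sup>2) + (2 + 1 / h) * (C1 * m * h ^ 3)"
      unfolding o1(2) o2(2) bB(2) mult_zero_right add_0_right diff_0_right
      using h P2(2) b2(2) rm2(2) ra2(2) by (intro add_mono mult_left_mono) auto
    also have "(2 + 1 / h) * (C1 * m * h ^ 3) = (2 * h + 1) * (C1 * m) * h\<^sup>2" using h by (simp add: power2_eq_square power3_eq_cube distrib_right algebra_simps)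
    also have "(1 + h) * ((1 + L * h)\<^sup>2 * ?e) + 4 * (h * (L\<^sup>2 * ?e)) + 4 * (C2 * m * h\<^sup>2) + (2 * h + 1) * (C1 * m) * h\<^sup>2 \<le> (1 + a * h) * ?e + b * h\<^sup>2"
    proof -
      have "(2 * h + 1) * (C1 * m) * h\<^sup>2 \<le> (2 * d + 1) * (C1 * m) * h\<^sup>2" using h C1(1) m0 by (intro mult_right_mono) auto
      then have 1: "4 * (C2 * m * h\<^sup>2) + (2 * h + 1) * (C1 * m) * h\<^sup>2 \<le> b * h\<^sup>2" by (simp add: b_def distrib_right)
      have "(1 + h) * (1 + L * h)\<^sup>2 = 1 + (1 + (2 * L + L\<^sup>2 * h) * (1 + h)) * h" by (simp add: power2_eq_square algebra_simps)
      also have "\<dots> \<le> 1 + (1 + (2 * L + L\<^sup>2 * d) * (1 + d)) * h"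
        using h K(1) by (intro add_left_mono mult_right_mono mult_mono mult_left_mono) auto
      finally have "(1 + h) * (1 + L * h)\<^sup>2 + 4 * h * L\<^sup>2 \<le> 1 + a * h" by (simp add: a_def algebra_simps)
      then have "((1 + h) * (1 + L * h)\<^sup>2 + 4 * h * L\<^sup>2) * ?e \<le> (1 + a * h) * ?e" using e0 by (intro mult_right_mono) auto
      then show ?thesis using 1 by (simp only: distrib_right mult.assoc mult.left_commute)
    qed
    finally show "EG (stay p q h s (Suc i)) (\<lambda>w. (X ?v w - euler p q h s (Suc i) w)\<^sup>2) \<le>
      (1 + a * h) * EG (stay p q h s i) (\<lambda>w. (X ?u w - euler p q h s i w)\<^sup>2) + b * h\<^sup>2"
      unfolding defs(1) .
  qed
qed

end

section \<open>Transition operators of the Euler scheme\<close>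

context brownian_filtration
begin

text \<open>The increment is independent of the pair formed by the indicator of \<open>G\<close> and
  \<open>V\<close>, so the joint law is a product; Fubini's theorem integrates out the increment
  with the rest frozen.\<close>

lemma increment_disintegration:
  fixes \<psi> :: "'b \<times> real \<Rightarrow> real"
  assumes s: "0 \<le> s" "s < t" and V: "V \<in> measurable (F s) N" and G: "G \<in> sets (F s)"
    and \<psi>[measurable]: "\<psi> \<in> borel_measurable (N \<Otimes>\<^sub>M borel)" and c: "\<And>x. \<bar>\<psi> x\<bar> \<le> c"
  shows "EG G (\<lambda>w. \<psi> (V w, B t w - B s w)) = EG G (\<lambda>w. \<integral>d. \<psi> (V w, d) \<partial>density lborel (normal_density 0 (sqrt (t - s))))"
proof -
  let ?D = "\<lambda>w. B t w - B s w" and ?\<nu> = "density lborel (normal_density 0 (sqrt (t - s)))"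
  let ?N = "borel \<Otimes>\<^sub>M N :: (real \<times> 'b) measure"
  define W where "W w = (indicator G w :: real, V w)" for w
  have GM[measurable]: "G \<in> sets M" using M_sets[OF s(1) G] .
  have VM[measurable]: "V \<in> measurable M N" using M_measurable[OF s(1) V] .
  have WF: "W \<in> measurable (F s) ?N" unfolding W_def[abs_def] using V G by measurable
  have WM[measurable]: "W \<in> measurable M ?N" using M_measurable[OF s(1) WF] .
  have DM[measurable]: "?D \<in> borel_measurable M" using s by (intro borel_measurable_diff B_measurable) auto
  have \<nu>: "distr M borel ?D = ?\<nu>"
  proof -
    have "distr M borel ?D = distr M lborel ?D" by (rule distr_cong) auto
    then show ?thesis using B_inc[OF s] by (simp add: distributed_distr_eq_density)
  qed
  interpret W: prob_space "distr M ?N W" by (rule prob_space_distr[OF WM])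
  interpret D: prob_space "distr M borel ?D" by (rule prob_space_distr[OF DM])
  interpret P: pair_prob_space "distr M ?N W" "distr M borel ?D" ..
  have law: "distr M ?N W \<Otimes>\<^sub>M distr M borel ?D = distr M (?N \<Otimes>\<^sub>M borel) (\<lambda>w. (W w, ?D w))"
  proof (rule pair_measure_eqI)
    show "sigma_finite_measure (distr M ?N W)" "sigma_finite_measure (distr M borel ?D)" by unfold_locales
    show "sets (distr M ?N W \<Otimes>\<^sub>M distr M borel ?D) = sets (distr M (?N \<Otimes>\<^sub>M borel) (\<lambda>w. (W w, ?D w)))"
      by (simp cong: sets_pair_measure_cong)
    fix A E assume "A \<in> sets (distr M ?N W)" "E \<in> sets (distr M borel ?D)"
    then have A[measurable]: "A \<in> sets ?N" and E[measurable]: "E \<in> sets borel" by auto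
    have AF: "W -` A \<inter> space M \<in> sets (F s)" using measurable_sets[OF WF A] space_F[OF s(1)] by simp
    have "emeasure (distr M (?N \<Otimes>\<^sub>M borel) (\<lambda>w. (W w, ?D w))) (A \<times> E) = emeasure M ((\<lambda>w. (W w, ?D w)) -` (A \<times> E) \<inter> space M)"
      by (intro emeasure_distr) measurable
    also have "(\<lambda>w. (W w, ?D w)) -` (A \<times> E) \<inter> space M = (W -` A \<inter> space M) \<inter> (?D -` E \<inter> space M)" by auto
    also have "emeasure M \<dots> = ennreal (prob (W -` A \<inter> space M) * prob (?D -` E \<inter> space M))"
      unfolding emeasure_eq_measure increment_prob[OF s AF E] ..
    also have "\<dots> = emeasure (distr M ?N W) A * emeasure (distr M borel ?D) E"
      using A E by (simp add: emeasure_distr emeasure_eq_measure ennreal_mult)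
    finally show "emeasure (distr M ?N W) A * emeasure (distr M borel ?D) E = emeasure (distr M (?N \<Otimes>\<^sub>M borel) (\<lambda>w. (W w, ?D w))) (A \<times> E)" ..
  qed
  let ?f = "\<lambda>x. fst (fst x) * \<psi> (snd (fst x), snd x)"
  have fm[measurable]: "?f \<in> borel_measurable (?N \<Otimes>\<^sub>M borel)" by measurable
  have \<psi>M: "(\<lambda>w. \<psi> (V w, ?D w)) \<in> borel_measurable M" by measurable
  have i0: "integrable M (\<lambda>w. indicator G w * \<psi> (V w, ?D w))"
  proof (rule integrable_const_bound[where B = c])
    show "AE w in M. norm (indicator G w * \<psi> (V w, ?D w)) \<le> c"
      using c order_trans[OF abs_ge_zero c] by (intro AE_I2) (simp add: indicator_def)
  qed (use \<psi>M in measurable)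
  have i1: "integrable (distr M (?N \<Otimes>\<^sub>M borel) (\<lambda>w. (W w, ?D w))) ?f"
    using i0 by (subst integrable_distr_eq) (auto simp: W_def)
  have "EG G (\<lambda>w. \<psi> (V w, ?D w)) = integral\<^sup>L (distr M (?N \<Otimes>\<^sub>M borel) (\<lambda>w. (W w, ?D w))) ?f"
    by (subst integral_distr) (auto simp: W_def)
  also have "\<dots> = (\<integral>x. \<integral>d. ?f (x, d) \<partial>distr M borel ?D \<partial>distr M ?N W)"
    using i1 unfolding law[symmetric] by (rule P.integral_fst'[symmetric])
  also have "\<dots> = (\<integral>x. fst x * (\<integral>d. \<psi> (snd x, d) \<partial>?\<nu>) \<partial>distr M ?N W)"
    unfolding \<nu> by simp
  also have "\<dots> = expectation (\<lambda>w. fst (W w) * (\<integral>d. \<psi> (snd (W w), d) \<partial>?\<nu>))"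
  proof (rule integral_distr[OF WM])
    have "(\<lambda>x. \<integral>d. \<psi> (snd x, d) \<partial>distr M borel ?D) \<in> borel_measurable ?N"
    proof (rule D.borel_measurable_lebesgue_integral)
      have "(\<lambda>x. \<psi> (snd (fst x), snd x)) \<in> borel_measurable (?N \<Otimes>\<^sub>M borel)" by measurable
      then show "case_prod (\<lambda>x d. \<psi> (snd x, d)) \<in> borel_measurable (?N \<Otimes>\<^sub>M distr M borel ?D)"
        by (simp add: split_beta' cong: measurable_cong_sets sets_pair_measure_cong)
    qed
    then show "(\<lambda>x. fst x * (\<integral>d. \<psi> (snd x, d) \<partial>?\<nu>)) \<in> borel_measurable ?N" unfolding \<nu> by measurable
  qed
  finally show ?thesis by (simp add: W_def)
qed

end

context prob_space
begin

text \<open>Conditional expectations are taken on the law of \<open>(V, Y)\<close>: there, a function that is measurable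
  for the first coordinate is constant along the second one.\<close>

lemma conditional_expectation_factor:
  assumes V[measurable]: "V \<in> borel_measurable M" and Y: "integrable M (Y :: 'a \<Rightarrow> real)"
  obtains g :: "real \<Rightarrow> real" where "g \<in> borel_measurable borel" "integrable M (\<lambda>w. g (V w))"
    "\<And>A. A \<in> sets borel \<Longrightarrow> EG (V -` A \<inter> space M) Y = EG (V -` A \<inter> space M) (\<lambda>w. g (V w))"
proof -
  have Ym[measurable]: "Y \<in> borel_measurable M" using Y by measurable
  let ?N = "distr M (borel \<Otimes>\<^sub>M borel) (\<lambda>w. (V w, Y w))"
  let ?F = "vimage_algebra UNIV fst borel :: (real \<times> real) measure"
  interpret N: prob_space ?N by (rule prob_space_distr) measurable
  have sub: "subalgebra ?N ?F"
    unfolding subalgebra_def by (auto simp: space_pair_measure sets_vimage_algebra2 intro!: measurable_sets_borel[of fst, unfolded space_borel])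
       (metis Int_UNIV_right borel_prod measurable_fst measurable_sets_borel)
  interpret sf: sigma_finite_subalgebra ?N ?F
    by (rule finite_measure_subalgebra_is_sigma_finite) (unfold_locales, rule sub)
  have Yi: "integrable ?N snd" using Y by (subst integrable_distr_eq) auto
  define k where "k = real_cond_exp ?N ?F snd"
  have kF: "k \<in> borel_measurable ?F" unfolding k_def by simp
  \<comment> \<open>A level set of \<open>k\<close> is a cylinder over a set of first coordinates,
    so it contains the whole fibre over \<open>x\<close>.\<close>
  have fiber: "k (x, u) = k (x, 0)" for x u
  proof -
    have "k -` {k (x, u)} \<inter> space ?F \<in> sets ?F" using kF by (rule measurable_sets) simp
    then obtain A where "k -` {k (x, u)} = fst -` A" by (auto simp: sets_vimage_algebra2)
    then show ?thesis by (metis fst_conv insertI1 singletonD vimage_eq)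
  qed
  define g where "g x = k (x, 0)" for x
  have kg: "k y = g (fst y)" for y using fiber[of "fst y" "snd y"] by (simp add: g_def)
  have gm[measurable]: "g \<in> borel_measurable borel"
  proof -
    have "(\<lambda>x::real. (x, 0::real)) \<in> measurable borel ?F" by (rule measurable_vimage_algebra2) auto
    from measurable_compose[OF this kF] show ?thesis by (simp add: g_def[abs_def])
  qed
  have ki: "integrable ?N k" unfolding k_def by (rule sf.real_cond_exp_int(1)[OF Yi])
  have gi: "integrable M (\<lambda>w. g (V w))"
    using ki unfolding kg[abs_def] by (subst (asm) integrable_distr_eq) auto
  show ?thesis
  proof (rule that[OF gm gi])
    fix A :: "real set" assume A[measurable]: "A \<in> sets borel"
    have AF: "fst -` A \<in> sets ?F" using in_vimage_algebra[of A borel fst UNIV] A by simp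
    have "EG (V -` A \<inter> space M) Y = expectation (\<lambda>w. indicator A (V w) * Y w)"
      by (rule Bochner_Integration.integral_cong) (auto simp: indicator_def)
    also have "\<dots> = (\<integral>y. indicator A (fst y) * snd y \<partial>?N)" by (subst integral_distr) auto
    also have "\<dots> = (\<integral>y\<in>fst -` A. snd y \<partial>?N)" by (simp add: set_lebesgue_integral_def indicator_def)
    also have "\<dots> = (\<integral>y\<in>fst -` A. k y \<partial>?N)" unfolding k_def by (rule sf.real_cond_exp_intA[OF Yi AF])
    also have "\<dots> = (\<integral>y. indicator A (fst y) * g (fst y) \<partial>?N)" by (simp add: set_lebesgue_integral_def indicator_def kg)
    also have "\<dots> = expectation (\<lambda>w. indicator A (V w) * g (V w))" by (subst integral_distr) auto
    also have "\<dots> = EG (V -` A \<inter> space M) (\<lambda>w. g (V w))"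
      by (rule Bochner_Integration.integral_cong) (auto simp: indicator_def)
    finally show "EG (V -` A \<inter> space M) Y = EG (V -` A \<inter> space M) (\<lambda>w. g (V w))" .
  qed
qed

end

context stationary_diffusion
begin

text \<open>State of the Euler scheme: starting point, current value, sum of the past values, current
  Brownian increment, sum of the past Brownian increments.\<close>

type_synonym state = "real \<times> real \<times> real \<times> real \<times> real"

abbreviation state_space :: "state measure" where
  "state_space \<equiv> borel \<Otimes>\<^sub>M borel \<Otimes>\<^sub>M borel \<Otimes>\<^sub>M borel \<Otimes>\<^sub>M borel"

text \<open>The sums are updated with the old values, so after \<open>m\<close> steps they run over
  \<open>j < m\<close>, as in left Riemann sums.\<close>

definition euler_step :: "real \<Rightarrow> real \<Rightarrow> real \<Rightarrow> state \<Rightarrow> real \<Rightarrow> state" where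
  "euler_step p q h = (\<lambda>(x, z, sz, w, sw) d. (x, z + \<alpha> (clamp_to p q z) * h + \<beta> (clamp_to p q z) * d, sz + z, w + d, sw + w))"

definition euler_state :: "real \<Rightarrow> real \<Rightarrow> real \<Rightarrow> real \<Rightarrow> nat \<Rightarrow> 'w \<Rightarrow> state" where
  "euler_state p q h s j w = (X s w, euler p q h s j w, \<Sum>i<j. euler p q h s i w, B (s + real j * h) w - B s w, \<Sum>i<j. B (s + real i * h) w - B s w)"

text \<open>The transition operator of the scheme; it depends on the mesh but not on the starting
  time.\<close>

definition kern :: "real \<Rightarrow> real \<Rightarrow> real \<Rightarrow> (state \<Rightarrow> real) \<Rightarrow> state \<Rightarrow> real" where
  "kern p q h \<phi> st = (\<integral>d. \<phi> (euler_step p q h st d) \<partial>density lborel (normal_density 0 (sqrt h)))"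

lemma euler_state_Suc: "euler_state p q h s (Suc j) w = euler_step p q h (euler_state p q h s j w) (B (s + real (Suc j) * h) w - B (s + real j * h) w)"
  by (simp add: euler_state_def euler_step_def)

lemma euler_step_measurable:
  assumes pq: "p \<le> q" "{p..q} \<subseteq> S"
  shows "(\<lambda>x. euler_step p q h (fst x) (snd x)) \<in> measurable (state_space \<Otimes>\<^sub>M borel) state_space"
proof -
  note clamp_coeff_measurable[OF pq, measurable]
  show ?thesis unfolding euler_step_def split_beta' by measurable
qed

text \<open>An average over a probability law keeps the bound \<open>c\<close>, so all iterates are
  bounded by the same constant.\<close>

lemma kern_measurable:
  assumes pq: "p \<le> q" "{p..q} \<subseteq> S" and h: "0 < h" and \<phi>[measurable]: "\<phi> \<in> borel_measurable state_space" and c: "\<And>x. \<bar>\<phi> x\<bar> \<le> c"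
  shows "kern p q h \<phi> \<in> borel_measurable state_space" "\<bar>kern p q h \<phi> x\<bar> \<le> c"
proof -
  let ?\<nu> = "density lborel (normal_density 0 (sqrt h))"
  have sh: "0 < sqrt h" using h by simp
  interpret nu: prob_space ?\<nu> by (rule prob_space_normal_density[OF sh])
  note euler_step_measurable[OF pq, measurable]
  have "(\<lambda>x. \<phi> (euler_step p q h (fst x) (snd x))) \<in> borel_measurable (state_space \<Otimes>\<^sub>M borel)" by measurable
  then have "case_prod (\<lambda>x d. \<phi> (euler_step p q h x d)) \<in> borel_measurable (state_space \<Otimes>\<^sub>M ?\<nu>)"
    by (simp add: split_beta' cong: measurable_cong_sets sets_pair_measure_cong)
  then show "kern p q h \<phi> \<in> borel_measurable state_space"
    unfolding kern_def[abs_def] by (rule nu.borel_measurable_lebesgue_integral)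
  have m: "(\<lambda>d. \<phi> (euler_step p q h x d)) \<in> borel_measurable ?\<nu>"
  proof -
    have "(\<lambda>d. (x, d)) \<in> measurable borel (state_space \<Otimes>\<^sub>M borel)" by (rule measurable_Pair1') (simp add: space_pair_measure)
    from measurable_compose[OF this \<open>(\<lambda>x. \<phi> (euler_step p q h (fst x) (snd x))) \<in> borel_measurable (state_space \<Otimes>\<^sub>M borel)\<close>]
    show ?thesis by simp
  qed
  have "\<bar>kern p q h \<phi> x\<bar> \<le> (\<integral>d. \<bar>\<phi> (euler_step p q h x d)\<bar> \<partial>?\<nu>)" unfolding kern_def by (rule integral_abs_bound)
  also have "\<dots> \<le> (\<integral>d. c \<partial>?\<nu>)"
    using m c by (intro integral_mono nu.integrable_const_bound[where B = c] nu.integrable_const) auto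
  finally show "\<bar>kern p q h \<phi> x\<bar> \<le> c" using nu.prob_space by simp
qed

lemma kern_funpow_measurable:
  assumes pq: "p \<le> q" "{p..q} \<subseteq> S" and h: "0 < h" and \<phi>: "\<phi> \<in> borel_measurable state_space" and c: "\<And>x. \<bar>\<phi> x\<bar> \<le> c"
  shows "(kern p q h ^^ j) \<phi> \<in> borel_measurable state_space \<and> (\<forall>x. \<bar>(kern p q h ^^ j) \<phi> x\<bar> \<le> c)"
  using kern_measurable[OF pq h] \<phi> c by (induction j) auto

lemma euler_state_measurable:
  assumes pq: "p \<le> q" "{p..q} \<subseteq> S" and s: "0 \<le> s" and h: "0 < h"
  shows "euler_state p q h s j \<in> measurable (F (s + real j * h)) state_space"
proof -
  have le: "0 \<le> s + real i * h" "s + real i * h \<le> s + real j * h" if "i \<le> j" for i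
    using that s h by (auto intro!: mult_right_mono)
  have "X s \<in> borel_measurable (F (s + real j * h))" using F_measurable[OF s _ X_adapted[OF s], of "s + real j * h"] h by simp
  moreover have "euler p q h s i \<in> borel_measurable (F (s + real j * h))" if "i \<le> j" for i
    by (rule F_measurable[OF le[OF that] euler_facts(1)[OF pq s h]])
  moreover have "B (s + real i * h) \<in> borel_measurable (F (s + real j * h))" if "i \<le> j" for i
    by (rule F_measurable[OF le[OF that] B_adapted[OF le(1)[OF that]]])
  moreover have "B s \<in> borel_measurable (F (s + real j * h))" using F_measurable[OF s _ B_adapted[OF s], of "s + real j * h"] h by simp
  ultimately show ?thesis
    unfolding euler_state_def[abs_def]
    by (intro measurable_Pair borel_measurable_sum borel_measurable_diff) auto
qed

text \<open>Freezing the state and integrating out the last increment applies \<open>kern\<close>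
  once; the test function changes in the induction. On the right the starting time enters only
  through \<open>X s\<close> and the event, and this is the homogeneity in time.\<close>

lemma euler_chain:
  assumes pq: "p \<le> q" "{p..q} \<subseteq> S" and s: "0 \<le> s" and h: "0 < h" and G: "G \<in> sets (F s)"
    and \<phi>: "\<phi> \<in> borel_measurable state_space" and c: "\<And>x. \<bar>\<phi> x\<bar> \<le> c"
  shows "EG G (\<lambda>w. \<phi> (euler_state p q h s j w)) = EG G (\<lambda>w. (kern p q h ^^ j) \<phi> (X s w, X s w, 0, 0, 0))"
  using \<phi> c
proof (induction j arbitrary: \<phi>)
  case 0 then show ?case by (simp add: euler_state_def)
next
  case (Suc j)
  let ?u = "s + real j * h" and ?v = "s + real (Suc j) * h"
  have u: "0 \<le> ?u" "?u < ?v" "s \<le> ?u" "?v - ?u = h" using s h by (auto simp: distrib_right)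
  have GF: "G \<in> sets (F ?u)" by (rule F_sets[OF s u(3) G])
  note Suc.prems(1)[measurable] euler_step_measurable[OF pq, measurable]
  have m: "(\<lambda>x. \<phi> (euler_step p q h (fst x) (snd x))) \<in> borel_measurable (state_space \<Otimes>\<^sub>M borel)" by measurable
  have "EG G (\<lambda>w. \<phi> (euler_state p q h s (Suc j) w)) = EG G (\<lambda>w. (kern p q h \<phi>) (euler_state p q h s j w))"
    using increment_disintegration[OF u(1,2) euler_state_measurable[OF pq s h] GF m Suc.prems(2)]
    unfolding euler_state_Suc u(4) kern_def by simp
  also have "\<dots> = EG G (\<lambda>w. (kern p q h ^^ j) (kern p q h \<phi>) (X s w, X s w, 0, 0, 0))"
    using kern_measurable[OF pq h Suc.prems(1,2)] by (intro Suc.IH) auto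
  finally show ?case by (simp only: funpow_Suc_right comp_def)
qed

end

context prob_space
begin

lemma EG_diff_le:
  assumes U: "integrable M U" and V: "integrable M (V :: 'a \<Rightarrow> real)" and G[measurable]: "G \<in> sets M"
  shows "\<bar>EG G U - EG G V\<bar> \<le> expectation (\<lambda>w. \<bar>U w - V w\<bar>)"
proof -
  have "EG G U - EG G V = expectation (\<lambda>w. indicator G w * U w - indicator G w * V w)"
    using integrable_imp_on_event[OF U G] integrable_imp_on_event[OF V G] by simp
  then have "\<bar>EG G U - EG G V\<bar> \<le> expectation (\<lambda>w. \<bar>indicator G w * U w - indicator G w * V w\<bar>)"
    by (simp only: integral_abs_bound)
  also have "\<dots> \<le> expectation (\<lambda>w. \<bar>U w - V w\<bar>)"
    using U V integrable_imp_on_event[OF U G] integrable_imp_on_event[OF V G]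
    by (intro integral_mono) (auto simp: indicator_def)
  finally show ?thesis .
qed

end

section \<open>Convergence of the Euler averages\<close>

context stationary_diffusion
begin

text \<open>Discrete Gronwall with \<open>m\<close> steps of size \<open>d / m\<close>: the local
  contributions \<open>b * h^2\<close> add up to order \<open>1 / m\<close>. The constant does not
  depend on the starting time.\<close>

lemma euler_error:
  assumes pq: "p \<le> q" "{p..q} \<subseteq> S" and d: "0 < d"
  obtains C where "0 \<le> C" "\<And>s m j. 0 \<le> s \<Longrightarrow> 0 < m \<Longrightarrow> j \<le> m \<Longrightarrow>
    EG (stay p q (d / real m) s j) (\<lambda>w. (X (s + real j * (d / real m)) w - euler p q (d / real m) s j w)\<^sup>2) \<le> C / real m"
proof -
  obtain a b where ab: "0 \<le> a" "0 \<le> b" "\<And>s h i. 0 \<le> s \<Longrightarrow> 0 < h \<Longrightarrow> h \<le> d \<Longrightarrow>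
    EG (stay p q h s (Suc i)) (\<lambda>w. (X (s + real (Suc i) * h) w - euler p q h s (Suc i) w)\<^sup>2) \<le>
    (1 + a * h) * EG (stay p q h s i) (\<lambda>w. (X (s + real i * h) w - euler p q h s i w)\<^sup>2) + b * h\<^sup>2"
    by (rule euler_error_step[OF pq d]) (rule that; assumption)
  show ?thesis
  proof (rule that[of "b * d\<^sup>2 * exp (a * d)"])
    show "0 \<le> b * d\<^sup>2 * exp (a * d)" using ab by simp
    fix s :: real and m j :: nat assume s: "0 \<le> s" and m: "0 < m" "j \<le> m"
    define h where "h = d / real m"
    have h: "0 < h" "h \<le> d" "real m * h = d" using m d by (auto simp: h_def field_simps)
    let ?e = "\<lambda>j. EG (stay p q h s j) (\<lambda>w. (X (s + real j * h) w - euler p q h s j w)\<^sup>2)"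
    have "?e j \<le> real j * (b * h\<^sup>2) * (1 + a * h) ^ j"
      by (rule discrete_gronwall[where n = m and e = ?e]) (use ab(1,2) ab(3)[OF s h(1,2)] h m in auto)
    also have "\<dots> \<le> real m * (b * h\<^sup>2) * exp (a * d)"
    proof (intro mult_mono)
      have "(1 + a * h) ^ j \<le> (1 + a * h) ^ m" using ab(1) h m(2) by (intro power_increasing) auto
      also have "\<dots> \<le> exp (a * h) ^ m" using ab(1) h by (intro power_mono exp_ge_add_one_self) auto
      also have "\<dots> = exp (a * d)" using h(3) by (simp add: exp_of_nat_mult[symmetric] algebra_simps)
      finally show "(1 + a * h) ^ j \<le> exp (a * d)" .
    qed (use ab h m in auto)
    also have "\<dots> = b * d\<^sup>2 * exp (a * d) / real m" using m by (simp add: h_def power2_eq_square field_simps)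
    finally show "EG (stay p q (d / real m) s j) (\<lambda>w. (X (s + real j * (d / real m)) w - euler p q (d / real m) s j w)\<^sup>2) \<le> b * d\<^sup>2 * exp (a * d) / real m"
      unfolding h_def .
  qed
qed

abbreviation euler_mean :: "real \<Rightarrow> real \<Rightarrow> real \<Rightarrow> nat \<Rightarrow> real \<Rightarrow> 'w \<Rightarrow> real" where
  "euler_mean p q d m s w \<equiv> (\<Sum>j<m. euler p q (d / real m) s j w) / real m"

text \<open>On the event \<open>stay\<close>, \<open>|x| <= 1 / k + k * x^2\<close> with
  \<open>k = sqrt m\<close> balances the mean square error \<open>C / m\<close>; off the event the
  truncated distance is at most 1.\<close>

lemma euler_mean_error:
  assumes pq: "p \<le> q" "{p..q} \<subseteq> S" and d: "0 < d"
  obtains C where "0 \<le> C" "\<And>s m. 0 \<le> s \<Longrightarrow> 0 < m \<Longrightarrow>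
    pdist (euler_mean p q d m s) (\<lambda>w. (\<Sum>j<m. X (s + real j * (d / real m)) w) / real m) \<le>
    prob (space M - stay p q (d / real m) s m) + C / sqrt (real m)"
proof -
  obtain C where C: "0 \<le> C" "\<And>s m j. 0 \<le> s \<Longrightarrow> 0 < m \<Longrightarrow> j \<le> m \<Longrightarrow>
    EG (stay p q (d / real m) s j) (\<lambda>w. (X (s + real j * (d / real m)) w - euler p q (d / real m) s j w)\<^sup>2) \<le> C / real m"
    by (rule euler_error[OF pq d]) (rule that; assumption)
  show ?thesis
  proof (rule that[of "1 + C"])
    show "0 \<le> 1 + C" using C(1) by simp
    fix s :: real and m :: nat assume s: "0 \<le> s" and m: "0 < m"
    define h where "h = d / real m"
    have h: "0 < h" using m d by (simp add: h_def)
    let ?k = "sqrt (real m)"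
    have k: "0 < ?k" "?k * ?k = real m" using m by auto
    define D where "D j w = X (s + real j * h) w - euler p q h s j w" for j w
    let ?A = "stay p q h s m"
    have u: "0 \<le> s + real j * h" for j using s h by simp
    have eM[measurable]: "euler p q h s j \<in> borel_measurable M" for j by (rule M_measurable[OF u euler_facts(1)[OF pq s h]])
    have XM[measurable]: "X (s + real j * h) \<in> borel_measurable M" for j by (rule X_measurable[OF u])
    have DM[measurable]: "D j \<in> borel_measurable M" for j unfolding D_def by measurable
    have AM[measurable]: "stay p q h s j \<in> sets M" for j by (rule M_sets[OF u stay_measurable[OF s h]])
    have D2: "integrable M (\<lambda>w. (D j w)\<^sup>2)" for j
    proof (rule Bochner_Integration.integrable_bound)
      show "integrable M (\<lambda>w. 2 * wt 2 (X (s + real j * h) w) + 2 * (euler p q h s j w)\<^sup>2)"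
        using euler_facts(2)[OF pq s h] wt_integrable[OF u, where k = 2] by simp
      show "AE w in M. norm ((D j w)\<^sup>2) \<le> norm (2 * wt 2 (X (s + real j * h) w) + 2 * (euler p q h s j w)\<^sup>2)"
      proof (rule AE_I2)
        fix w
        let ?x = "X (s + real j * h) w" and ?z = "euler p q h s j w"
        have "(D j w)\<^sup>2 \<le> 2 * ?x\<^sup>2 + 2 * ?z\<^sup>2"
          using sum_squares_ge_zero[of "?x + ?z" 0] unfolding D_def by (simp add: power2_eq_square algebra_simps)
        also have "?x\<^sup>2 \<le> wt 2 ?x" by (simp add: power2_sum)
        finally show "norm ((D j w)\<^sup>2) \<le> norm (2 * wt 2 ?x + 2 * ?z\<^sup>2)" by simp
      qed
    qed measurable
    have sub: "?A \<subseteq> stay p q h s j" if "j \<le> m" for j using that by (auto simp: stay_def)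
    have E: "EG ?A (\<lambda>w. (D j w)\<^sup>2) \<le> C / real m" if "j < m" for j
    proof -
      have "EG ?A (\<lambda>w. (D j w)\<^sup>2) \<le> EG (stay p q h s j) (\<lambda>w. (D j w)\<^sup>2)"
        using sub[of j] that by (intro integral_mono integrable_imp_on_event[OF D2] AM mult_right_mono) (auto simp: indicator_def)
      also have "\<dots> \<le> C / real m" using C(2)[OF s m, of j] that by (simp add: D_def h_def)
      finally show ?thesis .
    qed
    let ?R = "\<lambda>w. indicator (space M - ?A) w + (1 / real m) * (\<Sum>j<m. 1 / ?k + ?k * (indicator ?A w * (D j w)\<^sup>2))"
    have iD: "integrable M (\<lambda>w. indicator ?A w * (D j w)\<^sup>2)" for j by (rule integrable_imp_on_event[OF D2 AM])
    have i1: "integrable M (\<lambda>w. 1 / ?k + ?k * (indicator ?A w * (D j w)\<^sup>2))" for j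
      using iD[of j] by simp
    have i2: "integrable M (\<lambda>w. (1 / real m) * (\<Sum>j<m. 1 / ?k + ?k * (indicator ?A w * (D j w)\<^sup>2)))"
      by (intro integrable_mult_right Bochner_Integration.integrable_sum i1)
    have i3: "integrable M (indicator (space M - ?A) :: 'w \<Rightarrow> real)" by (intro integrable_real_indicator) (auto simp: emeasure_eq_measure)
    have ab: "\<bar>x\<bar> \<le> 1 / ?k + ?k * x\<^sup>2" for x
    proof -
      have "0 \<le> (?k * \<bar>x\<bar> - 1)\<^sup>2" by simp
      then have "2 * (?k * \<bar>x\<bar>) \<le> ?k * ?k * x\<^sup>2 + 1" by (simp add: power2_eq_square algebra_simps abs_mult_self_eq)
      moreover have "0 \<le> ?k * \<bar>x\<bar>" using k by simp
      ultimately have "?k * \<bar>x\<bar> \<le> 1 + ?k * ?k * x\<^sup>2" by linarith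
      also have "\<dots> = ?k * (1 / ?k + ?k * x\<^sup>2)" using k(1) by (simp add: distrib_left mult.assoc)
      finally show ?thesis using k(1) by (simp only: mult_le_cancel_left_pos)
    qed
    have "pdist (euler_mean p q d m s) (\<lambda>w. (\<Sum>j<m. X (s + real j * h) w) / real m) \<le> expectation ?R"
      unfolding pdist_def
    proof (rule integral_mono)
      show "integrable M (\<lambda>w. min 1 \<bar>euler_mean p q d m s w - (\<Sum>j<m. X (s + real j * h) w) / real m\<bar>)"
        unfolding h_def[symmetric] by (intro integrable_pdist) measurable
      show "integrable M ?R" by (intro Bochner_Integration.integrable_add i2 i3)
      fix w assume w: "w \<in> space M"
      show "min 1 \<bar>euler_mean p q d m s w - (\<Sum>j<m. X (s + real j * h) w) / real m\<bar> \<le> ?R w"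
      proof (cases "w \<in> ?A")
        case True
        have "euler_mean p q d m s w - (\<Sum>j<m. X (s + real j * h) w) / real m = - ((1 / real m) * (\<Sum>j<m. D j w))"
          unfolding h_def[symmetric] D_def by (simp add: sum_subtractf diff_divide_distrib)
        then have "\<bar>euler_mean p q d m s w - (\<Sum>j<m. X (s + real j * h) w) / real m\<bar> \<le> (1 / real m) * (\<Sum>j<m. \<bar>D j w\<bar>)"
          using m by (simp add: abs_mult divide_right_mono)
        also have "\<dots> \<le> (1 / real m) * (\<Sum>j<m. 1 / ?k + ?k * (D j w)\<^sup>2)" by (intro mult_left_mono sum_mono ab) simp
        finally show ?thesis using True by simp
      next
        case False
        have "0 \<le> (1 / real m) * (\<Sum>j<m. 1 / ?k + ?k * (indicator ?A w * (D j w)\<^sup>2))" using k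
          by (intro mult_nonneg_nonneg sum_nonneg add_nonneg_nonneg) auto
        moreover have "indicator (space M - ?A) w = (1 :: real)" using False w by simp
        ultimately show ?thesis by linarith
      qed
    qed
    also have "\<dots> = prob (space M - ?A) + (1 / real m) * (\<Sum>j<m. 1 / ?k + ?k * EG ?A (\<lambda>w. (D j w)\<^sup>2))"
      using i1 i2 i3 iD by (simp add: Bochner_Integration.integral_add Bochner_Integration.integral_sum prob_space)
    also have "\<dots> \<le> prob (space M - ?A) + (1 / real m) * (\<Sum>j<m. 1 / ?k + ?k * (C / real m))"
      using k by (intro add_left_mono mult_left_mono sum_mono E) auto
    also have "(1 / real m) * (\<Sum>j<m. 1 / ?k + ?k * (C / real m)) = (1 + C) / ?k"
    proof -
      have "c * (C / (c * c)) = C / c" if "0 < c" for c :: real using that by simp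
      from this[OF k(1)] have "?k * (C / real m) = C / ?k" unfolding k(2) .
      then show ?thesis using m by (simp add: add_divide_distrib)
    qed
    finally show "pdist (euler_mean p q d m s) (\<lambda>w. (\<Sum>j<m. X (s + real j * (d / real m)) w) / real m) \<le>
      prob (space M - stay p q (d / real m) s m) + (1 + C) / sqrt (real m)" unfolding h_def .
  qed
qed

text \<open>A continuous path on a compact time interval keeps to a compact part of
  \<open>S\<close>, hence to some \<open>[pk k, qk k]\<close>; the exit events therefore decrease to
  the empty set.\<close>

lemma stay_probability:
  assumes pq: "decseq pk" "incseq qk" "S = (\<Union>k. {pk k..qk k})" and s: "0 \<le> s" and d: "0 < d" and e: "0 < e"
  shows "\<forall>\<^sub>F k in sequentially. \<forall>m>0. prob (space M - stay (pk k) (qk k) (d / real m) s m) < e"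
proof -
  \<comment> \<open>Rational fractions of \<open>[s, s + d]\<close> make the exit event measurable
    and include all grid points \<open>j / m\<close>, so one \<open>k\<close> serves all
    \<open>m\<close>.\<close>
  let ?N = "\<lambda>k. {w\<in>space M. \<exists>r::rat. 0 \<le> real_of_rat r \<and> real_of_rat r \<le> 1 \<and> X (s + d * real_of_rat r) w \<notin> {pk k..qk k}}"
  have XM: "X (s + d * r) \<in> borel_measurable M" if "0 \<le> r" for r using X_measurable[of "s + d * r"] s d that by simp
  have NM[measurable]: "?N k \<in> sets M" for k
  proof (rule sets.sets_Collect_countable_Ex)
    fix r :: rat
    show "{w\<in>space M. 0 \<le> real_of_rat r \<and> real_of_rat r \<le> 1 \<and> X (s + d * real_of_rat r) w \<notin> {pk k..qk k}} \<in> sets M"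
    proof (cases "0 \<le> real_of_rat r")
      case True
      note XM[OF this, measurable]
      show ?thesis by measurable
    qed simp
  qed
  have mono: "{pk i..qk i} \<subseteq> {pk j..qk j}" if "i \<le> j" for i j
    using decseqD[OF pq(1) that] incseqD[OF pq(2) that] by auto
  have dec: "decseq ?N" unfolding decseq_def using mono by blast
  have "(\<lambda>k. prob (?N k)) \<longlonglongrightarrow> prob (\<Inter>k. ?N k)"
    by (rule finite_Lim_measure_decseq[OF _ dec]) (use NM in auto)
  moreover have "(\<Inter>k. ?N k) = {}"
  proof (rule equals0I)
    fix w assume w: "w \<in> (\<Inter>k. ?N k)"
    then have wM: "w \<in> space M" by blast
    have c: "continuous_on {s..s + d} (\<lambda>u. X u w)" by (rule X_cont_on[OF wM s])
    have ne: "{s..s + d} \<noteq> {}" using d by simp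
    obtain u where u: "u \<in> {s..s + d}" "\<And>v. v \<in> {s..s + d} \<Longrightarrow> X v w \<le> X u w"
      using continuous_attains_sup[OF compact_Icc ne c] by blast
    obtain v where v: "v \<in> {s..s + d}" "\<And>r. r \<in> {s..s + d} \<Longrightarrow> X v w \<le> X r w"
      using continuous_attains_inf[OF compact_Icc ne c] by blast
    have "X u w \<in> S" "X v w \<in> S" using X_S[OF _ wM] u(1) v(1) s by auto
    then obtain i j where "X u w \<in> {pk i..qk i}" "X v w \<in> {pk j..qk j}" unfolding pq(3) by blast
    then have uv: "X u w \<in> {pk (max i j)..qk (max i j)}" "X v w \<in> {pk (max i j)..qk (max i j)}"
      using mono[of i "max i j"] mono[of j "max i j"] by auto
    have "X (s + d * r) w \<in> {pk (max i j)..qk (max i j)}" if "0 \<le> r" "r \<le> 1" for r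
    proof -
      have "s + d * r \<in> {s..s + d}" using d that mult_left_le[of r d] by auto
      from u(2)[OF this] v(2)[OF this] uv show ?thesis by auto
    qed
    then show False using w by blast
  qed
  ultimately have "(\<lambda>k. prob (?N k)) \<longlonglongrightarrow> 0" by simp
  from order_tendstoD(2)[OF this e] show ?thesis
  proof eventually_elim
    case (elim k)
    show ?case
    proof (intro allI impI)
      fix m :: nat assume m: "0 < m"
      have "space M - stay (pk k) (qk k) (d / real m) s m \<subseteq> ?N k"
      proof
        fix w assume "w \<in> space M - stay (pk k) (qk k) (d / real m) s m"
        then obtain j where j: "w \<in> space M" "j \<le> m" "X (s + real j * (d / real m)) w \<notin> {pk k..qk k}" by (auto simp: stay_def)
        have "real_of_rat (of_nat j / of_nat m) = real j / real m" by (simp add: of_rat_divide)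
        moreover have "X (s + d * (real j / real m)) w \<notin> {pk k..qk k}" proof -
          have eq: "real j * (d / real m) = d * (real j / real m)" by simp
          show ?thesis using j(3) unfolding eq .
        qed
        ultimately show "w \<in> ?N k"
        proof (intro CollectI conjI exI[of _ "of_nat j / of_nat m :: rat"])
          assume eq: "real_of_rat (of_nat j / of_nat m) = real j / real m" and out: "X (s + d * (real j / real m)) w \<notin> {pk k..qk k}"
          show "w \<in> space M" by (rule j(1))
          show "0 \<le> real_of_rat (of_nat j / of_nat m)" "real_of_rat (of_nat j / of_nat m) \<le> 1" unfolding eq using j(2) m by auto
          show "X (s + d * real_of_rat (of_nat j / of_nat m)) w \<notin> {pk k..qk k}" unfolding eq by (rule out)
        qed
      qed
      then show "prob (space M - stay (pk k) (qk k) (d / real m) s m) < e"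
        using elim finite_measure_mono[OF _ NM] by (meson order_le_less_trans)
    qed
  qed
qed

text \<open>The limits are nested in this order because the error constant of the scheme depends on
  \<open>k\<close>: the solution is confined first, then the mesh is refined.\<close>

lemma euler_mean_approx:
  assumes pq: "\<And>k. pk k \<le> qk k" "decseq pk" "incseq qk" "S = (\<Union>k. {pk k..qk k})" and s: "0 \<le> s" and d: "0 < d" and e: "0 < e"
  shows "\<forall>\<^sub>F k in sequentially. \<forall>\<^sub>F m in sequentially. pdist (euler_mean (pk k) (qk k) d m s) (X_mean s (s + d)) < e"
proof -
  have "0 < e / 3" using e by simp
  from stay_probability[OF pq(2-4) s d this] show ?thesis
  proof eventually_elim
    case (elim k)
    have sub: "{pk k..qk k} \<subseteq> S" unfolding pq(4) by blast
    obtain C where C: "0 \<le> C" "\<And>s m. 0 \<le> s \<Longrightarrow> 0 < m \<Longrightarrow>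
      pdist (euler_mean (pk k) (qk k) d m s) (\<lambda>w. (\<Sum>j<m. X (s + real j * (d / real m)) w) / real m) \<le>
      prob (space M - stay (pk k) (qk k) (d / real m) s m) + C / sqrt (real m)"
      by (rule euler_mean_error[OF pq(1) sub d]) (rule that; assumption)
    let ?x = "\<lambda>m w. (\<Sum>j<m. X (s + real j * (d / real m)) w) / real m"
    have xM: "?x m \<in> borel_measurable M" for m
      using s d by (intro borel_measurable_divide borel_measurable_sum X_measurable) auto
    have YM: "X_mean s (s + d) \<in> borel_measurable M" using X_mean_measurable[of s "s + d"] s d by simp
    have "(\<lambda>m. pdist (?x m) (X_mean s (s + d))) \<longlonglongrightarrow> 0"
    proof (rule AE_tendsto_pdist[OF xM YM], rule AE_I2)
      fix w assume "w \<in> space M"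
      from riemann_mean_tendsto[OF X_cont_on[OF this s, of "s + d"]] d
      show "(\<lambda>m. ?x m w) \<longlonglongrightarrow> X_mean s (s + d) w" by (simp add: X_mean_def)
    qed
    then have 1: "\<forall>\<^sub>F m in sequentially. pdist (?x m) (X_mean s (s + d)) < e / 3" using e by (intro order_tendstoD(2)) auto
    have "(\<lambda>m. C / sqrt (real m)) \<longlonglongrightarrow> 0" by real_asymp
    then have 2: "\<forall>\<^sub>F m in sequentially. C / sqrt (real m) < e / 3" using e by (intro order_tendstoD(2)) auto
    show ?case using 1 2 eventually_gt_at_top[of 0]
    proof eventually_elim
      case (elim m)
      have zM: "euler_mean (pk k) (qk k) d m s \<in> borel_measurable M"
      proof (intro borel_measurable_divide borel_measurable_sum)
        fix j
        have h: "0 < d / real m" using d elim by simp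
        have u: "0 \<le> s + real j * (d / real m)" using s h by (intro add_nonneg_nonneg mult_nonneg_nonneg) auto
        show "euler (pk k) (qk k) (d / real m) s j \<in> borel_measurable M"
          by (rule M_measurable[OF u euler_facts(1)[OF pq(1) sub s h]])
      qed simp
      have "pdist (euler_mean (pk k) (qk k) d m s) (?x m) < e / 3 + e / 3"
        using C(2)[OF s elim(3)] \<open>\<forall>m>0. prob (space M - stay (pk k) (qk k) (d / real m) s m) < e / 3\<close>[rule_format, OF elim(3)] elim(2) by linarith
      then show ?case using pdist_triangle[OF zM xM[of m] YM] elim(1) by linarith
    qed
  qed
qed

lemma bm_mean_riemann:
  assumes "w \<in> space M" "0 \<le> s" "0 < d"
  shows "(\<lambda>m. (\<Sum>j<m. B (s + real j * (d / real m)) w - B s w) / real m) \<longlonglongrightarrow> bm_mean s (s + d) w"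
proof -
  have "continuous_on {s..s + d} (\<lambda>u. B u w - B s w)" using assms by (intro continuous_intros B_cont_on) auto
  from riemann_mean_tendsto[OF this] assms(3) show ?thesis by (simp add: bm_mean_def)
qed

text \<open>One Euler scheme serves two starting times at once; this is what makes the conditional
  expectations below the same function of the starting point.\<close>

lemma euler_functional_approx:
  assumes pq: "\<And>k. pk k \<le> qk k" "decseq pk" "incseq qk" "S = (\<Union>k. {pk k..qk k})" and d: "0 < d"
    and \<Psi>: "(\<lambda>x. \<Psi> (fst x) (fst (snd x)) (snd (snd x))) \<in> borel_measurable (borel \<Otimes>\<^sub>M borel \<Otimes>\<^sub>M borel)"
    and cont: "\<And>x y w yn wn. x \<in> S \<Longrightarrow> y \<in> S \<Longrightarrow> yn \<longlonglongrightarrow> y \<Longrightarrow> wn \<longlonglongrightarrow> w \<Longrightarrow> (\<lambda>n. \<Psi> x (yn n) (wn n)) \<longlonglongrightarrow> (\<Psi> x y w :: real)"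
    and int: "\<And>s. 0 \<le> s \<Longrightarrow> integrable M (\<lambda>w. \<Psi> (X s w) (X_mean s (s + d) w) (bm_mean s (s + d) w))"
    and s: "0 \<le> s1" "0 \<le> s2" and e: "0 < e"
  obtains p q h m L \<phi> where "p \<le> q" "{p..q} \<subseteq> S" "0 < h" "\<phi> \<in> borel_measurable state_space" "\<And>x. \<bar>\<phi> x\<bar> \<le> L"
    "\<And>s. s = s1 \<or> s = s2 \<Longrightarrow>
      expectation (\<lambda>w. \<bar>\<phi> (euler_state p q h s m w) - \<Psi> (X s w) (X_mean s (s + d) w) (bm_mean s (s + d) w)\<bar>) < e"
proof -
  let ?\<psi> = "\<lambda>s w. \<Psi> (X s w) (X_mean s (s + d) w) (bm_mean s (s + d) w)"
  have sd: "s < s + d" for s using d by simp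
  have XmM: "X_mean s (s + d) \<in> borel_measurable M" if "0 \<le> s" for s by (rule X_mean_measurable[OF that sd])
  have sub: "{pk k..qk k} \<subseteq> S" for k unfolding pq(4) by blast
  have \<psi>M: "?\<psi> s \<in> borel_measurable M" if "0 \<le> s" for s using int[OF that] by measurable
  \<comment> \<open>Truncation at level \<open>L\<close> makes the functional bounded, as the
    transition operators require; the loss is below \<open>e / 2\<close> for large
    \<open>L\<close>.\<close>
  let ?c = "\<lambda>L. clamp_to (- real L) (real L)"
  have c1: "\<bar>?c L x\<bar> \<le> real L" for L x by (simp add: clamp_to_def)
  have clim: "(\<lambda>n. ?c L (a n)) \<longlonglongrightarrow> ?c L x" if "a \<longlonglongrightarrow> x" for a x L unfolding clamp_to_def by (intro tendsto_intros that)
  have L0: "\<forall>\<^sub>F L in sequentially. expectation (\<lambda>w. \<bar>?c L (?\<psi> s w) - ?\<psi> s w\<bar>) < e / 2" if s: "0 \<le> s" for s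
  proof -
    note \<psi>M[OF s, measurable]
    have "(\<lambda>L. expectation (\<lambda>w. \<bar>?c L (?\<psi> s w) - ?\<psi> s w\<bar>)) \<longlonglongrightarrow> expectation (\<lambda>w. 0)"
    proof (rule integral_dominated_convergence[where w = "\<lambda>w. \<bar>?\<psi> s w\<bar>"])
      show "integrable M (\<lambda>w. \<bar>?\<psi> s w\<bar>)" using int[OF s] by simp
      show "AE w in M. (\<lambda>L. \<bar>?c L (?\<psi> s w) - ?\<psi> s w\<bar>) \<longlonglongrightarrow> 0"
      proof (rule AE_I2)
        fix w
        obtain K :: nat where K: "\<bar>?\<psi> s w\<bar> \<le> real K" using real_arch_simple by blast
        have "\<forall>\<^sub>F L in sequentially. \<bar>?c L (?\<psi> s w) - ?\<psi> s w\<bar> = 0"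
          using eventually_ge_at_top[of K]
        proof eventually_elim
          case (elim L)
          then have "\<bar>?\<psi> s w\<bar> \<le> real L" using K by linarith
          then show ?case unfolding clamp_to_def by linarith
        qed
        then show "(\<lambda>L. \<bar>?c L (?\<psi> s w) - ?\<psi> s w\<bar>) \<longlonglongrightarrow> 0" by (rule tendsto_eventually)
      qed
      show "AE w in M. norm \<bar>?c L (?\<psi> s w) - ?\<psi> s w\<bar> \<le> \<bar>?\<psi> s w\<bar>" for L
        by (intro AE_I2) (auto simp: clamp_to_def)
    qed measurable
    then show ?thesis using e by (intro order_tendstoD(2)) auto
  qed
  obtain L where L: "expectation (\<lambda>w. \<bar>?c L (?\<psi> s w) - ?\<psi> s w\<bar>) < e / 2" if "s = s1 \<or> s = s2" for s
    using eventually_happens[OF eventually_conj[OF L0[OF s(1)] L0[OF s(2)]]] by auto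
  \<comment> \<open>Intervals and meshes along which both averages converge; \<open>n < m n\<close>
    sends the mesh to 0, as the Brownian averages need.\<close>
  have "\<forall>n. \<exists>k m. n < m \<and> pdist (euler_mean (pk k) (qk k) d m s1) (X_mean s1 (s1 + d)) < inverse (real (Suc n))
    \<and> pdist (euler_mean (pk k) (qk k) d m s2) (X_mean s2 (s2 + d)) < inverse (real (Suc n))"
  proof
    fix n
    have "0 < inverse (real (Suc n))" by simp
    from eventually_happens[OF eventually_conj[OF euler_mean_approx[OF pq s(1) d this] euler_mean_approx[OF pq s(2) d this]]]
    obtain k where k: "\<forall>\<^sub>F m in sequentially. pdist (euler_mean (pk k) (qk k) d m s1) (X_mean s1 (s1 + d)) < inverse (real (Suc n))"
      "\<forall>\<^sub>F m in sequentially. pdist (euler_mean (pk k) (qk k) d m s2) (X_mean s2 (s2 + d)) < inverse (real (Suc n))" by auto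
    from eventually_happens[OF eventually_conj[OF eventually_conj[OF k] eventually_gt_at_top[of n]]]
    show "\<exists>k m. n < m \<and> pdist (euler_mean (pk k) (qk k) d m s1) (X_mean s1 (s1 + d)) < inverse (real (Suc n))
      \<and> pdist (euler_mean (pk k) (qk k) d m s2) (X_mean s2 (s2 + d)) < inverse (real (Suc n))" by auto
  qed
  then obtain k m where km: "\<And>n. n < m n" "\<And>n. pdist (euler_mean (pk (k n)) (qk (k n)) d (m n) s1) (X_mean s1 (s1 + d)) < inverse (real (Suc n))"
    "\<And>n. pdist (euler_mean (pk (k n)) (qk (k n)) d (m n) s2) (X_mean s2 (s2 + d)) < inverse (real (Suc n))"
    by metis
  have m0: "0 < m n" for n using km(1)[of n] by simp
  let ?z = "\<lambda>s n. euler_mean (pk (k n)) (qk (k n)) d (m n) s"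
  let ?w = "\<lambda>s n w. (\<Sum>j<m n. B (s + real j * (d / real (m n))) w - B s w) / real (m n)"
  have h: "0 < d / real (m n)" for n using d m0[of n] by simp
  have zM: "?z s n \<in> borel_measurable M" if s: "0 \<le> s" for s n
  proof (intro borel_measurable_divide borel_measurable_sum)
    fix j
    have u: "0 \<le> s + real j * (d / real (m n))" using s h[of n] by (intro add_nonneg_nonneg mult_nonneg_nonneg) auto
    show "euler (pk (k n)) (qk (k n)) (d / real (m n)) s j \<in> borel_measurable M"
      by (rule M_measurable[OF u euler_facts(1)[OF pq(1) sub s h]])
  qed simp
  have wM: "?w s n \<in> borel_measurable M" if s: "0 \<le> s" for s n
  proof (intro borel_measurable_divide borel_measurable_sum borel_measurable_diff B_measurable s)
    fix j show "0 \<le> s + real j * (d / real (m n))" using s h[of n] by (intro add_nonneg_nonneg mult_nonneg_nonneg) auto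
  qed simp
  have mtop: "filterlim m at_top sequentially"
    by (rule filterlim_at_top_mono[OF filterlim_ident]) (use km(1) in \<open>auto intro!: always_eventually less_imp_le\<close>)
  have wlim: "(\<lambda>n. ?w s n w) \<longlonglongrightarrow> bm_mean s (s + d) w" if "w \<in> space M" "0 \<le> s" for s w
    using filterlim_compose[OF bm_mean_riemann[OF that d] mtop] .
  have inv: "(\<lambda>n. inverse (real (Suc n))) \<longlonglongrightarrow> 0" by (rule LIMSEQ_inverse_real_of_nat)
  have z1: "(\<lambda>n. pdist (?z s1 n) (X_mean s1 (s1 + d))) \<longlonglongrightarrow> 0"
    by (rule tendsto_sandwich[OF _ _ tendsto_const inv]) (use km(2) in \<open>auto intro!: always_eventually less_imp_le\<close>)
  have z2: "(\<lambda>n. pdist (?z s2 n) (X_mean s2 (s2 + d))) \<longlonglongrightarrow> 0"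
    by (rule tendsto_sandwich[OF _ _ tendsto_const inv]) (use km(3) in \<open>auto intro!: always_eventually less_imp_le\<close>)
  \<comment> \<open>Almost sure convergence is needed to pass to the limit inside
    \<open>\<Psi>\<close>. The second subsequence is taken from the first, so it serves both
    starting times.\<close>
  obtain r1 where r1: "strict_mono r1" "AE w in M. (\<lambda>n. ?z s1 (r1 n) w) \<longlonglongrightarrow> X_mean s1 (s1 + d) w"
    by (rule pdist_AE_subseq[OF zM[OF s(1)] XmM[OF s(1)] z1]) (rule that; assumption)
  have z2': "(\<lambda>n. pdist (?z s2 (r1 n)) (X_mean s2 (s2 + d))) \<longlonglongrightarrow> 0"
    using LIMSEQ_subseq_LIMSEQ[OF z2 r1(1)] by (simp add: comp_def)
  obtain r2 where r2: "strict_mono r2" "AE w in M. (\<lambda>n. ?z s2 (r1 (r2 n)) w) \<longlonglongrightarrow> X_mean s2 (s2 + d) w"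
    by (rule pdist_AE_subseq[OF zM[OF s(2)] XmM[OF s(2)] z2']) (rule that; assumption)
  define r where "r n = r1 (r2 n)" for n
  have rtop: "filterlim r at_top sequentially"
    unfolding r_def using filterlim_compose[OF filterlim_subseq[OF r1(1)] filterlim_subseq[OF r2(1)]] .
  have zr1: "AE w in M. (\<lambda>n. ?z s1 (r n) w) \<longlonglongrightarrow> X_mean s1 (s1 + d) w"
    using r1(2)
  proof eventually_elim
    case (elim w)
    from filterlim_compose[OF elim filterlim_subseq[OF r2(1)]] show ?case unfolding r_def .
  qed
  have zr: "AE w in M. (\<lambda>n. ?z s (r n) w) \<longlonglongrightarrow> X_mean s (s + d) w" if "s = s1 \<or> s = s2" for s
    using that zr1 r2(2) unfolding r_def by auto
  \<comment> \<open>Read from the state: the starting point and the two sums, divided by the number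
    of steps.\<close>
  define \<phi> :: "nat \<Rightarrow> state \<Rightarrow> real"
    where "\<phi> n x = ?c L (\<Psi> (fst x) (fst (snd (snd x)) / real (m n)) (snd (snd (snd (snd x))) / real (m n)))" for n x
  have \<phi>M: "\<phi> n \<in> borel_measurable state_space" for n
  proof -
    have "(\<lambda>x::state. (fst x, fst (snd (snd x)) / real (m n), snd (snd (snd (snd x))) / real (m n))) \<in> measurable state_space (borel \<Otimes>\<^sub>M borel \<Otimes>\<^sub>M borel)"
      by measurable
    from measurable_compose[OF measurable_compose[OF this \<Psi>] clamp_to_measurable]
    show ?thesis by (simp add: \<phi>_def[abs_def])
  qed
  have \<phi>eq: "\<phi> n (euler_state (pk (k n)) (qk (k n)) (d / real (m n)) s (m n) w) = ?c L (\<Psi> (X s w) (?z s n w) (?w s n w))" for n s w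
    by (simp add: \<phi>_def euler_state_def)
  have \<Phi>M: "(\<lambda>w. ?c L (\<Psi> (X s w) (?z s n w) (?w s n w))) \<in> borel_measurable M" if s: "0 \<le> s" for s n
  proof -
    have "(\<lambda>w. (X s w, ?z s n w, ?w s n w)) \<in> measurable M (borel \<Otimes>\<^sub>M borel \<Otimes>\<^sub>M borel)"
      by (intro measurable_Pair X_measurable s zM wM)
    from measurable_compose[OF measurable_compose[OF this \<Psi>] clamp_to_measurable]
    show ?thesis by simp
  qed
  have c\<psi>M: "(\<lambda>w. ?c L (?\<psi> s w)) \<in> borel_measurable M" if s: "0 \<le> s" for s
    by (rule measurable_compose[OF \<psi>M[OF s] clamp_to_measurable])
  have N0: "\<forall>\<^sub>F n in sequentially. expectation (\<lambda>w. \<bar>?c L (\<Psi> (X s w) (?z s (r n) w) (?w s (r n) w)) - ?c L (?\<psi> s w)\<bar>) < e / 2"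
    if s': "s = s1 \<or> s = s2" for s
  proof -
    have s0: "0 \<le> s" using s' s by blast
    have "(\<lambda>n. expectation (\<lambda>w. \<bar>?c L (\<Psi> (X s w) (?z s (r n) w) (?w s (r n) w)) - ?c L (?\<psi> s w)\<bar>)) \<longlonglongrightarrow> expectation (\<lambda>w. 0)"
    proof (rule integral_dominated_convergence[where w = "\<lambda>w. 2 * real L"])
      show "(\<lambda>w. \<bar>?c L (\<Psi> (X s w) (?z s (r n) w) (?w s (r n) w)) - ?c L (?\<psi> s w)\<bar>) \<in> borel_measurable M" for n
        by (intro borel_measurable_abs borel_measurable_diff \<Phi>M c\<psi>M s0)
      show "AE w in M. (\<lambda>n. \<bar>?c L (\<Psi> (X s w) (?z s (r n) w) (?w s (r n) w)) - ?c L (?\<psi> s w)\<bar>) \<longlonglongrightarrow> 0"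
        using zr[OF s'] AE_space
      proof eventually_elim
        case (elim w)
        have "(\<lambda>n. \<Psi> (X s w) (?z s (r n) w) (?w s (r n) w)) \<longlonglongrightarrow> ?\<psi> s w"
          by (rule cont[OF X_S[OF s0 elim(2)] X_mean_S elim(1) filterlim_compose[OF wlim[OF elim(2) s0] rtop]]) (use elim s0 sd in auto)
        from tendsto_diff[OF clim[OF this, of L] tendsto_const[of "?c L (?\<psi> s w)"]] show ?case
          by (simp only: diff_self tendsto_rabs_zero)
      qed
      show "AE w in M. norm \<bar>?c L (\<Psi> (X s w) (?z s (r n) w) (?w s (r n) w)) - ?c L (?\<psi> s w)\<bar> \<le> 2 * real L" for n
      proof (rule AE_I2)
        fix w
        have "\<bar>x - y\<bar> \<le> 2 * real L" if "\<bar>x\<bar> \<le> real L" "\<bar>y\<bar> \<le> real L" for x y using that by linarith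
        from this[OF c1 c1] show "norm \<bar>?c L (\<Psi> (X s w) (?z s (r n) w) (?w s (r n) w)) - ?c L (?\<psi> s w)\<bar> \<le> 2 * real L"
          by (simp only: real_norm_def abs_abs)
      qed
    qed simp_all
    then show ?thesis using e by (intro order_tendstoD(2)) auto
  qed
  obtain n where n: "expectation (\<lambda>w. \<bar>?c L (\<Psi> (X s w) (?z s (r n) w) (?w s (r n) w)) - ?c L (?\<psi> s w)\<bar>) < e / 2" if "s = s1 \<or> s = s2" for s
    using eventually_happens[OF eventually_conj[OF N0[OF disjI1[OF refl]] N0[OF disjI2[OF refl]]]] by auto
  show ?thesis
  proof (rule that[OF pq(1) sub h \<phi>M])
    show "\<bar>\<phi> (r n) x\<bar> \<le> real L" for x unfolding \<phi>_def by (rule c1)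
    fix s assume s': "s = s1 \<or> s = s2"
    have s0: "0 \<le> s" using s' s by blast
    let ?\<Phi> = "\<lambda>w. ?c L (\<Psi> (X s w) (?z s (r n) w) (?w s (r n) w))"
    have ci: "integrable M ?\<Phi>" "integrable M (\<lambda>w. ?c L (?\<psi> s w))"
      using c1 by (intro integrable_const_bound[where B = "real L"] \<Phi>M c\<psi>M s0 AE_I2; simp only: real_norm_def)+
    have "expectation (\<lambda>w. \<bar>?\<Phi> w - ?\<psi> s w\<bar>) \<le> expectation (\<lambda>w. \<bar>?\<Phi> w - ?c L (?\<psi> s w)\<bar> + \<bar>?c L (?\<psi> s w) - ?\<psi> s w\<bar>)"
      using ci int[OF s0] by (intro integral_mono Bochner_Integration.integrable_add integrable_abs Bochner_Integration.integrable_diff) auto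
    also have "\<dots> = expectation (\<lambda>w. \<bar>?\<Phi> w - ?c L (?\<psi> s w)\<bar>) + expectation (\<lambda>w. \<bar>?c L (?\<psi> s w) - ?\<psi> s w\<bar>)"
      using ci int[OF s0] by (intro Bochner_Integration.integral_add integrable_abs Bochner_Integration.integrable_diff)
    also have "\<dots> < e" using n[OF s'] L[OF s'] by linarith
    finally show "expectation (\<lambda>w. \<bar>\<phi> (r n) (euler_state (pk (k (r n))) (qk (k (r n))) (d / real (m (r n))) s (m (r n)) w) - ?\<psi> s w\<bar>) < e"
      unfolding \<phi>eq .
  qed
qed

text \<open>The function \<open>g\<close> is found at time \<open>0\<close>, where \<open>X 0\<close> is \<open>F 0\<close>-measurable, and transported to time
  \<open>s\<close>: the Euler scheme has a transition function that does not depend on \<open>s\<close>, and the laws of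
  \<open>X s\<close> and \<open>X 0\<close> agree.\<close>

lemma homogeneous_conditional_expectation:
  assumes pq: "\<And>k. pk k \<le> qk k" "decseq pk" "incseq qk" "S = (\<Union>k. {pk k..qk k})" and d: "0 < d"
    and \<Psi>: "(\<lambda>x. \<Psi> (fst x) (fst (snd x)) (snd (snd x))) \<in> borel_measurable (borel \<Otimes>\<^sub>M borel \<Otimes>\<^sub>M borel)"
    and cont: "\<And>x y w yn wn. x \<in> S \<Longrightarrow> y \<in> S \<Longrightarrow> yn \<longlonglongrightarrow> y \<Longrightarrow> wn \<longlonglongrightarrow> w \<Longrightarrow> (\<lambda>n. \<Psi> x (yn n) (wn n)) \<longlonglongrightarrow> (\<Psi> x y w :: real)"
    and int: "\<And>s. 0 \<le> s \<Longrightarrow> integrable M (\<lambda>w. \<Psi> (X s w) (X_mean s (s + d) w) (bm_mean s (s + d) w))"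
  obtains g where "g \<in> borel_measurable borel" "\<And>s. 0 \<le> s \<Longrightarrow> integrable M (\<lambda>w. g (X s w))"
    "\<And>s G. 0 \<le> s \<Longrightarrow> G \<in> sets (F s) \<Longrightarrow>
      EG G (\<lambda>w. \<Psi> (X s w) (X_mean s (s + d) w) (bm_mean s (s + d) w)) = EG G (\<lambda>w. g (X s w))"
proof -
  let ?\<psi> = "\<lambda>s w. \<Psi> (X s w) (X_mean s (s + d) w) (bm_mean s (s + d) w)"
  have X0: "X 0 \<in> borel_measurable M" by simp
  obtain g where g: "g \<in> borel_measurable borel" "integrable M (\<lambda>w. g (X 0 w))"
    "\<And>A. A \<in> sets borel \<Longrightarrow> EG (X 0 -` A \<inter> space M) (?\<psi> 0) = EG (X 0 -` A \<inter> space M) (\<lambda>w. g (X 0 w))"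
    by (rule conditional_expectation_factor[OF X0 int[OF order_refl]]) (rule that; assumption)
  have gi: "integrable M (\<lambda>w. g (X s w))" if "0 \<le> s" for s using X_integral_law(1)[OF that g(1)] g(2) by simp
  show ?thesis
  proof (rule that[OF g(1) gi])
    fix s G assume s: "0 \<le> s" and G: "G \<in> sets (F s)"
    have GM: "G \<in> sets M" by (rule M_sets[OF s G])
    have le: "\<bar>EG G (?\<psi> s) - EG G (\<lambda>w. g (X s w))\<bar> \<le> e" if e: "0 < e" for e
    proof -
      have e3: "0 < e / 3" using e by simp
      obtain p q h m L \<phi> where \<phi>: "p \<le> q" "{p..q} \<subseteq> S" "0 < h" "\<phi> \<in> borel_measurable state_space" "\<And>x. \<bar>\<phi> x\<bar> \<le> L"
        "\<And>s'. s' = s \<or> s' = 0 \<Longrightarrow> expectation (\<lambda>w. \<bar>\<phi> (euler_state p q h s' m w) - ?\<psi> s' w\<bar>) < e / 3"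
        by (rule euler_functional_approx[OF pq d \<Psi> cont int s order_refl e3]) (assumption | rule that; assumption)+
      let ?\<Phi> = "\<lambda>s' w. \<phi> (euler_state p q h s' m w)"
      \<comment> \<open>The conditional mean of the Euler functional as a function of the starting
        point; it is the same at time 0 and at time \<open>s\<close>.\<close>
      define k where "k x = (kern p q h ^^ m) \<phi> (x, x, 0, 0, 0)" for x
      have kb: "\<bar>k x\<bar> \<le> L" for x unfolding k_def using kern_funpow_measurable[OF \<phi>(1-5)] by blast
      have kM: "k \<in> borel_measurable borel"
      proof -
        have "(\<lambda>x::real. (x, x, 0::real, 0::real, 0::real)) \<in> measurable borel state_space" by measurable
        from measurable_compose[OF this kern_funpow_measurable[OF \<phi>(1-5), THEN conjunct1]] show ?thesis by (simp add: k_def[abs_def])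
      qed
      have chain: "EG H (?\<Phi> s') = EG H (\<lambda>w. k (X s' w))" if "0 \<le> s'" "H \<in> sets (F s')" for s' H
        unfolding k_def by (rule euler_chain[OF \<phi>(1,2) that(1) \<phi>(3) that(2) \<phi>(4,5)])
      have \<Phi>i: "integrable M (?\<Phi> s')" if s': "0 \<le> s'" for s'
      proof (rule integrable_const_bound[where B = L])
        have u: "0 \<le> s' + real m * h" using s' \<phi>(3) by simp
        show "?\<Phi> s' \<in> borel_measurable M"
          by (rule measurable_compose[OF M_measurable[OF u euler_state_measurable[OF \<phi>(1,2) s' \<phi>(3)]] \<phi>(4)])
      qed (use \<phi>(5) in simp)
      have ki: "integrable M (\<lambda>w. k (X s' w))" if "0 \<le> s'" for s'
        by (rule integrable_const_bound[where B = L]) (use kb kM measurable_compose[OF X_measurable[OF that] kM] in auto)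
      \<comment> \<open>The sign of \<open>k - g\<close> at \<open>X 0\<close> is decided by events
        of \<open>X 0\<close>, so their distance in \<open>L1\<close> is a difference of integrals
        over such events, on which \<open>g\<close> has its defining property.\<close>
      let ?A = "{x. g x < k x}"
      let ?H = "X 0 -` ?A \<inter> space M" and ?H' = "X 0 -` (- ?A) \<inter> space M"
      have A: "?A \<in> sets borel" "- ?A \<in> sets borel"
      proof -
        show "?A \<in> sets borel" using g(1) kM by measurable
        then show "- ?A \<in> sets borel" by auto
      qed
      have H: "X 0 -` A \<inter> space M \<in> sets (F 0)" if "A \<in> sets borel" for A
        using measurable_sets[OF X_adapted[OF order_refl] that] space_F[OF order_refl] by simp
      have part: "\<bar>EG (X 0 -` A \<inter> space M) (\<lambda>w. k (X 0 w)) - EG (X 0 -` A \<inter> space M) (\<lambda>w. g (X 0 w))\<bar> < e / 3" if "A \<in> sets borel" for A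
        using EG_diff_le[OF \<Phi>i[OF order_refl] int[OF order_refl] M_sets[OF order_refl H[OF that]]] \<phi>(6)[of 0]
        unfolding chain[OF order_refl H[OF that]] g(3)[OF that] by simp
      have "expectation (\<lambda>w. \<bar>k (X 0 w) - g (X 0 w)\<bar>) =
        expectation (\<lambda>w. (indicator ?H w * k (X 0 w) - indicator ?H w * g (X 0 w)) - (indicator ?H' w * k (X 0 w) - indicator ?H' w * g (X 0 w)))"
        by (rule Bochner_Integration.integral_cong[OF refl]) (auto simp: indicator_def)
      also have "\<dots> = (EG ?H (\<lambda>w. k (X 0 w)) - EG ?H (\<lambda>w. g (X 0 w))) - (EG ?H' (\<lambda>w. k (X 0 w)) - EG ?H' (\<lambda>w. g (X 0 w)))"
      proof -
        have i: "integrable_on_event (X 0 -` A \<inter> space M) (\<lambda>w. k (X 0 w))" "integrable_on_event (X 0 -` A \<inter> space M) (\<lambda>w. g (X 0 w))" if "A \<in> sets borel" for A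
          using ki[OF order_refl] g(2) M_sets[OF order_refl H[OF that]] by (auto intro: integrable_imp_on_event)
        show ?thesis
          by (simp only: Bochner_Integration.integral_diff[OF Bochner_Integration.integrable_diff[OF i[OF A(1)]] Bochner_Integration.integrable_diff[OF i[OF A(2)]]]
              Bochner_Integration.integral_diff[OF i[OF A(1)]] Bochner_Integration.integral_diff[OF i[OF A(2)]])
      qed
      also have "\<dots> \<le> e / 3 + e / 3" using part[OF A(1)] part[OF A(2)] by linarith
      finally have E0: "expectation (\<lambda>w. \<bar>k (X 0 w) - g (X 0 w)\<bar>) \<le> e / 3 + e / 3" .
      have kg: "(\<lambda>x. \<bar>k x - g x\<bar>) \<in> borel_measurable borel" using kM g(1) by measurable
      \<comment> \<open>The laws of \<open>X s\<close> and \<open>X 0\<close> agree, so the distance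
        of \<open>k\<close> and \<open>g\<close> found at time 0 is also the one at time
        \<open>s\<close>.\<close>
      have "\<bar>EG G (\<lambda>w. k (X s w)) - EG G (\<lambda>w. g (X s w))\<bar> \<le> e / 3 + e / 3"
        using EG_diff_le[OF ki[OF s] gi[OF s] GM] X_integral_law(2)[OF s kg] E0 by linarith
      moreover have "\<bar>EG G (\<lambda>w. k (X s w)) - EG G (?\<psi> s)\<bar> < e / 3"
        using EG_diff_le[OF \<Phi>i[OF s] int[OF s] GM] \<phi>(6)[of s] unfolding chain[OF s G] by simp
      ultimately show ?thesis by linarith
    qed
    have "\<bar>EG G (?\<psi> s) - EG G (\<lambda>w. g (X s w))\<bar> \<le> 0"
    proof (rule field_le_epsilon)
      fix e :: real assume "0 < e"
      from le[OF this] show "\<bar>EG G (?\<psi> s) - EG G (\<lambda>w. g (X s w))\<bar> \<le> 0 + e" unfolding add_0 .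
    qed
    then show "EG G (?\<psi> s) = EG G (\<lambda>w. g (X s w))" by simp
  qed
qed

end

section \<open>From integrals over events to conditional expectations\<close>

context brownian_filtration
begin

text \<open>The event \<open>W < U\<close> belongs to \<open>F s\<close>; on it the integral of the
  nonnegative difference is at most 0, so the event is null.\<close>

lemma AE_le_of_EG_le:
  assumes s: "0 \<le> s" and U: "U \<in> borel_measurable (F s)" "integrable M U" and W: "W \<in> borel_measurable (F s)" "integrable M W"
    and le: "\<And>G. G \<in> sets (F s) \<Longrightarrow> EG G U \<le> EG G W"
  shows "AE w in M. U w \<le> (W w :: real)"
proof -
  let ?G = "{w\<in>space M. W w < U w}"
  have GF: "?G \<in> sets (F s)"
  proof -
    have "{w\<in>space (F s). W w < U w} \<in> sets (F s)" using U(1) W(1) by measurable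
    then show ?thesis using space_F[OF s] by simp
  qed
  have GM: "?G \<in> sets M" by (rule M_sets[OF s GF])
  note iU = integrable_imp_on_event[OF U(2) GM] and iW = integrable_imp_on_event[OF W(2) GM]
  have i: "integrable M (\<lambda>w. indicator ?G w * U w - indicator ?G w * W w)" using iU iW by (rule Bochner_Integration.integrable_diff)
  have nn: "AE w in M. 0 \<le> indicator ?G w * U w - indicator ?G w * W w" by (intro AE_I2) (auto simp: indicator_def)
  have "expectation (\<lambda>w. indicator ?G w * U w - indicator ?G w * W w) \<le> 0"
    using le[OF GF] Bochner_Integration.integral_diff[OF iU iW] by simp
  then have "expectation (\<lambda>w. indicator ?G w * U w - indicator ?G w * W w) = 0"
    using integral_nonneg_AE[OF nn] by linarith
  then have "AE w in M. indicator ?G w * U w - indicator ?G w * W w = 0"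
    using integral_nonneg_eq_0_iff_AE[OF i nn] by simp
  then show ?thesis using AE_space by eventually_elim (auto simp: indicator_def split: if_splits)
qed

lemma AE_abs_le_of_EG_le:
  assumes s: "0 \<le> s" and U: "U \<in> borel_measurable (F s)" "integrable M U" and W: "W \<in> borel_measurable (F s)" "integrable M W"
    and le: "\<And>G. G \<in> sets (F s) \<Longrightarrow> \<bar>EG G U\<bar> \<le> EG G W"
  shows "AE w in M. \<bar>U w\<bar> \<le> (W w :: real)"
proof -
  have 1: "AE w in M. U w \<le> W w"
    by (rule AE_le_of_EG_le[OF s U W]) (use le in \<open>auto simp: abs_le_iff\<close>)
  have 2: "AE w in M. - U w \<le> W w"
  proof (rule AE_le_of_EG_le[OF s _ _ W])
    fix G assume "G \<in> sets (F s)"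
    from le[OF this] show "EG G (\<lambda>w. - U w) \<le> EG G W" by (simp add: abs_le_iff)
  qed (use U in auto)
  show ?thesis using 1 2 by eventually_elim (simp add: abs_le_iff)
qed

lemma cond_exp_eqI:
  assumes s: "0 \<le> s" and V: "integrable M V" and W: "W \<in> borel_measurable (F s)" "integrable M W"
    and eq: "\<And>G. G \<in> sets (F s) \<Longrightarrow> EG G V = EG G W"
  shows "AE w in M. real_cond_exp M (F s) V w = W w"
proof -
  interpret sf: sigma_finite_subalgebra M "F s" by (rule cond_exp_subalgebra[OF s])
  show ?thesis by (rule sf.real_cond_exp_charact[OF _ V W(2,1)]) (use eq in \<open>simp add: set_lebesgue_integral_def\<close>)
qed

end

context stationary_diffusion
begin

text \<open>The function \<open>g\<close> is chosen before \<open>s\<close>, so that one function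
  serves all sampling times. The bounds on events become almost sure bounds because both sides are
  functions of \<open>X s\<close>, hence \<open>F s\<close>-measurable.\<close>

lemma conditional_remainder:
  assumes pq: "\<And>k. pk k \<le> qk k" "decseq pk" "incseq qk" "S = (\<Union>k. {pk k..qk k})" and d: "0 < d"
    and \<Psi>: "(\<lambda>x. \<Psi> (fst x) (fst (snd x)) (snd (snd x))) \<in> borel_measurable (borel \<Otimes>\<^sub>M borel \<Otimes>\<^sub>M borel)"
    and cont: "\<And>x y w yn wn. x \<in> S \<Longrightarrow> y \<in> S \<Longrightarrow> yn \<longlonglongrightarrow> y \<Longrightarrow> wn \<longlonglongrightarrow> w \<Longrightarrow> (\<lambda>n. \<Psi> x (yn n) (wn n)) \<longlonglongrightarrow> (\<Psi> x y w :: real)"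
    and V: "\<And>s. 0 \<le> s \<Longrightarrow> integrable M (V s)"
      "\<And>s w. 0 \<le> s \<Longrightarrow> w \<in> space M \<Longrightarrow> \<Psi> (X s w) (X_mean s (s + d) w) (bm_mean s (s + d) w) = V s w"
    and h: "continuous_on S h" "\<And>s. 0 \<le> s \<Longrightarrow> integrable M (\<lambda>w. h (X s w))"
    and b: "\<And>s G. 0 \<le> s \<Longrightarrow> G \<in> sets (F s) \<Longrightarrow> \<bar>EG G (\<lambda>w. V s w - h (X s w))\<bar> \<le> c * EG G (\<lambda>w. wt q (X s w))"
  shows "\<exists>g. \<forall>s\<ge>0. (AE w in M. real_cond_exp M (F s) (V s) w = g (X s w)) \<and> (AE w in M. \<bar>g (X s w) - h (X s w)\<bar> \<le> c * wt q (X s w))"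
proof -
  have i: "integrable M (\<lambda>w. \<Psi> (X s w) (X_mean s (s + d) w) (bm_mean s (s + d) w))" if s: "0 \<le> s" for s
    by (rule Bochner_Integration.integrable_cong[OF refl V(2)[OF s], THEN iffD2, OF _ V(1)[OF s]])
  obtain g where g: "g \<in> borel_measurable borel" "\<And>s. 0 \<le> s \<Longrightarrow> integrable M (\<lambda>w. g (X s w))"
    "\<And>s G. 0 \<le> s \<Longrightarrow> G \<in> sets (F s) \<Longrightarrow>
      EG G (\<lambda>w. \<Psi> (X s w) (X_mean s (s + d) w) (bm_mean s (s + d) w)) = EG G (\<lambda>w. g (X s w))"
    by (rule homogeneous_conditional_expectation[where \<Psi> = \<Psi>, OF pq d \<Psi> cont i]) (assumption | rule that; assumption)+
  show ?thesis
  proof (intro exI[of _ g] allI impI conjI)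
    fix s :: real assume s: "0 \<le> s"
    have E: "EG G (V s) = EG G (\<lambda>w. g (X s w))" if G: "G \<in> sets (F s)" for G
      unfolding g(3)[OF s G, symmetric] by (rule Bochner_Integration.integral_cong[OF refl]) (simp add: V(2)[OF s])
    have gF: "(\<lambda>w. g (X s w)) \<in> borel_measurable (F s)" by (rule measurable_compose[OF X_adapted[OF s] g(1)])
    show "AE w in M. real_cond_exp M (F s) (V s) w = g (X s w)"
      by (rule cond_exp_eqI[OF s V(1)[OF s] gF g(2)[OF s] E])
    show "AE w in M. \<bar>g (X s w) - h (X s w)\<bar> \<le> c * wt q (X s w)"
    proof (rule AE_abs_le_of_EG_le[OF s])
      show "(\<lambda>w. g (X s w) - h (X s w)) \<in> borel_measurable (F s)"
        by (intro borel_measurable_diff gF fX_adapted[OF h(1) s])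
      show "integrable M (\<lambda>w. g (X s w) - h (X s w))" by (intro Bochner_Integration.integrable_diff g(2) h(2) s)
      show "(\<lambda>w. c * wt q (X s w)) \<in> borel_measurable (F s)" using X_adapted[OF s] by measurable
      show "integrable M (\<lambda>w. c * wt q (X s w))" by (intro integrable_mult_right wt_integrable s)
      fix G assume G: "G \<in> sets (F s)"
      have GM: "G \<in> sets M" by (rule M_sets[OF s G])
      note lin = EG_linear(2)[OF integrable_imp_on_event[OF _ GM] integrable_imp_on_event[OF h(2)[OF s] GM], of _ 1 "- 1"]
      have "EG G (\<lambda>w. g (X s w) - h (X s w)) = EG G (\<lambda>w. V s w - h (X s w))"
        using lin[OF g(2)[OF s]] lin[OF V(1)[OF s]] E[OF G] by simp
      then show "\<bar>EG G (\<lambda>w. g (X s w) - h (X s w))\<bar> \<le> EG G (\<lambda>w. c * wt q (X s w))"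
        using b[OF s G] EG_cmult(2)[OF wt_integrable_on[OF s GM, of q], of c] by simp
    qed
  qed
qed

end

context diffusion_expansion
begin

text \<open>Averages of Euler schemes may leave \<open>S\<close>, where \<open>f\<close> is not
  controlled; extension by 0 gives a Borel function on the whole space.\<close>

definition rem_fun :: "real \<Rightarrow> real \<Rightarrow> real \<Rightarrow> real" where
  "rem_fun x y w = (if y \<in> S then f y else 0) - (if x \<in> S then f x else 0) - (if x \<in> S then f1 x * \<beta> x else 0) * w"

lemma rem_fun_measurable: "(\<lambda>x. rem_fun (fst x) (fst (snd x)) (snd (snd x))) \<in> borel_measurable (borel \<Otimes>\<^sub>M borel \<Otimes>\<^sub>M borel)"
proof -
  have [measurable]: "(\<lambda>x. if x \<in> S then f x else 0) \<in> borel_measurable borel" "(\<lambda>x. if x \<in> S then f1 x * \<beta> x else 0) \<in> borel_measurable borel"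
    using S_open by (auto intro!: borel_measurable_continuous_on_if f_cont continuous_on_mult f1_cont \<beta>_cont)
  show ?thesis unfolding rem_fun_def by measurable
qed

text \<open>A sequence whose limit lies in the open set \<open>S\<close> is eventually in
  \<open>S\<close>, so the extension by 0 is invisible in the limit.\<close>

lemma rem_fun_tendsto:
  assumes "x \<in> S" "y \<in> S" "yn \<longlonglongrightarrow> y" "wn \<longlonglongrightarrow> w"
  shows "(\<lambda>n. rem_fun x (yn n) (wn n)) \<longlonglongrightarrow> rem_fun x y w"
proof -
  have "isCont f y" using f_cont S_open assms(2) continuous_on_eq_continuous_at by blast
  then have "(\<lambda>n. f (yn n)) \<longlonglongrightarrow> f y" using assms(3) by (rule isCont_tendsto_compose)
  moreover have "\<forall>\<^sub>F n in sequentially. f (yn n) = (if yn n \<in> S then f (yn n) else 0)"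
    using topological_tendstoD[OF assms(3) S_open assms(2)] by eventually_elim simp
  ultimately have "(\<lambda>n. if yn n \<in> S then f (yn n) else 0) \<longlonglongrightarrow> (if y \<in> S then f y else 0)"
    using assms(2) by (simp add: Lim_transform_eventually)
  then show ?thesis unfolding rem_fun_def by (intro tendsto_intros assms(4))
qed

lemma rem_term_eq: "w \<in> space M \<Longrightarrow> 0 \<le> s \<Longrightarrow> s < t \<Longrightarrow> rem_fun (X s w) (X_mean s t w) (bm_mean s t w) = rem_term s t w"
  using X_S[of s w] X_mean_S[of s t w] by (simp add: rem_fun_def rem_term_def)

lemma rem_term_integrable:
  assumes "0 \<le> s" "s < t" "t \<le> s + T"
  shows "integrable M (\<lambda>w. (rem_term s t w)\<^sup>2)" "integrable M (rem_term s t)"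
proof -
  show 2: "integrable M (\<lambda>w. (rem_term s t w)\<^sup>2)" by (rule moment_bound_integrable[OF rem_term_square_bound assms])
  show "integrable M (rem_term s t)" by (rule square_integrable_imp_integrable[OF meas(11)[OF assms(1,2)] 2])
qed

lemma H_op_cont: "continuous_on S H_op"
  unfolding H_op_def by (intro continuous_intros \<alpha>_cont \<beta>_cont f1_cont f2_cont) auto

lemma H_op_integrable:
  assumes s: "0 \<le> s" shows "integrable M (\<lambda>w. H_op (X s w))"
proof -
  have b: "\<bar>H_op x\<bar> \<le> (CG * C + CG\<^sup>2 * C) * wt (p + 2) x" if x: "x \<in> S" for x
  proof -
    let ?a = "1 + \<bar>x\<bar>"
    have 1: "\<bar>\<alpha> x * f1 x\<bar> \<le> CG * C * wt (p + 2) x"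
    proof -
      have "\<bar>\<alpha> x * f1 x\<bar> \<le> (CG * ?a) * (C * wt p x)" unfolding abs_mult
        using \<alpha>_growth[OF x] f1_bound[OF x] CG by (intro mult_mono) auto
      also have "\<dots> = CG * C * wt (p + 1) x" by simp
      also have "\<dots> \<le> CG * C * wt (p + 2) x" using CG C0 by (intro mult_left_mono wt_mono) auto
      finally show ?thesis .
    qed
    have 2: "\<bar>(\<beta> x)\<^sup>2 * f2 x\<bar> \<le> CG\<^sup>2 * C * wt (p + 2) x"
    proof -
      have "\<bar>(\<beta> x)\<^sup>2 * f2 x\<bar> \<le> (CG * ?a)\<^sup>2 * (C * wt p x)" unfolding abs_mult
        using power_mono[OF \<beta>_growth[OF x] abs_ge_zero, of 2] f2_bound[OF x] by (intro mult_mono) auto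
      also have "\<dots> = CG\<^sup>2 * C * wt (p + 2) x" by (simp add: power_mult_distrib power2_eq_square)
      finally show ?thesis .
    qed
    have "\<bar>H_op x\<bar> \<le> \<bar>\<alpha> x * f1 x\<bar> + \<bar>(\<beta> x)\<^sup>2 * f2 x\<bar>" unfolding H_op_def by linarith
    then show ?thesis using 1 2 unfolding distrib_right by linarith
  qed
  have "integrable M (\<lambda>w. \<bar>H_op (X s w)\<bar> ^ 1)"
    using moment_bound_integrable[OF moment_bound_start[OF H_op_cont b, of 1 1], of s "s + 1"] s by simp
  then show ?thesis using integrable_abs_iff[OF fX_measurable[OF H_op_cont s]] by simp
qed

text \<open>The remainders have to be bounded everywhere, but \<open>g1\<close> and
  \<open>g2\<close> are bounded only almost surely along \<open>X s\<close>. Clamping the quotients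
  to \<open>D * wt q x\<close> enforces the bound and changes nothing almost surely.\<close>

lemma conditional_expansion:
  assumes pq: "\<And>k. pk k \<le> qk k" "decseq pk" "incseq qk" "S = (\<Union>k. {pk k..qk k})"
  obtains D q R1 R2 where "\<And>\<delta> x. \<bar>R1 \<delta> x\<bar> \<le> D * wt q x" "\<And>\<delta> x. \<bar>R2 \<delta> x\<bar> \<le> D * wt q x"
    "\<And>s \<delta>. 0 \<le> s \<Longrightarrow> 0 < \<delta> \<Longrightarrow> \<delta> \<le> T \<Longrightarrow> AE w in M. real_cond_exp M (F s) (rem_term s (s + \<delta>)) w = \<delta> * H_op (X s w) + \<delta> powr (3/2) * R1 \<delta> (X s w)"
    "\<And>s \<delta>. 0 \<le> s \<Longrightarrow> 0 < \<delta> \<Longrightarrow> \<delta> \<le> T \<Longrightarrow> AE w in M. real_cond_exp M (F s) (\<lambda>w. (rem_term s (s + \<delta>) w)\<^sup>2) w = \<delta>\<^sup>2 * R2 \<delta> (X s w)"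
proof -
  obtain D1 q1 where D1: "0 \<le> D1" "\<And>s t G. 0 \<le> s \<Longrightarrow> s < t \<Longrightarrow> t \<le> s + T \<Longrightarrow> G \<in> sets (F s) \<Longrightarrow>
     \<bar>EG G (\<lambda>w. rem_term s t w - (t - s) * H_op (X s w))\<bar> \<le> D1 * sqrt (t - s) ^ 3 * EG G (\<lambda>w. wt q1 (X s w))"
    by (rule rem_term_expansion) (rule that; assumption)
  obtain D2 q2 where "moment_est T 4 (\<lambda>s t. \<lambda>w. (rem_term s t w)\<^sup>2) D2 q2" by (rule moment_boundE[OF rem_term_square_bound])
  note D2 = moment_estD[OF this]
  define q D where "q = max q1 q2" and "D = max D1 D2"
  have D0: "0 \<le> D" using D1(1) by (simp add: D_def)
  have 1: "\<exists>g. \<forall>s\<ge>0. (AE w in M. real_cond_exp M (F s) (rem_term s (s + \<delta>)) w = g (X s w)) \<and>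
      (AE w in M. \<bar>g (X s w) - \<delta> * H_op (X s w)\<bar> \<le> \<delta> powr (3/2) * D * wt q (X s w))" if \<delta>: "0 < \<delta>" "\<delta> \<le> T" for \<delta>
  proof (rule conditional_remainder[OF pq \<delta>(1) rem_fun_measurable rem_fun_tendsto])
    fix s :: real assume s: "0 \<le> s"
    have sd: "s < s + \<delta>" "s + \<delta> \<le> s + T" using \<delta> by auto
    show "integrable M (rem_term s (s + \<delta>))" by (rule rem_term_integrable(2)[OF s sd])
    show "rem_fun (X s w) (X_mean s (s + \<delta>) w) (bm_mean s (s + \<delta>) w) = rem_term s (s + \<delta>) w" if "w \<in> space M" for w
      by (rule rem_term_eq[OF that s sd(1)])
    show "integrable M (\<lambda>w. \<delta> * H_op (X s w))" by (intro integrable_mult_right H_op_integrable s)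
    fix G assume G: "G \<in> sets (F s)"
    have sq: "sqrt \<delta> ^ 3 = \<delta> powr (3/2)" using \<delta>(1) by (simp add: powr_half_sqrt[symmetric] powr_powr flip: powr_numeral)
    have "\<bar>EG G (\<lambda>w. rem_term s (s + \<delta>) w - \<delta> * H_op (X s w))\<bar> \<le> D1 * \<delta> powr (3/2) * EG G (\<lambda>w. wt q1 (X s w))"
      using D1(2)[OF s sd G] sq by simp
    also have "\<dots> \<le> D * \<delta> powr (3/2) * EG G (\<lambda>w. wt q (X s w))"
      using D0 by (intro mult_mono EG_wt_mono EG_wt_nonneg s M_sets[OF s G]) (auto simp: D_def q_def)
    finally show "\<bar>EG G (\<lambda>w. rem_term s (s + \<delta>) w - \<delta> * H_op (X s w))\<bar> \<le> \<delta> powr (3/2) * D * EG G (\<lambda>w. wt q (X s w))"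
      by (simp only: mult.commute)
  qed (assumption | rule continuous_on_mult continuous_on_const H_op_cont)+
  \<comment> \<open>One function for each step size, valid for all starting times at once.\<close>
  define g1 where "g1 \<delta> = (SOME g. \<forall>s\<ge>0. (AE w in M. real_cond_exp M (F s) (rem_term s (s + \<delta>)) w = g (X s w)) \<and>
      (AE w in M. \<bar>g (X s w) - \<delta> * H_op (X s w)\<bar> \<le> \<delta> powr (3/2) * D * wt q (X s w)))" for \<delta>
  have g1: "AE w in M. real_cond_exp M (F s) (rem_term s (s + \<delta>)) w = g1 \<delta> (X s w)"
    "AE w in M. \<bar>g1 \<delta> (X s w) - \<delta> * H_op (X s w)\<bar> \<le> \<delta> powr (3/2) * D * wt q (X s w)" if "0 < \<delta>" "\<delta> \<le> T" "0 \<le> s" for s \<delta>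
    using someI_ex[OF 1[OF that(1,2)]] that(3) unfolding g1_def by blast+
  have 2: "\<exists>g. \<forall>s\<ge>0. (AE w in M. real_cond_exp M (F s) (\<lambda>w. (rem_term s (s + \<delta>) w)\<^sup>2) w = g (X s w)) \<and>
      (AE w in M. \<bar>g (X s w) - 0\<bar> \<le> \<delta>\<^sup>2 * D * wt q (X s w))" if \<delta>: "0 < \<delta>" "\<delta> \<le> T" for \<delta>
  proof (rule conditional_remainder[where \<Psi> = "\<lambda>x y w. (rem_fun x y w)\<^sup>2", OF pq \<delta>(1)])
    show "(\<lambda>x. (rem_fun (fst x) (fst (snd x)) (snd (snd x)))\<^sup>2) \<in> borel_measurable (borel \<Otimes>\<^sub>M borel \<Otimes>\<^sub>M borel)"
      by (intro borel_measurable_power rem_fun_measurable)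
    show "(\<lambda>n. (rem_fun x (yn n) (wn n))\<^sup>2) \<longlonglongrightarrow> (rem_fun x y w)\<^sup>2"
      if "x \<in> S" "y \<in> S" "yn \<longlonglongrightarrow> y" "wn \<longlonglongrightarrow> w" for x y w yn wn
      by (intro tendsto_power rem_fun_tendsto that)
    fix s :: real assume s: "0 \<le> s"
    have sd: "s < s + \<delta>" "s + \<delta> \<le> s + T" using \<delta> by auto
    show "integrable M (\<lambda>w. (rem_term s (s + \<delta>) w)\<^sup>2)" by (rule rem_term_integrable(1)[OF s sd])
    show "(rem_fun (X s w) (X_mean s (s + \<delta>) w) (bm_mean s (s + \<delta>) w))\<^sup>2 = (rem_term s (s + \<delta>) w)\<^sup>2" if "w \<in> space M" for w
      by (simp only: rem_term_eq[OF that s sd(1)])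
    fix G assume G: "G \<in> sets (F s)"
    have sq: "sqrt \<delta> ^ 4 = \<delta>\<^sup>2" using \<delta>(1) power_mult[of "sqrt \<delta>" 2 2] by simp
    have "0 \<le> EG G (\<lambda>w. (rem_term s (s + \<delta>) w)\<^sup>2)" by (intro Bochner_Integration.integral_nonneg) simp
    moreover have "EG G (\<lambda>w. (rem_term s (s + \<delta>) w)\<^sup>2) \<le> D2 * \<delta>\<^sup>2 * EG G (\<lambda>w. wt q (X s w))"
      using D2(3)[OF s sd G, of q] sq by (simp add: q_def)
    moreover have "D2 * \<delta>\<^sup>2 * EG G (\<lambda>w. wt q (X s w)) \<le> D * \<delta>\<^sup>2 * EG G (\<lambda>w. wt q (X s w))"
      by (intro mult_right_mono EG_wt_nonneg s M_sets[OF s G]) (auto simp: D_def)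
    ultimately show "\<bar>EG G (\<lambda>w. (rem_term s (s + \<delta>) w)\<^sup>2 - 0)\<bar> \<le> \<delta>\<^sup>2 * D * EG G (\<lambda>w. wt q (X s w))"
      by (simp add: mult.commute)
  qed auto
  define g2 where "g2 \<delta> = (SOME g. \<forall>s\<ge>0. (AE w in M. real_cond_exp M (F s) (\<lambda>w. (rem_term s (s + \<delta>) w)\<^sup>2) w = g (X s w)) \<and>
      (AE w in M. \<bar>g (X s w) - 0\<bar> \<le> \<delta>\<^sup>2 * D * wt q (X s w)))" for \<delta>
  have g2: "AE w in M. real_cond_exp M (F s) (\<lambda>w. (rem_term s (s + \<delta>) w)\<^sup>2) w = g2 \<delta> (X s w)"
    "AE w in M. \<bar>g2 \<delta> (X s w) - 0\<bar> \<le> \<delta>\<^sup>2 * D * wt q (X s w)" if "0 < \<delta>" "\<delta> \<le> T" "0 \<le> s" for s \<delta>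
    using someI_ex[OF 2[OF that(1,2)]] that(3) unfolding g2_def by blast+
  let ?R = "\<lambda>y x. clamp_to (- (D * wt q x)) (D * wt q x) y"
  have w0: "- (D * wt q x) \<le> D * wt q x" for x
  proof -
    have "0 \<le> D * wt q x" using D0 by simp
    then show ?thesis by linarith
  qed
  have Rb: "\<bar>?R y x\<bar> \<le> D * wt q x" for x y using clamp_to_simps(1)[OF w0, of x y] by (simp add: abs_le_iff)
  have Req: "c * ?R (y / c) x = y" if "0 < c" "\<bar>y\<bar> \<le> c * D * wt q x" for c x y
  proof -
    have "\<bar>y / c\<bar> \<le> D * wt q x" using that by (simp add: abs_div_pos[symmetric] divide_le_eq mult.commute mult.left_commute)
    then have "y / c \<in> {- (D * wt q x)..D * wt q x}" unfolding abs_le_iff atLeastAtMost_iff by linarith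
    then have "?R (y / c) x = y / c" by (rule clamp_to_simps(2)[OF w0])
    then show ?thesis using that(1) by simp
  qed
  show ?thesis
  proof (rule that[of "\<lambda>\<delta> x. ?R ((g1 \<delta> x - \<delta> * H_op x) / \<delta> powr (3/2)) x" D q "\<lambda>\<delta> x. ?R (g2 \<delta> x / \<delta>\<^sup>2) x"])
    fix s \<delta> :: real assume s: "0 \<le> s" and \<delta>: "0 < \<delta>" "\<delta> \<le> T"
    have c: "0 < \<delta> powr (3/2)" "0 < \<delta>\<^sup>2" using \<delta> by auto
    show "AE w in M. real_cond_exp M (F s) (rem_term s (s + \<delta>)) w =
        \<delta> * H_op (X s w) + \<delta> powr (3/2) * ?R ((g1 \<delta> (X s w) - \<delta> * H_op (X s w)) / \<delta> powr (3/2)) (X s w)"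
      using g1[OF \<delta> s]
    proof eventually_elim
      case (elim w)
      from Req[OF c(1) elim(2)] elim(1) show ?case by simp
    qed
    show "AE w in M. real_cond_exp M (F s) (\<lambda>w. (rem_term s (s + \<delta>) w)\<^sup>2) w = \<delta>\<^sup>2 * ?R (g2 \<delta> (X s w) / \<delta>\<^sup>2) (X s w)"
      using g2[OF \<delta> s]
    proof eventually_elim
      case (elim w)
      from Req[OF c(2) elim(2)[unfolded diff_0_right]] elim(1) show ?case by simp
    qed
  qed (rule Rb)+
qed

end

section \<open>Weak solutions\<close>

lemma space_gen_alg [simp]: "space (gen_alg M T Z) = space M"
  by (simp add: gen_alg_def space_measure_of_conv)

lemma space_filt [simp]: "space (filt M B X t) = space M"
  by (simp add: filt_def space_measure_of_conv)

lemma sets_gen_alg: "sets (gen_alg M T Z) = sigma_sets (space M) (\<Union>t\<in>T. {Z t -` A \<inter> space M |A. A \<in> sets borel})"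
  unfolding gen_alg_def by (rule sets_measure_of) auto

lemma sets_filt: "sets (filt M B X t) = sigma_sets (space M) (sets (gen_alg M {0} X) \<union> sets (gen_alg M {0..t} B))"
  unfolding filt_def by (rule sets_measure_of) (use sets.sets_into_space[of _ "gen_alg M _ _"] in auto)

lemma gen_alg_measurable: "t \<in> T \<Longrightarrow> Z t \<in> borel_measurable (gen_alg M T Z)"
  by (rule measurableI) (auto simp: sets_gen_alg intro!: sigma_sets.Basic)

lemma gen_alg_sets_subset: "(\<And>t. t \<in> T \<Longrightarrow> Z t \<in> borel_measurable M) \<Longrightarrow> sets (gen_alg M T Z) \<subseteq> sets M"
  unfolding sets_gen_alg by (rule sets.sigma_sets_subset) (auto intro: measurable_sets)

lemma gen_alg_mono: "T \<subseteq> T' \<Longrightarrow> sets (gen_alg M T Z) \<subseteq> sets (gen_alg M T' Z)"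
  unfolding sets_gen_alg by (rule sigma_sets_mono') auto

text \<open>The events \<open>a \<inter> b\<close> with \<open>a \<in> \<sigma>(X 0)\<close> and \<open>b \<in> \<sigma>(B u : u \<le> s)\<close> generate \<open>F s\<close>; on them independence of
  the increments follows by splitting off \<open>a\<close> first.\<close>

lemma brownian_filtration_filt:
  assumes "prob_space M" and bm: "standard_brownian_motion M B" and X0: "X 0 \<in> borel_measurable M"
    and ind: "indep_alg M (gen_alg M {0} X) (gen_alg M {0..} B)"
  shows "brownian_filtration M (filt M B X) B"
proof -
  interpret prob_space M by fact
  let ?F = "filt M B X"
  have BM: "B t \<in> borel_measurable M" if "0 \<le> t" for t using bm that unfolding standard_brownian_motion_def continuous_process_def by blast
  have gX: "sets (gen_alg M {0} X) \<subseteq> sets M" by (rule gen_alg_sets_subset) (use X0 in simp)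
  have gB: "sets (gen_alg M T B) \<subseteq> sets M" if "T \<subseteq> {0..}" for T by (rule gen_alg_sets_subset) (use BM that in auto)
  show ?thesis
  proof
    show "subalgebra M (?F t)" if "0 \<le> t" for t
    proof -
      have "sets (?F t) \<subseteq> sets M" unfolding sets_filt using gX gB[of "{0..t}"] by (intro sets.sigma_sets_subset) auto
      then show ?thesis unfolding subalgebra_def by simp
    qed
    show "subalgebra (?F t) (?F s)" if "0 \<le> s" "s \<le> t" for s t
    proof -
      have "sets (gen_alg M {0..s} B) \<subseteq> sets (gen_alg M {0..t} B)" using that by (intro gen_alg_mono) auto
      then have "sets (?F s) \<subseteq> sets (?F t)" unfolding sets_filt by (intro sigma_sets_mono') blast
      then show ?thesis unfolding subalgebra_def by simp
    qed
    show "B t \<in> borel_measurable (?F t)" if "0 \<le> t" for t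
    proof (rule measurable_from_subalg)
      show "subalgebra (?F t) (gen_alg M {0..t} B)" unfolding subalgebra_def sets_filt by (auto intro: sigma_sets.Basic)
      show "B t \<in> borel_measurable (gen_alg M {0..t} B)" by (rule gen_alg_measurable) (use that in simp)
    qed
    fix s t :: real assume st: "0 \<le> s" "s < t"
    show "distributed M lborel (\<lambda>w. B t w - B s w) (normal_density 0 (sqrt (t - s)))"
      using bm st unfolding standard_brownian_motion_def by blast
    let ?D = "vimage_algebra (space M) (\<lambda>w. B t w - B s w) borel"
    let ?E = "{a \<inter> b |a b. a \<in> sets (gen_alg M {0} X) \<and> b \<in> sets (gen_alg M {0..s} B)}"
    have D: "sets ?D = {(\<lambda>w. B t w - B s w) -` A \<inter> space M |A. A \<in> sets borel}" by (rule sets_vimage_algebra2) simp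
    have DB: "sets ?D \<subseteq> sets (gen_alg M {0..} B)"
    proof -
      have "(\<lambda>w. B t w - B s w) \<in> borel_measurable (gen_alg M {0..} B)"
        using st by (intro borel_measurable_diff gen_alg_measurable) auto
      then have "(\<lambda>w. B t w - B s w) -` A \<inter> space M \<in> sets (gen_alg M {0..} B)" if "A \<in> sets borel" for A
        using measurable_sets[OF _ that] by (metis space_gen_alg)
      then show ?thesis unfolding D by blast
    qed
    have indD: "prob (d \<inter> b) = prob d * prob b" if "d \<in> sets ?D" "b \<in> sets (gen_alg M {0..s} B)" for d b
    proof -
      have "indep_of_alg M (\<lambda>w. B t w - B s w) (gen_alg M {0..s} B)"
        using bm st unfolding standard_brownian_motion_def by blast
      then show ?thesis using that unfolding indep_of_alg_def indep_alg_def by (rule indep_setD)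
    qed
    have indX: "prob (a \<inter> b) = prob a * prob b" if "a \<in> sets (gen_alg M {0} X)" "b \<in> sets (gen_alg M {0..} B)" for a b
      using ind that unfolding indep_alg_def by (rule indep_setD)
    have BB: "sets (gen_alg M {0..s} B) \<subseteq> sets (gen_alg M {0..} B)" by (rule gen_alg_mono) auto
    have "indep_set (sets ?D) ?E"
    proof (rule indep_setI)
      show "sets ?D \<subseteq> events" using DB gB[of "{0..}"] by blast
      show "?E \<subseteq> events"
      proof
        fix x assume "x \<in> ?E"
        then obtain a b where "x = a \<inter> b" "a \<in> sets (gen_alg M {0} X)" "b \<in> sets (gen_alg M {0..s} B)" by blast
        moreover have "sets (gen_alg M {0..s} B) \<subseteq> events" by (rule gB) auto
        ultimately show "x \<in> events" using gX by blast
      qed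
      fix d e assume d: "d \<in> sets ?D" and "e \<in> ?E"
      then obtain a b where e: "e = a \<inter> b" "a \<in> sets (gen_alg M {0} X)" "b \<in> sets (gen_alg M {0..s} B)" by blast
      have db: "d \<inter> b \<in> sets (gen_alg M {0..} B)" by (rule sets.Int[OF subsetD[OF DB d] subsetD[OF BB e(3)]])
      have "prob (d \<inter> e) = prob (a \<inter> (d \<inter> b))" unfolding e(1) by (simp only: Int_ac)
      also have "\<dots> = prob d * (prob a * prob b)" unfolding indX[OF e(2) db] indD[OF d e(3)] by simp
      finally show "prob (d \<inter> e) = prob d * prob e" unfolding e(1) indX[OF e(2) subsetD[OF BB e(3)]] .
    qed
    then have "indep_set (sigma_sets (space M) (sets ?D)) (sigma_sets (space M) ?E)"
    proof (rule indep_set_sigma_sets)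
      show "Int_stable (sets ?D)" unfolding Int_stable_def by auto
      show "Int_stable ?E"
      proof (rule Int_stableI)
        fix x y assume "x \<in> ?E" "y \<in> ?E"
        then obtain a b a' b' where "x = a \<inter> b" "y = a' \<inter> b'" "a \<inter> a' \<in> sets (gen_alg M {0} X)" "b \<inter> b' \<in> sets (gen_alg M {0..s} B)" by blast
        moreover have "(a \<inter> b) \<inter> (a' \<inter> b') = (a \<inter> a') \<inter> (b \<inter> b')" by blast
        ultimately show "x \<inter> y \<in> ?E" by blast
      qed
    qed
    moreover have "sigma_sets (space M) (sets ?D) = sets ?D" using sets.sigma_sets_eq[of ?D] by simp
    moreover have "sets (?F s) \<subseteq> sigma_sets (space M) ?E"
      unfolding sets_filt
    proof (rule sigma_sets_mono, rule subsetI)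
      fix x assume x: "x \<in> sets (gen_alg M {0} X) \<union> sets (gen_alg M {0..s} B)"
      have top: "space M \<in> sets (gen_alg M {0} X)" "space M \<in> sets (gen_alg M {0..s} B)"
        using sets.top[of "gen_alg M {0} X"] sets.top[of "gen_alg M {0..s} B"] by simp_all
      have "x \<in> ?E"
      proof (cases "x \<in> sets (gen_alg M {0} X)")
        case True
        then have "x = x \<inter> space M" using sets.sets_into_space[OF True] by auto
        then show ?thesis using True top(2) by blast
      next
        case False
        then have xB: "x \<in> sets (gen_alg M {0..s} B)" using x by blast
        then have "x = space M \<inter> x" using sets.sets_into_space[OF xB] by auto
        then show ?thesis using xB top(1) by blast
      qed
      then show "x \<in> sigma_sets (space M) ?E" by (rule sigma_sets.Basic)
    qed
    ultimately show "indep_of_alg M (\<lambda>w. B t w - B s w) (?F s)"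
      unfolding indep_of_alg_def indep_alg_def indep_sets2_eq by auto
  qed
qed

lemma Cp_continuous:
  assumes "Cp n S f" "i < n" shows "continuous_on S ((deriv ^^ i) f)"
  using assms unfolding Cp_def by (intro continuous_at_imp_continuous_on ballI field_differentiable_imp_continuous_at) auto

text \<open>Maxima over the finitely many orders give one constant and one exponent for all
  derivatives.\<close>

lemma Cp_deriv_bounds:
  assumes "Cp n S f" "k \<le> n"
  obtains C p where "0 \<le> C" "\<And>i x. i \<le> k \<Longrightarrow> x \<in> S \<Longrightarrow> \<bar>(deriv ^^ i) f x\<bar> \<le> C * wt p x"
proof -
  have "\<exists>C p. 0 \<le> C \<and> (\<forall>x\<in>S. \<bar>(deriv ^^ i) f x\<bar> \<le> C * wt p x)" if "i \<le> k" for i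
  proof -
    have "polynomial_growth S ((deriv ^^ i) f)" using assms that unfolding Cp_def by auto
    then obtain C p where "0 \<le> C" "\<And>x. x \<in> S \<Longrightarrow> \<bar>(deriv ^^ i) f x\<bar> \<le> C * wt p x" by (rule polynomial_growthE) (rule that; assumption)
    then show ?thesis by blast
  qed
  then obtain C p where C: "\<And>i. i \<le> k \<Longrightarrow> 0 \<le> C i" "\<And>i x. i \<le> k \<Longrightarrow> x \<in> S \<Longrightarrow> \<bar>(deriv ^^ i) f x\<bar> \<le> C i * wt (p i) x" by metis
  let ?C = "Max (C ` {..k})" and ?p = "Max (p ` {..k})"
  have m: "C i \<le> ?C" "p i \<le> ?p" if "i \<le> k" for i using that by auto
  show ?thesis
  proof (rule that)
    show "0 \<le> ?C" using order_trans[OF C(1) m(1)] by blast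
    fix i x assume i: "i \<le> k" and x: "x \<in> S"
    show "\<bar>(deriv ^^ i) f x\<bar> \<le> ?C * wt ?p x"
      by (rule order_trans[OF C(2)[OF i x]], rule mult_mono[OF m(1)[OF i] wt_mono[OF m(2)[OF i]]]) (use order_trans[OF C(1)[OF i] m(1)[OF i]] in auto)
  qed
qed

text \<open>Lagrange remainder, with the weight at the intermediate point distributed over both end
  points; the factorial is at least 1 and is dropped.\<close>

lemma taylor_bound:
  assumes S: "is_interval S" and f: "Cp k S f" and n: "0 < n" "n \<le> k" and C: "0 \<le> C" "\<And>x. x \<in> S \<Longrightarrow> \<bar>(deriv ^^ n) f x\<bar> \<le> C * wt p x"
    and x: "x \<in> S" "y \<in> S"
  shows "\<bar>f y - (\<Sum>m<n. (deriv ^^ m) f x / fact m * (y - x) ^ m)\<bar> \<le> C * (wt p x * wt p y) * \<bar>y - x\<bar> ^ n"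
proof -
  have d: "\<And>i x. i < n \<Longrightarrow> x \<in> S \<Longrightarrow> (deriv ^^ i) f field_differentiable at x" using f n(2) unfolding Cp_def by auto
  obtain z where z: "z \<in> S" "\<bar>z\<bar> \<le> \<bar>x\<bar> + \<bar>y\<bar>"
    "f y = (\<Sum>m<n. (deriv ^^ m) f x / fact m * (y - x) ^ m) + (deriv ^^ n) f z / fact n * (y - x) ^ n"
    using taylor_mean_value[OF S d n(1) x] by blast
  have "(1 + \<bar>x\<bar>) * (1 + \<bar>y\<bar>) = 1 + \<bar>x\<bar> + \<bar>y\<bar> + \<bar>x\<bar> * \<bar>y\<bar>" by (simp add: algebra_simps)
  moreover have "0 \<le> \<bar>x\<bar> * \<bar>y\<bar>" by simp
  ultimately have "1 + \<bar>z\<bar> \<le> (1 + \<bar>x\<bar>) * (1 + \<bar>y\<bar>)" using z(2) by linarith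
  then have "wt p z \<le> wt p x * wt p y" unfolding power_mult_distrib[symmetric] by (rule power_mono) simp
  then have "\<bar>(deriv ^^ n) f z\<bar> \<le> C * (wt p x * wt p y)" using C(2)[OF z(1)] mult_left_mono[OF _ C(1)] order_trans by blast
  moreover have "\<bar>(deriv ^^ n) f z\<bar> / fact n \<le> \<bar>(deriv ^^ n) f z\<bar>" using divide_left_mono[of 1 "fact n :: real"] by simp
  ultimately have "\<bar>(deriv ^^ n) f z\<bar> / fact n \<le> C * (wt p x * wt p y)" by linarith
  then have "\<bar>(deriv ^^ n) f z\<bar> / fact n * \<bar>y - x\<bar> ^ n \<le> C * (wt p x * wt p y) * \<bar>y - x\<bar> ^ n" by (rule mult_right_mono) simp
  then show ?thesis unfolding z(3) by (simp add: abs_mult power_abs)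
qed

text \<open>The Lipschitz bound comes from the first derivatives of the coefficients, the moments of
  \<open>X 0\<close> from those of the invariant law; the exponent 0, where the integrand is
  constant, is treated apart.\<close>

lemma stationary_diffusion_weak_solution:
  assumes M: "condition_M (einterval l r) \<Theta> a b \<mu> P B X" and \<theta>: "\<theta> \<in> \<Theta>"
  obtains CG CL pL where "stationary_diffusion (P \<theta>) (filt (P \<theta>) (B \<theta>) (X \<theta>)) (B \<theta>) (X \<theta>) (\<lambda>x. a x \<theta>) (\<lambda>x. b x \<theta>) (einterval l r) CG CL pL"
proof -
  let ?S = "einterval l r"
  have w: "weak_solution ?S (\<lambda>x. a x \<theta>) (\<lambda>x. b x \<theta>) (\<mu> \<theta>) (P \<theta>) (B \<theta>) (X \<theta>)"
    and law: "\<And>t. 0 \<le> t \<Longrightarrow> distr (P \<theta>) borel (X \<theta> t) = \<mu> \<theta>" and ab: "Cp 2 ?S (\<lambda>x. a x \<theta>)" "Cp 2 ?S (\<lambda>x. b x \<theta>)"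
    and mom: "\<And>k::nat. 1 \<le> k \<Longrightarrow> set_integrable (\<mu> \<theta>) ?S (\<lambda>x. \<bar>x\<bar> ^ k)"
    using M \<theta> unfolding condition_M_def Cp20_def by blast+
  obtain CG where CG: "0 < CG" "\<And>x. x \<in> ?S \<Longrightarrow> \<bar>a x \<theta>\<bar> + \<bar>b x \<theta>\<bar> \<le> CG * (1 + \<bar>x\<bar>)"
    using M \<theta> unfolding condition_M_def by blast
  have pr: "prob_space (P \<theta>)" and XM: "\<And>t. 0 \<le> t \<Longrightarrow> X \<theta> t \<in> borel_measurable (P \<theta>)"
    and XS: "\<And>t w. 0 \<le> t \<Longrightarrow> w \<in> space (P \<theta>) \<Longrightarrow> X \<theta> t w \<in> ?S"
    using w unfolding weak_solution_def continuous_process_def by blast+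
  interpret prob_space "P \<theta>" by (rule pr)
  interpret brownian_filtration "P \<theta>" "filt (P \<theta>) (B \<theta>) (X \<theta>)" "B \<theta>"
    using w XM[OF order_refl] by (intro brownian_filtration_filt) (auto simp: weak_solution_def)
  have iS: "is_interval ?S" unfolding is_interval_1
  proof (intro ballI allI impI)
    fix u v x assume "u \<in> ?S" "v \<in> ?S" and x: "u \<le> x \<and> x \<le> v"
    then have "l < ereal u" "ereal v < r" "ereal u \<le> ereal x" "ereal x \<le> ereal v" by (simp_all add: einterval_def)
    then show "x \<in> ?S" unfolding einterval_def using less_le_trans[of l "ereal u"] le_less_trans[of "ereal x" "ereal v"] by simp
  qed
  have oS: "open ?S" by simp
  obtain Ca pa where Ca: "0 \<le> Ca" "\<And>i x. i \<le> 2 \<Longrightarrow> x \<in> ?S \<Longrightarrow> \<bar>(deriv ^^ i) (\<lambda>x. a x \<theta>) x\<bar> \<le> Ca * wt pa x"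
    by (rule Cp_deriv_bounds[OF ab(1) order_refl]) (rule that; assumption)
  obtain Cb pb where Cb: "0 \<le> Cb" "\<And>i x. i \<le> 2 \<Longrightarrow> x \<in> ?S \<Longrightarrow> \<bar>(deriv ^^ i) (\<lambda>x. b x \<theta>) x\<bar> \<le> Cb * wt pb x"
    by (rule Cp_deriv_bounds[OF ab(2) order_refl]) (rule that; assumption)
  have lip: "\<bar>g x - g y\<bar> \<le> C' * ((1 + \<bar>x\<bar>) * (1 + \<bar>y\<bar>)) ^ p' * \<bar>x - y\<bar>"
    if g: "Cp 2 ?S g" and C: "0 \<le> C" "\<And>i x. i \<le> 2 \<Longrightarrow> x \<in> ?S \<Longrightarrow> \<bar>(deriv ^^ i) g x\<bar> \<le> C * wt p x" and le: "C \<le> C'" "p \<le> p'" and x: "x \<in> ?S" "y \<in> ?S"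
    for g C p C' p' x y
  proof -
    have d: "\<And>x. x \<in> ?S \<Longrightarrow> g field_differentiable at x"
      using g unfolding Cp_def by (metis funpow_0 zero_less_numeral)
    have "\<bar>g x - g y\<bar> \<le> C * ((1 + \<bar>x\<bar>) * (1 + \<bar>y\<bar>)) ^ p * \<bar>x - y\<bar>"
      by (rule polynomially_lipschitz[OF iS d C(1) _ x]) (use C(2)[of 1] in auto)
    also have "\<dots> \<le> C' * ((1 + \<bar>x\<bar>) * (1 + \<bar>y\<bar>)) ^ p' * \<bar>x - y\<bar>"
    proof (intro mult_right_mono mult_mono power_increasing le)
      have "1 * 1 \<le> (1 + \<bar>x\<bar>) * (1 + \<bar>y\<bar>)" by (intro mult_mono) auto
      then show "1 \<le> (1 + \<bar>x\<bar>) * (1 + \<bar>y\<bar>)" by simp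
    qed (use C(1) le in auto)
    finally show ?thesis .
  qed
  show ?thesis
  proof (rule that, unfold_locales)
    show "is_interval ?S" "open ?S" by (rule iS oS)+
    show "continuous_on {0..} (\<lambda>t. B \<theta> t w)" if "w \<in> space (P \<theta>)" for w
      using w that unfolding weak_solution_def standard_brownian_motion_def continuous_process_def by blast
    show "continuous_on {0..} (\<lambda>t. X \<theta> t w)" if "w \<in> space (P \<theta>)" for w
      using w that unfolding weak_solution_def continuous_process_def by blast
    show "X \<theta> t \<in> borel_measurable (filt (P \<theta>) (B \<theta>) (X \<theta>) t)"
      "has_ito_integral (P \<theta>) (filt (P \<theta>) (B \<theta>) (X \<theta>)) (B \<theta>) (\<lambda>s w. b (X \<theta> s w) \<theta>) t (\<lambda>w. X \<theta> t w - X \<theta> 0 w - (LINT s:{0..t}|lborel. a (X \<theta> s w) \<theta>))"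
      if "0 \<le> t" for t using w that unfolding weak_solution_def by blast+
    show "distr (P \<theta>) borel (X \<theta> t) = distr (P \<theta>) borel (X \<theta> 0)" if "0 \<le> t" for t using law that by simp
    show "integrable (P \<theta>) (\<lambda>w. \<bar>X \<theta> 0 w\<bar> ^ k)" for k :: nat
    proof (cases "k = 0")
      case False
      have "integrable (distr (P \<theta>) borel (X \<theta> 0)) (\<lambda>x. indicator ?S x * \<bar>x\<bar> ^ k)"
        using mom[of k] False unfolding law[OF order_refl] set_integrable_def by simp
      then have "integrable (P \<theta>) (\<lambda>w. indicator ?S (X \<theta> 0 w) * \<bar>X \<theta> 0 w\<bar> ^ k)"
        using oS by (subst (asm) integrable_distr_eq[OF XM[OF order_refl]]) auto
      then show ?thesis by (rule Bochner_Integration.integrable_cong[OF refl, THEN iffD1, rotated]) (simp add: XS)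
    qed simp
    show "continuous_on ?S (\<lambda>x. a x \<theta>)" "continuous_on ?S (\<lambda>x. b x \<theta>)" using Cp_continuous[OF ab(1), of 0] Cp_continuous[OF ab(2), of 0] by auto
    show "0 \<le> CG" "0 \<le> max Ca Cb" using CG(1) Ca(1) by auto
    show "\<bar>a x \<theta>\<bar> \<le> CG * (1 + \<bar>x\<bar>)" "\<bar>b x \<theta>\<bar> \<le> CG * (1 + \<bar>x\<bar>)" if "x \<in> ?S" for x using CG(2)[OF that] by linarith+
    fix x y assume xy: "x \<in> ?S" "y \<in> ?S"
    show "\<bar>a x \<theta> - a y \<theta>\<bar> \<le> max Ca Cb * ((1 + \<bar>x\<bar>) * (1 + \<bar>y\<bar>)) ^ max pa pb * \<bar>x - y\<bar>"
      by (rule lip[OF ab(1) Ca _ _ xy]) auto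
    show "\<bar>b x \<theta> - b y \<theta>\<bar> \<le> max Ca Cb * ((1 + \<bar>x\<bar>) * (1 + \<bar>y\<bar>)) ^ max pa pb * \<bar>x - y\<bar>"
      by (rule lip[OF ab(2) Cb _ _ xy]) auto
  qed (use XS in auto)
qed

context diffusion_expansion
begin

lemma rem_term_adapted:
  assumes st: "0 \<le> s" "s < t" shows "rem_term s t \<in> borel_measurable (F t)"
proof -
  have t: "0 \<le> t" "s \<le> t" using st by auto
  have "(\<lambda>w. f (X_mean s t w)) \<in> borel_measurable (F t)"
    by (rule measurable_continuous_on_open[OF f_cont S_open X_mean_adapted[OF st]]) (use X_mean_S[OF st] space_F[OF t(1)] in simp)
  moreover have "(\<lambda>w. g (X s w)) \<in> borel_measurable (F t)" if "continuous_on S g" for g :: "real \<Rightarrow> real"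
    by (rule F_measurable[OF st(1) t(2) fX_adapted[OF that st(1)]])
  ultimately show ?thesis
    unfolding rem_term_def[abs_def] using f_cont f1_cont \<beta>_cont bm_mean_measurable[OF B_cont st]
    by (intro borel_measurable_diff borel_measurable_times) auto
qed

end

section \<open>Application to the sampled observations\<close>

theorem proposition3p3:
  fixes l r :: ereal
    and \<Theta> :: "(real ^ 'd) set"
    and a b :: "real \<Rightarrow> real ^ 'd \<Rightarrow> real"
    and \<mu> :: "real ^ 'd \<Rightarrow> real measure"
    and P :: "real ^ 'd \<Rightarrow> 'w measure"
    and B X :: "real ^ 'd \<Rightarrow> real \<Rightarrow> 'w \<Rightarrow> real"
    and \<Delta> :: "nat \<Rightarrow> real"
    and \<theta> :: "real ^ 'd"
    and f :: "real \<Rightarrow> real"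
  assumes "l < r"
    and "condition_M (einterval l r) \<Theta> a b \<mu> P B X"
    and "\<And>n. \<Delta> n > 0"
    and "\<Delta> \<longlonglongrightarrow> 0"
    and "filterlim (\<lambda>n. real n * \<Delta> n) at_top sequentially"
    and "\<theta> \<in> \<Theta>"
    and "Cp 4 (einterval l r) f"
  shows "\<exists>(\<xi>1 :: nat \<Rightarrow> nat \<Rightarrow> 'w \<Rightarrow> real) (\<xi>2 :: nat \<Rightarrow> nat \<Rightarrow> 'w \<Rightarrow> real) R1 R2.
    generic_remainder (einterval l r) R1 \<and> generic_remainder (einterval l r) R2 \<and>
    (\<forall>n. \<forall>i\<in>{1..n}.
      let t0 = (real i - 1) * \<Delta> n;
          t1 = real i * \<Delta> n;
          F0 = filt (P \<theta>) (B \<theta>) (X \<theta>) t0;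
          F1 = filt (P \<theta>) (B \<theta>) (X \<theta>) t1
      in
        \<xi>1 n i \<in> borel_measurable F1 \<and>
        \<xi>2 n i \<in> borel_measurable F1 \<and>
        (\<forall>\<omega>\<in>space (P \<theta>).
           f (integrated_obs (X \<theta>) (\<Delta> n) i \<omega>) =
             f (X \<theta> t0 \<omega>) + sqrt (\<Delta> n) * deriv f (X \<theta> t0 \<omega>) * b (X \<theta> t0 \<omega>) \<theta> * \<xi>1 n i \<omega>
             + \<xi>2 n i \<omega>) \<and>
        distributed (P \<theta>) lborel (\<xi>1 n i) (normal_density 0 (sqrt (1/3))) \<and>
        indep_of_alg (P \<theta>) (\<xi>1 n i) F0 \<and>
        integrable (P \<theta>) (\<xi>2 n i) \<and>
        integrable (P \<theta>) (\<lambda>\<omega>. (\<xi>2 n i \<omega>)\<^sup>2) \<and>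
        (AE \<omega> in P \<theta>. real_cond_exp (P \<theta>) F0 (\<xi>2 n i) \<omega> =
           \<Delta> n * op_H a b \<theta> f (X \<theta> t0 \<omega>) + \<Delta> n powr (3/2) * R1 (\<Delta> n) (X \<theta> t0 \<omega>)) \<and>
        (AE \<omega> in P \<theta>. real_cond_exp (P \<theta>) F0 (\<lambda>\<omega>'. (\<xi>2 n i \<omega>')\<^sup>2) \<omega> =
           (\<Delta> n)\<^sup>2 * R2 (\<Delta> n) (X \<theta> t0 \<omega>)) \<and>
        (\<integral>\<omega>. (B \<theta> t1 \<omega> - B \<theta> t0 \<omega>) / sqrt (\<Delta> n) * \<xi>1 n i \<omega> \<partial>P \<theta>) = 1/2)"
proof -
  let ?S = "einterval l r"
  obtain CG CL pL where "stationary_diffusion (P \<theta>) (filt (P \<theta>) (B \<theta>) (X \<theta>)) (B \<theta>) (X \<theta>) (\<lambda>x. a x \<theta>) (\<lambda>x. b x \<theta>) ?S CG CL pL"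
    by (rule stationary_diffusion_weak_solution[OF assms(2,6)]) (rule that; assumption)
  then interpret stationary_diffusion "P \<theta>" "filt (P \<theta>) (B \<theta>) (X \<theta>)" "B \<theta>" "X \<theta>" "\<lambda>x. a x \<theta>" "\<lambda>x. b x \<theta>" ?S CG CL pL .
  \<comment> \<open>The third derivative is included because it controls the remainder of the
    second-order expansion.\<close>
  obtain C p where C: "0 \<le> C" "\<And>i x. i \<le> 3 \<Longrightarrow> x \<in> ?S \<Longrightarrow> \<bar>(deriv ^^ i) f x\<bar> \<le> C * wt p x"
    by (rule Cp_deriv_bounds[OF assms(7), of 3, simplified]) (rule that; assumption)
  \<comment> \<open>Convergent step sizes are bounded; the bound is the horizon \<open>T\<close> of
    all moment estimates.\<close>
  have "Bseq \<Delta>" using assms(4) by (intro convergent_imp_Bseq) (auto simp: convergent_def)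
  then obtain T where T: "0 < T" "\<And>n. norm (\<Delta> n) \<le> T" unfolding Bseq_def by blast
  have \<Delta>: "0 < \<Delta> n" "\<Delta> n \<le> T" for n using assms(3)[of n] T(2)[of n] by auto
  interpret diffusion_expansion "P \<theta>" "filt (P \<theta>) (B \<theta>) (X \<theta>)" "B \<theta>" "X \<theta>" "\<lambda>x. a x \<theta>" "\<lambda>x. b x \<theta>" ?S CG CL pL
    f "deriv f" "(deriv ^^ 2) f" C p T
  proof
    show "0 \<le> T" "0 \<le> C" using T(1) C(1) by auto
    show "continuous_on ?S f" "continuous_on ?S (deriv f)" "continuous_on ?S ((deriv ^^ 2) f)"
      using Cp_continuous[OF assms(7), of 0] Cp_continuous[OF assms(7), of 1] Cp_continuous[OF assms(7), of 2] by simp_all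
    show "\<bar>deriv f x\<bar> \<le> C * wt p x" "\<bar>(deriv ^^ 2) f x\<bar> \<le> C * wt p x" if "x \<in> ?S" for x
      using C(2)[of 1 x] C(2)[of 2 x] that by simp_all
    fix x y assume xy: "x \<in> ?S" "y \<in> ?S"
    show "\<bar>f y - f x - deriv f x * (y - x)\<bar> \<le> C * (wt p x * wt p y) * \<bar>y - x\<bar> ^ 2"
      using taylor_bound[OF S_interval assms(7), of 2, OF _ _ C(1) C(2) xy] by (simp add: lessThan_nat_numeral diff_diff_eq ac_simps)
    show "\<bar>f y - f x - deriv f x * (y - x) - (deriv ^^ 2) f x / 2 * (y - x)\<^sup>2\<bar> \<le> C * (wt p x * wt p y) * \<bar>y - x\<bar> ^ 3"
      using taylor_bound[OF S_interval assms(7), of 3, OF _ _ C(1) C(2) xy] by (simp add: lessThan_nat_numeral diff_diff_eq ac_simps)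
  qed
  \<comment> \<open>Compact intervals that exhaust the state space, for the clamped Euler
    schemes.\<close>
  obtain u v where uv: "?S = (\<Union>k. {v k..u k})" "incseq u" "decseq v" "\<And>k. v k < u k"
    by (rule einterval_Icc_approximation[OF assms(1)]) (rule that; assumption)
  obtain D q R1 R2 where R: "\<And>\<delta> x. \<bar>R1 \<delta> x\<bar> \<le> D * wt q x" "\<And>\<delta> x. \<bar>R2 \<delta> x\<bar> \<le> D * wt q x"
    "\<And>s \<delta>. 0 \<le> s \<Longrightarrow> 0 < \<delta> \<Longrightarrow> \<delta> \<le> T \<Longrightarrow> AE w in P \<theta>. real_cond_exp (P \<theta>) (filt (P \<theta>) (B \<theta>) (X \<theta>) s) (rem_term s (s + \<delta>)) w = \<delta> * H_op (X \<theta> s w) + \<delta> powr (3/2) * R1 \<delta> (X \<theta> s w)"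
    "\<And>s \<delta>. 0 \<le> s \<Longrightarrow> 0 < \<delta> \<Longrightarrow> \<delta> \<le> T \<Longrightarrow> AE w in P \<theta>. real_cond_exp (P \<theta>) (filt (P \<theta>) (B \<theta>) (X \<theta>) s) (\<lambda>w. (rem_term s (s + \<delta>) w)\<^sup>2) w = \<delta>\<^sup>2 * R2 \<delta> (X \<theta> s w)"
    by (rule conditional_expansion[OF less_imp_le[OF uv(4)] uv(3,2,1)]) (rule that; assumption)
  \<comment> \<open>The coefficients of the second derivative agree since 1/4 - 1/12 = 1/6.\<close>
  have H: "H_op = op_H a b \<theta> f" by (rule ext) (simp add: H_op_def op_H_def gen_L_def field_simps)
  have rem: "generic_remainder ?S R1" "generic_remainder ?S R2"
    unfolding generic_remainder_def using polynomial_growth_weight[of ?S D q] R(1,2) by blast+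
  define \<xi>1 where "\<xi>1 n i w = bm_mean ((real i - 1) * \<Delta> n) (real i * \<Delta> n) w / sqrt (\<Delta> n)" for n and i :: nat and w
  define \<xi>2 where "\<xi>2 n i = rem_term ((real i - 1) * \<Delta> n) (real i * \<Delta> n)" for n and i :: nat
  show ?thesis
  proof (rule exI[of _ \<xi>1], rule exI[of _ \<xi>2], rule exI[of _ R1], rule exI[of _ R2], intro conjI rem allI ballI)
    fix n i :: nat assume i: "i \<in> {1..n}"
    define s where "s = (real i - 1) * \<Delta> n"
    have t: "real i * \<Delta> n = s + \<Delta> n" by (simp add: s_def algebra_simps)
    have s: "0 \<le> s" "s < s + \<Delta> n" "s + \<Delta> n \<le> s + T" using i \<Delta>[of n] by (auto simp: s_def)
    have \<xi>: "\<xi>1 n i = (\<lambda>w. bm_mean s (s + \<Delta> n) w / sqrt (s + \<Delta> n - s))" "\<xi>2 n i = rem_term s (s + \<Delta> n)"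
      by (simp_all add: \<xi>1_def \<xi>2_def fun_eq_iff s_def[symmetric] t)
    have eq: "f (integrated_obs (X \<theta>) (\<Delta> n) i w) =
        f (X \<theta> s w) + sqrt (\<Delta> n) * deriv f (X \<theta> s w) * b (X \<theta> s w) \<theta> * \<xi>1 n i w + \<xi>2 n i w"
      if w: "w \<in> space (P \<theta>)" for w
    proof -
      have "(LINT u:{s..s + \<Delta> n}|lborel. X \<theta> u w) = integral {s..s + \<Delta> n} (\<lambda>u. X \<theta> u w)"
        by (intro set_borel_integral_eq_integral borel_integrable_atLeastAtMost' X_cont_on w s)
      then have "integrated_obs (X \<theta>) (\<Delta> n) i w = X_mean s (s + \<Delta> n) w"
        unfolding integrated_obs_def X_mean_def t s_def[symmetric] by simp
      then show ?thesis using \<Delta>(1)[of n] unfolding \<xi> rem_term_def by simp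
    qed
    note g = bm_mean_gaussian[OF B_cont s(1,2)]
    note r = rem_term_integrable[OF s]
    show "let t0 = (real i - 1) * \<Delta> n; t1 = real i * \<Delta> n;
          F0 = filt (P \<theta>) (B \<theta>) (X \<theta>) t0; F1 = filt (P \<theta>) (B \<theta>) (X \<theta>) t1
      in \<xi>1 n i \<in> borel_measurable F1 \<and> \<xi>2 n i \<in> borel_measurable F1 \<and>
        (\<forall>w\<in>space (P \<theta>). f (integrated_obs (X \<theta>) (\<Delta> n) i w) =
             f (X \<theta> t0 w) + sqrt (\<Delta> n) * deriv f (X \<theta> t0 w) * b (X \<theta> t0 w) \<theta> * \<xi>1 n i w + \<xi>2 n i w) \<and>
        distributed (P \<theta>) lborel (\<xi>1 n i) (normal_density 0 (sqrt (1/3))) \<and>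
        indep_of_alg (P \<theta>) (\<xi>1 n i) F0 \<and>
        integrable (P \<theta>) (\<xi>2 n i) \<and> integrable (P \<theta>) (\<lambda>w. (\<xi>2 n i w)\<^sup>2) \<and>
        (AE w in P \<theta>. real_cond_exp (P \<theta>) F0 (\<xi>2 n i) w =
           \<Delta> n * op_H a b \<theta> f (X \<theta> t0 w) + \<Delta> n powr (3/2) * R1 (\<Delta> n) (X \<theta> t0 w)) \<and>
        (AE w in P \<theta>. real_cond_exp (P \<theta>) F0 (\<lambda>w'. (\<xi>2 n i w')\<^sup>2) w = (\<Delta> n)\<^sup>2 * R2 (\<Delta> n) (X \<theta> t0 w)) \<and>
        (\<integral>w. (B \<theta> t1 w - B \<theta> t0 w) / sqrt (\<Delta> n) * \<xi>1 n i w \<partial>P \<theta>) = 1/2"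
      unfolding Let_def t s_def[symmetric]
    proof (intro conjI ballI)
      show "\<xi>1 n i \<in> borel_measurable (filt (P \<theta>) (B \<theta>) (X \<theta>) (s + \<Delta> n))" "distributed (P \<theta>) lborel (\<xi>1 n i) (normal_density 0 (sqrt (1/3)))"
        "indep_of_alg (P \<theta>) (\<xi>1 n i) (filt (P \<theta>) (B \<theta>) (X \<theta>) s)"
        unfolding \<xi> using g(1-3) by simp_all
      show "(\<integral>w. (B \<theta> (s + \<Delta> n) w - B \<theta> s w) / sqrt (\<Delta> n) * \<xi>1 n i w \<partial>P \<theta>) = 1/2" using g(4) unfolding \<xi> add_diff_cancel_left' .
      show "\<xi>2 n i \<in> borel_measurable (filt (P \<theta>) (B \<theta>) (X \<theta>) (s + \<Delta> n))" unfolding \<xi> by (rule rem_term_adapted[OF s(1,2)])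
      show "integrable (P \<theta>) (\<xi>2 n i)" "integrable (P \<theta>) (\<lambda>w. (\<xi>2 n i w)\<^sup>2)" unfolding \<xi> by (rule r)+
      show "AE w in P \<theta>. real_cond_exp (P \<theta>) (filt (P \<theta>) (B \<theta>) (X \<theta>) s) (\<xi>2 n i) w =
           \<Delta> n * op_H a b \<theta> f (X \<theta> s w) + \<Delta> n powr (3/2) * R1 (\<Delta> n) (X \<theta> s w)"
        unfolding \<xi> using R(3)[OF s(1) \<Delta>] unfolding H .
      show "AE w in P \<theta>. real_cond_exp (P \<theta>) (filt (P \<theta>) (B \<theta>) (X \<theta>) s) (\<lambda>w'. (\<xi>2 n i w')\<^sup>2) w = (\<Delta> n)\<^sup>2 * R2 (\<Delta> n) (X \<theta> s w)"
        unfolding \<xi> by (rule R(4)[OF s(1) \<Delta>])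
    qed (rule eq)
  qed
qed

end
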